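(* There exists a sequence of unknotted closed polygonal curves $\{K_n\}_{n\ge 1}$ in $\mathbb{R}^3$ having the following properties. (1) $K_n$ contains at most $24n+40$ edges. (2) Any embedded, piecewise-smooth disk spanning $K_n$ intersects the $y$-axis in at least $2^{n-1}$ points. (3) Any embedded PL triangulated disk $D_n$ bounded by $K_n$ contains at least $2^{n-1}$ triangles. (4) Each $K_n$ has length one, and there exists a constant $r_0 > 0$ independent of $n$ such that each $K_n$ is disjoint from the solid cylinder $Cyl(r_0)$ of radius $r_0$ around the $y$-axis.
   Context: Coordinates on $\mathbb{R}^3$ are $(x,y,z)$, and $Cyl(r_0)=\{(x,y,z): x^2+z^2\le r_0^2\}$. A closed polygonal curve is an embedded piecewise-linear simple closed curve in $\mathbb{R}^3$; it is unknotted if it is the boundary of an embedded PL disk in $\mathbb{R}^3$. A disk spans (is bounded by) a closed curve if its boundary is that curve. An embedded PL triangulated disk is an embedded disk that is a finite simplicial complex made of flat triangles. *)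

theory Defs
  imports "HOL-Analysis.Analysis"
begin

fun polygonal_path :: "'a::real_normed_vector list \<Rightarrow> real \<Rightarrow> 'a" where
  "polygonal_path [] = linepath 0 0"
| "polygonal_path [a] = linepath a a"
| "polygonal_path [a, b] = linepath a b"
| "polygonal_path (a # b # c # vs) = linepath a b +++ polygonal_path (b # c # vs)"

text \<open>A closed polygonal curve is given by the cyclic list of its vertices, without
  repeating the first one at the end.\<close>

definition closed_polygon_path :: "'a::real_normed_vector list \<Rightarrow> real \<Rightarrow> 'a" where
  "closed_polygon_path vs = polygonal_path (vs @ [hd vs])"

text \<open>Lists with fewer than three vertices, or with repeated vertices, are excluded because
  the corresponding path is not simple.\<close>

definition closed_polygonal_curve :: "'a::real_normed_vector list \<Rightarrow> bool" where
  "closed_polygonal_curve vs \<longleftrightarrow>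
     simple_path (closed_polygon_path vs) \<and>
     pathfinish (closed_polygon_path vs) = pathstart (closed_polygon_path vs)"

definition polygon_carrier :: "'a::real_normed_vector list \<Rightarrow> 'a set" where
  "polygon_carrier vs = path_image (closed_polygon_path vs)"

definition polygon_edges :: "'a list \<Rightarrow> ('a \<times> 'a) list" where
  "polygon_edges vs = zip vs (rotate1 vs)"

definition polygon_length :: "'a::real_normed_vector list \<Rightarrow> real" where
  "polygon_length vs = (\<Sum>(a, b)\<leftarrow>polygon_edges vs. dist a b)"

text \<open>The boundary of a disk is the image of the unit circle; by invariance of domain it does
  not depend on the chosen homeomorphism.\<close>

definition disk_bounded_by :: "'a::topological_space set \<Rightarrow> 'a set \<Rightarrow> bool" where
  "disk_bounded_by D K \<longleftrightarrow>
     (\<exists>f g. homeomorphism (cball (0::real^2) 1) D f g \<and> f ` sphere 0 1 = K)"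

definition PL_triangulated_disk_bounded_by ::
  "'a::euclidean_space set set \<Rightarrow> 'a set \<Rightarrow> bool" where
  "PL_triangulated_disk_bounded_by \<T> K \<longleftrightarrow>
     simplicial_complex \<T> \<and> disk_bounded_by (\<Union>\<T>) K"

definition triangles :: "'a::euclidean_space set set \<Rightarrow> 'a set set" where
  "triangles \<T> = {T \<in> \<T>. 2 simplex T}"

definition unknotted :: "(real^3) set \<Rightarrow> bool" where
  "unknotted K \<longleftrightarrow> (\<exists>\<T>. PL_triangulated_disk_bounded_by \<T> K)"

primrec Ck_on :: "nat \<Rightarrow> ('a::real_normed_vector \<Rightarrow> 'b::real_normed_vector) \<Rightarrow> 'a set \<Rightarrow> bool" where
  "Ck_on 0 f U \<longleftrightarrow> continuous_on U f"
| "Ck_on (Suc k) f U \<longleftrightarrow>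
     (\<forall>x\<in>U. f differentiable at x) \<and>
     (\<forall>v. Ck_on k (\<lambda>x. frechet_derivative f (at x) v) U)"

text \<open>Meant for open \<open>U\<close> in a finite-dimensional space.\<close>

definition smooth_on_open :: "('a::real_normed_vector \<Rightarrow> 'b::real_normed_vector) \<Rightarrow> 'a set \<Rightarrow> bool" where
  "smooth_on_open f U \<longleftrightarrow> (\<forall>k. Ck_on k f U)"

definition smooth_immersion_on :: "('a::real_normed_vector \<Rightarrow> 'b::real_normed_vector) \<Rightarrow> 'a set \<Rightarrow> bool" where
  "smooth_immersion_on f T \<longleftrightarrow>
     (\<exists>U F. open U \<and> T \<subseteq> U \<and> smooth_on_open F U \<and>
        (\<forall>x\<in>T. F x = f x \<and> inj (frechet_derivative F (at x))))"

text \<open>An embedded piecewise-smooth disk is the image of a topological embedding \<open>f\<close> of a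
  triangulated planar disk that is, on each closed triangle, a smooth immersion up to the
  boundary.  As every triangulated disk has a straight-line planar realization,
  taking the domain in the plane is no restriction.\<close>

definition piecewise_smooth_disk_bounded_by :: "(real^3) set \<Rightarrow> (real^3) set \<Rightarrow> bool" where
  "piecewise_smooth_disk_bounded_by D K \<longleftrightarrow>
     (\<exists>(\<T> :: (real^2) set set) B (f :: real^2 \<Rightarrow> real^3) g.
        PL_triangulated_disk_bounded_by \<T> B \<and>
        homeomorphism (\<Union>\<T>) D f g \<and> f ` B = K \<and>
        (\<forall>T\<in>triangles \<T>. smooth_immersion_on f T))"

definition y_axis :: "(real^3) set" where
  "y_axis = {p. p $ 1 = 0 \<and> p $ 3 = 0}"

definition Cyl :: "real \<Rightarrow> (real^3) set" where
  "Cyl r = {p. (p $ 1)\<^sup>2 + (p $ 3)\<^sup>2 \<le> r\<^sup>2}"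

end

theory Submission
  imports Defs "HOL-Combinatorics.Perm"
begin

text \<open>
  The curve consists of three almost vertical strands and a fourth one that winds many times around two of them, in the
  same way above and below the middle level; in the middle, the \<open>y\<close>-axis (drawn as a slanted line) passes behind two
  strands and in front of the other two.  Undoing the windings from the middle outwards by shears shows that the curve
  is unknotted.

  For the lower bound, the complement of the curve and the axis is mapped to a group of permutations in such a way that a
  meridian of the axis moves at most three points.  Walking once along the curve, close to it and inside a spanning disk
  that meets the axis in \<open>m\<close> points, gives a product of \<open>m\<close> conjugates of such meridians, up to a meridian of the curve, so it
  moves at most \<open>3 m\<close> points.  On the other hand the labels of the strands wind up to elements of dihedral type whose
  indices solve a Pell equation, and the commutator that represents the longitude moves exponentially many points.
  No fundamental group is needed: the representation is given by a locally defined cocycle on pairs of points.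

  A triangle meets a line that is generic among the parallels of the axis in at most one point, so the number of triangles
  of a spanning disk is bounded below as well.
\<close>

section \<open>Parallel transport for a locally defined cocycle, and holonomy bounded by counting
  punctures\<close>

section \<open>Holonomy along the boundary of a disk\<close>

text \<open>The disk is only a topological embedding, without normal direction or transversality.
  Hence potentials are given between nearby points only, and values next to the curve are known
  modulo the meridian subgroup there. Reflections serve as labels of the strands because their
  meridian subgroup is {0, a}: the unknown multiple of the meridian then costs a single case
  distinction.

  Conjugation by the label of the axis must carry the reflections met above to those met below while
  moving few points. To this end two rotations act on the same 2x + 2y points, one with blocks of
  lengths 2x and 2y, the other with two blocks of length x + y; their unit steps differ at no more
  than three points. The windings act linearly on the indices of the reflections. Starting from
  indices 0 and 1 at the caps, the labels match in the middle because D' E - D E' = 1, which follows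
  from x^2 - 3 y^2 = 1.

  Raising j by one adds 24 edges to the windings of each half and multiplies x + y sqrt 3 by (2 +
  sqrt 3)^2, which exceeds 4; so two consecutive n can share one curve.\<close>

lemma minus_add_cancel_left: "- a + (a + b) = (b :: 'a::group_add)"
  by (simp flip: add.assoc)

lemma add_minus_cancel_left: "a + (- a + b) = (b :: 'a::group_add)"
  by (simp flip: add.assoc)

lemmas group_normal = diff_conv_add_uminus minus_add add.assoc minus_minus minus_add_cancel_left
  add_minus_cancel_left left_minus right_minus add_0_left add_0_right minus_zero

text \<open>The property is guarded by containment in [a, b] before bisecting, so that both premises
  need to be checked for subintervals only, where paths and squares are under control.\<close>

lemma Bolzano_subintervals [consumes 1, case_names trans local]:
  fixes P :: "real \<Rightarrow> real \<Rightarrow> bool"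
  assumes "a \<le> b"
    and trans: "\<And>c d e. a \<le> c \<Longrightarrow> c \<le> d \<Longrightarrow> d \<le> e \<Longrightarrow> e \<le> b \<Longrightarrow> P c d \<Longrightarrow> P d e \<Longrightarrow> P c e"
    and local: "\<And>x. a \<le> x \<Longrightarrow> x \<le> b \<Longrightarrow> \<exists>\<delta>>0. \<forall>c d. a \<le> c \<and> c \<le> x \<and> x \<le> d \<and> d \<le> b \<and> d - c < \<delta> \<longrightarrow> P c d"
  shows "P a b"
proof -
  \<comment> \<open>Fresh names for the fixed bounds keep the induction from generalising over
    them.\<close>
  obtain lo hi where lohi: "lo = a" "hi = b" by blast
  have "lo \<le> a \<longrightarrow> b \<le> hi \<longrightarrow> P a b"
    using assms(1)
  proof (induction rule: Bolzano)
    case (trans c d e)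
    then show ?case using assms(2)[of c d e] lohi by auto
  next
    case (local x)
    then show ?case using assms(3)[of x] lohi by auto
  qed
  then show ?thesis using lohi by simp
qed

text \<open>\<open>\<phi> p q\<close> is thought of as the value at \<open>q\<close> of the parallel
  section that vanishes at \<open>p\<close>, meaningful for \<open>q\<close> near \<open>p\<close>.
  The points \<open>p\<close> and \<open>p'\<close> may lie on \<open>L\<close>, \<open>q\<close>
  may not. The radius around \<open>p'\<close> depends on \<open>p'\<close>, so the two
  neighbourhoods are nested rather than uniform. \<open>H p\<close> is the ambiguity caused by
  winding around \<open>L\<close> close to \<open>p\<close>.\<close>

locale local_system =
  fixes \<phi> :: "'a::metric_space \<Rightarrow> 'a \<Rightarrow> 'g::group_add"
    and H :: "'a \<Rightarrow> 'g set" and L :: "'a set"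
  assumes cocycle: "\<exists>\<delta>>0. \<forall>p'\<in>ball p \<delta>. \<exists>\<delta>'>0. \<forall>q\<in>ball p' \<delta>' - L. \<phi> p p' + \<phi> p' q - \<phi> p q \<in> H p"
    and trivial_off_L: "p \<notin> L \<Longrightarrow> H p = {0}"
    and subgroup_zero: "0 \<in> H p"
    and subgroup_add: "a \<in> H p \<Longrightarrow> b \<in> H p \<Longrightarrow> a + b \<in> H p"
    and subgroup_minus: "a \<in> H p \<Longrightarrow> - a \<in> H p"
    and potential_self: "\<phi> p p = 0"
begin

definition rad :: "'a \<Rightarrow> real" where
  "rad p = (SOME \<delta>. \<delta> > 0 \<and> (\<forall>p'\<in>ball p \<delta>. \<exists>\<delta>'>0. \<forall>q\<in>ball p' \<delta>' - L. \<phi> p p' + \<phi> p' q - \<phi> p q \<in> H p))"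

lemma rad: "rad p > 0"
  "p' \<in> ball p (rad p) \<Longrightarrow> \<exists>\<delta>'>0. \<forall>q\<in>ball p' \<delta>' - L. \<phi> p p' + \<phi> p' q - \<phi> p q \<in> H p"
proof -
  have "rad p > 0 \<and> (\<forall>p'\<in>ball p (rad p). \<exists>\<delta>'>0. \<forall>q\<in>ball p' \<delta>' - L. \<phi> p p' + \<phi> p' q - \<phi> p q \<in> H p)"
    unfolding rad_def by (rule someI_ex[OF cocycle[of p]])
  then show "rad p > 0"
    "p' \<in> ball p (rad p) \<Longrightarrow> \<exists>\<delta>'>0. \<forall>q\<in>ball p' \<delta>' - L. \<phi> p p' + \<phi> p' q - \<phi> p q \<in> H p"
    by auto
qed

text \<open>Values are compared only with the centre \<open>t0\<close> and not with each other,
  which is all that the nested radii of the cocycle provide.\<close>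

definition parallel :: "(real \<Rightarrow> 'a) \<Rightarrow> real \<Rightarrow> real \<Rightarrow> (real \<Rightarrow> 'g) \<Rightarrow> bool" where
  "parallel \<gamma> a b k \<longleftrightarrow>
     (\<forall>t0\<in>{a..b}. \<exists>\<epsilon>>0. \<forall>t\<in>{a..b}. \<bar>t - t0\<bar> < \<epsilon> \<longrightarrow> k t = k t0 + \<phi> (\<gamma> t0) (\<gamma> t))"

definition clear :: "(real \<Rightarrow> 'a) \<Rightarrow> real \<Rightarrow> real \<Rightarrow> bool" where
  "clear \<gamma> a b \<longleftrightarrow> continuous_on {a..b} \<gamma> \<and> \<gamma> ` {a..b} \<inter> L = {}"

lemma clear_subinterval: "clear \<gamma> a b \<Longrightarrow> a \<le> c \<Longrightarrow> d \<le> b \<Longrightarrow> clear \<gamma> c d"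
  unfolding clear_def by (meson atLeastatMost_subset_iff continuous_on_subset disjoint_iff image_mono subsetD)

lemma parallel_subinterval: "parallel \<gamma> a b k \<Longrightarrow> a \<le> c \<Longrightarrow> d \<le> b \<Longrightarrow> parallel \<gamma> c d k"
  unfolding parallel_def by (meson atLeastAtMost_iff order_trans)

lemma parallel_shift: "parallel \<gamma> a b k \<Longrightarrow> parallel \<gamma> a b (\<lambda>t. c + k t)"
  unfolding parallel_def by (metis add.assoc)

lemma near_point:
  assumes "clear \<gamma> a b" "x \<in> {a..b}" "\<gamma> x \<in> ball p (rad p)"
  shows "\<exists>\<epsilon>>0. \<forall>t\<in>{a..b}. \<bar>t - x\<bar> < \<epsilon> \<longrightarrow> \<phi> p (\<gamma> x) + \<phi> (\<gamma> x) (\<gamma> t) - \<phi> p (\<gamma> t) \<in> H p"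
proof -
  obtain \<delta> where \<delta>: "\<delta> > 0" "\<forall>q\<in>ball (\<gamma> x) \<delta> - L. \<phi> p (\<gamma> x) + \<phi> (\<gamma> x) q - \<phi> p q \<in> H p"
    using rad(2)[OF assms(3)] by blast
  obtain \<epsilon> where "\<epsilon> > 0" "\<forall>t\<in>{a..b}. dist t x < \<epsilon> \<longrightarrow> dist (\<gamma> t) (\<gamma> x) < \<delta>"
    using assms(1,2) \<delta>(1) unfolding clear_def continuous_on_iff by meson
  moreover have "\<gamma> t \<notin> L" if "t \<in> {a..b}" for t
    using assms(1) that unfolding clear_def by blast
  ultimately show ?thesis
    using \<delta> by (intro exI[of _ \<epsilon>]) (auto simp: dist_commute dist_real_def)
qed

text \<open>In the ball of \<open>p\<close> the quantity \<open>k t - \<phi> p (\<gamma> t)\<close>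
  changes by right factors from \<open>H p\<close> only; as \<open>H p\<close> is a subgroup, this
  survives concatenation of intervals. The centre \<open>p\<close> itself may lie on
  \<open>L\<close>.\<close>

lemma parallel_coset:
  assumes "clear \<gamma> a b" "a \<le> b" "\<gamma> ` {a..b} \<subseteq> ball p (rad p)" "parallel \<gamma> a b k"
  shows "\<exists>h\<in>H p. k b = k a - \<phi> p (\<gamma> a) + h + \<phi> p (\<gamma> b)"
proof -
  show ?thesis
    using assms(2)
  proof (induction rule: Bolzano_subintervals)
    case (trans c d e)
    then show ?case
    proof -
      obtain h1 h2 where h: "h1 \<in> H p" "k d = k c - \<phi> p (\<gamma> c) + h1 + \<phi> p (\<gamma> d)"
          "h2 \<in> H p" "k e = k d - \<phi> p (\<gamma> d) + h2 + \<phi> p (\<gamma> e)"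
        using trans by auto
      show "\<exists>h\<in>H p. k e = k c - \<phi> p (\<gamma> c) + h + \<phi> p (\<gamma> e)"
        using h subgroup_add[OF h(1,3)] by (intro bexI[of _ "h1 + h2"]) (simp_all only: group_normal)
    qed
  next
    case (local x)
    then have x: "x \<in> {a..b}" by simp
    obtain \<epsilon>1 where e1: "\<epsilon>1 > 0" "\<forall>t\<in>{a..b}. \<bar>t - x\<bar> < \<epsilon>1 \<longrightarrow> \<phi> p (\<gamma> x) + \<phi> (\<gamma> x) (\<gamma> t) - \<phi> p (\<gamma> t) \<in> H p"
      using near_point[OF assms(1) x] assms(3) x by blast
    obtain \<epsilon>2 where e2: "\<epsilon>2 > 0" "\<forall>t\<in>{a..b}. \<bar>t - x\<bar> < \<epsilon>2 \<longrightarrow> k t = k x + \<phi> (\<gamma> x) (\<gamma> t)"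
      using assms(4) x unfolding parallel_def by blast
    have step: "\<exists>h\<in>H p. k t - \<phi> p (\<gamma> t) = k x - \<phi> p (\<gamma> x) + h" if "t \<in> {a..b}" "\<bar>t - x\<bar> < min \<epsilon>1 \<epsilon>2" for t
    proof -
      have "k x - \<phi> p (\<gamma> x) + (\<phi> p (\<gamma> x) + \<phi> (\<gamma> x) (\<gamma> t) - \<phi> p (\<gamma> t)) = k t - \<phi> p (\<gamma> t)"
        using e2(2)[rule_format, of t] that by (simp only: group_normal)
      then show ?thesis using e1 that by force
    qed
    show ?case
    proof (intro exI[of _ "min \<epsilon>1 \<epsilon>2"] conjI allI impI)
      fix c d assume *: "a \<le> c \<and> c \<le> x \<and> x \<le> d \<and> d \<le> b \<and> d - c < min \<epsilon>1 \<epsilon>2"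
      obtain h1 h2 where h: "h1 \<in> H p" "k c - \<phi> p (\<gamma> c) = k x - \<phi> p (\<gamma> x) + h1"
        "h2 \<in> H p" "k d - \<phi> p (\<gamma> d) = k x - \<phi> p (\<gamma> x) + h2"
        using step[of c] step[of d] * by auto
      have "- h1 + h2 \<in> H p"
        using h subgroup_add subgroup_minus by blast
      moreover have "k d = k c - \<phi> p (\<gamma> c) + (- h1 + h2) + \<phi> p (\<gamma> d)"
      proof -
        have "k d = k x - \<phi> p (\<gamma> x) + h2 + \<phi> p (\<gamma> d)"
          using h(4) by (metis diff_add_cancel)
        then show ?thesis
          using h(2) by (simp add: add.assoc)
      qed
      ultimately show "\<exists>h\<in>H p. k d = k c - \<phi> p (\<gamma> c) + h + \<phi> p (\<gamma> d)" by blast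
    qed (use e1 e2 in auto)
  qed
qed

text \<open>Near a point off \<open>L\<close> the group is trivial, so the potential itself is
  parallel along the path. Sections on adjacent intervals are glued after a translation of the
  second one from the left, which preserves parallelism.\<close>

lemma parallel_exists:
  assumes "clear \<gamma> a b" "a \<le> b"
  shows "\<exists>k. parallel \<gamma> a b k"
proof -
  show ?thesis
    using assms(2)
  proof (induction rule: Bolzano_subintervals)
    case (trans c d e)
    then show ?case
    proof -
      obtain k1 k2 where k1: "parallel \<gamma> c d k1" and k2: "parallel \<gamma> d e k2"
        using trans by auto
      define k3 where "k3 = (\<lambda>t. k1 d - k2 d + k2 t)"
      have k3: "parallel \<gamma> d e k3" "k3 d = k1 d"
        using parallel_shift[OF k2, of "k1 d - k2 d"] by (simp_all add: k3_def)
      have "parallel \<gamma> c e (\<lambda>t. if t \<le> d then k1 t else k3 t)"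
        unfolding parallel_def
      proof
        fix t0 assume t0: "t0 \<in> {c..e}"
        show "\<exists>\<epsilon>>0. \<forall>t\<in>{c..e}. \<bar>t - t0\<bar> < \<epsilon> \<longrightarrow>
            (if t \<le> d then k1 t else k3 t) = (if t0 \<le> d then k1 t0 else k3 t0) + \<phi> (\<gamma> t0) (\<gamma> t)"
        proof (cases "t0 < d")
          case True
          then have "t0 \<in> {c..d}" using t0 by simp
          then obtain \<epsilon> where e: "\<epsilon> > 0" "\<forall>t\<in>{c..d}. \<bar>t - t0\<bar> < \<epsilon> \<longrightarrow> k1 t = k1 t0 + \<phi> (\<gamma> t0) (\<gamma> t)"
            using k1 unfolding parallel_def by meson
          have "(if t \<le> d then k1 t else k3 t) = k1 t0 + \<phi> (\<gamma> t0) (\<gamma> t)"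
            if "t \<in> {c..e}" "\<bar>t - t0\<bar> < min \<epsilon> (d - t0)" for t
            using that e(2)[rule_format, of t] by auto
          then show ?thesis using True e(1)
            by (intro exI[of _ "min \<epsilon> (d - t0)"]) simp
        next
          case False
          then have "t0 \<in> {d..e}" using t0 by simp
          then obtain \<epsilon> where e: "\<epsilon> > 0" "\<forall>t\<in>{d..e}. \<bar>t - t0\<bar> < \<epsilon> \<longrightarrow> k3 t = k3 t0 + \<phi> (\<gamma> t0) (\<gamma> t)"
            using k3 unfolding parallel_def by meson
          show ?thesis
          proof (cases "t0 = d")
            case t0d: True
            have "d \<in> {c..d}" using t0d t0 by simp
            then obtain \<epsilon>' where e': "\<epsilon>' > 0" "\<forall>t\<in>{c..d}. \<bar>t - d\<bar> < \<epsilon>' \<longrightarrow> k1 t = k1 d + \<phi> (\<gamma> d) (\<gamma> t)"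
              using k1 unfolding parallel_def by meson
            have "(if t \<le> d then k1 t else k3 t) = k1 d + \<phi> (\<gamma> d) (\<gamma> t)" if "t \<in> {c..e}" "\<bar>t - d\<bar> < min \<epsilon> \<epsilon>'" for t
              using that e(2)[rule_format, of t] e'(2)[rule_format, of t] t0d k3(2) by (cases "t \<le> d") auto
            then show ?thesis
              using t0d e(1) e'(1) by (intro exI[of _ "min \<epsilon> \<epsilon>'"]) simp
          next
            case t0d: False
            have "(if t \<le> d then k1 t else k3 t) = k3 t0 + \<phi> (\<gamma> t0) (\<gamma> t)"
              if "t \<in> {c..e}" "\<bar>t - t0\<bar> < min \<epsilon> (t0 - d)" for t
              using that e(2)[rule_format, of t] False by auto
            then show ?thesis
              using e(1) False t0d by (intro exI[of _ "min \<epsilon> (t0 - d)"]) simp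
          qed
        qed
      qed
      then show "\<exists>k. parallel \<gamma> c e k" by blast
    qed
  next
    case (local x)
    then have x: "x \<in> {a..b}" by simp
    define p where "p = \<gamma> x"
    have pL: "p \<notin> L" using assms(1) x unfolding clear_def p_def by blast
    obtain \<epsilon> where e: "\<epsilon> > 0" "\<forall>t\<in>{a..b}. dist t x < \<epsilon> \<longrightarrow> dist (\<gamma> t) p < rad p"
      using assms(1) x rad(1)[of p] unfolding clear_def continuous_on_iff p_def by meson
    show ?case
    proof (intro exI[of _ \<epsilon>] conjI allI impI)
      fix c d assume *: "a \<le> c \<and> c \<le> x \<and> x \<le> d \<and> d \<le> b \<and> d - c < \<epsilon>"
      have "parallel \<gamma> c d (\<lambda>t. \<phi> p (\<gamma> t))"
        unfolding parallel_def
      proof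
        fix t0 assume t0: "t0 \<in> {c..d}"
        then have "\<gamma> t0 \<in> ball p (rad p)"
          using e * by (auto simp: dist_commute dist_real_def)
        then obtain \<epsilon>1 where "\<epsilon>1 > 0" "\<forall>t\<in>{a..b}. \<bar>t - t0\<bar> < \<epsilon>1 \<longrightarrow> \<phi> p (\<gamma> t0) + \<phi> (\<gamma> t0) (\<gamma> t) - \<phi> p (\<gamma> t) \<in> H p"
          using near_point[OF assms(1), of t0 p] t0 * by auto
        then show "\<exists>\<epsilon>>0. \<forall>t\<in>{c..d}. \<bar>t - t0\<bar> < \<epsilon> \<longrightarrow> \<phi> p (\<gamma> t) = \<phi> p (\<gamma> t0) + \<phi> (\<gamma> t0) (\<gamma> t)"
          using * trivial_off_L[OF pL] by (intro exI[of _ \<epsilon>1]) auto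
      qed
      then show "\<exists>k. parallel \<gamma> c d k" by blast
    qed (use e in auto)
  qed
qed

text \<open>Increments are right factors and cancel in \<open>k t - k' t\<close>, which is therefore
  locally constant.\<close>

lemma parallel_unique:
  assumes "a \<le> b" "parallel \<gamma> a b k" "parallel \<gamma> a b k'"
  shows "k b - k' b = k a - k' a"
proof -
  show ?thesis
    using assms(1)
  proof (induction rule: Bolzano_subintervals)
    case (trans c d e)
    then show ?case by auto
  next
    case (local x)
    then have x: "x \<in> {a..b}" by simp
    obtain e1 where e1: "e1 > 0" "\<forall>t\<in>{a..b}. \<bar>t - x\<bar> < e1 \<longrightarrow> k t = k x + \<phi> (\<gamma> x) (\<gamma> t)"
      using assms(2) x unfolding parallel_def by blast
    obtain e2 where e2: "e2 > 0" "\<forall>t\<in>{a..b}. \<bar>t - x\<bar> < e2 \<longrightarrow> k' t = k' x + \<phi> (\<gamma> x) (\<gamma> t)"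
      using assms(3) x unfolding parallel_def by blast
    have step: "k t - k' t = k x - k' x" if "t \<in> {a..b}" "\<bar>t - x\<bar> < min e1 e2" for t
      using e1(2)[rule_format, of t] e2(2)[rule_format, of t] that by (simp only: group_normal)
    show ?case
    proof (intro exI[of _ "min e1 e2"] conjI allI impI)
      fix c d assume *: "a \<le> c \<and> c \<le> x \<and> x \<le> d \<and> d \<le> b \<and> d - c < min e1 e2"
      then show "k d - k' d = k c - k' c"
        using step[of c] step[of d] by auto
    qed (use e1 e2 in auto)
  qed
qed

definition transport :: "(real \<Rightarrow> 'a) \<Rightarrow> real \<Rightarrow> real \<Rightarrow> 'g" where
  "transport \<gamma> a b = (let k = SOME k. parallel \<gamma> a b k in - k a + k b)"

lemma transport_parallel:
  assumes "a \<le> b" "parallel \<gamma> a b k"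
  shows "k b = k a + transport \<gamma> a b"
proof -
  define k' where "k' = (SOME k. parallel \<gamma> a b k)"
  have "parallel \<gamma> a b k'"
    unfolding k'_def using someI[of "parallel \<gamma> a b" k] assms(2) by simp
  from parallel_unique[OF assms(1,2) this] have "k b = k a - k' a + k' b"
    by (metis diff_add_cancel)
  then show ?thesis
    by (simp only: transport_def k'_def Let_def group_normal)
qed

lemma transport_split:
  assumes "clear \<gamma> a c" "a \<le> b" "b \<le> c"
  shows "transport \<gamma> a c = transport \<gamma> a b + transport \<gamma> b c"
proof -
  obtain k where k: "parallel \<gamma> a c k"
    using parallel_exists assms by fastforce
  have "k c = k a + transport \<gamma> a c" "k b = k a + transport \<gamma> a b" "k c = k b + transport \<gamma> b c"
    using transport_parallel[OF _ k] transport_parallel[OF _ parallel_subinterval[OF k]] assms by auto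
  then show ?thesis by (simp add: add.assoc)
qed

lemma transport_coset:
  assumes "clear \<gamma> a b" "a \<le> b" "\<gamma> ` {a..b} \<subseteq> ball p (rad p)"
  shows "\<exists>h\<in>H p. transport \<gamma> a b = - \<phi> p (\<gamma> a) + h + \<phi> p (\<gamma> b)"
proof -
  obtain k where k: "parallel \<gamma> a b k"
    using parallel_exists assms by fastforce
  obtain h where "h \<in> H p" "k b = k a - \<phi> p (\<gamma> a) + h + \<phi> p (\<gamma> b)"
    using parallel_coset[OF assms k] by blast
  moreover have "k b = k a + transport \<gamma> a b"
    by (rule transport_parallel[OF assms(2) k])
  ultimately have "k a + transport \<gamma> a b = k a + (- \<phi> p (\<gamma> a) + h + \<phi> p (\<gamma> b))"
    by (simp only: group_normal)
  then show ?thesis using \<open>h \<in> H p\<close> by (meson add_left_cancel)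
qed

definition hol :: "(real \<Rightarrow> real \<Rightarrow> 'a) \<Rightarrow> real \<Rightarrow> real \<Rightarrow> real \<Rightarrow> real \<Rightarrow> 'g" where
  "hol F x1 x2 y1 y2 =
     transport (\<lambda>x. F x y1) x1 x2 + transport (F x2) y1 y2 - transport (\<lambda>x. F x y2) x1 x2 - transport (F x1) y1 y2"

text \<open>The right part is based at \<open>x2\<close> instead of \<open>x1\<close>, hence its
  conjugation by the transport along the bottom. A conjugation-invariant norm does not see
  it.\<close>

lemma hol_split_x:
  assumes "clear (\<lambda>x. F x y1) x1 x3" "clear (\<lambda>x. F x y2) x1 x3" "x1 \<le> x2" "x2 \<le> x3"
  shows "hol F x1 x3 y1 y2 = transport (\<lambda>x. F x y1) x1 x2 + hol F x2 x3 y1 y2 - transport (\<lambda>x. F x y1) x1 x2 + hol F x1 x2 y1 y2"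
  unfolding hol_def transport_split[OF assms(1,3,4)] transport_split[OF assms(2,3,4)]
  by (simp only: group_normal)

lemma hol_split_y:
  assumes "clear (F x1) y1 y3" "clear (F x2) y1 y3" "y1 \<le> y2" "y2 \<le> y3"
  shows "hol F x1 x2 y1 y3 = hol F x1 x2 y1 y2 + (transport (F x1) y1 y2 + hol F x1 x2 y2 y3 - transport (F x1) y1 y2)"
  unfolding hol_def transport_split[OF assms(1,3,4)] transport_split[OF assms(2,3,4)]
  by (simp only: group_normal)

text \<open>All four transports happen in one ball around \<open>p\<close>: the potentials of the
  corners telescope, and only factors from \<open>H p\<close> remain. This serves both for small
  squares without puncture, where \<open>H p\<close> is trivial, and for a small square around a
  puncture \<open>p\<close>.\<close>

lemma hol_coset:
  assumes "clear (\<lambda>x. F x y1) x1 x2" "clear (\<lambda>x. F x y2) x1 x2" "clear (F x1) y1 y2" "clear (F x2) y1 y2"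
    and "x1 \<le> x2" "y1 \<le> y2"
    and ball: "\<And>x y. x \<in> {x1..x2} \<Longrightarrow> y \<in> {y1..y2} \<Longrightarrow> F x y \<in> ball p (rad p)"
  shows "\<exists>h\<in>H p. hol F x1 x2 y1 y2 = - \<phi> p (F x1 y1) + h + \<phi> p (F x1 y1)"
proof -
  have b: "(\<lambda>x. F x y1) ` {x1..x2} \<subseteq> ball p (rad p)" "(\<lambda>x. F x y2) ` {x1..x2} \<subseteq> ball p (rad p)"
    "F x1 ` {y1..y2} \<subseteq> ball p (rad p)" "F x2 ` {y1..y2} \<subseteq> ball p (rad p)"
    using ball assms(5,6) by (auto simp del: mem_ball)
  obtain h1 where h1: "h1 \<in> H p" "transport (\<lambda>x. F x y1) x1 x2 = - \<phi> p (F x1 y1) + h1 + \<phi> p (F x2 y1)"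
    using transport_coset[OF assms(1,5) b(1)] by blast
  obtain h2 where h2: "h2 \<in> H p" "transport (\<lambda>x. F x y2) x1 x2 = - \<phi> p (F x1 y2) + h2 + \<phi> p (F x2 y2)"
    using transport_coset[OF assms(2,5) b(2)] by blast
  obtain h3 where h3: "h3 \<in> H p" "transport (F x1) y1 y2 = - \<phi> p (F x1 y1) + h3 + \<phi> p (F x1 y2)"
    using transport_coset[OF assms(3,6) b(3)] by blast
  obtain h4 where h4: "h4 \<in> H p" "transport (F x2) y1 y2 = - \<phi> p (F x2 y1) + h4 + \<phi> p (F x2 y2)"
    using transport_coset[OF assms(4,6) b(4)] by blast
  have "h1 + h4 + - h2 + - h3 \<in> H p"
    by (intro subgroup_add subgroup_minus h1 h2 h3 h4)
  moreover have "hol F x1 x2 y1 y2 = - \<phi> p (F x1 y1) + (h1 + h4 + - h2 + - h3) + \<phi> p (F x1 y1)"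
    unfolding hol_def h1(2) h2(2) h3(2) h4(2)
    by (simp only: group_normal)
  ultimately show ?thesis by blast
qed

end

text \<open>\<open>N\<close> is a conjugation-invariant length, later the number of points moved by
  a permutation. Only the meridians of \<open>A\<close> get a bound, since the squares to be filled
  avoid \<open>K\<close>.\<close>

locale normed_local_system = local_system \<phi> H "K \<union> A"
  for \<phi> :: "'a::metric_space \<Rightarrow> 'a \<Rightarrow> 'g::group_add" and H K A +
  fixes N :: "'g \<Rightarrow> nat" and M :: nat
  assumes norm_zero: "N 0 = 0"
    and norm_add: "N (a + b) \<le> N a + N b"
    and norm_minus: "N (- a) = N a"
    and norm_conj: "N (- c + a + c) = N a"
    and norm_meridian: "p \<in> A \<Longrightarrow> h \<in> H p \<Longrightarrow> N h \<le> M"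
begin

lemma norm_conj': "N (c + a - c) = N a"
  using norm_conj[of "- c" a] by simp

definition punctures :: "(real \<Rightarrow> real \<Rightarrow> 'a) \<Rightarrow> real \<Rightarrow> real \<Rightarrow> real \<Rightarrow> real \<Rightarrow> (real \<times> real) set" where
  "punctures F x1 x2 y1 y2 = {(x, y). x \<in> {x1..x2} \<and> y \<in> {y1..y2} \<and> F x y \<in> A}"

definition good :: "(real \<Rightarrow> real \<Rightarrow> 'a) \<Rightarrow> real \<Rightarrow> real \<Rightarrow> real \<Rightarrow> real \<Rightarrow> bool" where
  "good F x1 x2 y1 y2 \<longleftrightarrow> -1 < x1 \<and> x1 \<le> x2 \<and> x2 < 1 \<and> -1 < y1 \<and> y1 \<le> y2 \<and> y2 < 1 \<and>
     (\<forall>x\<in>{x1..x2}. F x y1 \<notin> A \<and> F x y2 \<notin> A) \<and> (\<forall>y\<in>{y1..y2}. F x1 y \<notin> A \<and> F x2 y \<notin> A)"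

context
  fixes F :: "real \<Rightarrow> real \<Rightarrow> 'a"
  assumes contF: "continuous_on ({-1<..<1} \<times> {-1<..<1}) (\<lambda>(x, y). F x y)"
    and offK: "\<And>x y. x \<in> {-1<..<1} \<Longrightarrow> y \<in> {-1<..<1} \<Longrightarrow> F x y \<notin> K"
    and finite_punctures: "finite {(x, y). x \<in> {-1<..<1} \<and> y \<in> {-1<..<1} \<and> F x y \<in> A}"
begin

lemma clear_horizontal:
  assumes "-1 < a" "b < 1" "y \<in> {-1<..<1}" "\<And>x. x \<in> {a..b} \<Longrightarrow> F x y \<notin> A"
  shows "clear (\<lambda>x. F x y) a b"
proof -
  have "continuous_on {a..b} ((\<lambda>(x, y). F x y) \<circ> (\<lambda>x. (x, y)))"
    using assms(1-3) by (intro continuous_on_compose continuous_on_subset[OF contF] continuous_intros) auto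
  then show ?thesis
    using assms offK unfolding clear_def by (auto simp: o_def)
qed

lemma clear_vertical:
  assumes "-1 < a" "b < 1" "x \<in> {-1<..<1}" "\<And>y. y \<in> {a..b} \<Longrightarrow> F x y \<notin> A"
  shows "clear (F x) a b"
proof -
  have "continuous_on {a..b} ((\<lambda>(x, y). F x y) \<circ> (\<lambda>y. (x, y)))"
    using assms(1-3) by (intro continuous_on_compose continuous_on_subset[OF contF] continuous_intros) auto
  then show ?thesis
    using assms offK unfolding clear_def by (auto simp: o_def)
qed

lemma near_ball:
  assumes "x0 \<in> {-1<..<1}" "y0 \<in> {-1<..<1}"
  shows "\<exists>\<delta>>0. \<forall>x\<in>{-1<..<1}. \<forall>y\<in>{-1<..<1}. \<bar>x - x0\<bar> < \<delta> \<longrightarrow> \<bar>y - y0\<bar> < \<delta> \<longrightarrow> F x y \<in> ball (F x0 y0) (rad (F x0 y0))"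
proof -
  have xy: "(x0, y0) \<in> {-1<..<1::real} \<times> {-1<..<1::real}" using assms by simp
  obtain d where d: "d > 0" "\<And>u. u \<in> {-1<..<1} \<times> {-1<..<1} \<Longrightarrow> dist u (x0, y0) < d \<Longrightarrow>
      dist (case u of (x, y) \<Rightarrow> F x y) (F x0 y0) < rad (F x0 y0)"
    using contF[unfolded continuous_on_iff, rule_format, OF xy rad(1)[of "F x0 y0"]] by auto
  show ?thesis
  proof (intro exI[of _ "d / 2"] conjI ballI impI)
    fix x y assume *: "x \<in> {-1<..<1::real}" "y \<in> {-1<..<1::real}" "\<bar>x - x0\<bar> < d / 2" "\<bar>y - y0\<bar> < d / 2"
    have "dist (x, y) (x0, y0) \<le> dist (x, y) (x0, y) + dist (x0, y) (x0, y0)"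
      by (rule dist_triangle)
    also have "\<dots> = \<bar>x - x0\<bar> + \<bar>y - y0\<bar>" by (simp add: dist_Pair_Pair dist_real_def)
    finally have "dist (x, y) (x0, y0) < d" using * by simp
    then show "F x y \<in> ball (F x0 y0) (rad (F x0 y0))"
      using d(2)[of "(x, y)"] * by (simp add: dist_commute)
  qed (use d in simp)
qed

text \<open>Two nested bisections. For fixed \<open>x0\<close> the interval of \<open>y\<close> is
  bisected first and yields a width that works for the full height; then the interval of
  \<open>x\<close> is bisected.\<close>

lemma hol_eq_0:
  assumes "-1 < x1" "x1 \<le> x2" "x2 < 1" "-1 < y1" "y1 \<le> y2" "y2 < 1"
    and free: "\<And>x y. x \<in> {x1..x2} \<Longrightarrow> y \<in> {y1..y2} \<Longrightarrow> F x y \<notin> A"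
  shows "hol F x1 x2 y1 y2 = 0"
  using assms(2)
proof (induction rule: Bolzano_subintervals)
  case (trans c d e)
  have "clear (\<lambda>x. F x y1) c e" "clear (\<lambda>x. F x y2) c e"
    using assms trans(1-4) by (auto intro!: clear_horizontal free)
  from hol_split_x[OF this trans(2,3)] show ?case
    using trans by simp
next
  case (local x0)
  note x0 = this
  have "\<exists>\<delta>>0. \<forall>c d. x1 \<le> c \<and> c \<le> x0 \<and> x0 \<le> d \<and> d \<le> x2 \<and> d - c < \<delta> \<longrightarrow> hol F c d y1 y2 = 0"
    using assms(5)
  proof (induction rule: Bolzano_subintervals)
    case (trans c d e)
    obtain e1 where e1: "e1 > 0" "\<And>a b. x1 \<le> a \<Longrightarrow> a \<le> x0 \<Longrightarrow> x0 \<le> b \<Longrightarrow> b \<le> x2 \<Longrightarrow> b - a < e1 \<Longrightarrow> hol F a b c d = 0"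
      using trans by blast
    obtain e2 where e2: "e2 > 0" "\<And>a b. x1 \<le> a \<Longrightarrow> a \<le> x0 \<Longrightarrow> x0 \<le> b \<Longrightarrow> b \<le> x2 \<Longrightarrow> b - a < e2 \<Longrightarrow> hol F a b d e = 0"
      using trans by blast
    show ?case
    proof (intro exI[of _ "min e1 e2"] conjI allI impI)
      fix a b assume *: "x1 \<le> a \<and> a \<le> x0 \<and> x0 \<le> b \<and> b \<le> x2 \<and> b - a < min e1 e2"
      have "clear (F a) c e" "clear (F b) c e"
        using assms trans(1-4) * by (auto intro!: clear_vertical free)
      from hol_split_y[OF this trans(2,3)] show "hol F a b c e = 0"
        using e1(2)[of a b] e2(2)[of a b] * by simp
    qed (use e1 e2 in auto)
  next
    case (local y0)
    have "F x0 y0 \<notin> K \<union> A"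
      using offK[of x0 y0] free[of x0 y0] local x0 assms by auto
    then have H0: "H (F x0 y0) = {0}" by (rule trivial_off_L)
    obtain \<delta> where \<delta>: "\<delta> > 0" "\<forall>x\<in>{-1<..<1}. \<forall>y\<in>{-1<..<1}. \<bar>x - x0\<bar> < \<delta> \<longrightarrow> \<bar>y - y0\<bar> < \<delta> \<longrightarrow> F x y \<in> ball (F x0 y0) (rad (F x0 y0))"
      using near_ball[of x0 y0] local x0 assms by auto
    show ?case
    proof (intro exI[of _ \<delta>] conjI allI impI)
      fix c d a b
      assume cd: "y1 \<le> c \<and> c \<le> y0 \<and> y0 \<le> d \<and> d \<le> y2 \<and> d - c < \<delta>"
        and ab: "x1 \<le> a \<and> a \<le> x0 \<and> x0 \<le> b \<and> b \<le> x2 \<and> b - a < \<delta>"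
      have "\<exists>h\<in>H (F x0 y0). hol F a b c d = - \<phi> (F x0 y0) (F a c) + h + \<phi> (F x0 y0) (F a c)"
      proof (rule hol_coset)
        show "clear (\<lambda>x. F x c) a b" "clear (\<lambda>x. F x d) a b" "clear (F a) c d" "clear (F b) c d"
          using assms ab cd by (auto intro!: clear_vertical clear_horizontal free)
        show "F x y \<in> ball (F x0 y0) (rad (F x0 y0))" if "x \<in> {a..b}" "y \<in> {c..d}" for x y
          using \<delta>(2)[rule_format, of x y] that ab cd assms by auto
      qed (use ab cd in auto)
      then show "hol F a b c d = 0" using H0 by simp
    qed (use \<delta> in auto)
  qed
  then show ?case by blast
qed

lemma good_clear:
  assumes "good F x1 x2 y1 y2"
  shows "clear (\<lambda>x. F x y1) x1 x2" "clear (\<lambda>x. F x y2) x1 x2" "clear (F x1) y1 y2" "clear (F x2) y1 y2"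
  using assms unfolding good_def by (auto intro!: clear_vertical clear_horizontal)

lemma finite_punctures_rect: "good F x1 x2 y1 y2 \<Longrightarrow> finite (punctures F x1 x2 y1 y2)"
  unfolding punctures_def good_def by (rule finite_subset[OF _ finite_punctures]) auto

lemma split_x:
  assumes "good F x1 x3 y1 y2" "x1 \<le> x2" "x2 \<le> x3" "\<And>y. y \<in> {y1..y2} \<Longrightarrow> F x2 y \<notin> A"
  shows "good F x1 x2 y1 y2" "good F x2 x3 y1 y2"
    "N (hol F x1 x3 y1 y2) \<le> N (hol F x1 x2 y1 y2) + N (hol F x2 x3 y1 y2)"
    "card (punctures F x1 x3 y1 y2) = card (punctures F x1 x2 y1 y2) + card (punctures F x2 x3 y1 y2)"
proof -
  show g: "good F x1 x2 y1 y2" "good F x2 x3 y1 y2"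
    using assms unfolding good_def by auto
  show "N (hol F x1 x3 y1 y2) \<le> N (hol F x1 x2 y1 y2) + N (hol F x2 x3 y1 y2)"
    unfolding hol_split_x[OF good_clear(1,2)[OF assms(1)] assms(2,3)]
    using norm_add norm_conj' by (metis add.commute)
  have "punctures F x1 x3 y1 y2 = punctures F x1 x2 y1 y2 \<union> punctures F x2 x3 y1 y2"
    using assms(2,3) unfolding punctures_def by auto
  moreover have "punctures F x1 x2 y1 y2 \<inter> punctures F x2 x3 y1 y2 = {}"
    using assms unfolding punctures_def by force
  ultimately show "card (punctures F x1 x3 y1 y2) = card (punctures F x1 x2 y1 y2) + card (punctures F x2 x3 y1 y2)"
    using card_Un_disjoint finite_punctures_rect[OF g(1)] finite_punctures_rect[OF g(2)] by metis
qed

lemma split_y: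
  assumes "good F x1 x2 y1 y3" "y1 \<le> y2" "y2 \<le> y3" "\<And>x. x \<in> {x1..x2} \<Longrightarrow> F x y2 \<notin> A"
  shows "good F x1 x2 y1 y2" "good F x1 x2 y2 y3"
    "N (hol F x1 x2 y1 y3) \<le> N (hol F x1 x2 y1 y2) + N (hol F x1 x2 y2 y3)"
    "card (punctures F x1 x2 y1 y3) = card (punctures F x1 x2 y1 y2) + card (punctures F x1 x2 y2 y3)"
proof -
  show g: "good F x1 x2 y1 y2" "good F x1 x2 y2 y3"
    using assms unfolding good_def by auto
  show "N (hol F x1 x2 y1 y3) \<le> N (hol F x1 x2 y1 y2) + N (hol F x1 x2 y2 y3)"
    unfolding hol_split_y[OF good_clear(3,4)[OF assms(1)] assms(2,3)]
    using norm_add norm_conj' by metis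
  have "punctures F x1 x2 y1 y3 = punctures F x1 x2 y1 y2 \<union> punctures F x1 x2 y2 y3"
    using assms(2,3) unfolding punctures_def by auto
  moreover have "punctures F x1 x2 y1 y2 \<inter> punctures F x1 x2 y2 y3 = {}"
    using assms unfolding punctures_def by force
  ultimately show "card (punctures F x1 x2 y1 y3) = card (punctures F x1 x2 y1 y2) + card (punctures F x1 x2 y2 y3)"
    using card_Un_disjoint finite_punctures_rect[OF g(1)] finite_punctures_rect[OF g(2)] by metis
qed

text \<open>Two vertical and two horizontal cuts isolate one puncture in a small square, whose
  holonomy is conjugate to a meridian and has norm at most \<open>M\<close>. The four remaining
  rectangles contain fewer punctures.\<close>

lemma hol_norm_le:
  "good F x1 x2 y1 y2 \<Longrightarrow> N (hol F x1 x2 y1 y2) \<le> M * card (punctures F x1 x2 y1 y2)"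
proof (induction "card (punctures F x1 x2 y1 y2)" arbitrary: x1 x2 y1 y2 rule: less_induct)
  case less
  show ?case
  proof (cases "punctures F x1 x2 y1 y2 = {}")
    case True
    then have "hol F x1 x2 y1 y2 = 0"
      using less.prems unfolding good_def punctures_def by (intro hol_eq_0) auto
    then show ?thesis by (simp add: norm_zero)
  next
    case False
    then obtain a b where ab: "(a, b) \<in> punctures F x1 x2 y1 y2" by auto
    then have pA: "F a b \<in> A" and strict: "x1 < a" "a < x2" "y1 < b" "b < y2"
      using less.prems unfolding punctures_def good_def by (auto simp: less_le)
    have S: "a \<in> {-1<..<1}" "b \<in> {-1<..<1}"
      using strict less.prems unfolding good_def by auto
    obtain \<delta> where \<delta>: "\<delta> > 0" "\<forall>x\<in>{-1<..<1}. \<forall>y\<in>{-1<..<1}. \<bar>x - a\<bar> < \<delta> \<longrightarrow> \<bar>y - b\<bar> < \<delta> \<longrightarrow> F x y \<in> ball (F a b) (rad (F a b))"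
      using near_ball[OF S] by blast
    define m where "m = Min {\<delta>, a - x1, x2 - a, b - y1, y2 - b}"
    have m: "m > 0" "m \<le> \<delta>" "m \<le> a - x1" "m \<le> x2 - a" "m \<le> b - y1" "m \<le> y2 - b"
      using \<delta>(1) strict unfolding m_def by auto
    let ?Z = "{(x, y). x \<in> {-1<..<1} \<and> y \<in> {-1<..<1} \<and> F x y \<in> A}"
    \<comment> \<open>The half side \<open>e\<close> must avoid the finitely many distances at which
      a cutting line would run through a puncture.\<close>
    have "infinite ({0<..<m} - ((\<lambda>(x, y). \<bar>x - a\<bar>) ` ?Z \<union> (\<lambda>(x, y). \<bar>y - b\<bar>) ` ?Z))"
      using m(1) finite_punctures by (intro Diff_infinite_finite) auto
    then obtain e where eD: "e \<in> {0<..<m} - ((\<lambda>(x, y). \<bar>x - a\<bar>) ` ?Z \<union> (\<lambda>(x, y). \<bar>y - b\<bar>) ` ?Z)"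
      using infinite_imp_nonempty by blast
    have e: "0 < e" "e < m" using eD by auto
    have e3: "\<bar>x - a\<bar> \<noteq> e \<and> \<bar>y - b\<bar> \<noteq> e" if "(x, y) \<in> ?Z" for x y
    proof -
      have "\<bar>x - a\<bar> \<in> (\<lambda>(x, y). \<bar>x - a\<bar>) ` ?Z" "\<bar>y - b\<bar> \<in> (\<lambda>(x, y). \<bar>y - b\<bar>) ` ?Z"
        using that by (force intro: rev_image_eqI)+
      then show ?thesis using eD by blast
    qed
    have off: "F x y \<notin> A" if "x \<in> {x1..x2}" "y \<in> {y1..y2}" "\<bar>x - a\<bar> = e \<or> \<bar>y - b\<bar> = e" for x y
      using e3[of x y] that less.prems unfolding good_def by auto
    have s1: "good F x1 (a - e) y1 y2" "good F (a - e) x2 y1 y2"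
      "N (hol F x1 x2 y1 y2) \<le> N (hol F x1 (a - e) y1 y2) + N (hol F (a - e) x2 y1 y2)"
      "card (punctures F x1 x2 y1 y2) = card (punctures F x1 (a - e) y1 y2) + card (punctures F (a - e) x2 y1 y2)"
      using split_x[OF less.prems, of "a - e"] e m strict off by auto
    have s2: "good F (a - e) (a + e) y1 y2" "good F (a + e) x2 y1 y2"
      "N (hol F (a - e) x2 y1 y2) \<le> N (hol F (a - e) (a + e) y1 y2) + N (hol F (a + e) x2 y1 y2)"
      "card (punctures F (a - e) x2 y1 y2) = card (punctures F (a - e) (a + e) y1 y2) + card (punctures F (a + e) x2 y1 y2)"
      using split_x[OF s1(2), of "a + e"] e m strict off by auto
    have s3: "good F (a - e) (a + e) y1 (b - e)" "good F (a - e) (a + e) (b - e) y2"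
      "N (hol F (a - e) (a + e) y1 y2) \<le> N (hol F (a - e) (a + e) y1 (b - e)) + N (hol F (a - e) (a + e) (b - e) y2)"
      "card (punctures F (a - e) (a + e) y1 y2) = card (punctures F (a - e) (a + e) y1 (b - e)) + card (punctures F (a - e) (a + e) (b - e) y2)"
      using split_y[OF s2(1), of "b - e"] e m strict off by auto
    have s4: "good F (a - e) (a + e) (b - e) (b + e)" "good F (a - e) (a + e) (b + e) y2"
      "N (hol F (a - e) (a + e) (b - e) y2) \<le> N (hol F (a - e) (a + e) (b - e) (b + e)) + N (hol F (a - e) (a + e) (b + e) y2)"
      "card (punctures F (a - e) (a + e) (b - e) y2) = card (punctures F (a - e) (a + e) (b - e) (b + e)) + card (punctures F (a - e) (a + e) (b + e) y2)"
      using split_y[OF s3(2), of "b + e"] e m strict off by auto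
    have "(a, b) \<in> punctures F (a - e) (a + e) (b - e) (b + e)"
      using pA e unfolding punctures_def by auto
    then have c1: "card (punctures F (a - e) (a + e) (b - e) (b + e)) \<ge> 1"
      using finite_punctures_rect[OF s4(1)] by (metis One_nat_def Suc_leI card_gt_0_iff empty_iff)
    have "\<exists>h\<in>H (F a b). hol F (a - e) (a + e) (b - e) (b + e) = - \<phi> (F a b) (F (a - e) (b - e)) + h + \<phi> (F a b) (F (a - e) (b - e))"
    proof (rule hol_coset)
      show "F x y \<in> ball (F a b) (rad (F a b))" if "x \<in> {a - e..a + e}" "y \<in> {b - e..b + e}" for x y
        using \<delta>(2)[rule_format, of x y] that e m s4(1) unfolding good_def by auto
    qed (use good_clear[OF s4(1)] e in auto)
    then have "N (hol F (a - e) (a + e) (b - e) (b + e)) \<le> M"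
      using norm_conj norm_meridian[OF pA] by auto
    also have "M \<le> M * card (punctures F (a - e) (a + e) (b - e) (b + e))"
      using c1 by simp
    finally have n0: "N (hol F (a - e) (a + e) (b - e) (b + e)) \<le> M * card (punctures F (a - e) (a + e) (b - e) (b + e))" .
    have n1: "N (hol F x1 (a - e) y1 y2) \<le> M * card (punctures F x1 (a - e) y1 y2)"
      "N (hol F (a + e) x2 y1 y2) \<le> M * card (punctures F (a + e) x2 y1 y2)"
      "N (hol F (a - e) (a + e) y1 (b - e)) \<le> M * card (punctures F (a - e) (a + e) y1 (b - e))"
      "N (hol F (a - e) (a + e) (b + e) y2) \<le> M * card (punctures F (a - e) (a + e) (b + e) y2)"
      using s1 s2 s3 s4 c1 by (auto intro!: less.hyps)
    show ?thesis
      using n0 n1 s1(3) s2(3) s3(3) s4(3) unfolding s1(4) s2(4) s3(4) s4(4) by (simp add: algebra_simps)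
  qed
qed

end

end

section \<open>Transport next to the boundary curve, modulo meridians\<close>

context normed_local_system
begin

text \<open>The values at \<open>q\<close> that are compatible with the value \<open>c\<close> at
  \<open>p\<close>. If \<open>p\<close> lies on \<open>K\<close>, a path approaching it may wind
  around \<open>K\<close>, which inserts an element of \<open>H p\<close>.\<close>

definition coset :: "'g \<Rightarrow> 'a \<Rightarrow> 'a \<Rightarrow> 'g set" where
  "coset c p q = (\<lambda>h. c + h + \<phi> p q) ` H p"

text \<open>Because the meridian subgroups at \<open>p\<close> and \<open>p'\<close> are conjugate
  by \<open>\<phi> p p'\<close>, the reference point can be moved along \<open>K\<close> without
  changing the coset seen from nearby points.\<close>

lemma coset_rebase:
  assumes "p' \<in> ball p (rad p)" "c' \<in> coset c p p'"
    and conj: "H p' = (\<lambda>h. - \<phi> p p' + h + \<phi> p p') ` H p"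
  shows "\<exists>\<delta>>0. \<forall>q\<in>ball p' \<delta> - (K \<union> A). coset c' p' q = coset c p q"
proof -
  obtain \<delta> where \<delta>: "\<delta> > 0" "\<forall>q\<in>ball p' \<delta> - (K \<union> A). \<phi> p p' + \<phi> p' q - \<phi> p q \<in> H p"
    using rad(2)[OF assms(1)] by blast
  obtain h1 where h1: "h1 \<in> H p" "c' = c + h1 + \<phi> p p'"
    using assms(2) unfolding coset_def by blast
  have "coset c' p' q = coset c p q" if q: "q \<in> ball p' \<delta> - (K \<union> A)" for q
  proof -
    define h2 where "h2 = \<phi> p p' + \<phi> p' q - \<phi> p q"
    have h2: "h2 \<in> H p" using \<delta>(2) q h2_def by blast
    have eq: "c' + (- \<phi> p p' + h + \<phi> p p') + \<phi> p' q = c + (h1 + h + h2) + \<phi> p q" for h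
      unfolding h1(2) h2_def by (simp only: group_normal)
    have "c' + (- \<phi> p p' + h + \<phi> p p') + \<phi> p' q \<in> coset c p q" if "h \<in> H p" for h
      unfolding eq coset_def using that h1 h2 by (intro imageI subgroup_add)
    moreover have "c + h + \<phi> p q \<in> coset c' p' q" if "h \<in> H p" for h
    proof -
      have "c + h + \<phi> p q = c' + (- \<phi> p p' + (- h1 + h + - h2) + \<phi> p p') + \<phi> p' q"
        unfolding eq by (simp only: group_normal)
      moreover have "- h1 + h + - h2 \<in> H p"
        using that h1 h2 by (intro subgroup_add subgroup_minus)
      ultimately show ?thesis
        unfolding coset_def conj by blast
    qed
    ultimately show ?thesis
      unfolding coset_def[of c' p'] conj coset_def[of c p q] by (force simp: coset_def conj)
  qed
  then show ?thesis using \<delta>(1) by blast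
qed

text \<open>The transport has the form
  \<open>- \<phi> p (\<gamma> a) + h0 + \<phi> p (\<gamma> b)\<close>, so it merely multiplies the
  middle factor by \<open>h0\<close>. Both directions are used, as the sides of a square are
  traversed forwards and backwards.\<close>

lemma transport_in_coset:
  assumes "clear \<gamma> a b" "a \<le> b" "\<gamma> ` {a..b} \<subseteq> ball p (rad p)"
  shows "z \<in> coset c p (\<gamma> a) \<longleftrightarrow> z + transport \<gamma> a b \<in> coset c p (\<gamma> b)"
proof -
  obtain h0 where h0: "h0 \<in> H p" "transport \<gamma> a b = - \<phi> p (\<gamma> a) + h0 + \<phi> p (\<gamma> b)"
    using transport_coset[OF assms] by blast
  have "z + transport \<gamma> a b \<in> coset c p (\<gamma> b)" if "z = c + h + \<phi> p (\<gamma> a)" "h \<in> H p" for h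
  proof -
    have "z + transport \<gamma> a b = c + (h + h0) + \<phi> p (\<gamma> b)"
      unfolding that(1) h0(2) by (simp only: group_normal)
    then show ?thesis
      unfolding coset_def using subgroup_add[OF that(2) h0(1)] by blast
  qed
  moreover have "z \<in> coset c p (\<gamma> a)" if "z + transport \<gamma> a b = c + h + \<phi> p (\<gamma> b)" "h \<in> H p" for h
  proof -
    have "z = c + h + \<phi> p (\<gamma> b) - transport \<gamma> a b"
      using that(1) by (metis add_diff_cancel)
    also have "\<dots> = c + (h + - h0) + \<phi> p (\<gamma> a)"
      unfolding h0(2) by (simp only: group_normal)
    finally show ?thesis
      unfolding coset_def using subgroup_add[OF that(2) subgroup_minus[OF h0(1)]] by blast
  qed
  ultimately show ?thesis
    unfolding coset_def by blast
qed

text \<open>\<open>w \<eta>\<close> is the path \<open>w 0\<close> in \<open>K\<close> pushed off by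
  \<open>\<eta>\<close>, and \<open>c\<close> is a section over it. Cosets at an end point can be
  rebased only for \<open>\<eta>\<close> below a bound depending on that point; this is why the
  claim holds eventually in \<open>\<eta>\<close>, a form that passes through the bisection.\<close>

lemma transport_near_boundary:
  fixes w :: "real \<Rightarrow> real \<Rightarrow> 'a" and c :: "'a \<Rightarrow> 'g"
  assumes "a \<le> b"
    and cont: "continuous_on ({a..b} \<times> {0..1}) (\<lambda>(x, \<eta>). w \<eta> x)"
    and clear: "\<And>\<eta>. 0 < \<eta> \<Longrightarrow> \<eta> < \<eta>' \<Longrightarrow> clear (w \<eta>) a b" and "\<eta>' > 0"
    and onK: "\<And>x. x \<in> {a..b} \<Longrightarrow> w 0 x \<in> K"
    and sec: "\<And>x. x \<in> {a..b} \<Longrightarrow> \<exists>\<delta>>0. \<forall>p'\<in>ball (w 0 x) \<delta> \<inter> K. c p' \<in> coset (c (w 0 x)) (w 0 x) p'"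
    and conj: "\<And>p. p \<in> K \<Longrightarrow> \<exists>\<delta>>0. \<forall>p'\<in>ball p \<delta> \<inter> K. H p' = (\<lambda>h. - \<phi> p p' + h + \<phi> p p') ` H p"
  shows "eventually (\<lambda>\<eta>. \<forall>z. z \<in> coset (c (w 0 a)) (w 0 a) (w \<eta> a) \<longleftrightarrow>
      z + transport (w \<eta>) a b \<in> coset (c (w 0 b)) (w 0 b) (w \<eta> b)) (at_right 0)"
  using assms(1)
proof (induction rule: Bolzano_subintervals)
  case (trans d e f)
  have "eventually (\<lambda>\<eta>. 0 < \<eta> \<and> \<eta> < \<eta>') (at_right 0)"
    using \<open>\<eta>' > 0\<close> by (auto simp: eventually_at_right)
  with trans(5,6) show ?case
  proof eventually_elim
    case (elim \<eta>)
    then have "transport (w \<eta>) d f = transport (w \<eta>) d e + transport (w \<eta>) e f"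
      using trans(1-4) clear by (intro transport_split) (auto intro: clear_subinterval)
    then show ?case using elim by (simp add: add.assoc)
  qed
next
  case (local x)
  then have x: "x \<in> {a..b}" by simp
  define p where "p = w 0 x"
  obtain \<delta>1 where \<delta>1: "\<delta>1 > 0" "\<forall>p'\<in>ball p \<delta>1 \<inter> K. c p' \<in> coset (c p) p p'"
    using sec[OF x] p_def by blast
  obtain \<delta>2 where \<delta>2: "\<delta>2 > 0" "\<forall>p'\<in>ball p \<delta>2 \<inter> K. H p' = (\<lambda>h. - \<phi> p p' + h + \<phi> p p') ` H p"
    using conj[OF onK[OF x]] p_def by blast
  define r where "r = Min {rad p, \<delta>1, \<delta>2}"
  have r: "r > 0" "r \<le> rad p" "r \<le> \<delta>1" "r \<le> \<delta>2"
    using rad(1) \<delta>1 \<delta>2 unfolding r_def by auto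
  have x0: "(x, 0) \<in> {a..b} \<times> {0..1::real}" using x by simp
  obtain d where d: "d > 0" "\<And>u. u \<in> {a..b} \<times> {0..1} \<Longrightarrow> dist u (x, 0) < d \<Longrightarrow>
      dist (case u of (x, \<eta>) \<Rightarrow> w \<eta> x) p < r"
    using cont[unfolded continuous_on_iff, rule_format, OF x0 r(1)] p_def by auto
  define \<epsilon> where "\<epsilon> = min (d / 2) 1"
  have near: "w \<eta> t \<in> ball p r" if "t \<in> {a..b}" "0 \<le> \<eta>" "\<eta> < \<epsilon>" "\<bar>t - x\<bar> < \<epsilon>" for \<eta> t
  proof -
    have "dist (t, \<eta>) (x, 0) \<le> dist (t, \<eta>) (x, \<eta>) + dist (x, \<eta>) (x, 0)"
      by (rule dist_triangle)
    also have "\<dots> = \<bar>t - x\<bar> + \<bar>\<eta>\<bar>" by (simp add: dist_Pair_Pair dist_real_def)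
    finally have "dist (t, \<eta>) (x, 0) < d" using that unfolding \<epsilon>_def by linarith
    then show ?thesis using d(2)[of "(t, \<eta>)"] that unfolding \<epsilon>_def by (simp add: dist_commute)
  qed
  have \<epsilon>: "\<epsilon> > 0" using d unfolding \<epsilon>_def by simp
  have rebase: "eventually (\<lambda>\<eta>. coset (c (w 0 t)) (w 0 t) (w \<eta> t) = coset (c p) p (w \<eta> t)) (at_right 0)"
    if t: "t \<in> {a..b}" "\<bar>t - x\<bar> < \<epsilon>" for t
  proof -
    have "w 0 t \<in> ball p r" "w 0 t \<in> K"
      using near[of t 0] t \<epsilon> onK by auto
    then obtain \<delta>3 where \<delta>3: "\<delta>3 > 0" "\<forall>q\<in>ball (w 0 t) \<delta>3 - (K \<union> A). coset (c (w 0 t)) (w 0 t) q = coset (c p) p q"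
      using coset_rebase[of "w 0 t" p "c (w 0 t)" "c p"] r \<delta>1(2) \<delta>2(2) by auto
    have t0: "(t, 0) \<in> {a..b} \<times> {0..1::real}" using t by simp
    obtain d' where d': "d' > 0" "\<And>u. u \<in> {a..b} \<times> {0..1} \<Longrightarrow> dist u (t, 0) < d' \<Longrightarrow>
      dist (case u of (x, \<eta>) \<Rightarrow> w \<eta> x) (w 0 t) < \<delta>3"
      using cont[unfolded continuous_on_iff, rule_format, OF t0 \<delta>3(1)] by auto
    have "coset (c (w 0 t)) (w 0 t) (w \<eta> t) = coset (c p) p (w \<eta> t)" if "0 < \<eta>" "\<eta> < Min {\<eta>', d', 1}" for \<eta>
    proof -
      have "dist (t, \<eta>) (t, 0) < d'" using that by (simp add: dist_Pair_Pair dist_real_def)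
      then have "w \<eta> t \<in> ball (w 0 t) \<delta>3"
        using d'(2)[of "(t, \<eta>)"] that t by (simp add: dist_commute)
      moreover have "w \<eta> t \<notin> K \<union> A"
        using clear[of \<eta>] that t(1) unfolding clear_def by (simp add: disjoint_iff)
      ultimately show ?thesis using \<delta>3 by blast
    qed
    moreover have "Min {\<eta>', d', 1} > 0" using d'(1) \<open>\<eta>' > 0\<close> by simp
    ultimately show ?thesis
      unfolding eventually_at_right_field by blast
  qed
  show ?case
  proof (intro exI[of _ \<epsilon>] conjI allI impI)
    fix d e assume *: "a \<le> d \<and> d \<le> x \<and> x \<le> e \<and> e \<le> b \<and> e - d < \<epsilon>"
    have "eventually (\<lambda>\<eta>. 0 < \<eta> \<and> \<eta> < \<eta>' \<and> \<eta> < \<epsilon>) (at_right 0)"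
      using \<open>\<eta>' > 0\<close> \<epsilon> unfolding eventually_at_right_field by (intro exI[of _ "min \<eta>' \<epsilon>"]) simp
    moreover have "eventually (\<lambda>\<eta>. coset (c (w 0 d)) (w 0 d) (w \<eta> d) = coset (c p) p (w \<eta> d)) (at_right 0)"
      "eventually (\<lambda>\<eta>. coset (c (w 0 e)) (w 0 e) (w \<eta> e) = coset (c p) p (w \<eta> e)) (at_right 0)"
      using rebase[of d] rebase[of e] * by auto
    ultimately show "eventually (\<lambda>\<eta>. \<forall>z. z \<in> coset (c (w 0 d)) (w 0 d) (w \<eta> d) \<longleftrightarrow>
      z + transport (w \<eta>) d e \<in> coset (c (w 0 e)) (w 0 e) (w \<eta> e)) (at_right 0)"
    proof eventually_elim
      case (elim \<eta>)
      have "w \<eta> ` {d..e} \<subseteq> ball p (rad p)"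
      proof safe
        fix t assume "t \<in> {d..e}"
        then have "w \<eta> t \<in> ball p r" using near[of t \<eta>] elim * by auto
        then show "w \<eta> t \<in> ball p (rad p)" using r by auto
      qed
      moreover have "clear (w \<eta>) d e"
        using clear_subinterval[OF clear[of \<eta>]] elim(1) * by auto
      ultimately have "z \<in> coset (c p) p (w \<eta> d) \<longleftrightarrow> z + transport (w \<eta>) d e \<in> coset (c p) p (w \<eta> e)" for z
        using * by (intro transport_in_coset) auto
      then show ?case
        using elim(2,3) by simp
    qed
  qed (use \<epsilon> in simp)
qed

lemma boundary_coset_eventually:
  fixes w :: "real \<Rightarrow> 'a"
  assumes "p' \<in> ball p (rad p)" "c' \<in> coset c p p'"
    and "H p' = (\<lambda>h. - \<phi> p p' + h + \<phi> p p') ` H p"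
    and lim: "(w \<longlongrightarrow> p') (at_right 0)" and off: "eventually (\<lambda>\<eta>. w \<eta> \<notin> K \<union> A) (at_right 0)"
  shows "eventually (\<lambda>\<eta>. coset c' p' (w \<eta>) = coset c p (w \<eta>)) (at_right 0)"
proof -
  obtain \<delta> where \<delta>: "\<delta> > 0" "\<forall>q\<in>ball p' \<delta> - (K \<union> A). coset c' p' q = coset c p q"
    using coset_rebase[OF assms(1-3)] by blast
  have "eventually (\<lambda>\<eta>. dist (w \<eta>) p' < \<delta>) (at_right 0)"
    using lim \<delta>(1) by (rule tendstoD)
  with off show ?thesis
    by eventually_elim (use \<delta> in \<open>auto simp: dist_commute\<close>)
qed

lemma uniform_near_side:
  fixes F :: "real \<Rightarrow> real \<Rightarrow> 'a"
  assumes cont: "continuous_on ({-1..1} \<times> {-1..1}) (\<lambda>(x, y). F x y)"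
    and "r > 0" "x0 \<in> {-1..1}" "\<And>y. y \<in> {-1..1} \<Longrightarrow> F x0 y = p"
  shows "\<exists>\<epsilon>>0. \<forall>x\<in>{-1..1}. \<forall>y\<in>{-1..1}. \<bar>x - x0\<bar> < \<epsilon> \<longrightarrow> F x y \<in> ball p r"
proof -
  have "uniformly_continuous_on ({-1..1} \<times> {-1..1}) (\<lambda>(x, y). F x y)"
    by (intro compact_uniformly_continuous cont compact_Times) simp_all
  then obtain d where d: "d > 0" "\<And>u v. u \<in> {-1..1} \<times> {-1..1} \<Longrightarrow> v \<in> {-1..1} \<times> {-1..1} \<Longrightarrow> dist u v < d \<Longrightarrow>
      dist (case u of (x, y) \<Rightarrow> F x y) (case v of (x, y) \<Rightarrow> F x y) < r"
    using \<open>r > 0\<close> unfolding uniformly_continuous_on_def by metis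
  have "F x y \<in> ball p r" if "x \<in> {-1..1}" "y \<in> {-1..1}" "\<bar>x - x0\<bar> < d" for x y
    using d(2)[of "(x0, y)" "(x, y)"] that assms(3,4) by (auto simp: dist_Pair_Pair dist_real_def abs_minus_commute)
  then show ?thesis using d(1) by blast
qed

text \<open>The left side is collapsed to \<open>p0\<close>, the right side to \<open>p1\<close>,
  and bottom and top run along the two arcs of \<open>K\<close> between them. The section
  \<open>c\<close> is coherent away from \<open>p0\<close>, where it has the value \<open>ca\<close>
  along one arc and \<open>cb\<close> along the other. Walking once around, just inside the square,
  compares the two values: the holonomy is conjugate to \<open>- ca + cb + h\<close>.\<close>

theorem square_bound:
  fixes F :: "real \<Rightarrow> real \<Rightarrow> 'a" and c :: "'a \<Rightarrow> 'g"
  assumes cont: "continuous_on ({-1..1} \<times> {-1..1}) (\<lambda>(x, y). F x y)"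
    and offK: "\<And>x y. x \<in> {-1<..<1} \<Longrightarrow> y \<in> {-1<..<1} \<Longrightarrow> F x y \<notin> K"
    and fin: "finite {(x, y). x \<in> {-1<..<1} \<and> y \<in> {-1<..<1} \<and> F x y \<in> A}"
    and left: "\<And>y. y \<in> {-1..1} \<Longrightarrow> F (-1) y = p0" and right: "\<And>y. y \<in> {-1..1} \<Longrightarrow> F 1 y = p1"
    and bot: "\<And>x. x \<in> {-1<..<1} \<Longrightarrow> F x (-1) \<in> K - {p0}" and top: "\<And>x. x \<in> {-1<..<1} \<Longrightarrow> F x 1 \<in> K - {p0}"
    and p: "p0 \<in> K" "p1 \<in> K - {p0}"
    and sec: "\<And>p. p \<in> K - {p0} \<Longrightarrow> \<exists>\<delta>>0. \<forall>p'\<in>ball p \<delta> \<inter> K. c p' \<in> coset (c p) p p'"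
    and conj: "\<And>p. p \<in> K \<Longrightarrow> \<exists>\<delta>>0. \<forall>p'\<in>ball p \<delta> \<inter> K. H p' = (\<lambda>h. - \<phi> p p' + h + \<phi> p p') ` H p"
    and ends: "\<delta>0 > 0" "\<And>x. -1 < x \<Longrightarrow> x < -1 + \<delta>0 \<Longrightarrow> c (F x (-1)) \<in> coset ca p0 (F x (-1))"
      "\<And>x. -1 < x \<Longrightarrow> x < -1 + \<delta>0 \<Longrightarrow> c (F x 1) \<in> coset cb p0 (F x 1)"
  shows "\<exists>h\<in>H p0. N (- ca + cb + h) \<le> M * card {(x, y). x \<in> {-1<..<1} \<and> y \<in> {-1<..<1} \<and> F x y \<in> A}"
proof -
  let ?Z = "{(x, y). x \<in> {-1<..<1} \<and> y \<in> {-1<..<1} \<and> F x y \<in> A}"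
  have contI: "continuous_on ({-1<..<1} \<times> {-1<..<1}) (\<lambda>(x, y). F x y)"
    by (rule continuous_on_subset[OF cont]) auto
  obtain m where m: "0 < m" "m < 1" "\<And>x y. (x, y) \<in> ?Z \<Longrightarrow> \<bar>x\<bar> < m \<and> \<bar>y\<bar> < m"
  proof -
    define S where "S = insert (1/2) ((\<lambda>(x, y). max \<bar>x\<bar> \<bar>y\<bar>) ` ?Z)"
    have S: "finite S" "S \<noteq> {}" "\<And>s. s \<in> S \<Longrightarrow> s < 1" using fin unfolding S_def by auto
    then have "Max S < 1" by simp
    have "1/2 \<in> S" by (simp add: S_def)
    then have "1/2 \<le> Max S" by (rule Max_ge[OF S(1)])
    have le: "\<bar>x\<bar> \<le> Max S \<and> \<bar>y\<bar> \<le> Max S" if "(x, y) \<in> ?Z" for x y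
    proof -
      have "max \<bar>x\<bar> \<bar>y\<bar> \<in> S"
        unfolding S_def using image_eqI[of "max \<bar>x\<bar> \<bar>y\<bar>" "\<lambda>(x, y). max \<bar>x\<bar> \<bar>y\<bar>" "(x, y)" ?Z] that by simp
      then have "max \<bar>x\<bar> \<bar>y\<bar> \<le> Max S" by (rule Max_ge[OF S(1)])
      then show ?thesis by simp
    qed
    show ?thesis
    proof (rule that[of "(1 + Max S) / 2"])
      show "\<bar>x\<bar> < (1 + Max S) / 2 \<and> \<bar>y\<bar> < (1 + Max S) / 2" if "(x, y) \<in> ?Z" for x y
        using le[OF that] \<open>Max S < 1\<close> by argo
    qed (use \<open>Max S < 1\<close> \<open>1/2 \<le> Max S\<close> in \<open>simp_all add: field_simps\<close>)
  qed
  obtain \<delta>1 where \<delta>1: "\<delta>1 > 0" "\<forall>p'\<in>ball p0 \<delta>1 \<inter> K. H p' = (\<lambda>h. - \<phi> p0 p' + h + \<phi> p0 p') ` H p0"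
    using conj[OF p(1)] by blast
  obtain \<delta>2 where \<delta>2: "\<delta>2 > 0" "\<forall>p'\<in>ball p1 \<delta>2 \<inter> K. H p' = (\<lambda>h. - \<phi> p1 p' + h + \<phi> p1 p') ` H p1"
    using conj[of p1] p by blast
  obtain \<delta>3 where \<delta>3: "\<delta>3 > 0" "\<forall>p'\<in>ball p1 \<delta>3 \<inter> K. c p' \<in> coset (c p1) p1 p'"
    using sec[OF p(2)] by blast
  obtain e1 where e1: "e1 > 0" "\<forall>x\<in>{-1..1}. \<forall>y\<in>{-1..1}. \<bar>x - (-1)\<bar> < e1 \<longrightarrow> F x y \<in> ball p0 (min (rad p0) \<delta>1)"
    using uniform_near_side[OF cont _ _ left, of "min (rad p0) \<delta>1"] rad(1)[of p0] \<delta>1 by auto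
  obtain e2 where e2: "e2 > 0" "\<forall>x\<in>{-1..1}. \<forall>y\<in>{-1..1}. \<bar>x - 1\<bar> < e2 \<longrightarrow> F x y \<in> ball p1 (Min {rad p1, \<delta>2, \<delta>3})"
    using uniform_near_side[OF cont _ _ right, of "Min {rad p1, \<delta>2, \<delta>3}"] rad(1)[of p1] \<delta>2 \<delta>3 by auto
  \<comment> \<open>The vertical sides are placed beyond all punctures and so close to the ends that
    each of them stays in the ball around its collapsed point.\<close>
  define x1 where "x1 = -1 + Min {e1, \<delta>0, 1 - m} / 2"
  have "0 < Min {e1, \<delta>0, 1 - m}" "Min {e1, \<delta>0, 1 - m} \<le> e1" "Min {e1, \<delta>0, 1 - m} \<le> \<delta>0" "Min {e1, \<delta>0, 1 - m} \<le> 1 - m"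
    using e1 ends(1) m by auto
  then have x1: "-1 < x1" "x1 < -1 + e1" "x1 < -1 + \<delta>0" "x1 < - m"
    using m(1,2) unfolding x1_def by linarith+
  define x2 where "x2 = 1 - Min {e2, 1 - m} / 2"
  have "0 < Min {e2, 1 - m}" "Min {e2, 1 - m} \<le> e2" "Min {e2, 1 - m} \<le> 1 - m"
    using e2 m by auto
  then have x2: "x2 < 1" "x2 > 1 - e2" "x2 > m"
    using m(1,2) unfolding x2_def by linarith+
  have x12: "x1 < x2" using x1 x2 m by linarith
  have offA: "F x y \<notin> A" if "x \<in> {-1<..<1}" "y \<in> {-1<..<1}" "m \<le> \<bar>x\<bar> \<or> m \<le> \<bar>y\<bar>" for x y
    using m(3)[of x y] that by auto
  have lims: "((\<lambda>\<eta>. F x (-1 + \<eta>)) \<longlongrightarrow> F x (-1)) (at_right 0)" "((\<lambda>\<eta>. F x (1 - \<eta>)) \<longlongrightarrow> F x 1) (at_right 0)"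
    if "x \<in> {-1..1}" for x
  proof -
    have "continuous_on {0..1} ((\<lambda>(x, y). F x y) \<circ> (\<lambda>\<eta>. (x, -1 + \<eta>)))"
      using that by (intro continuous_on_compose continuous_on_subset[OF cont] continuous_intros) auto
    then have "((\<lambda>\<eta>. F x (-1 + \<eta>)) \<longlongrightarrow> F x (-1 + 0)) (at 0 within {0..1})"
      unfolding continuous_on_def o_def by (drule_tac bspec[of _ _ 0]) auto
    then show "((\<lambda>\<eta>. F x (-1 + \<eta>)) \<longlongrightarrow> F x (-1)) (at_right 0)"
      by (simp add: at_within_Icc_at_right)
    have "continuous_on {0..1} ((\<lambda>(x, y). F x y) \<circ> (\<lambda>\<eta>. (x, 1 - \<eta>)))"
      using that by (intro continuous_on_compose continuous_on_subset[OF cont] continuous_intros) auto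
    then have "((\<lambda>\<eta>. F x (1 - \<eta>)) \<longlongrightarrow> F x (1 - 0)) (at 0 within {0..1})"
      unfolding continuous_on_def o_def by (drule_tac bspec[of _ _ 0]) auto
    then show "((\<lambda>\<eta>. F x (1 - \<eta>)) \<longlongrightarrow> F x 1) (at_right 0)"
      by (simp add: at_within_Icc_at_right)
  qed
  have small: "eventually (\<lambda>\<eta>. 0 < \<eta> \<and> \<eta> < 1 - m) (at_right 0)"
    unfolding eventually_at_right_field using m by (intro exI[of _ "1 - m"]) auto
  have offs: "eventually (\<lambda>\<eta>. F x (-1 + \<eta>) \<notin> K \<union> A) (at_right 0)" "eventually (\<lambda>\<eta>. F x (1 - \<eta>) \<notin> K \<union> A) (at_right 0)"
    if "x \<in> {-1<..<1}" for x
    using small offA[OF that] offK[OF that] m by (auto elim!: eventually_mono)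
  have cleart: "clear (\<lambda>x. F x (-1 + \<eta>)) x1 x2" "clear (\<lambda>x. F x (1 - \<eta>)) x1 x2" if "0 < \<eta>" "\<eta> < 1 - m" for \<eta>
    using that m x1 x2 offA by (auto intro!: clear_horizontal[OF contI offK fin])
  have inner: "x \<in> {-1<..<1}" if "x \<in> {x1..x2}" for x using that x1 x2 by auto
  have E1: "eventually (\<lambda>\<eta>. \<forall>z. z \<in> coset (c (F x1 (-1))) (F x1 (-1)) (F x1 (-1 + \<eta>)) \<longleftrightarrow>
      z + transport (\<lambda>x. F x (-1 + \<eta>)) x1 x2 \<in> coset (c (F x2 (-1))) (F x2 (-1)) (F x2 (-1 + \<eta>))) (at_right 0)"
  proof -
    have "continuous_on ({x1..x2} \<times> {0..1}) ((\<lambda>(x, y). F x y) \<circ> (\<lambda>(x, \<eta>). (x, -1 + \<eta>)))"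
      using x1 x2 unfolding case_prod_unfold
      by (intro continuous_on_compose continuous_intros continuous_on_subset[OF cont[unfolded case_prod_unfold]]) auto
    then have "continuous_on ({x1..x2} \<times> {0..1}) (\<lambda>(x, \<eta>). F x (-1 + \<eta>))"
      by (simp add: o_def case_prod_unfold)
    from transport_near_boundary[where w = "\<lambda>\<eta> x. F x (-1 + \<eta>)" and c = c, OF _ this cleart(1), of "1 - m"]
    show ?thesis using x12 m bot inner sec conj by auto
  qed
  have E2: "eventually (\<lambda>\<eta>. \<forall>z. z \<in> coset (c (F x1 1)) (F x1 1) (F x1 (1 - \<eta>)) \<longleftrightarrow>
      z + transport (\<lambda>x. F x (1 - \<eta>)) x1 x2 \<in> coset (c (F x2 1)) (F x2 1) (F x2 (1 - \<eta>))) (at_right 0)"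
  proof -
    have "continuous_on ({x1..x2} \<times> {0..1}) ((\<lambda>(x, y). F x y) \<circ> (\<lambda>(x, \<eta>). (x, 1 - \<eta>)))"
      using x1 x2 unfolding case_prod_unfold
      by (intro continuous_on_compose continuous_intros continuous_on_subset[OF cont[unfolded case_prod_unfold]]) auto
    then have "continuous_on ({x1..x2} \<times> {0..1}) (\<lambda>(x, \<eta>). F x (1 - \<eta>))"
      by (simp add: o_def case_prod_unfold)
    from transport_near_boundary[where w = "\<lambda>\<eta> x. F x (1 - \<eta>)" and c = c, OF _ this cleart(2), of "1 - m"]
    show ?thesis using x12 m top inner sec conj by auto
  qed
  have i12: "x1 \<in> {-1<..<1}" "x2 \<in> {-1<..<1}" using x1 x2 x12 by auto
  have nb1: "F x1 y \<in> ball p0 (rad p0)" "F x1 y \<in> ball p0 \<delta>1" if "y \<in> {-1..1}" for y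
    using e1(2)[rule_format, of x1 y] that x1 i12 by auto
  have nb2: "F x2 y \<in> ball p1 (rad p1)" "F x2 y \<in> ball p1 \<delta>2" "F x2 y \<in> ball p1 \<delta>3" if "y \<in> {-1..1}" for y
    using e2(2)[rule_format, of x2 y] that x2 i12 by auto
  have R1: "eventually (\<lambda>\<eta>. coset (c (F x1 (-1))) (F x1 (-1)) (F x1 (-1 + \<eta>)) = coset ca p0 (F x1 (-1 + \<eta>))) (at_right 0)"
    using bot[OF i12(1)] nb1[of "-1"] \<delta>1(2) ends(2)[of x1] x1 i12 lims(1)[of x1] offs(1)[of x1]
    by (intro boundary_coset_eventually) auto
  have R2: "eventually (\<lambda>\<eta>. coset (c (F x1 1)) (F x1 1) (F x1 (1 - \<eta>)) = coset cb p0 (F x1 (1 - \<eta>))) (at_right 0)"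
    using top[OF i12(1)] nb1[of 1] \<delta>1(2) ends(3)[of x1] x1 i12 lims(2)[of x1] offs(2)[of x1]
    by (intro boundary_coset_eventually) auto
  have R3: "eventually (\<lambda>\<eta>. coset (c (F x2 (-1))) (F x2 (-1)) (F x2 (-1 + \<eta>)) = coset (c p1) p1 (F x2 (-1 + \<eta>))) (at_right 0)"
    using bot[OF i12(2)] nb2[of "-1"] \<delta>2(2) \<delta>3(2) i12 lims(1)[of x2] offs(1)[of x2]
    by (intro boundary_coset_eventually) auto
  have R4: "eventually (\<lambda>\<eta>. coset (c (F x2 1)) (F x2 1) (F x2 (1 - \<eta>)) = coset (c p1) p1 (F x2 (1 - \<eta>))) (at_right 0)"
    using top[OF i12(2)] nb2[of 1] \<delta>2(2) \<delta>3(2) i12 lims(2)[of x2] offs(2)[of x2]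
    by (intro boundary_coset_eventually) auto
  from small E1 E2 R1 R2 R3 R4
  have "eventually (\<lambda>\<eta>. 0 < \<eta> \<and> \<eta> < 1 - m \<and>
     (\<forall>z. z \<in> coset ca p0 (F x1 (-1 + \<eta>)) \<longleftrightarrow> z + transport (\<lambda>x. F x (-1 + \<eta>)) x1 x2 \<in> coset (c p1) p1 (F x2 (-1 + \<eta>))) \<and>
     (\<forall>z. z \<in> coset cb p0 (F x1 (1 - \<eta>)) \<longleftrightarrow> z + transport (\<lambda>x. F x (1 - \<eta>)) x1 x2 \<in> coset (c p1) p1 (F x2 (1 - \<eta>)))) (at_right 0)"
    by eventually_elim simp
  then obtain \<eta> where \<eta>: "0 < \<eta>" "\<eta> < 1 - m"
     "\<And>z. z \<in> coset ca p0 (F x1 (-1 + \<eta>)) \<longleftrightarrow> z + transport (\<lambda>x. F x (-1 + \<eta>)) x1 x2 \<in> coset (c p1) p1 (F x2 (-1 + \<eta>))"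
     "\<And>z. z \<in> coset cb p0 (F x1 (1 - \<eta>)) \<longleftrightarrow> z + transport (\<lambda>x. F x (1 - \<eta>)) x1 x2 \<in> coset (c p1) p1 (F x2 (1 - \<eta>))"
    using eventually_happens trivial_limit_at_right_real by blast
  let ?y1 = "-1 + \<eta>" and ?y2 = "1 - \<eta>"
  have good: "good F x1 x2 ?y1 ?y2"
    unfolding good_def using \<eta> m x1 x2 x12 i12 offA by auto
  have "punctures F x1 x2 ?y1 ?y2 = ?Z"
    unfolding punctures_def using m(3) \<eta> x1 x2 by fastforce
  then have bound: "N (hol F x1 x2 ?y1 ?y2) \<le> M * card ?Z"
    using hol_norm_le[OF contI offK fin good] by simp
  have cl: "clear (F x1) ?y1 ?y2" "clear (F x2) ?y1 ?y2"
    using good_clear[OF contI offK fin good] by auto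
  have y12: "?y1 \<le> ?y2" using \<eta> m by linarith
  \<comment> \<open>A value of the coset at the lower left corner, with trivial middle factor, is
    carried once around the rectangle.\<close>
  define z where "z = ca + 0 + \<phi> p0 (F x1 ?y1)"
  have "z \<in> coset ca p0 (F x1 ?y1)"
    unfolding z_def coset_def using subgroup_zero by blast
  then have "z + transport (\<lambda>x. F x ?y1) x1 x2 \<in> coset (c p1) p1 (F x2 ?y1)"
    using \<eta>(3) by blast
  then have "z + transport (\<lambda>x. F x ?y1) x1 x2 + transport (F x2) ?y1 ?y2 \<in> coset (c p1) p1 (F x2 ?y2)"
    using transport_in_coset[OF cl(2) y12, of p1] nb2(1) \<eta> m by fastforce
  then have "z + transport (\<lambda>x. F x ?y1) x1 x2 + transport (F x2) ?y1 ?y2 - transport (\<lambda>x. F x ?y2) x1 x2 \<in> coset cb p0 (F x1 ?y2)"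
    using \<eta>(4) by simp
  then have "z + transport (\<lambda>x. F x ?y1) x1 x2 + transport (F x2) ?y1 ?y2 - transport (\<lambda>x. F x ?y2) x1 x2 - transport (F x1) ?y1 ?y2 \<in> coset cb p0 (F x1 ?y1)"
    using transport_in_coset[OF cl(1) y12, of p0] nb1(1) \<eta> m by fastforce
  then have "z + hol F x1 x2 ?y1 ?y2 \<in> coset cb p0 (F x1 ?y1)"
    unfolding hol_def by (simp only: group_normal)
  then obtain h where h: "h \<in> H p0" "z + hol F x1 x2 ?y1 ?y2 = cb + h + \<phi> p0 (F x1 ?y1)"
    unfolding coset_def by blast
  have "hol F x1 x2 ?y1 ?y2 = - z + (cb + h + \<phi> p0 (F x1 ?y1))"
    using h(2) by (metis minus_add_cancel_left)
  also have "\<dots> = - \<phi> p0 (F x1 ?y1) + (- ca + cb + h) + \<phi> p0 (F x1 ?y1)"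
    unfolding z_def by (simp only: group_normal)
  finally have "N (- ca + cb + h) \<le> M * card ?Z"
    using bound norm_conj by simp
  then show ?thesis using h(1) by blast
qed

end

section \<open>From the square to an embedded disk\<close>

context normed_local_system
begin

text \<open>The open sets \<open>U1\<close> and \<open>U2\<close> tell the two branches of
  \<open>K\<close> at \<open>p0\<close> apart. By connectedness each of the two arcs of the circle
  issuing from \<open>p0\<close> starts in one of them, and since both sets accumulate at
  \<open>p0\<close> the arcs go to different ones. Which arc is which remains unknown, but inversion
  in the group exchanges the two cases.\<close>

theorem disk_bound:
  fixes f :: "real^2 \<Rightarrow> 'a" and c :: "'a \<Rightarrow> 'g"
  assumes hom: "homeomorphism (cball 0 1) D f g" and fK: "f ` sphere 0 1 = K"
    and KA: "K \<inter> A = {}" and fin: "finite (D \<inter> A)" and p0: "p0 \<in> K"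
    and sec: "\<And>p. p \<in> K - {p0} \<Longrightarrow> \<exists>\<delta>>0. \<forall>p'\<in>ball p \<delta> \<inter> K. c p' \<in> coset (c p) p p'"
    and conj: "\<And>p. p \<in> K \<Longrightarrow> \<exists>\<delta>>0. \<forall>p'\<in>ball p \<delta> \<inter> K. H p' = (\<lambda>h. - \<phi> p p' + h + \<phi> p p') ` H p"
    and U: "open U1" "open U2" "U1 \<inter> U2 = {}" "r > 0" "(K - {p0}) \<inter> ball p0 r \<subseteq> U1 \<union> U2"
    and c1: "\<And>p'. p' \<in> K \<inter> U1 \<inter> ball p0 r \<Longrightarrow> c p' \<in> coset c1 p0 p'"
    and c2: "\<And>p'. p' \<in> K \<inter> U2 \<inter> ball p0 r \<Longrightarrow> c p' \<in> coset c2 p0 p'"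
    and acc: "\<And>e. e > 0 \<Longrightarrow> \<exists>p'\<in>K \<inter> U1. dist p' p0 < e" "\<And>e. e > 0 \<Longrightarrow> \<exists>p'\<in>K \<inter> U2. dist p' p0 < e"
  shows "\<exists>h\<in>H p0. N (- c1 + c2 + h) \<le> M * card (D \<inter> A)"
proof -
  obtain u0 where u0: "u0 \<in> sphere 0 1" "f u0 = p0" using p0 fK by auto
  define u1 :: "real^2" where "u1 = vector [- (u0 $ 2), u0 $ 1]"
  have u1c: "u1 $ 1 = - (u0 $ 2)" "u1 $ 2 = u0 $ 1" by (simp_all add: u1_def)
  have sq: "(u0 $ 1)\<^sup>2 + (u0 $ 2)\<^sup>2 = 1"
    using u0(1) by (simp add: norm_vec_def L2_set_def sum_2)
  have ip: "u0 \<bullet> u0 = 1" "u1 \<bullet> u1 = 1" "u0 \<bullet> u1 = 0" "u1 \<bullet> u0 = 0"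
    using sq by (simp_all add: inner_vec_def sum_2 u1c power2_eq_square algebra_simps)
  have basis: "v = (v \<bullet> u0) *\<^sub>R u0 + (v \<bullet> u1) *\<^sub>R u1" for v :: "real^2"
  proof -
    have "v $ 1 * ((u0 $ 1)\<^sup>2 + (u0 $ 2)\<^sup>2) = v $ 1" "v $ 2 * ((u0 $ 1)\<^sup>2 + (u0 $ 2)\<^sup>2) = v $ 2"
      using sq by simp_all
    then show ?thesis
      by (simp add: vec_eq_iff forall_2 inner_vec_def sum_2 u1c power2_eq_square algebra_simps)
  qed
  \<comment> \<open>Vertical segments of the square become chords orthogonal to \<open>u0\<close>;
    the left and right sides collapse to \<open>u0\<close> and \<open>- u0\<close>.\<close>
  define P where "P x y = (- x) *\<^sub>R u0 + (y * sqrt (1 - x\<^sup>2)) *\<^sub>R u1" for x y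
  have Pip: "P x y \<bullet> u0 = - x" "P x y \<bullet> u1 = y * sqrt (1 - x\<^sup>2)" for x y
    using ip by (simp_all add: P_def inner_add_left inner_diff_left)
  have Pn: "(norm (P x y))\<^sup>2 = x\<^sup>2 + y\<^sup>2 * (1 - x\<^sup>2)" if "x \<in> {-1..1}" for x y
  proof -
    have "x\<^sup>2 \<le> 1" using that by (simp add: abs_square_le_1 abs_le_iff)
    moreover have "(norm (P x y))\<^sup>2 = P x y \<bullet> P x y" by (simp add: power2_norm_eq_inner)
    moreover have "P x y \<bullet> P x y = x\<^sup>2 + (y * sqrt (1 - x\<^sup>2))\<^sup>2"
      unfolding P_def by (simp add: inner_add_left inner_add_right inner_diff_left inner_diff_right ip power2_eq_square)
    ultimately show ?thesis by (simp add: power_mult_distrib)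
  qed
  have sqle: "x\<^sup>2 \<le> 1" if "x \<in> {-1..1}" for x :: real using that by (simp add: abs_square_le_1 abs_le_iff)
  have sqlt: "x\<^sup>2 < 1" if "x \<in> {-1<..<1}" for x :: real using that by (simp add: abs_square_less_1 abs_less_iff)
  have Pc: "P x y \<in> cball 0 1" if "x \<in> {-1..1}" "y \<in> {-1..1}" for x y
  proof -
    have "x\<^sup>2 + y\<^sup>2 * (1 - x\<^sup>2) \<le> x\<^sup>2 + 1 * (1 - x\<^sup>2)"
      using sqle[OF that(1)] sqle[OF that(2)] by (intro add_left_mono mult_right_mono) auto
    then have "(norm (P x y))\<^sup>2 \<le> 1" using Pn[OF that(1)] by simp
    then show ?thesis by (simp add: abs_square_le_1)
  qed
  have Pi: "norm (P x y) < 1" if "x \<in> {-1<..<1}" "y \<in> {-1<..<1}" for x y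
  proof -
    have "x\<^sup>2 + y\<^sup>2 * (1 - x\<^sup>2) < x\<^sup>2 + 1 * (1 - x\<^sup>2)"
      using sqlt[OF that(1)] sqlt[OF that(2)] by (intro add_strict_left_mono mult_strict_right_mono) auto
    then have "(norm (P x y))\<^sup>2 < 1" using Pn[of x y] that(1) by simp
    then show ?thesis by (simp add: abs_square_less_1)
  qed
  have Ps: "P x y \<in> sphere 0 1" if "x \<in> {-1..1}" "y = 1 \<or> y = -1" for x y
  proof -
    have "(norm (P x y))\<^sup>2 = 1" using Pn[OF that(1), of y] that(2) by auto
    then show ?thesis by (simp add: power2_eq_1_iff) (metis norm_ge_zero not_one_le_zero le_minus_one_simps(3))
  qed
  have contP: "continuous_on ({-1..1} \<times> {-1..1}) (\<lambda>(x, y). P x y)"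
    unfolding P_def case_prod_unfold by (intro continuous_intros)
  define F where "F x y = f (P x y)" for x y
  have contf: "continuous_on (cball 0 1) f" and injf: "inj_on f (cball 0 1)" and contg: "continuous_on D g"
    and gf: "\<And>v. v \<in> cball 0 1 \<Longrightarrow> g (f v) = v" and fimg: "f ` cball 0 1 = D"
    using hom unfolding homeomorphism_def by (auto intro: inj_on_inverseI)
  have contF: "continuous_on ({-1..1} \<times> {-1..1}) (\<lambda>(x, y). F x y)"
  proof -
    have "continuous_on ({-1..1} \<times> {-1..1}) (f \<circ> (\<lambda>(x, y). P x y))"
      by (intro continuous_on_compose contP continuous_on_subset[OF contf]) (use Pc in auto)
    then show ?thesis by (simp add: F_def o_def case_prod_unfold)
  qed
  have notK: "f v \<notin> K" if "norm v < 1" for v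
  proof
    assume "f v \<in> K"
    then obtain w where "w \<in> sphere 0 1" "f w = f v" using fK by force
    then have "w = v" using injf that by (auto dest: inj_onD)
    then show False using \<open>w \<in> sphere 0 1\<close> that by simp
  qed
  have offK: "F x y \<notin> K" if "x \<in> {-1<..<1}" "y \<in> {-1<..<1}" for x y
    unfolding F_def using notK Pi that by blast
  let ?Z = "{(x, y). x \<in> {-1<..<1} \<and> y \<in> {-1<..<1} \<and> F x y \<in> A}"
  have "inj_on (\<lambda>(x, y). F x y) ?Z"
  proof (rule inj_onI, clarsimp)
    fix x y x' y' assume *: "-1 < x" "x < 1" "-1 < y" "y < 1" "-1 < x'" "x' < 1" "-1 < y'" "y' < 1" "F x y = F x' y'"
    then have "P x y = P x' y'"
      unfolding F_def using injf Pc[of x y] Pc[of x' y'] by (auto dest: inj_onD)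
    then have "x = x'" "y * sqrt (1 - x\<^sup>2) = y' * sqrt (1 - x'\<^sup>2)"
      using Pip[of x y] Pip[of x' y'] by auto
    moreover have "sqrt (1 - x\<^sup>2) \<noteq> 0" using sqlt[of x] * by simp
    ultimately show "x = x' \<and> y = y'" by simp
  qed
  moreover have "(\<lambda>(x, y). F x y) ` ?Z \<subseteq> D \<inter> A"
  proof -
    have "F x y \<in> D" if "x \<in> {-1<..<1::real}" "y \<in> {-1<..<1::real}" for x y
    proof -
      have "P x y \<in> cball 0 1" using that by (intro Pc) auto
      then show ?thesis unfolding F_def fimg[symmetric] by (rule imageI)
    qed
    then show ?thesis by auto
  qed
  ultimately have finZ: "finite ?Z" and cardZ: "card ?Z \<le> card (D \<inter> A)"
    using inj_on_finite[OF _ _ fin] card_inj_on_le[OF _ _ fin] by blast+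
  have left: "F (-1) y = p0" for y using u0 by (simp add: F_def P_def)
  have right: "F 1 y = f (- u0)" for y by (simp add: F_def P_def)
  have ne: "P x y \<noteq> u0" if "x \<noteq> -1" for x y
    using Pip(1)[of x y] ip(1) that by auto
  have side: "F x y \<in> K - {p0}" if "x \<in> {-1<..<1}" "y = 1 \<or> y = -1" for x y
  proof -
    have s: "P x y \<in> sphere 0 1" using Ps[of x y] that by auto
    then have "F x y \<in> K" using fK unfolding F_def by blast
    moreover have "F x y \<noteq> p0"
      unfolding F_def using ne[of x y] that s u0 injf by (auto dest: inj_onD)
    ultimately show ?thesis by simp
  qed
  have p1: "f (- u0) \<in> K - {p0}"
  proof -
    have "u0 \<noteq> - u0" using ip(1) by (metis inner_minus_left one_neq_neg_one)
    moreover have "- u0 \<in> sphere 0 1" using u0 by simp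
    ultimately show ?thesis using fK u0 injf by (auto dest: inj_onD)
  qed
  obtain e0 where e0: "e0 > 0" "\<forall>x\<in>{-1..1}. \<forall>y\<in>{-1..1}. \<bar>x - (-1)\<bar> < e0 \<longrightarrow> F x y \<in> ball p0 r"
    using uniform_near_side[OF contF U(4), of "-1" p0] left by auto
  define e where "e = min e0 1"
  have e: "e > 0" "e \<le> 1" "\<And>x y. -1 \<le> x \<Longrightarrow> x < -1 + e \<Longrightarrow> y \<in> {-1..1} \<Longrightarrow> F x y \<in> ball p0 r"
    using e0 unfolding e_def by auto
  have one_side: "(\<forall>x\<in>{-1<..<-1+e}. F x y \<in> U1) \<or> (\<forall>x\<in>{-1<..<-1+e}. F x y \<in> U2)" if y: "y = 1 \<or> y = -1" for y
  proof -
    have "continuous_on {-1<..<-1+e} ((\<lambda>(x, y). F x y) \<circ> (\<lambda>x. (x, y)))"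
      using y e by (intro continuous_on_compose continuous_on_subset[OF contF] continuous_intros) auto
    then have "connected ((\<lambda>x. F x y) ` {-1<..<-1+e})"
      by (intro connected_continuous_image) (auto simp: o_def)
    moreover have "(\<lambda>x. F x y) ` {-1<..<-1+e} \<subseteq> U1 \<union> U2"
    proof safe
      fix x assume x: "x \<in> {-1<..<-1+e}" "F x y \<notin> U2"
      have "F x y \<in> K - {p0}" using side[of x y] x e(2) y by auto
      moreover have "F x y \<in> ball p0 r" using e(3)[of x y] x y by auto
      ultimately show "F x y \<in> U1" using U(5) x(2) by blast
    qed
    ultimately have "U1 \<inter> (\<lambda>x. F x y) ` {-1<..<-1+e} = {} \<or> U2 \<inter> (\<lambda>x. F x y) ` {-1<..<-1+e} = {}"
      using connectedD[OF _ U(1,2)] U(3) by blast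
    then show ?thesis using \<open>(\<lambda>x. F x y) ` {-1<..<-1+e} \<subseteq> U1 \<union> U2\<close> by blast
  qed
  \<comment> \<open>Continuity of the inverse \<open>g\<close> puts the preimage of a point of
    \<open>K\<close> near \<open>p0\<close> close to \<open>u0\<close> on the circle, hence on the
    top or bottom arc near the left end.\<close>
  have reach: "\<exists>x\<in>{-1<..<-1+e}. F x 1 \<in> U \<or> F x (-1) \<in> U"
    if acc: "\<And>e. e > 0 \<Longrightarrow> \<exists>p'\<in>K \<inter> U. dist p' p0 < e" and "p0 \<notin> U" for U
  proof -
    have KD: "K \<subseteq> D" using fK fimg by auto
    have "p0 \<in> D" using p0 KD by blast
    then obtain d where d: "d > 0" "\<And>p'. p' \<in> D \<Longrightarrow> dist p' p0 < d \<Longrightarrow> dist (g p') (g p0) < e"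
      using contg e(1) unfolding continuous_on_iff by meson
    obtain p' where p': "p' \<in> K" "p' \<in> U" "dist p' p0 < d" using acc[OF d(1)] by blast
    obtain v where v: "v \<in> sphere 0 1" "f v = p'" using p' fK by auto
    have gv: "g p' = v" "g p0 = u0" using gf[of v] gf[of u0] v u0 by auto
    define x where "x = - (v \<bullet> u0)"
    have vv: "v \<bullet> v = 1" using v by (simp add: dot_square_norm)
    have "(v \<bullet> u0)\<^sup>2 + (v \<bullet> u1)\<^sup>2 = 1"
    proof -
      have "v \<bullet> v = ((v \<bullet> u0) *\<^sub>R u0 + (v \<bullet> u1) *\<^sub>R u1) \<bullet> ((v \<bullet> u0) *\<^sub>R u0 + (v \<bullet> u1) *\<^sub>R u1)"
        using basis[of v] by simp
      also have "\<dots> = (v \<bullet> u0)\<^sup>2 + (v \<bullet> u1)\<^sup>2"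
        by (simp add: inner_add_left inner_add_right inner_diff_left inner_diff_right ip power2_eq_square)
      finally show ?thesis using vv by simp
    qed
    then have s1: "\<bar>v \<bullet> u1\<bar> = sqrt (1 - x\<^sup>2)" unfolding x_def by (simp flip: real_sqrt_abs)
    then have "v = P x 1 \<or> v = P x (-1)"
    proof (cases "v \<bullet> u1 \<ge> 0")
      case True
      then show ?thesis using basis[of v] s1 unfolding P_def x_def by simp
    next
      case False
      then have "v \<bullet> u1 = - 1 * sqrt (1 - x\<^sup>2)" using s1 by simp
      then show ?thesis using basis[of v] unfolding P_def x_def by simp
    qed
    moreover have "x \<in> {-1<..<-1+e}"
    proof -
      have ne: "v \<noteq> u0" using v u0 p'(2) \<open>p0 \<notin> U\<close> by auto
      have "v \<bullet> u0 \<le> norm v * norm u0" by (rule norm_cauchy_schwarz)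
      then have "x \<ge> -1" using v u0 by (simp add: x_def)
      moreover have "x \<noteq> -1"
      proof
        assume "x = -1"
        then have "v \<bullet> u0 = 1" "v \<bullet> u1 = 0" using s1 by (auto simp: x_def)
        then have "v = u0" using basis[of v] by simp
        then show False using ne by simp
      qed
      moreover have "x < -1 + e"
      proof -
        have "x + 1 = (u0 - v) \<bullet> u0" using ip by (simp add: x_def inner_diff_left)
        also have "\<dots> \<le> norm (u0 - v) * norm u0" by (rule norm_cauchy_schwarz)
        also have "\<dots> < e" using d(2)[of p'] p' KD gv u0 by (auto simp: dist_norm norm_minus_commute)
        finally show ?thesis by simp
      qed
      ultimately show ?thesis by auto
    qed
    ultimately show ?thesis using v p' unfolding F_def by auto
  qed
  have p0U: "p0 \<notin> U1" "p0 \<notin> U2"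
  proof -
    have "False" if pU: "p0 \<in> V" "open V" "V \<inter> W = {}" "\<And>e. e > 0 \<Longrightarrow> \<exists>p'\<in>K \<inter> W. dist p' p0 < e" for V W
    proof -
      obtain e where "e > 0" "ball p0 e \<subseteq> V" using pU by (meson openE)
      then show False using pU(3) pU(4)[of e] by (auto simp: dist_commute subset_iff)
    qed
    then show "p0 \<notin> U1" "p0 \<notin> U2" using U(1-3) acc by blast+
  qed
  have main: "\<exists>h\<in>H p0. N (- ca + cb + h) \<le> M * card (D \<inter> A)"
    if "\<And>x. -1 < x \<Longrightarrow> x < -1 + e \<Longrightarrow> c (F x (-1)) \<in> coset ca p0 (F x (-1))"
      "\<And>x. -1 < x \<Longrightarrow> x < -1 + e \<Longrightarrow> c (F x 1) \<in> coset cb p0 (F x 1)" for ca cb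
  proof -
    have "\<exists>h\<in>H p0. N (- ca + cb + h) \<le> M * card ?Z"
      by (rule square_bound[OF contF offK finZ left right _ _ p0 p1 sec conj e(1) that]) (use side in auto)
    then show ?thesis using mult_le_mono2[OF cardZ, of M] by (meson order_trans)
  qed
  have in1: "c (F x y) \<in> coset c1 p0 (F x y)" if "-1 < x" "x < -1 + e" "y = 1 \<or> y = -1" "F x y \<in> U1" for x y
    using c1[of "F x y"] side[of x y] e(3)[of x y] e(2) that by auto
  have in2: "c (F x y) \<in> coset c2 p0 (F x y)" if "-1 < x" "x < -1 + e" "y = 1 \<or> y = -1" "F x y \<in> U2" for x y
    using c2[of "F x y"] side[of x y] e(3)[of x y] e(2) that by auto
  have r1: "\<exists>x\<in>{-1<..<-1+e}. F x 1 \<in> U1 \<or> F x (-1) \<in> U1" using reach[OF acc(1) p0U(1)] .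
  have r2: "\<exists>x\<in>{-1<..<-1+e}. F x 1 \<in> U2 \<or> F x (-1) \<in> U2" using reach[OF acc(2) p0U(2)] .
  consider "(\<forall>x\<in>{-1<..<-1+e}. F x (-1) \<in> U1) \<and> (\<forall>x\<in>{-1<..<-1+e}. F x 1 \<in> U2)"
    | "(\<forall>x\<in>{-1<..<-1+e}. F x (-1) \<in> U2) \<and> (\<forall>x\<in>{-1<..<-1+e}. F x 1 \<in> U1)"
    using one_side[of 1] one_side[of "-1"] r1 r2 U(3) by blast
  then show ?thesis
  proof cases
    case 1
    then show ?thesis by (intro main in1 in2) auto
  next
    case 2
    then have "\<exists>h\<in>H p0. N (- c2 + c1 + h) \<le> M * card (D \<inter> A)" by (intro main in1 in2) auto
    then obtain h where h: "h \<in> H p0" "N (- c2 + c1 + h) \<le> M * card (D \<inter> A)" by blast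
    \<comment> \<open>Inversion followed by conjugation by \<open>h\<close> turns
      \<open>- c2 + c1 + h\<close> into \<open>- c1 + c2 - h\<close>.\<close>
    have "N (- c2 + c1 + h) = N (- (- c2 + c1 + h))" by (simp only: norm_minus)
    also have "\<dots> = N (h + (- (- c2 + c1 + h)) - h)" by (simp only: norm_conj')
    also have "h + (- (- c2 + c1 + h)) - h = - c1 + c2 + - h" by (simp only: group_normal)
    finally show ?thesis using h subgroup_minus[OF h(1)] by metis
  qed
qed

end

section \<open>Potentials read off from a diagram of labelled strands\<close>

section \<open>Local systems from labelled strands\<close>

text \<open>Height is the third coordinate; at height \<open>s\<close> strand \<open>i\<close> sits
  at \<open>(X i s, Y i s)\<close>, and the viewer looks from large first coordinates. The labels
  are Wirtinger generators of this projection. The local pictures are: no strand, one strand, strand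
  \<open>i\<close> passing in front of \<open>j\<close> and conjugating its label, and an apex at
  which two strands with a common involution begin or end. With an involution there the strands need
  no orientation.\<close>

locale movie =
  fixes I :: "nat set" and X Y :: "nat \<Rightarrow> real \<Rightarrow> real" and live :: "nat \<Rightarrow> real \<Rightarrow> bool"
    and lab :: "nat \<Rightarrow> real \<Rightarrow> 'g::group_add" and hs :: "nat \<Rightarrow> 'g \<Rightarrow> 'g set"
  assumes finite_strands: "finite I"
    and cont_X: "i \<in> I \<Longrightarrow> isCont (X i) s" and cont_Y: "i \<in> I \<Longrightarrow> isCont (Y i) s"
    and closed_live: "i \<in> I \<Longrightarrow> closed {s. live i s}"
    and hs: "0 \<in> hs i a" "a \<in> hs i a" "b \<in> hs i a \<Longrightarrow> c \<in> hs i a \<Longrightarrow> b + c \<in> hs i a" "b \<in> hs i a \<Longrightarrow> - b \<in> hs i a"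
    and hs_conj: "hs i (- c + a + c) = (\<lambda>h. - c + h + c) ` hs i a"
    and local_form: "{i \<in> I. live i s0 \<and> Y i s0 = y0} = {} \<or>
      (\<exists>i. {i \<in> I. live i s0 \<and> Y i s0 = y0} = {i} \<and> (\<forall>\<^sub>F s in nhds s0. live i s \<and> lab i s = lab i s0)) \<or>
      (\<exists>i j. i \<noteq> j \<and> {i \<in> I. live i s0 \<and> Y i s0 = y0} = {i, j} \<and> X j s0 < X i s0 \<and>
        (\<forall>\<^sub>F s in nhds s0. live i s \<and> live j s \<and> lab i s = lab i s0 \<and>
          lab j s = (if Y j s \<le> Y i s then lab j s0 else - lab i s0 + lab j s0 + lab i s0))) \<or>
      (\<exists>i j a. i \<noteq> j \<and> {i \<in> I. live i s0 \<and> Y i s0 = y0} = {i, j} \<and> X j s0 = X i s0 \<and> a + a = 0 \<and>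
        hs i a = {0, a} \<and> hs j a = {0, a} \<and> lab i s0 = a \<and> lab j s0 = a \<and>
        ((\<forall>\<^sub>F s in nhds s0. (live i s \<longleftrightarrow> s \<le> s0) \<and> (live j s \<longleftrightarrow> s \<le> s0) \<and> (s \<le> s0 \<longrightarrow> lab i s = a \<and> lab j s = a)) \<or>
         (\<forall>\<^sub>F s in nhds s0. (live i s \<longleftrightarrow> s0 \<le> s) \<and> (live j s \<longleftrightarrow> s0 \<le> s) \<and> (s0 \<le> s \<longrightarrow> lab i s = a \<and> lab j s = a))))"
begin

definition stack :: "real^3 \<Rightarrow> nat set" where
  "stack p = {i \<in> I. live i (p $ 3) \<and> Y i (p $ 3) = p $ 2}"

text \<open>Strands in front of \<open>p\<close>. Equivalently, \<open>p\<close> lies on the wall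
  hanging behind such a strand, away from the viewer.\<close>

definition hid :: "real^3 \<Rightarrow> nat set" where
  "hid p = {i \<in> stack p. p $ 1 < X i (p $ 3)}"

definition on :: "real^3 \<Rightarrow> nat set" where
  "on p = {i \<in> stack p. p $ 1 = X i (p $ 3)}"

text \<open>Crossing the wall behind strand \<open>i\<close> towards larger second coordinate
  contributes its label. The strict inequality gives the wall itself no charge, which makes
  \<open>potential p p\<close> vanish.\<close>

definition charge :: "nat \<Rightarrow> real^3 \<Rightarrow> 'g" where
  "charge i q = (if live i (q $ 3) \<and> Y i (q $ 3) < q $ 2 then lab i (q $ 3) else 0)"

text \<open>Two walls are crossed in the order of their second coordinates. Here \<open>i\<close> is
  meant to be the strand in front.\<close>

definition charge2 :: "nat \<Rightarrow> nat \<Rightarrow> real^3 \<Rightarrow> 'g" where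
  "charge2 i j q = (if Y j (q $ 3) \<le> Y i (q $ 3) then charge j q + charge i q else charge i q + charge j q)"

text \<open>Near \<open>p\<close> only the walls through \<open>p\<close> matter. When there are
  two, the pair is chosen with the front strand first; at an apex, where the depths agree, both
  orders are admissible.\<close>

definition potential :: "real^3 \<Rightarrow> real^3 \<Rightarrow> 'g" where
  "potential p q = (if hid p = {} then 0 else if \<exists>i. hid p = {i} then charge (THE i. hid p = {i}) q
     else (\<lambda>(i, j). charge2 i j q) (SOME (i, j). hid p = {i, j} \<and> i \<noteq> j \<and> X j (p $ 3) \<le> X i (p $ 3)))"

text \<open>Two strands through the same point occur at an apex only, where both carry the same
  subgroup, so the choice is harmless.\<close>

definition holo :: "real^3 \<Rightarrow> 'g set" where
  "holo p = (if on p = {} then {0} else hs (SOME i. i \<in> on p) (lab (SOME i. i \<in> on p) (p $ 3)))"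

lemma potential_0: "hid p = {} \<Longrightarrow> potential p q = 0"
  by (simp add: potential_def)

lemma potential_1: "hid p = {i} \<Longrightarrow> potential p q = charge i q"
  by (simp add: potential_def)

lemma potential_2:
  assumes "hid p = {i, j}" "i \<noteq> j" "X j (p $ 3) < X i (p $ 3)"
  shows "potential p q = charge2 i j q"
proof -
  have "(SOME (i, j). hid p = {i, j} \<and> i \<noteq> j \<and> X j (p $ 3) \<le> X i (p $ 3)) = (i, j)"
    by (rule some_equality) (use assms in \<open>auto simp: doubleton_eq_iff\<close>)
  moreover have "\<not> (\<exists>k. hid p = {k})" using assms by (metis doubleton_eq_iff insert_absorb2)
  ultimately show ?thesis using assms by (auto simp: potential_def)
qed

lemma potential_2_eq:
  assumes "hid p = {i, j}" "i \<noteq> j" "X j (p $ 3) = X i (p $ 3)"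
  shows "potential p q = charge2 i j q \<or> potential p q = charge2 j i q"
proof -
  obtain i' j' where ij: "(SOME (i, j). hid p = {i, j} \<and> i \<noteq> j \<and> X j (p $ 3) \<le> X i (p $ 3)) = (i', j')" by force
  have "(\<lambda>(i, j). hid p = {i, j} \<and> i \<noteq> j \<and> X j (p $ 3) \<le> X i (p $ 3)) (SOME (i, j). hid p = {i, j} \<and> i \<noteq> j \<and> X j (p $ 3) \<le> X i (p $ 3))"
    by (rule someI[of _ "(i, j)"]) (use assms in auto)
  then have "{i', j'} = {i, j}" using ij assms by simp
  then have "(i', j') = (i, j) \<or> (i', j') = (j, i)" by (simp add: doubleton_eq_iff)
  moreover have "\<not> (\<exists>k. hid p = {k})" using assms by (metis doubleton_eq_iff insert_absorb2)
  ultimately show ?thesis using assms ij by (auto simp: potential_def)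
qed

lemma holo_off: "on p = {} \<Longrightarrow> holo p = {0}"
  by (simp add: holo_def)

lemma holo_1: "on p = {i} \<Longrightarrow> holo p = hs i (lab i (p $ 3))"
  by (simp add: holo_def)

lemma holo_2:
  assumes "on p = {i, j}" "hs i (lab i (p $ 3)) = S" "hs j (lab j (p $ 3)) = S"
  shows "holo p = S"
proof -
  have "(SOME k. k \<in> on p) \<in> on p" using assms(1) by (metis insertI1 someI_ex)
  then show ?thesis using assms by (auto simp: holo_def)
qed

lemma holo_subgroup: "0 \<in> holo p" "b \<in> holo p \<Longrightarrow> c \<in> holo p \<Longrightarrow> b + c \<in> holo p" "b \<in> holo p \<Longrightarrow> - b \<in> holo p"
  by (auto simp: holo_def hs split: if_splits)

lemma stack_pair: "\<exists>i j. stack p \<subseteq> {i, j}"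
  using local_form[of "p $ 3" "p $ 2", folded stack_def]
  apply (elim disjE exE conjE)
  subgoal by simp
  subgoal for i by (rule exI[of _ i], rule exI[of _ i]) simp
  subgoal for i j by (rule exI[of _ i], rule exI[of _ j]) simp
  subgoal for i j by (rule exI[of _ i], rule exI[of _ j]) simp
  subgoal for i j by (rule exI[of _ i], rule exI[of _ j]) simp
  done

lemma potential_self: "potential p p = 0"
proof -
  have "charge i p = 0" if "i \<in> hid p" for i
    using that by (auto simp: charge_def hid_def stack_def)
  moreover have "finite (hid p)" using finite_strands by (auto simp: hid_def stack_def)
  moreover have "(case SOME (i, j). hid p = {i, j} \<and> i \<noteq> j \<and> X j (p $ 3) \<le> X i (p $ 3) of (i, j) \<Rightarrow> charge2 i j p) = 0"
    if ne: "hid p \<noteq> {}" "\<not> (\<exists>i. hid p = {i})"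
  proof -
    have two: "A = {} \<or> A = {i} \<or> A = {j} \<or> A = {i, j}" if "A \<subseteq> {i, j}" for A and i j :: nat
      using that by blast
    obtain i j where "hid p \<subseteq> {i, j}"
      using stack_pair[of p] unfolding hid_def by blast
    then have "i \<noteq> j \<and> hid p = {i, j}" using two[of "hid p" i j] ne by (metis insert_absorb2)
    then have "\<exists>i j. i \<noteq> j \<and> hid p = {i, j}" by blast
    then obtain i j where ij: "i \<noteq> j" "hid p = {i, j}" by blast
    then have "\<exists>z. (\<lambda>(i, j). hid p = {i, j} \<and> i \<noteq> j \<and> X j (p $ 3) \<le> X i (p $ 3)) z"
    proof (cases "X j (p $ 3) \<le> X i (p $ 3)")
      case True
      then show ?thesis using ij by (intro exI[of _ "(i, j)"]) simp
    next
      case False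
      then show ?thesis using ij by (intro exI[of _ "(j, i)"]) (simp add: insert_commute)
    qed
    from someI_ex[OF this] calculation(1) show ?thesis
      by (auto simp: charge2_def split: prod.splits)
  qed
  moreover have "charge (THE i. hid p = {i}) p = 0" if "\<exists>i. hid p = {i}"
    using that calculation(1) by auto
  ultimately show ?thesis by (auto simp: potential_def)
qed

lemma eventually_less_nhds:
  fixes f g :: "real^3 \<Rightarrow> real"
  assumes "isCont f p" "isCont g p" "f p < g p"
  shows "\<forall>\<^sub>F q in nhds p. f q < g q"
proof -
  have "((\<lambda>q. g q - f q) \<longlongrightarrow> g p - f p) (nhds p)"
    using assms(1,2) by (intro tendsto_diff) (auto simp: isCont_def tendsto_at_iff_tendsto_nhds)
  then have "\<forall>\<^sub>F q in nhds p. 0 < g q - f q"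
    using assms(3) by (intro order_tendstoD) auto
  then show ?thesis by simp
qed

lemma cont_coord: "i \<in> I \<Longrightarrow> isCont (\<lambda>q. Y i (q $ 3)) (p :: real^3)" "i \<in> I \<Longrightarrow> isCont (\<lambda>q. X i (q $ 3)) (p :: real^3)"
  by (intro isCont_o2[OF _ cont_Y] isCont_o2[OF _ cont_X] continuous_intros; simp)+

text \<open>What persists near \<open>p\<close>: strict inequalities, not being live, and being live
  throughout a neighbourhood. Equalities may break up, so the relation is not symmetric.\<close>

definition follows :: "real^3 \<Rightarrow> real^3 \<Rightarrow> bool" where
  "follows p q \<longleftrightarrow> (\<forall>i\<in>I. (Y i (p $ 3) < p $ 2 \<longrightarrow> Y i (q $ 3) < q $ 2) \<and> (p $ 2 < Y i (p $ 3) \<longrightarrow> q $ 2 < Y i (q $ 3)) \<and>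
     (X i (p $ 3) < p $ 1 \<longrightarrow> X i (q $ 3) < q $ 1) \<and> (p $ 1 < X i (p $ 3) \<longrightarrow> q $ 1 < X i (q $ 3)) \<and>
     (\<not> live i (p $ 3) \<longrightarrow> \<not> live i (q $ 3)) \<and> ((\<forall>\<^sub>F s in nhds (p $ 3). live i s) \<longrightarrow> live i (q $ 3)) \<and>
     (\<forall>j\<in>I. (Y i (p $ 3) < Y j (p $ 3) \<longrightarrow> Y i (q $ 3) < Y j (q $ 3)) \<and> (X i (p $ 3) < X j (p $ 3) \<longrightarrow> X i (q $ 3) < X j (q $ 3))))"

lemma eventually_height:
  assumes "\<forall>\<^sub>F s in nhds (p $ 3). P s"
  shows "\<forall>\<^sub>F q in nhds (p :: real^3). P (q $ 3)"
proof -
  have "filterlim (\<lambda>q :: real^3. q $ 3) (nhds (p $ 3)) (nhds p)"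
    by (rule tendsto_vec_nth) (rule filterlim_ident)
  then show ?thesis using assms by (rule eventually_compose_filterlim[rotated])
qed

lemma eventually_follows: "\<forall>\<^sub>F q in nhds p. follows p q"
  unfolding follows_def
proof (intro eventually_ball_finite[OF finite_strands] ballI eventually_conj)
  fix i assume i: "i \<in> I"
  have imp: "\<forall>\<^sub>F q in nhds p. f p < g p \<longrightarrow> f q < g q" if "isCont f p" "isCont g p" for f g :: "real^3 \<Rightarrow> real"
    using eventually_less_nhds[OF that] by (cases "f p < g p") auto
  show "\<forall>\<^sub>F q in nhds p. Y i (p $ 3) < p $ 2 \<longrightarrow> Y i (q $ 3) < q $ 2"
    "\<forall>\<^sub>F q in nhds p. p $ 2 < Y i (p $ 3) \<longrightarrow> q $ 2 < Y i (q $ 3)"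
    "\<forall>\<^sub>F q in nhds p. X i (p $ 3) < p $ 1 \<longrightarrow> X i (q $ 3) < q $ 1"
    "\<forall>\<^sub>F q in nhds p. p $ 1 < X i (p $ 3) \<longrightarrow> q $ 1 < X i (q $ 3)"
    by (rule imp[where f = "\<lambda>q. Y i (q $ 3)" and g = "\<lambda>q. q $ 2"] imp[where f = "\<lambda>q. q $ 2" and g = "\<lambda>q. Y i (q $ 3)"]
        imp[where f = "\<lambda>q. X i (q $ 3)" and g = "\<lambda>q. q $ 1"] imp[where f = "\<lambda>q. q $ 1" and g = "\<lambda>q. X i (q $ 3)"];
        intro cont_coord[OF i] continuous_intros)+
  show "\<forall>\<^sub>F q in nhds p. \<not> live i (p $ 3) \<longrightarrow> \<not> live i (q $ 3)"
  proof (cases "live i (p $ 3)")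
    case False
    have "open (- {s. live i s})" using closed_live[OF i] by (simp add: open_Compl)
    then have "\<forall>\<^sub>F s in nhds (p $ 3). \<not> live i s"
      using eventually_nhds_in_open[of "- {s. live i s}" "p $ 3"] False by simp
    then have "\<forall>\<^sub>F q in nhds p. \<not> live i (q $ 3)" by (rule eventually_height)
    then show ?thesis by (rule eventually_mono) simp
  qed simp
  show "\<forall>\<^sub>F q in nhds p. (\<forall>\<^sub>F s in nhds (p $ 3). live i s) \<longrightarrow> live i (q $ 3)"
    using eventually_height[of "live i" p] by (cases "\<forall>\<^sub>F s in nhds (p $ 3). live i s") auto
  fix j assume j: "j \<in> I"
  show "\<forall>\<^sub>F q in nhds p. Y i (p $ 3) < Y j (p $ 3) \<longrightarrow> Y i (q $ 3) < Y j (q $ 3)"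
    "\<forall>\<^sub>F q in nhds p. X i (p $ 3) < X j (p $ 3) \<longrightarrow> X i (q $ 3) < X j (q $ 3)"
    by (rule imp[where f = "\<lambda>q. Y i (q $ 3)" and g = "\<lambda>q. Y j (q $ 3)"] imp[where f = "\<lambda>q. X i (q $ 3)" and g = "\<lambda>q. X j (q $ 3)"];
        intro cont_coord[OF i] cont_coord[OF j])+
qed

lemma stack_follows: "follows p q \<Longrightarrow> stack q \<subseteq> stack p"
  unfolding follows_def stack_def by (auto intro: antisym simp: not_less[symmetric])

lemma follows_pair:
  assumes "follows p q" "stack p = {i, j}"
  shows "stack q = {k \<in> {i, j}. live k (q $ 3) \<and> Y k (q $ 3) = q $ 2}"
    "k \<in> {i, j} \<Longrightarrow> X k (p $ 3) < p $ 1 \<Longrightarrow> X k (q $ 3) < q $ 1"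
    "k \<in> {i, j} \<Longrightarrow> p $ 1 < X k (p $ 3) \<Longrightarrow> q $ 1 < X k (q $ 3)"
    "k \<in> {i, j} \<Longrightarrow> l \<in> {i, j} \<Longrightarrow> X k (p $ 3) < X l (p $ 3) \<Longrightarrow> X k (q $ 3) < X l (q $ 3)"
proof -
  have I: "k \<in> I" if "k \<in> {i, j}" for k using that assms(2) unfolding stack_def by blast
  show "stack q = {k \<in> {i, j}. live k (q $ 3) \<and> Y k (q $ 3) = q $ 2}"
    using stack_follows[OF assms(1)] I unfolding assms(2) by (auto simp: stack_def)
  show "k \<in> {i, j} \<Longrightarrow> X k (p $ 3) < p $ 1 \<Longrightarrow> X k (q $ 3) < q $ 1"
    "k \<in> {i, j} \<Longrightarrow> p $ 1 < X k (p $ 3) \<Longrightarrow> q $ 1 < X k (q $ 3)"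
    "k \<in> {i, j} \<Longrightarrow> l \<in> {i, j} \<Longrightarrow> X k (p $ 3) < X l (p $ 3) \<Longrightarrow> X k (q $ 3) < X l (q $ 3)"
    using assms(1) I unfolding follows_def by blast+
qed

text \<open>In the cocycle condition \<open>q\<close> is close to \<open>p'\<close>, which is close
  to \<open>p\<close>. The nested form also provides \<open>follows p' q\<close>, which controls the
  order of \<open>q\<close> relative to the strands not passing through the line of sight of
  \<open>p'\<close>.\<close>

lemma eventually_follows2:
  assumes "\<forall>\<^sub>F q in nhds p. G q"
    and "\<And>p' q. G p' \<Longrightarrow> G q \<Longrightarrow> follows p p' \<Longrightarrow> follows p q \<Longrightarrow> follows p' q \<Longrightarrow> R p' q"
  shows "\<forall>\<^sub>F p' in nhds p. \<forall>\<^sub>F q in nhds p'. R p' q"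
proof -
  have 1: "\<forall>\<^sub>F q in nhds p. G q \<and> follows p q"
    using assms(1) eventually_follows by (rule eventually_conj)
  then have "\<forall>\<^sub>F p' in nhds p. \<forall>\<^sub>F q in nhds p'. G q \<and> follows p q"
    by (simp only: eventually_eventually)
  with 1 show ?thesis
  proof eventually_elim
    case (elim p')
    show ?case using elim(2) eventually_follows[of p']
      by eventually_elim (use assms(2) elim(1) in blast)
  qed
qed

lemma follows_Y:
  assumes "follows p' q" "k \<in> I"
  shows "Y k (p' $ 3) < p' $ 2 \<Longrightarrow> Y k (q $ 3) < q $ 2" "p' $ 2 < Y k (p' $ 3) \<Longrightarrow> q $ 2 < Y k (q $ 3)"
    "l \<in> I \<Longrightarrow> Y k (p' $ 3) < Y l (p' $ 3) \<Longrightarrow> Y k (q $ 3) < Y l (q $ 3)"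
  using assms unfolding follows_def by blast+

text \<open>In front of the strand no wall matters, behind it charges are additive, and on it the
  discrepancy is 0 or the label, both in \<open>holo p\<close>. The stack is written
  \<open>{i, i}\<close> so that the lemmas about pairs apply.\<close>

lemma cocycle_single:
  assumes st: "stack p = {i, i}" and lab: "live i (p' $ 3) \<and> lab i (p' $ 3) = a" "live i (q $ 3) \<and> lab i (q $ 3) = a"
    and f: "follows p p'" "follows p q" "follows p' q" and a: "lab i (p $ 3) = a"
  shows "potential p p' + potential p' q - potential p q \<in> holo p"
proof -
  have iI: "i \<in> I" "live i (p $ 3)" "Y i (p $ 3) = p $ 2" using st unfolding stack_def by auto
  have hidp: "hid p = (if p $ 1 < X i (p $ 3) then {i} else {})" and onp: "on p = (if p $ 1 = X i (p $ 3) then {i} else {})"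
    using st by (auto simp: hid_def on_def)
  have hid': "hid p' = (if Y i (p' $ 3) = p' $ 2 \<and> p' $ 1 < X i (p' $ 3) then {i} else {})"
    unfolding hid_def follows_pair(1)[OF f(1) st] using lab by auto
  have ch: "charge i r = (if Y i (r $ 3) < r $ 2 then a else 0)" if "r = p' \<or> r = q" for r
    using lab that by (auto simp: charge_def)
  consider "X i (p $ 3) < p $ 1" | "p $ 1 < X i (p $ 3)" | "p $ 1 = X i (p $ 3)" by linarith
  then show ?thesis
  proof cases
    case 1
    then have "\<not> p' $ 1 < X i (p' $ 3)" using follows_pair(2)[OF f(1) st, of i] by simp
    then show ?thesis using 1 hidp hid' by (simp add: potential_0 holo_subgroup)
  next
    case 2
    then have x': "p' $ 1 < X i (p' $ 3)" using follows_pair(3)[OF f(1) st, of i] by simp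
    have P: "potential p r = charge i r" for r using 2 hidp by (intro potential_1) simp
    show ?thesis
    proof (cases "Y i (p' $ 3) = p' $ 2")
      case True
      then show ?thesis using x' hid' by (simp add: P potential_1 charge_def holo_subgroup)
    next
      case False
      then have "potential p' q = 0" using hid' by (intro potential_0) simp
      moreover have "charge i p' = charge i q"
        using follows_Y(1,2)[OF f(3) iI(1)] False ch by (cases "Y i (p' $ 3) < p' $ 2") auto
      ultimately show ?thesis by (simp add: P holo_subgroup)
    qed
  next
    case 3
    have "potential p r = 0" for r using 3 hidp by (intro potential_0) simp
    moreover have "potential p' q = 0 \<or> potential p' q = a"
      using hid' ch[of q] potential_0[of p' q] potential_1[of p' i q] by (auto split: if_splits)
    moreover have "holo p = hs i a" using holo_1[of p i] onp 3 a by simp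
    ultimately show ?thesis using hs(1)[of i a] hs(2)[of a i] by auto
  qed
qed

end

section \<open>The cocycle condition at crossings and at apexes\<close>

context movie
begin

text \<open>The conjugated label makes the product of both walls independent of their order:
  \<open>a + (- a + b + a) = b + a\<close>. The five cases are the depths of \<open>p\<close>: in
  front of both strands, on the front one, between them, on the rear one, behind both. Only on a
  strand does a discrepancy remain, namely 0 or that strand's label.\<close>

lemma cocycle_crossing:
  assumes st: "stack p = {i, j}" and ij: "i \<noteq> j" "X j (p $ 3) < X i (p $ 3)"
    and lab: "\<And>r. r \<in> {p', q} \<Longrightarrow> live i (r $ 3) \<and> live j (r $ 3) \<and> lab i (r $ 3) = a \<and> lab j (r $ 3) = (if Y j (r $ 3) \<le> Y i (r $ 3) then b else - a + b + a)"
    and f: "follows p p'" "follows p q" "follows p' q" and a: "lab i (p $ 3) = a" "lab j (p $ 3) = b"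
  shows "potential p p' + potential p' q - potential p q \<in> holo p"
proof -
  have I: "i \<in> I" "j \<in> I" using st unfolding stack_def by auto
  have hidp: "hid p = {k \<in> {i, j}. p $ 1 < X k (p $ 3)}" and onp: "on p = {k \<in> {i, j}. p $ 1 = X k (p $ 3)}"
    using st by (auto simp: hid_def on_def)
  have hid': "hid p' = {k \<in> {i, j}. Y k (p' $ 3) = p' $ 2 \<and> p' $ 1 < X k (p' $ 3)}"
    unfolding hid_def follows_pair(1)[OF f(1) st] using lab[of p'] by auto
  have X': "X j (p' $ 3) < X i (p' $ 3)" using follows_pair(4)[OF f(1) st, of j i] ij by simp
  have chi: "charge i r = (if Y i (r $ 3) < r $ 2 then a else 0)" if "r \<in> {p', q}" for r
    using lab[OF that] by (auto simp: charge_def)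
  have chj: "charge j r = (if Y j (r $ 3) < r $ 2 then (if Y j (r $ 3) \<le> Y i (r $ 3) then b else - a + b + a) else 0)" if "r \<in> {p', q}" for r
    using lab[OF that] by (auto simp: charge_def)
  have ch2: "charge2 i j r = (if Y j (r $ 3) < r $ 2 \<and> Y i (r $ 3) < r $ 2 then b + a else if Y j (r $ 3) < r $ 2 then b
      else if Y i (r $ 3) < r $ 2 then a else 0)" if "r \<in> {p', q}" for r
    unfolding charge2_def chi[OF that] chj[OF that] by (auto simp: group_normal simp del: add_uminus_conv_diff)
  note Yi = follows_Y(1,2)[OF f(3) I(1)] and Yj = follows_Y(1,2)[OF f(3) I(2)]
    and Yij = follows_Y(3)[OF f(3) I(1) I(2)] and Yji = follows_Y(3)[OF f(3) I(2) I(1)]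
  have P'i: "potential p' q = charge i q" if "Y i (p' $ 3) = p' $ 2" "p' $ 1 < X i (p' $ 3)" "Y j (p' $ 3) = p' $ 2 \<longrightarrow> \<not> p' $ 1 < X j (p' $ 3)"
    by (rule potential_1) (use that in \<open>auto simp: hid'\<close>)
  have P'j: "potential p' q = charge j q" if "Y j (p' $ 3) = p' $ 2" "p' $ 1 < X j (p' $ 3)" "Y i (p' $ 3) \<noteq> p' $ 2"
    by (rule potential_1) (use that in \<open>auto simp: hid'\<close>)
  have P'0: "potential p' q = 0" if "Y i (p' $ 3) = p' $ 2 \<longrightarrow> \<not> p' $ 1 < X i (p' $ 3)" "Y j (p' $ 3) = p' $ 2 \<longrightarrow> \<not> p' $ 1 < X j (p' $ 3)"
    by (rule potential_0) (use that in \<open>auto simp: hid'\<close>)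
  have P'2: "potential p' q = charge2 i j q" if "Y i (p' $ 3) = p' $ 2" "Y j (p' $ 3) = p' $ 2" "p' $ 1 < X j (p' $ 3)"
    by (rule potential_2[OF _ ij(1) X']) (use that X' in \<open>auto simp: hid'\<close>)
  have const_i: "charge i p' = charge i q" if "Y i (p' $ 3) \<noteq> p' $ 2"
    using that Yi chi by (cases "Y i (p' $ 3) < p' $ 2") auto
  have ci0: "charge i p' = 0" if "Y i (p' $ 3) = p' $ 2" using that by (simp add: charge_def)
  consider "X i (p $ 3) < p $ 1" | "p $ 1 = X i (p $ 3)" | "X j (p $ 3) < p $ 1" "p $ 1 < X i (p $ 3)" | "p $ 1 = X j (p $ 3)" | "p $ 1 < X j (p $ 3)"
    using ij by linarith
  then show ?thesis
  proof cases
    case 1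
    then have "hid p = {}" using hidp ij by auto
    moreover have "X i (p' $ 3) < p' $ 1" "X j (p' $ 3) < p' $ 1"
      using 1 ij follows_pair(2)[OF f(1) st] by auto
    ultimately show ?thesis using P'0 by (simp add: potential_0 holo_subgroup)
  next
    case 2
    then have "hid p = {}" "on p = {i}" using hidp onp ij by auto
    moreover have "X j (p' $ 3) < p' $ 1" using 2 ij follows_pair(2)[OF f(1) st, of j] by simp
    then have "potential p' q = 0 \<or> potential p' q = charge i q" using P'0 P'i by (meson order_less_asym)
    then have "potential p' q = 0 \<or> potential p' q = a" using chi[of q] by auto
    ultimately show ?thesis using hs(1)[of i a] hs(2)[of a i] holo_1[of p i] a by (auto simp: potential_0)
  next
    case 3
    then have "hid p = {i}" using hidp by auto
    then have P: "potential p r = charge i r" for r by (rule potential_1)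
    have "X j (p' $ 3) < p' $ 1" "p' $ 1 < X i (p' $ 3)" using 3 follows_pair(2,3)[OF f(1) st] by auto
    then have "charge i p' + potential p' q = charge i q"
      using P'i P'0 const_i ci0 by (cases "Y i (p' $ 3) = p' $ 2") auto
    then show ?thesis by (simp add: P holo_subgroup)
  next
    case 4
    then have "hid p = {i}" "on p = {j}" using hidp onp ij by auto
    then have P: "potential p r = charge i r" for r by (intro potential_1)
    have Hp: "holo p = hs j b" using holo_1[of p j] \<open>on p = {j}\<close> a by simp
    have xi: "p' $ 1 < X i (p' $ 3)" using 4 ij follows_pair(3)[OF f(1) st, of i] by auto
    have "charge i p' + potential p' q - charge i q \<in> {0, b}"
    proof (cases "Y j (p' $ 3) = p' $ 2 \<and> p' $ 1 < X j (p' $ 3)")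
      case False
      then have "charge i p' + potential p' q = charge i q"
        using P'i P'0 const_i ci0 xi by (cases "Y i (p' $ 3) = p' $ 2") auto
      then show ?thesis by simp
    next
      case j: True
      show ?thesis
      proof (cases "Y i (p' $ 3) = p' $ 2")
        case True
        then have "charge i p' + potential p' q - charge i q = charge2 i j q - charge i q" using P'2 j ci0 by simp
        then show ?thesis unfolding ch2[of q, simplified] chi[of q, simplified] by (auto simp: group_normal simp del: add_uminus_conv_diff)
      next
        case False
        then have eq: "charge i p' + potential p' q - charge i q = charge i q + charge j q - charge i q" using P'j j const_i by simp
        show ?thesis
        proof (cases "Y i (p' $ 3) < p' $ 2")
          case True
          then have "Y i (q $ 3) < q $ 2" "Y i (q $ 3) < Y j (q $ 3)" using Yi Yij j by auto
          then show ?thesis unfolding eq unfolding chi[of q, simplified] chj[of q, simplified] by (auto simp: group_normal simp del: add_uminus_conv_diff)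
        next
          case False
          then have "q $ 2 < Y i (q $ 3)" "Y j (q $ 3) < Y i (q $ 3)" using Yi Yji j \<open>Y i (p' $ 3) \<noteq> p' $ 2\<close> by auto
          then show ?thesis unfolding eq unfolding chi[of q, simplified] chj[of q, simplified] by auto
        qed
      qed
    qed
    then show ?thesis using hs(1)[of j b] hs(2)[of b j] unfolding P Hp by (elim insertE emptyE) simp_all
  next
    case 5
    then have "p $ 1 < X i (p $ 3)" using ij(2) by linarith
    with 5 have "{k \<in> {i, j}. p $ 1 < X k (p $ 3)} = {i, j}" by auto
    then have "hid p = {i, j}" using hidp by simp
    then have P: "potential p r = charge2 i j r" for r using ij by (intro potential_2)
    have x: "p' $ 1 < X i (p' $ 3)" "p' $ 1 < X j (p' $ 3)" using 5 ij follows_pair(3)[OF f(1) st] by auto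
    have "charge2 i j p' + potential p' q = charge2 i j q"
    proof (cases "Y i (p' $ 3) = p' $ 2"; cases "Y j (p' $ 3) = p' $ 2")
      assume "Y i (p' $ 3) = p' $ 2" "Y j (p' $ 3) = p' $ 2"
      then show ?thesis using P'2 x by (simp add: ch2)
    next
      assume i: "Y i (p' $ 3) = p' $ 2" and j: "Y j (p' $ 3) \<noteq> p' $ 2"
      have P': "potential p' q = charge i q" using P'i i j x by simp
      consider "Y j (p' $ 3) < p' $ 2" "Y j (q $ 3) < q $ 2" | "p' $ 2 < Y j (p' $ 3)" "q $ 2 < Y j (q $ 3)" using j Yj by linarith
      then show ?thesis by cases (simp_all add: P' i ch2 chi)
    next
      assume i: "Y i (p' $ 3) \<noteq> p' $ 2" and j: "Y j (p' $ 3) = p' $ 2"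
      have P': "potential p' q = charge j q" using P'j i j x by simp
      consider "Y i (p' $ 3) < p' $ 2" "Y i (q $ 3) < q $ 2" "Y i (q $ 3) < Y j (q $ 3)" | "p' $ 2 < Y i (p' $ 3)" "q $ 2 < Y i (q $ 3)" "Y j (q $ 3) < Y i (q $ 3)"
        using i j Yi Yij Yji by linarith
      then show ?thesis by cases (simp_all add: P' j ch2 chj group_normal del: add_uminus_conv_diff)
    next
      assume i: "Y i (p' $ 3) \<noteq> p' $ 2" and j: "Y j (p' $ 3) \<noteq> p' $ 2"
      have "potential p' q = 0" using P'0 i j by simp
      moreover have "Y i (p' $ 3) < p' $ 2 \<longleftrightarrow> Y i (q $ 3) < q $ 2" "Y j (p' $ 3) < p' $ 2 \<longleftrightarrow> Y j (q $ 3) < q $ 2"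
        using i j Yi Yj by linarith+
      ultimately show ?thesis by (simp add: ch2)
    qed
    then show ?thesis unfolding P by (simp add: holo_subgroup)
  qed
qed

lemma potential_pair:
  assumes "hid p = {i, j}" "i \<noteq> j"
  shows "potential p q = charge2 i j q \<or> potential p q = charge2 j i q"
proof -
  consider "X j (p $ 3) < X i (p $ 3)" | "X i (p $ 3) < X j (p $ 3)" | "X j (p $ 3) = X i (p $ 3)" by linarith
  then show ?thesis
    using potential_2[of p i j q] potential_2[of p j i q] potential_2_eq[of p i j q] assms
    by cases (auto simp: insert_commute)
qed

text \<open>Since \<open>a + a = 0\<close>, only the parity of the number of crossed walls counts.
  Therefore the two walls may end together at the apex. \<open>P\<close> is the half-line of heights
  at which the strands are live.\<close>

lemma cocycle_apex:
  assumes st: "stack p = {i, j}" and ij: "i \<noteq> j" "X j (p $ 3) = X i (p $ 3)" and aa: "a + a = 0"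
    and hs': "hs i a = {0, a}" "hs j a = {0, a}" and lab0: "lab i (p $ 3) = a" "lab j (p $ 3) = a"
    and P: "P = (\<lambda>s. s \<le> p $ 3) \<or> P = (\<lambda>s. p $ 3 \<le> s)"
    and G: "\<forall>\<^sub>F s in nhds (p' $ 3). (live i s \<longleftrightarrow> P s) \<and> (live j s \<longleftrightarrow> P s) \<and> (P s \<longrightarrow> lab i s = a \<and> lab j s = a)"
      "\<forall>\<^sub>F s in nhds (q $ 3). (live i s \<longleftrightarrow> P s) \<and> (live j s \<longleftrightarrow> P s) \<and> (P s \<longrightarrow> lab i s = a \<and> lab j s = a)"
    and f: "follows p p'" "follows p q" "follows p' q"
  shows "potential p p' + potential p' q - potential p q \<in> holo p"
proof -
  have I: "i \<in> I" "j \<in> I" and Y0: "Y i (p $ 3) = p $ 2" "Y j (p $ 3) = p $ 2" using st unfolding stack_def by auto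
  have W: "(live i (r $ 3) \<longleftrightarrow> P (r $ 3)) \<and> (live j (r $ 3) \<longleftrightarrow> P (r $ 3)) \<and> (P (r $ 3) \<longrightarrow> lab i (r $ 3) = a \<and> lab j (r $ 3) = a)"
    if "r \<in> {p', q}" for r
    using that eventually_nhds_x_imp_x[OF G(1)] eventually_nhds_x_imp_x[OF G(2)] by auto
  define \<beta> where "\<beta> k r \<longleftrightarrow> P (r $ 3) \<and> Y k (r $ 3) < r $ 2" for k and r :: "real^3"
  have ch: "charge k r = (if \<beta> k r then a else 0)" if "r \<in> {p', q}" "k \<in> {i, j}" for k r
    using W[OF that(1)] that(2) by (auto simp: charge_def \<beta>_def)
  have ch2: "charge2 i j r = (if \<beta> i r \<noteq> \<beta> j r then a else 0)" "charge2 j i r = (if \<beta> i r \<noteq> \<beta> j r then a else 0)" if "r \<in> {p', q}" for r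
    unfolding charge2_def ch[OF that insertI1] ch[OF that insertI2[OF singletonI]] using aa by auto
  have hidp: "hid p = (if p $ 1 < X i (p $ 3) then {i, j} else {})" and onp: "on p = (if p $ 1 = X i (p $ 3) then {i, j} else {})"
    unfolding hid_def on_def st using ij(2) by auto
  have hid': "hid p' = {k \<in> {i, j}. P (p' $ 3) \<and> Y k (p' $ 3) = p' $ 2 \<and> p' $ 1 < X k (p' $ 3)}"
    unfolding hid_def follows_pair(1)[OF f(1) st] using W[of p'] by auto
  have P': "potential p' q = (if (\<beta> i q \<and> i \<in> hid p') \<noteq> (\<beta> j q \<and> j \<in> hid p') then a else 0)"
  proof -
    have sub: "hid p' \<subseteq> {i, j}" unfolding hid' by (rule Collect_restrict)
    consider "hid p' = {}" | "hid p' = {i}" | "hid p' = {j}" | "hid p' = {i, j}" using sub by blast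
    then show ?thesis
    proof cases
      case 1
      then show ?thesis by (simp add: potential_0)
    next
      case 2
      then show ?thesis using ij(1) ch[of q i] by (simp add: potential_1)
    next
      case 3
      then show ?thesis using ij(1) ch[of q j] by (simp add: potential_1)
    next
      case 4
      then show ?thesis using potential_pair[OF 4 ij(1), of q] ch2[of q] by simp
    qed
  qed
  consider "X i (p $ 3) < p $ 1" | "p $ 1 = X i (p $ 3)" | "p $ 1 < X i (p $ 3)" by linarith
  then show ?thesis
  proof cases
    case 1
    then have "X i (p' $ 3) < p' $ 1" "X j (p' $ 3) < p' $ 1" using ij(2) follows_pair(2)[OF f(1) st] by auto
    then have "hid p' = {}" using hid' by auto
    moreover have "hid p = {}" using hidp 1 by simp
    ultimately show ?thesis by (simp add: potential_0 holo_subgroup)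
  next
    case 2
    then have "hid p = {}" using hidp by simp
    moreover have "holo p = {0, a}" by (rule holo_2[of p i j]) (use 2 onp hs' lab0 in simp_all)
    ultimately show ?thesis using P' by (simp add: potential_0)
  next
    case 3
    then have hp: "hid p = {i, j}" using hidp by simp
    have Pp: "potential p r = (if \<beta> i r \<noteq> \<beta> j r then a else 0)" if "r \<in> {p', q}" for r
      using potential_pair[OF hp ij(1), of r] ch2[OF that] by auto
    have "p' $ 1 < X i (p' $ 3)" "p' $ 1 < X j (p' $ 3)" using 3 ij(2) follows_pair(3)[OF f(1) st] by auto
    then have inh: "k \<in> hid p' \<longleftrightarrow> P (p' $ 3) \<and> Y k (p' $ 3) = p' $ 2" if "k \<in> {i, j}" for k using hid' that by auto
    have notlive: "\<not> P (q $ 3)" if "\<not> P (p' $ 3)"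
      using that W[of p'] W[of q] f(3) I(1) unfolding follows_def by blast
    have "potential p p' + potential p' q = potential p q"
    proof (cases "p' $ 3 = p $ 3")
      case True
      then have Pt: "P (p' $ 3)" using P by auto
      have YY: "Y i (p' $ 3) = p $ 2" "Y j (p' $ 3) = p $ 2" using Y0 True by auto
      show ?thesis
      proof (cases "p' $ 2 = p $ 2")
        case True
        then show ?thesis using YY Pt inh by (simp add: Pp P' \<beta>_def)
      next
        case False
        then have "Y i (q $ 3) < q $ 2 \<longleftrightarrow> Y j (q $ 3) < q $ 2"
          using follows_Y(1,2)[OF f(3) I(1)] follows_Y(1,2)[OF f(3) I(2)] YY by linarith
        then show ?thesis using False YY inh by (simp add: Pp P' \<beta>_def)
      qed
    next
      case False
      have Pq: "P (q $ 3) \<longleftrightarrow> P (p' $ 3)"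
      proof
        assume "P (p' $ 3)"
        then have "\<forall>\<^sub>F s in nhds (p' $ 3). P s"
          using P False eventually_nhds_in_open[of "{..<p $ 3}" "p' $ 3"] eventually_nhds_in_open[of "{p $ 3<..}" "p' $ 3"]
          by (auto elim!: eventually_mono)
        with G(1) have "\<forall>\<^sub>F s in nhds (p' $ 3). live i s" by eventually_elim simp
        then show "P (q $ 3)" using f(3) I(1) W[of q] unfolding follows_def by blast
      qed (use notlive in blast)
      have B: "\<beta> k q = \<beta> k p'" if "k \<in> {i, j}" "k \<notin> hid p'" for k
      proof (cases "P (p' $ 3)")
        case True
        have "k \<in> I" using that I by auto
        moreover have "Y k (p' $ 3) \<noteq> p' $ 2" using inh that True by blast
        ultimately have "Y k (q $ 3) < q $ 2 \<longleftrightarrow> Y k (p' $ 3) < p' $ 2" using follows_Y(1,2)[OF f(3)] by (meson linorder_neqE order_less_asym)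
        then show ?thesis using Pq by (simp add: \<beta>_def)
      next
        case False
        then show ?thesis using notlive by (simp add: \<beta>_def)
      qed
      have B0: "\<not> \<beta> k p'" if "k \<in> {i, j}" "k \<in> hid p'" for k using inh that by (auto simp: \<beta>_def)
      show ?thesis
        using B[of i] B[of j] B0[of i] B0[of j] aa by (cases "i \<in> hid p'"; cases "j \<in> hid p'") (auto simp: Pp P')
    qed
    then show ?thesis by (simp add: holo_subgroup)
  qed
qed

lemma cocycle_eventually: "\<forall>\<^sub>F p' in nhds p. \<forall>\<^sub>F q in nhds p'. potential p p' + potential p' q - potential p q \<in> holo p"
  using local_form[of "p $ 3" "p $ 2", folded stack_def]
proof (elim disjE exE conjE)
  assume st: "stack p = {}"
  show ?thesis
  proof (rule eventually_follows2[of "\<lambda>_. True" p])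
    fix p' q assume "follows p p'"
    then have "hid p' = {}" "hid p = {}" using stack_follows[of p p'] st by (auto simp: hid_def)
    then show "potential p p' + potential p' q - potential p q \<in> holo p" by (simp add: potential_0 holo_subgroup)
  qed simp
next
  fix i assume st: "stack p = {i}" and ev: "\<forall>\<^sub>F s in nhds (p $ 3). live i s \<and> lab i s = lab i (p $ 3)"
  show ?thesis
    by (rule eventually_follows2[OF eventually_height[OF ev]]) (rule cocycle_single, use st in auto)
next
  fix i j assume st: "stack p = {i, j}" and ij: "i \<noteq> j" "X j (p $ 3) < X i (p $ 3)"
    and ev: "\<forall>\<^sub>F s in nhds (p $ 3). live i s \<and> live j s \<and> lab i s = lab i (p $ 3) \<and>
       lab j s = (if Y j s \<le> Y i s then lab j (p $ 3) else - lab i (p $ 3) + lab j (p $ 3) + lab i (p $ 3))"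
  show ?thesis
    by (rule eventually_follows2[OF eventually_height[OF ev]]) (rule cocycle_crossing[OF st ij], auto)
next
  fix i j a assume st: "stack p = {i, j}" and ij: "i \<noteq> j" "X j (p $ 3) = X i (p $ 3)" and aa: "a + a = 0"
    and h: "hs i a = {0, a}" "hs j a = {0, a}" "lab i (p $ 3) = a" "lab j (p $ 3) = a"
    and ev: "\<forall>\<^sub>F s in nhds (p $ 3). (live i s \<longleftrightarrow> s \<le> p $ 3) \<and> (live j s \<longleftrightarrow> s \<le> p $ 3) \<and> (s \<le> p $ 3 \<longrightarrow> lab i s = a \<and> lab j s = a)"
  have ev': "\<forall>\<^sub>F s' in nhds (p $ 3). \<forall>\<^sub>F s in nhds s'. (live i s \<longleftrightarrow> s \<le> p $ 3) \<and> (live j s \<longleftrightarrow> s \<le> p $ 3) \<and> (s \<le> p $ 3 \<longrightarrow> lab i s = a \<and> lab j s = a)"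
    using ev by (simp only: eventually_eventually)
  show ?thesis
    by (rule eventually_follows2[OF eventually_height[OF ev']]) (rule cocycle_apex[OF st ij aa h, of "\<lambda>s. s \<le> p $ 3"], auto)
next
  fix i j a assume st: "stack p = {i, j}" and ij: "i \<noteq> j" "X j (p $ 3) = X i (p $ 3)" and aa: "a + a = 0"
    and h: "hs i a = {0, a}" "hs j a = {0, a}" "lab i (p $ 3) = a" "lab j (p $ 3) = a"
    and ev: "\<forall>\<^sub>F s in nhds (p $ 3). (live i s \<longleftrightarrow> p $ 3 \<le> s) \<and> (live j s \<longleftrightarrow> p $ 3 \<le> s) \<and> (p $ 3 \<le> s \<longrightarrow> lab i s = a \<and> lab j s = a)"
  have ev': "\<forall>\<^sub>F s' in nhds (p $ 3). \<forall>\<^sub>F s in nhds s'. (live i s \<longleftrightarrow> p $ 3 \<le> s) \<and> (live j s \<longleftrightarrow> p $ 3 \<le> s) \<and> (p $ 3 \<le> s \<longrightarrow> lab i s = a \<and> lab j s = a)"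
    using ev by (simp only: eventually_eventually)
  show ?thesis
    by (rule eventually_follows2[OF eventually_height[OF ev']]) (rule cocycle_apex[OF st ij aa h, of "\<lambda>s. p $ 3 \<le> s"], auto)
qed

lemma on_follows:
  assumes "follows p p'" "stack p = {i, j}" "k \<in> on p'"
  shows "k \<in> on p" "live k (p' $ 3)" "Y k (p' $ 3) = p' $ 2" "X k (p' $ 3) = p' $ 1"
proof -
  have k: "k \<in> stack p'" "X k (p' $ 3) = p' $ 1" using assms(3) by (auto simp: on_def)
  then show "live k (p' $ 3)" "Y k (p' $ 3) = p' $ 2" "X k (p' $ 3) = p' $ 1" by (auto simp: stack_def)
  have k': "k \<in> {i, j}" using stack_follows[OF assms(1)] k(1) assms(2) by blast
  have "X k (p $ 3) = p $ 1" using follows_pair(2,3)[OF assms(1,2) k'] k(2) by linarith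
  then show "k \<in> on p" using k' assms(2) by (simp add: on_def)
qed

lemma holo_conj_apex:
  assumes st: "stack p = {i, j}" and X: "X j (p $ 3) = X i (p $ 3)"
    and h: "hs i a = {0, a}" "hs j a = {0, a}" "lab i (p $ 3) = a" "lab j (p $ 3) = a"
    and lab: "(live i (p' $ 3) \<longrightarrow> lab i (p' $ 3) = a) \<and> (live j (p' $ 3) \<longrightarrow> lab j (p' $ 3) = a)" and f: "follows p p'"
  shows "on p' \<noteq> {} \<longrightarrow> holo p' = (\<lambda>h. - potential p p' + h + potential p p') ` holo p"
proof
  assume "on p' \<noteq> {}"
  then obtain k where k: "k \<in> on p'" by blast
  have sub: "on p' \<subseteq> {i, j}" using stack_follows[OF f] st by (auto simp: on_def)
  have hol: "hs l (lab l (p' $ 3)) = {0, a}" if "l \<in> on p'" for l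
    using that sub on_follows(2)[OF f st that] lab h(1,2) by auto
  have "(SOME l. l \<in> on p') \<in> on p'" using k by (rule someI)
  then have "holo p' = {0, a}" using hol k by (auto simp: holo_def)
  moreover have "k \<in> on p" using on_follows(1)[OF f st k] .
  then have "on p = {i, j}" "hid p = {}" using st X by (auto simp: on_def hid_def)
  then have "holo p = {0, a}" using holo_2[of p i j "{0, a}"] h by simp
  ultimately show "holo p' = (\<lambda>h. - potential p p' + h + potential p p') ` holo p"
    using \<open>hid p = {}\<close> by (simp add: potential_0)
qed

text \<open>Along the strands the subgroup changes only when a strand passes behind another one, and
  there the potential is exactly the conjugating label.\<close>

lemma holo_conj: "\<forall>\<^sub>F p' in nhds p. on p' \<noteq> {} \<longrightarrow> holo p' = (\<lambda>h. - potential p p' + h + potential p p') ` holo p"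
  using local_form[of "p $ 3" "p $ 2", folded stack_def]
proof (elim disjE exE conjE)
  assume st: "stack p = {}"
  show ?thesis using eventually_follows[of p]
  proof eventually_elim
    case (elim p')
    then have "on p' = {}" using stack_follows[of p p'] st by (auto simp: on_def)
    then show ?case by simp
  qed
next
  fix i assume st: "stack p = {i}" and ev: "\<forall>\<^sub>F s in nhds (p $ 3). live i s \<and> lab i s = lab i (p $ 3)"
  have st': "stack p = {i, i}" using st by simp
  show ?thesis using eventually_height[OF ev] eventually_follows[of p]
  proof eventually_elim
    case (elim p')
    show ?case
    proof
      assume "on p' \<noteq> {}"
      then obtain k where k: "k \<in> on p'" by blast
      have sub: "on p' \<subseteq> {i}" using stack_follows[OF elim(2)] st by (auto simp: on_def)
      then have on': "on p' = {i}" "k = i" using k by auto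
      have "i \<in> on p" using on_follows(1)[OF elim(2) st' k] on' by simp
      then have onp: "on p = {i}" and "hid p = {}" using st by (auto simp: on_def hid_def)
      then show "holo p' = (\<lambda>h. - potential p p' + h + potential p p') ` holo p"
        using elim(1) by (simp add: potential_0 holo_1[OF on'(1)] holo_1[OF onp])
    qed
  qed
next
  fix i j assume st: "stack p = {i, j}" and ij: "i \<noteq> j" "X j (p $ 3) < X i (p $ 3)"
    and ev: "\<forall>\<^sub>F s in nhds (p $ 3). live i s \<and> live j s \<and> lab i s = lab i (p $ 3) \<and>
       lab j s = (if Y j s \<le> Y i s then lab j (p $ 3) else - lab i (p $ 3) + lab j (p $ 3) + lab i (p $ 3))"
  show ?thesis using eventually_height[OF ev] eventually_follows[of p]
  proof eventually_elim
    case (elim p')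
    have X': "X j (p' $ 3) < X i (p' $ 3)" using follows_pair(4)[OF elim(2) st, of j i] ij by simp
    have sub: "on p' \<subseteq> {i, j}" using stack_follows[OF elim(2)] st by (auto simp: on_def)
    show ?case
    proof
      assume "on p' \<noteq> {}"
      then consider "i \<in> on p'" | "j \<in> on p'" using sub by blast
      then show "holo p' = (\<lambda>h. - potential p p' + h + potential p p') ` holo p"
      proof cases
        case 1
        note k = on_follows[OF elim(2) st 1]
        have "on p' = {i}" using sub 1 k(4) X' by (auto simp: on_def)
        moreover have "on p = {i}" "hid p = {}" using k(1) st ij by (auto simp: on_def hid_def)
        ultimately show ?thesis using elim(1) by (simp add: potential_0 holo_1)
      next
        case 2
        note k = on_follows[OF elim(2) st 2]
        have o': "on p' = {j}" using sub 2 k(4) X' by (auto simp: on_def)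
        have o: "on p = {j}" "hid p = {i}" using k(1) st ij by (auto simp: on_def hid_def)
        have pot: "potential p p' = (if Y i (p' $ 3) < Y j (p' $ 3) then lab i (p $ 3) else 0)"
          using elim(1) k(3) by (simp add: potential_1[OF o(2)] charge_def)
        show ?thesis
        proof (cases "Y j (p' $ 3) \<le> Y i (p' $ 3)")
          case True
          then show ?thesis using elim(1) pot by (simp add: holo_1[OF o'] holo_1[OF o(1)])
        next
          case False
          then show ?thesis using elim(1) pot by (simp add: holo_1[OF o'] holo_1[OF o(1)] hs_conj)
        qed
      qed
    qed
  qed
next
  fix i j a assume st: "stack p = {i, j}" and ij: "i \<noteq> j" "X j (p $ 3) = X i (p $ 3)" and aa: "a + a = 0"
    and h: "hs i a = {0, a}" "hs j a = {0, a}" "lab i (p $ 3) = a" "lab j (p $ 3) = a"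
    and ev: "\<forall>\<^sub>F s in nhds (p $ 3). (live i s \<longleftrightarrow> s \<le> p $ 3) \<and> (live j s \<longleftrightarrow> s \<le> p $ 3) \<and> (s \<le> p $ 3 \<longrightarrow> lab i s = a \<and> lab j s = a)"
  then have ev: "\<forall>\<^sub>F s in nhds (p $ 3). (live i s \<longrightarrow> lab i s = a) \<and> (live j s \<longrightarrow> lab j s = a)" by (auto elim: eventually_mono)
  show ?thesis using eventually_height[OF ev] eventually_follows[of p]
    by eventually_elim (rule holo_conj_apex[OF st ij(2) h])
next
  fix i j a assume st: "stack p = {i, j}" and ij: "i \<noteq> j" "X j (p $ 3) = X i (p $ 3)" and aa: "a + a = 0"
    and h: "hs i a = {0, a}" "hs j a = {0, a}" "lab i (p $ 3) = a" "lab j (p $ 3) = a"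
    and ev: "\<forall>\<^sub>F s in nhds (p $ 3). (live i s \<longleftrightarrow> p $ 3 \<le> s) \<and> (live j s \<longleftrightarrow> p $ 3 \<le> s) \<and> (p $ 3 \<le> s \<longrightarrow> lab i s = a \<and> lab j s = a)"
  then have ev: "\<forall>\<^sub>F s in nhds (p $ 3). (live i s \<longrightarrow> lab i s = a) \<and> (live j s \<longrightarrow> lab j s = a)" by (auto elim: eventually_mono)
  show ?thesis using eventually_height[OF ev] eventually_follows[of p]
    by eventually_elim (rule holo_conj_apex[OF st ij(2) h])
qed

sublocale local_system potential holo "{p. on p \<noteq> {}}"
proof
  fix p :: "real^3"
  obtain \<delta> where d: "\<delta> > 0" "\<And>p'. dist p' p < \<delta> \<Longrightarrow> \<forall>\<^sub>F q in nhds p'. potential p p' + potential p' q - potential p q \<in> holo p"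
    using cocycle_eventually[of p] unfolding eventually_nhds_metric[of _ p] by blast
  show "\<exists>\<delta>>0. \<forall>p'\<in>ball p \<delta>. \<exists>\<delta>'>0. \<forall>q\<in>ball p' \<delta>' - {p. on p \<noteq> {}}. potential p p' + potential p' q - potential p q \<in> holo p"
  proof (rule exI[of _ \<delta>], rule conjI[OF d(1)], rule ballI)
    fix p' assume "p' \<in> ball p \<delta>"
    then have "dist p' p < \<delta>" by (simp add: dist_commute)
    from d(2)[OF this] obtain \<delta>' where d': "\<delta>' > 0" "\<And>q. dist q p' < \<delta>' \<Longrightarrow> potential p p' + potential p' q - potential p q \<in> holo p"
      unfolding eventually_nhds_metric by blast
    then show "\<exists>\<delta>'>0. \<forall>q\<in>ball p' \<delta>' - {p. on p \<noteq> {}}. potential p p' + potential p' q - potential p q \<in> holo p"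
      by (intro exI[of _ \<delta>']) (simp add: dist_commute)
  qed
qed (auto simp: holo_subgroup potential_self holo_off)

end

section \<open>Dihedral permutations on two sheets, and a commutator moving many points\<close>

section \<open>Permutations and the Pell equation\<close>

unbundle permutation_syntax

text \<open>The holonomy part is written additively; here \<open>+\<close> is composition with the
  right summand acting first.\<close>

instantiation Perm.perm :: (type) group_add
begin

definition zero_perm :: "'a perm" where "zero_perm = 1"
definition plus_perm :: "'a perm \<Rightarrow> 'a perm \<Rightarrow> 'a perm" where "plus_perm f g = f * g"
definition uminus_perm :: "'a perm \<Rightarrow> 'a perm" where "uminus_perm f = inverse f"
definition minus_perm :: "'a perm \<Rightarrow> 'a perm \<Rightarrow> 'a perm" where "minus_perm f g = f * inverse g"

instance
proof
  fix a b c :: "'a perm"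
  show "a + b + c = a + (b + c)" by (simp add: plus_perm_def mult.assoc)
  show "0 + a = a" "a + 0 = a" by (simp_all add: plus_perm_def zero_perm_def)
  show "- a + a = 0" by (simp add: plus_perm_def zero_perm_def uminus_perm_def)
  show "a + - b = a - b" by (simp add: plus_perm_def minus_perm_def uminus_perm_def)
qed

end

lemma apply_plus [simp]: "(a + b) \<langle>$\<rangle> z = a \<langle>$\<rangle> (b \<langle>$\<rangle> z)"
  by (simp add: plus_perm_def apply_sequence)

lemma apply_zero [simp]: "0 \<langle>$\<rangle> z = z"
  by (simp add: zero_perm_def)

lemma apply_uminus [simp]: "a \<langle>$\<rangle> ((- a) \<langle>$\<rangle> z) = z" "(- a) \<langle>$\<rangle> (a \<langle>$\<rangle> z) = z" for a :: "'a perm"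
  by (simp_all flip: apply_plus)

lemma affected_zero [simp]: "affected (0 :: 'a perm) = {}"
  by (simp add: zero_perm_def)

lemma affected_plus: "affected (a + b :: 'a perm) \<subseteq> affected a \<union> affected b"
  by (auto simp: in_affected)

lemma affected_uminus [simp]: "affected (- a :: 'a perm) = affected a"
proof -
  have "(- a) \<langle>$\<rangle> z = z \<longleftrightarrow> a \<langle>$\<rangle> z = z" for z
    by (metis apply_uminus)
  then show ?thesis by (auto simp: in_affected)
qed

lemma card_affected_plus: "card (affected (a + b :: 'a perm)) \<le> card (affected a) + card (affected b)"
  by (meson affected_plus card_Un_le card_mono finite_UnI finite_affected order_trans)

lemma affected_conj: "affected (- c + a + c :: 'a perm) = (\<lambda>z. (- c) \<langle>$\<rangle> z) ` affected a"
proof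
  show "affected (- c + a + c) \<subseteq> (\<lambda>z. (- c) \<langle>$\<rangle> z) ` affected a"
  proof
    fix z assume "z \<in> affected (- c + a + c)"
    then have "c \<langle>$\<rangle> z \<in> affected a" by (auto simp: in_affected)
    then show "z \<in> (\<lambda>z. (- c) \<langle>$\<rangle> z) ` affected a" by (rule rev_image_eqI) simp
  qed
  have "(- c) \<langle>$\<rangle> y \<noteq> (- c) \<langle>$\<rangle> z" if "y \<noteq> z" for y z
    using that by (metis apply_uminus(1))
  then show "(\<lambda>z. (- c) \<langle>$\<rangle> z) ` affected a \<subseteq> affected (- c + a + c)"
    by (auto simp: in_affected)
qed

lemma card_affected_conj: "card (affected (- c + a + c :: 'a perm)) = card (affected a)"
  unfolding affected_conj by (rule card_image) (auto intro: inj_on_inverseI[of _ "\<lambda>z. c \<langle>$\<rangle> z"])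

lemma apply_Perm:
  assumes "\<And>z. g (f z) = z" "\<And>z. f (g z) = z" "finite S" "\<And>z. z \<notin> S \<Longrightarrow> f z = z"
  shows "Perm f \<langle>$\<rangle> z = f z"
proof -
  have "bij f" using assms(1,2) by (metis bijI')
  moreover have "{z. f z \<noteq> z} \<subseteq> S" using assms(4) by blast
  ultimately show ?thesis
    using finite_subset[OF _ assms(3)] by (simp add: Perm_inverse)
qed

text \<open>Simultaneous rotation of the cyclic blocks \<open>{0..<c}\<close> and
  \<open>{c..<n}\<close>. All other integers are fixed, for finite support.\<close>

definition brot :: "int \<Rightarrow> int \<Rightarrow> int \<Rightarrow> int \<Rightarrow> int" where
  "brot c n j i = (if 0 \<le> i \<and> i < c then (i + j) mod c
     else if c \<le> i \<and> i < n then c + (i - c + j) mod (n - c) else i)"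

context
  fixes c n :: int
  assumes cn: "0 < c" "c < n"
begin

lemma brot_blocks:
  "brot c n j i \<in> {0..<c} \<longleftrightarrow> i \<in> {0..<c}" "brot c n j i \<in> {c..<n} \<longleftrightarrow> i \<in> {c..<n}"
  "brot c n j i \<in> {0..<n} \<longleftrightarrow> i \<in> {0..<n}"
proof -
  have *: "0 \<le> (i + j) mod c" "(i + j) mod c < c" "0 \<le> (i - c + j) mod (n - c)" "(i - c + j) mod (n - c) < n - c"
    using cn by simp_all
  show "brot c n j i \<in> {0..<c} \<longleftrightarrow> i \<in> {0..<c}" "brot c n j i \<in> {c..<n} \<longleftrightarrow> i \<in> {c..<n}"
    "brot c n j i \<in> {0..<n} \<longleftrightarrow> i \<in> {0..<n}"
    using * cn unfolding brot_def by (smt (verit) atLeastLessThan_iff)+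
qed

lemma brot_add: "brot c n k (brot c n j i) = brot c n (k + j) i"
proof -
  consider "i \<in> {0..<c}" | "i \<in> {c..<n}" | "i \<notin> {0..<n}" using cn by fastforce
  then show ?thesis
  proof cases
    case 1
    then show ?thesis using brot_blocks(1)[of j i] cn
      by (simp add: brot_def mod_add_left_eq mod_add_right_eq ac_simps)
  next
    case 2
    define r where "r = (i - c + j) mod (n - c)"
    have r: "0 \<le> r" "r < n - c" using cn by (simp_all add: r_def)
    have "brot c n j i = c + r" using 2 cn by (simp add: brot_def r_def)
    moreover have "brot c n k (c + r) = c + (r + k) mod (n - c)" using r cn by (simp add: brot_def)
    moreover have "(r + k) mod (n - c) = (i - c + (k + j)) mod (n - c)"
      unfolding r_def mod_add_left_eq by (simp add: ac_simps)
    ultimately show ?thesis using 2 cn by (simp add: brot_def)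
  next
    case 3
    then show ?thesis using cn by (auto simp: brot_def)
  qed
qed

lemma brot_0: "brot c n 0 i = i"
  using cn by (auto simp: brot_def)

lemma brot_cong: "i \<in> {0..<c} \<Longrightarrow> c dvd j - k \<Longrightarrow> brot c n j i = brot c n k i"
  "i \<in> {c..<n} \<Longrightarrow> (n - c) dvd j - k \<Longrightarrow> brot c n j i = brot c n k i"
proof -
  assume "i \<in> {0..<c}" "c dvd j - k"
  then have "(i + j) mod c = (i + k) mod c"
    using mod_eq_dvd_iff[of "i + j" c "i + k"] by simp
  then show "brot c n j i = brot c n k i" using \<open>i \<in> {0..<c}\<close> by (simp add: brot_def)
next
  assume "i \<in> {c..<n}" "(n - c) dvd j - k"
  then have "(i - c + j) mod (n - c) = (i - c + k) mod (n - c)"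
    using mod_eq_dvd_iff[of "i - c + j" "n - c" "i - c + k"] by simp
  then show "brot c n j i = brot c n k i" using \<open>i \<in> {c..<n}\<close> by (simp add: brot_def)
qed

lemma brot_eq_id: "c dvd j \<Longrightarrow> (n - c) dvd j \<Longrightarrow> brot c n j i = i"
  using brot_cong[of i j 0] brot_0[of i] by (cases "i \<in> {0..<n}"; force simp: brot_def)

text \<open>The sheet \<open>True\<close> turns backwards, so exchanging the sheets inverts a
  rotation; rotation followed or preceded by the exchange is then a reflection of dihedral
  type.\<close>

definition rho :: "int \<Rightarrow> (int \<times> bool) perm" where
  "rho j = Perm (\<lambda>(i, b). (brot c n (if b then - j else j) i, b))"

lemma rho: "rho j \<langle>$\<rangle> (i, b) = (brot c n (if b then - j else j) i, b)"
proof -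
  have "rho j \<langle>$\<rangle> (i, b) = (\<lambda>(i, b). (brot c n (if b then - j else j) i, b)) (i, b)"
    unfolding rho_def
  proof (rule apply_Perm[where g = "\<lambda>(i, b). (brot c n (if b then j else - j) i, b)" and S = "{0..<n} \<times> UNIV"])
    fix z :: "int \<times> bool" assume "z \<notin> {0..<n} \<times> UNIV"
    then show "(\<lambda>(i, b). (brot c n (if b then - j else j) i, b)) z = z"
      using cn by (cases z) (auto simp: brot_def)
  qed (auto simp: brot_add brot_0)
  then show ?thesis by simp
qed

lemma rho_add: "rho (i + j) = rho i + rho j"
  by (rule perm_eqI) (clarsimp simp: rho brot_add algebra_simps)

end

definition flip :: "int \<Rightarrow> (int \<times> bool) perm" where
  "flip n = Perm (\<lambda>(i, b). (i, if 0 \<le> i \<and> i < n then \<not> b else b))"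

lemma flip: "flip n \<langle>$\<rangle> (i, b) = (i, if 0 \<le> i \<and> i < n then \<not> b else b)"
proof -
  have "flip n \<langle>$\<rangle> (i, b) = (\<lambda>(i, b). (i, if 0 \<le> i \<and> i < n then \<not> b else b)) (i, b)"
    unfolding flip_def
    by (rule apply_Perm[where g = "\<lambda>(i, b). (i, if 0 \<le> i \<and> i < n then \<not> b else b)" and S = "{0..<n} \<times> UNIV"]) (auto split: if_splits)
  then show ?thesis by simp
qed

lemma flip_flip: "flip n + flip n = 0"
  by (rule perm_eqI) (clarsimp simp: flip)

lemma flip_rho:
  assumes "0 < c" "c < n"
  shows "flip n + rho c n j = rho c n (- j) + flip n"
proof (rule perm_eqI, clarify)
  fix i b
  have "0 \<le> brot c n k i \<and> brot c n k i < n \<longleftrightarrow> 0 \<le> i \<and> i < n" for k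
    using brot_blocks(3)[OF assms, of k i] by simp
  moreover have "brot c n k i = i" if "\<not> (0 \<le> i \<and> i < n)" for k
    using that assms by (auto simp: brot_def)
  ultimately show "(flip n + rho c n j) \<langle>$\<rangle> (i, b) = (rho c n (- j) + flip n) \<langle>$\<rangle> (i, b)"
    by (auto simp: flip rho[OF assms])
qed

text \<open>The quotient of the unit steps for two ways of cutting into blocks, on one sheet only.
  One sheet is enough, because a reflection exchanges the sheets and therefore meets this
  permutation just once when conjugated by it.\<close>

definition meridian :: "int \<Rightarrow> int \<Rightarrow> int \<Rightarrow> (int \<times> bool) perm" where
  "meridian c d n = Perm (\<lambda>(i, b). (if b then i else brot c n 1 (brot d n (-1) i), b))"

lemma meridian:
  assumes "0 < c" "c < n" "0 < d" "d < n"
  shows "meridian c d n \<langle>$\<rangle> (i, b) = (if b then i else brot c n 1 (brot d n (-1) i), b)"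
proof -
  have "meridian c d n \<langle>$\<rangle> (i, b) = (\<lambda>(i, b). (if b then i else brot c n 1 (brot d n (-1) i), b)) (i, b)"
    unfolding meridian_def
  proof (rule apply_Perm[where g = "\<lambda>(i, b). (if b then i else brot d n 1 (brot c n (-1) i), b)" and S = "{0..<n} \<times> UNIV"])
    fix z :: "int \<times> bool" assume "z \<notin> {0..<n} \<times> UNIV"
    then show "(\<lambda>(i, b). (if b then i else brot c n 1 (brot d n (-1) i), b)) z = z"
      using assms by (cases z) (auto simp: brot_def)
  qed (auto simp: brot_add[OF assms(1,2)] brot_add[OF assms(3,4)] brot_0[OF assms(1,2)] brot_0[OF assms(3,4)])
  then show ?thesis by simp
qed

text \<open>A step back and a step forward cancel except near the start of a block, so only
  \<open>0\<close>, \<open>d\<close> and \<open>c\<close> can move.\<close>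

lemma card_affected_meridian:
  assumes "0 < c" "c < n" "0 < d" "d < n" "d \<le> c"
  shows "card (affected (meridian c d n)) \<le> 3"
proof -
  have "affected (meridian c d n) \<subseteq> {(0, False), (d, False), (c, False)}"
  proof
    fix z assume "z \<in> affected (meridian c d n)"
    then obtain i where z: "z = (i, False)" and ne: "brot c n 1 (brot d n (-1) i) \<noteq> i"
      by (cases z) (auto simp: in_affected meridian[OF assms(1-4)] split: if_splits)
    have "i = 0 \<or> i = d \<or> i = c"
    proof (rule ccontr)
      assume *: "\<not> (i = 0 \<or> i = d \<or> i = c)"
      then have "brot d n (-1) i = (if 0 < i \<and> i < n then i - 1 else i)"
        using assms by (auto simp: brot_def mod_pos_pos_trivial)
      moreover have "brot c n 1 (i - 1) = i" if "0 < i" "i < n"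
        using that * assms by (auto simp: brot_def mod_pos_pos_trivial)
      moreover have "brot c n 1 i = i" if "\<not> (0 < i \<and> i < n)"
        using that * assms by (auto simp: brot_def)
      ultimately show False using ne by (auto split: if_splits)
    qed
    then show "z \<in> {(0, False), (d, False), (c, False)}" using z by auto
  qed
  moreover have "card {(0, False), (d, False), (c, False)} \<le> 3"
    using card_length[of "[(0, False), (d, False), (c, False)]"] by simp
  ultimately show ?thesis
    by (meson card_mono finite.emptyI finite.insertI order_trans)
qed


text \<open>The block lengths will be \<open>2 * x\<close>, \<open>2 * y\<close> and twice
  \<open>x + y\<close>. The parities make \<open>x * y\<close> steps of \<open>rot\<close> a half
  turn of the block of length \<open>2 * x\<close> and the identity on the other one, and they make
  2 invertible modulo \<open>x + y\<close>.\<close>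

locale pell =
  fixes x y :: int
  assumes pell: "x\<^sup>2 = 3 * y\<^sup>2 + 1" and parity: "even x" "odd y" and pos: "0 < y" "y < x" "x < 3 * y"
begin

abbreviation n :: int where "n \<equiv> 2 * x + 2 * y"
text \<open>The indices of the reflections met in the middle are built from these numbers:
  \<open>D\<close> and \<open>E\<close> above the axis, \<open>D'\<close> and \<open>E'\<close>
  below it.\<close>

abbreviation D :: int where "D \<equiv> 2 * x * y"
abbreviation E :: int where "E \<equiv> (x - y) * (3 * y - x)"
abbreviation D' :: int where "D' \<equiv> - ((x + y) * (x + 3 * y))"
abbreviation E' :: int where "E' \<equiv> - (2 * x * y)"

text \<open>The multiplier \<open>- D'\<close> turns index \<open>- E\<close> into a unit step,
  because \<open>D' * E\<close> is 1 modulo both block lengths. In this way the integers produced by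
  the windings can serve as indices.\<close>

definition rot :: "int \<Rightarrow> (int \<times> bool) perm" where "rot i = rho (2 * x) n (- D' * i)"
definition rot' :: "int \<Rightarrow> (int \<times> bool) perm" where "rot' i = rho (x + y) n (D * i)"
definition fl :: "(int \<times> bool) perm" where "fl = flip n"
definition mer :: "(int \<times> bool) perm" where "mer = meridian (2 * x) (x + y) n"

lemma splits: "0 < 2 * x" "2 * x < n" "0 < x + y" "x + y < n"
  using pos by auto

text \<open>After substituting \<open>3 * y^2 + 1\<close> for \<open>x^2\<close> the product
  \<open>- (x^2 - y^2) * (9 * y^2 - x^2)\<close> becomes \<open>1 - 4 * x^2 * y^2\<close>.\<close>

lemma det: "D' * E = 1 + D * E'"
proof -
  have "D' * E = - ((x\<^sup>2 - y\<^sup>2) * (9 * y\<^sup>2 - x\<^sup>2))" by (simp add: power2_eq_square algebra_simps)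
  also have "\<dots> = 1 - 4 * x\<^sup>2 * y\<^sup>2" unfolding pell by (simp add: algebra_simps)
  finally show ?thesis by (simp add: power2_eq_square algebra_simps)
qed

lemma rot_add: "rot (i + j) = rot i + rot j" and rot'_add: "rot' (i + j) = rot' i + rot' j"
  using rho_add[OF splits(1,2)] rho_add[OF splits(3,4)] by (simp_all add: rot_def rot'_def distrib_left)

lemma fl_fl: "fl + fl = 0"
  by (simp add: fl_def flip_flip)

lemma fl_rot: "fl + rot i = rot (- i) + fl" and fl_rot': "fl + rot' i = rot' (- i) + fl"
  using flip_rho[OF splits(1,2)] flip_rho[OF splits(3,4)] by (simp_all add: rot_def rot'_def fl_def)

lemma rho_eq_0: "c dvd j \<Longrightarrow> n - c dvd j \<Longrightarrow> 0 < c \<Longrightarrow> c < n \<Longrightarrow> rho c n j = 0"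
  by (rule perm_eqI) (auto simp: rho brot_eq_id)

text \<open>Upper indices that differ by \<open>D\<close> thus give the same reflection, which lets
  strands 0 and 1 carry equal labels in the middle.\<close>

lemma rot_D: "rot D = 0"
proof -
  have "2 * x dvd - D' * D" "n - 2 * x dvd - D' * D" by simp_all
  then show ?thesis unfolding rot_def using splits by (intro rho_eq_0) auto
qed

lemma rot'_D': "rot' D' = 0"
proof -
  have "x + y dvd D * D'" by simp
  moreover have "n - (x + y) = x + y" by simp
  ultimately show ?thesis unfolding rot'_def using splits by (intro rho_eq_0) auto
qed

lemma rot_E: "rot (- E) = rho (2 * x) n 1"
proof -
  have "- D' * - E = 1 + D * E'" using det by simp
  moreover have "rho (2 * x) n (D * E') = 0" using splits by (intro rho_eq_0) auto
  ultimately show ?thesis unfolding rot_def by (simp only: rho_add[OF splits(1,2)] add_0_right)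
qed

lemma rot'_E': "rot' (- E') = rho (x + y) n 1"
proof -
  have "D * - E' = 1 + D' * - E" using det by simp
  moreover have "rho (x + y) n (D' * - E) = 0"
  proof (rule rho_eq_0)
    show "x + y dvd D' * - E" by simp
    moreover have "n - (x + y) = x + y" by simp
    ultimately show "n - (x + y) dvd D' * - E" by metis
  qed (use splits in auto)
  ultimately show ?thesis unfolding rot'_def by (simp only: rho_add[OF splits(3,4)] add_0_right)
qed

text \<open>The Wirtinger relation for a strand passing behind the axis: conjugation by
  \<open>mer\<close> takes the unit reflection for one cutting into blocks to the unit reflection
  for the other.\<close>

lemma meridian_relation: "rot (- E) + fl + mer = mer + rot' (- E') + fl"
proof (rule perm_eqI, clarify)
  fix i :: int and b :: bool
  show "(rot (- E) + fl + mer) \<langle>$\<rangle> (i, b) = (mer + rot' (- E') + fl) \<langle>$\<rangle> (i, b)"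
  proof (cases "0 \<le> i \<and> i < n")
    case True
    have "0 \<le> brot (2 * x) n 1 (brot (x + y) n (- 1) i) \<and> brot (2 * x) n 1 (brot (x + y) n (- 1) i) < n"
      using brot_blocks(3)[OF splits(1,2)] brot_blocks(3)[OF splits(3,4)] True by (simp add: atLeastLessThan_def)
    then show ?thesis
      unfolding rot_E rot'_E' mer_def fl_def using True
      by (simp add: rho[OF splits(1,2)] rho[OF splits(3,4)] flip meridian[OF splits] brot_add[OF splits(1,2)] brot_add[OF splits(3,4)]
        brot_0[OF splits(1,2)] brot_0[OF splits(3,4)])
  next
    case False
    then have "brot c n j i = i" if "0 < c" "c < n" for c j using that by (auto simp: brot_def)
    then show ?thesis
      unfolding rot_E rot'_E' mer_def fl_def using False splits
      by (simp add: rho[OF splits(1,2)] rho[OF splits(3,4)] flip meridian[OF splits])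
  qed
qed

text \<open>The commutator of \<open>rot (x * y)\<close> and \<open>mer + rot' (x * y)\<close>. Up
  to conjugation it will be the jump of the section after one trip along the curve.\<close>

definition longitude :: "(int \<times> bool) perm" where
  "longitude = - rot (x * y) + (mer + rot' (x * y)) + rot (x * y) - (mer + rot' (x * y))"

text \<open>\<open>D' * y\<close> is odd, so \<open>D' * (x * y)\<close> is \<open>x\<close> modulo
  \<open>2 * x\<close>; as \<open>x\<close> is even, it vanishes modulo \<open>2 * y\<close>. A half
  turn does not depend on the sign, so both sheets behave alike.\<close>

lemma half_turn:
  assumes "m = D' * (x * y) \<or> m = - (D' * (x * y))"
  shows "i \<in> {0..<x} \<Longrightarrow> brot (2 * x) n m i = i + x" "i \<in> {x..<2*x} \<Longrightarrow> brot (2 * x) n m i = i - x"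
    "i \<in> {2*x..<n} \<Longrightarrow> brot (2 * x) n m i = i"
proof -
  have "odd (D' * y)" using parity by simp
  then have "2 dvd D' * y - 1" "2 dvd - (D' * y) - 1" by simp_all
  then have "x * 2 dvd x * (D' * y - 1)" "x * 2 dvd x * (- (D' * y) - 1)" by (simp_all only: dvd_times_left_cancel_iff mult_dvd_mono dvd_refl)
  moreover have "x * (D' * y - 1) = D' * (x * y) - x" "x * (- (D' * y) - 1) = - (D' * (x * y)) - x"
    by (simp_all add: algebra_simps)
  ultimately have "x * 2 dvd D' * (x * y) - x" "x * 2 dvd - (D' * (x * y)) - x" by metis+
  then have d1: "2 * x dvd m - x" using assms by (metis mult.commute)
  have "x * y dvd D' * (x * y)" by simp
  moreover have "2 * y dvd x * y" using parity(1) by simp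
  ultimately have "2 * y dvd D' * (x * y)" by (rule dvd_trans[rotated])
  then have d2: "2 * y dvd m - 0" using assms by auto
  show "brot (2 * x) n m i = i + x" if "i \<in> {0..<x}"
  proof -
    have "brot (2 * x) n m i = brot (2 * x) n x i"
      using that d1 by (intro brot_cong(1)[OF splits(1,2)]) auto
    also have "\<dots> = i + x" using that by (simp add: brot_def)
    finally show ?thesis .
  qed
  show "brot (2 * x) n m i = i - x" if "i \<in> {x..<2*x}"
  proof -
    have "m - (- x) = (m - x) + 2 * x" by simp
    then have "2 * x dvd m - (- x)" using dvd_add[OF d1 dvd_refl] by metis
    then have "brot (2 * x) n m i = brot (2 * x) n (- x) i"
      using that by (intro brot_cong(1)[OF splits(1,2)]) auto
    also have "\<dots> = i - x" using that by (simp add: brot_def)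
    finally show ?thesis .
  qed
  show "brot (2 * x) n m i = i" if "i \<in> {2*x..<n}"
    using brot_cong(2)[OF splits(1,2) that, of m 0] d2 brot_0[OF splits(1,2)] by simp
qed

text \<open>Modulo \<open>x + y\<close> the square of \<open>D\<close> is 1, hence
  \<open>D * (x * y)\<close> is the inverse \<open>c\<close> of 2, and \<open>c - 1\<close> equals
  \<open>- c\<close>. The extra step \<open>-1\<close> that \<open>mer\<close> contributes on the
  sheet \<open>False\<close> therefore makes both sheets turn by the same amount
  \<open>- c\<close>.\<close>

lemma half_step:
  obtains c where "2 * c = x + y + 1" "\<And>i m. m = - (D * (x * y)) \<or> m = D * (x * y) - 1 \<Longrightarrow> i \<in> {0..<n} \<Longrightarrow> brot (x + y) n m i = brot (x + y) n (- c) i"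
proof -
  have odd: "odd (x + y)" using parity by simp
  then obtain c where c: "2 * c = x + y + 1" by (metis dvd_def even_plus_one_iff)
  have "2 * (D * (x * y)) - 1 = - (D' * E)" using det by simp
  moreover have "x + y dvd - (D' * E)" by simp
  ultimately have d: "x + y dvd 2 * (D * (x * y)) - 1" by metis
  have "x + y dvd (2 * (D * (x * y)) - 1) - (x + y)" using d by (simp only: dvd_diff dvd_refl)
  moreover have "(2 * (D * (x * y)) - 1) - (x + y) = (D * (x * y) - c) * 2" using c by simp
  ultimately have "x + y dvd (D * (x * y) - c) * 2" by metis
  moreover have "coprime (x + y) 2" using odd by simp
  ultimately have e: "x + y dvd D * (x * y) - c" using coprime_dvd_mult_left_iff by blast
  show thesis
  proof (rule that[OF c])
    fix i m assume m: "m = - (D * (x * y)) \<or> m = D * (x * y) - 1" and i: "i \<in> {0..<n}"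
    have "x + y dvd m - - c"
    proof (cases "m = - (D * (x * y))")
      case True
      then have "m - - c = - (D * (x * y) - c)" by simp
      then show ?thesis using e by (metis dvd_minus_iff)
    next
      case False
      then have "m - - c = (2 * (D * (x * y)) - 1) - (D * (x * y) - c)" using m by simp
      then show ?thesis using d e by (metis dvd_diff)
    qed
    moreover have "n - (x + y) = x + y" by simp
    ultimately have "x + y dvd m - - c" "n - (x + y) dvd m - - c" by metis+
    then show "brot (x + y) n m i = brot (x + y) n (- c) i"
      using i brot_cong[OF splits(3,4), of i m "- c"] by (cases "i < x + y") auto
  qed
qed

text \<open>For these \<open>i\<close> exactly one of the two compositions ends at or beyond
  \<open>2 * x\<close>, in the block that \<open>J\<close> fixes.\<close>

lemma no_commute:
  assumes i: "i \<in> {y..<x} \<union> {x + y..<2 * x}" and c: "2 * c = x + y + 1"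
    and J: "\<And>i. i \<in> {0..<x} \<Longrightarrow> J i = i + x" "\<And>i. i \<in> {x..<2*x} \<Longrightarrow> J i = i - x" "\<And>i. i \<in> {2*x..<n} \<Longrightarrow> J i = i"
  shows "brot (x + y) n (- c) (J i) \<noteq> J (brot (x + y) n (- c) i)"
proof -
  have up: "brot (x + y) n (- c) j = j - c + (x + y)" if "j \<in> {x + y..<2 * x}" for j
  proof -
    have "n - (x + y) = x + y" by simp
    then have "(j - (x + y) + - c) mod (n - (x + y)) = (j - (x + y) + - c + (x + y)) mod (x + y)"
      by (simp only: mod_add_self2)
    also have "\<dots> = j - c" using that c pos by (subst mod_pos_pos_trivial) auto
    finally show ?thesis using that pos by (simp add: brot_def)
  qed
  have up_ge: "2 * x \<le> j - c + (x + y)" "j - c + (x + y) < n" if "j \<in> {x + y..<2 * x}" for j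
    using that c pos by auto
  have low: "brot (x + y) n (- c) j \<in> {0..<x + y}" if "j \<in> {y..<x}" for j
    using brot_blocks(1)[OF splits(3,4), of "- c" j] that pos by auto
  have Jlow: "J j < 2 * x" if "j \<in> {0..<x + y}" for j
    using J(1)[of j] J(2)[of j] that pos by (cases "j < x") auto
  from i show ?thesis
  proof
    assume i: "i \<in> {y..<x}"
    then have "J i = i + x" "i + x \<in> {x + y..<2 * x}" using J(1)[of i] pos by auto
    then have "brot (x + y) n (- c) (J i) \<ge> 2 * x" using up[of "J i"] up_ge[of "J i"] by simp
    moreover have "J (brot (x + y) n (- c) i) < 2 * x" using Jlow low i by blast
    ultimately show ?thesis by simp
  next
    assume i: "i \<in> {x + y..<2 * x}"
    then have "J (brot (x + y) n (- c) i) \<ge> 2 * x" using up[OF i] up_ge[OF i] J(3) by auto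
    moreover have "J i = i - x" "i - x \<in> {y..<x}" using i J(2)[of i] pos by auto
    then have "brot (x + y) n (- c) (J i) < x + y" using low by auto
    ultimately show ?thesis using pos by simp
  qed
qed

text \<open>A commutator moves \<open>k \<langle>$\<rangle> z\<close> as soon as \<open>k\<close>
  and \<open>u\<close> fail to commute at \<open>z\<close>. There are \<open>2 * (x - y)\<close>
  such positions on each of the two sheets.\<close>

lemma longitude_moves: "card (affected longitude) \<ge> nat (4 * (x - y))"
proof -
  obtain c where c: "2 * c = x + y + 1" "\<And>i m. m = - (D * (x * y)) \<or> m = D * (x * y) - 1 \<Longrightarrow> i \<in> {0..<n} \<Longrightarrow> brot (x + y) n m i = brot (x + y) n (- c) i"
    by (rule half_step) blast
  define k where "k = mer + rot' (x * y)"
  define u where "u = rot (x * y)"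
  define S where "S = ({y..<x} \<union> {x + y..<2 * x}) \<times> (UNIV :: bool set)"
  have uF: "u \<langle>$\<rangle> (i, False) = (brot (2 * x) n (- (D' * (x * y))) i, False)" and uT: "u \<langle>$\<rangle> (i, True) = (brot (2 * x) n (D' * (x * y)) i, True)" for i
    unfolding u_def rot_def rho[OF splits(1,2)] by simp_all
  have kT: "k \<langle>$\<rangle> (i, True) = (brot (x + y) n (- c) i, True)" if "i \<in> {0..<n}" for i
    unfolding k_def rot'_def mer_def by (simp add: rho[OF splits(3,4)] meridian[OF splits] c(2)[OF disjI1[OF refl] that])
  have kF: "k \<langle>$\<rangle> (i, False) = (brot (2 * x) n 1 (brot (x + y) n (- c) i), False)" if "i \<in> {0..<n}" for i
    unfolding k_def rot'_def mer_def
    by (simp add: rho[OF splits(3,4)] meridian[OF splits] brot_add[OF splits(3,4)] c(2)[OF disjI2[OF refl] that, simplified])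
  have ne: "k \<langle>$\<rangle> (u \<langle>$\<rangle> z) \<noteq> u \<langle>$\<rangle> (k \<langle>$\<rangle> z)" if "z \<in> S" for z
  proof -
    obtain i b where z: "z = (i, b)" and i: "i \<in> {y..<x} \<union> {x + y..<2 * x}" using \<open>z \<in> S\<close> unfolding S_def by auto
    have i0: "i \<in> {0..<n}" using i pos by auto
    have rng: "brot (2 * x) n m i \<in> {0..<n}" for m using brot_blocks(3)[OF splits(1,2)] i0 by blast
    show ?thesis
    proof (cases b)
      case True
      have "brot (x + y) n (- c) (brot (2 * x) n (D' * (x * y)) i) \<noteq> brot (2 * x) n (D' * (x * y)) (brot (x + y) n (- c) i)"
        by (rule no_commute[OF i c(1)]) (use half_turn in blast)+
      then show ?thesis using z True kT uT i0 rng by simp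
    next
      case False
      have "brot (x + y) n (- c) (brot (2 * x) n (- (D' * (x * y))) i) \<noteq> brot (2 * x) n (- (D' * (x * y))) (brot (x + y) n (- c) i)"
        by (rule no_commute[OF i c(1)]) (use half_turn in blast)+
      moreover have "brot (2 * x) n (-1) (brot (2 * x) n 1 j) = j" for j
        using brot_add[OF splits(1,2)] brot_0[OF splits(1,2)] by simp
      ultimately have "brot (2 * x) n 1 (brot (x + y) n (- c) (brot (2 * x) n (- (D' * (x * y))) i)) \<noteq>
          brot (2 * x) n 1 (brot (2 * x) n (- (D' * (x * y))) (brot (x + y) n (- c) i))" by metis
      moreover have "brot (2 * x) n (- (D' * (x * y))) (brot (2 * x) n 1 j) = brot (2 * x) n 1 (brot (2 * x) n (- (D' * (x * y))) j)" for j
        by (simp only: brot_add[OF splits(1,2)] add.commute)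
      ultimately show ?thesis using z False kF uF i0 rng by simp
    qed
  qed
  have "(\<lambda>z. k \<langle>$\<rangle> z) ` S \<subseteq> affected longitude"
  proof (rule image_subsetI)
    fix z assume "z \<in> S"
    have "longitude \<langle>$\<rangle> (k \<langle>$\<rangle> z) = (- u) \<langle>$\<rangle> (k \<langle>$\<rangle> (u \<langle>$\<rangle> z))"
      unfolding longitude_def k_def[symmetric] u_def[symmetric] diff_conv_add_uminus by (simp del: add_uminus_conv_diff)
    moreover have "(- u) \<langle>$\<rangle> (k \<langle>$\<rangle> (u \<langle>$\<rangle> z)) \<noteq> k \<langle>$\<rangle> z"
      using ne[OF \<open>z \<in> S\<close>] by (metis apply_uminus(1))
    ultimately show "k \<langle>$\<rangle> z \<in> affected longitude" by (simp add: in_affected)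
  qed
  then have "card ((\<lambda>z. k \<langle>$\<rangle> z) ` S) \<le> card (affected longitude)" by (intro card_mono) auto
  moreover have "card ((\<lambda>z. k \<langle>$\<rangle> z) ` S) = card S"
    by (rule card_image) (auto intro: inj_on_inverseI[of _ "\<lambda>z. (- k) \<langle>$\<rangle> z"])
  moreover have "card S = nat (4 * (x - y))"
  proof -
    have "card ({y..<x} \<union> {x + y..<2 * x}) = nat (x - y) + nat (x - y)"
      using pos by (subst card_Un_disjoint) auto
    then show ?thesis unfolding S_def by (simp add: card_cartesian_product)
  qed
  ultimately show ?thesis by simp
qed

text \<open>The element exchanges the sheets and hence moves all \<open>2 * n\<close>
  points.\<close>

lemma reflection_moves:
  assumes "\<And>i b. snd (g \<langle>$\<rangle> (i, b)) = b"
  shows "card (affected (g + (rot i + fl))) \<ge> nat (4 * (x - y))"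
proof -
  have "{0..<n} \<times> UNIV \<subseteq> affected (g + (rot i + fl))"
  proof
    fix z :: "int \<times> bool" assume "z \<in> {0..<n} \<times> UNIV"
    then obtain j b where z: "z = (j, b)" "0 \<le> j" "j < n" by auto
    have "snd ((g + (rot i + fl)) \<langle>$\<rangle> z) = (\<not> b)"
      using assms z by (simp add: fl_def flip rot_def rho[OF splits(1,2)])
    then show "z \<in> affected (g + (rot i + fl))" using z by (auto simp: in_affected)
  qed
  then have "card ({0..<n} \<times> (UNIV :: bool set)) \<le> card (affected (g + (rot i + fl)))" by (intro card_mono) auto
  moreover have "card ({0..<n} \<times> (UNIV :: bool set)) = 2 * nat n" by (simp add: card_cartesian_product)
  moreover have "nat (4 * (x - y)) \<le> nat (2 * n)" using pos by (intro nat_mono) simp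
  then have "nat (4 * (x - y)) \<le> 2 * nat n" by (simp only: nat_mult_distrib) simp
  ultimately show ?thesis by linarith
qed

end

text \<open>The coefficients of \<open>(2 + sqrt 3) ^ (2 * j + 1)\<close>. Odd powers are the ones
  with even \<open>x\<close> and odd \<open>y\<close>.\<close>

fun pell_pair :: "nat \<Rightarrow> int \<times> int" where
  "pell_pair 0 = (2, 1)"
| "pell_pair (Suc j) = (case pell_pair j of (x, y) \<Rightarrow> (7 * x + 12 * y, 4 * x + 7 * y))"

lemma pell_pair: "pell (fst (pell_pair j)) (snd (pell_pair j))"
proof (induction j)
  case 0
  show ?case by standard auto
next
  case (Suc j)
  obtain x y where xy: "pell_pair j = (x, y)" by force
  interpret pell x y using Suc xy by simp
  have "(7 * x + 12 * y)\<^sup>2 - 3 * (4 * x + 7 * y)\<^sup>2 = x\<^sup>2 - 3 * y\<^sup>2" by (simp add: power2_eq_square algebra_simps)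
  then show ?case using xy pell parity pos by unfold_locales auto
qed

text \<open>Equality holds at \<open>j = 0\<close>. The subtracted 2 disappears later, when the
  number of moved points is divided by 3 and rounded up.\<close>

lemma pell_growth: "4 * (fst (pell_pair j) - snd (pell_pair j)) \<ge> 3 * 2 ^ (2 * j + 1) - 2"
proof (induction j)
  case (Suc j)
  obtain x y where xy: "pell_pair j = (x, y)" by force
  interpret pell x y using pell_pair[of j] xy by simp
  show ?case using Suc xy pos by (simp add: power_add)
qed simp

text \<open>\<open>cs i s\<close> is the value on strand \<open>i\<close> of a section modulo
  meridians. Behind a front strand the value changes by the label of that strand; the extra
  \<open>lab j s0\<close> lies in the meridian subgroup and is chosen so that the change is a
  product of two labels, later a rotation. At the apex \<open>T\<close>, given as (height, second
  coordinate), the two branches may disagree.\<close>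

locale movie_section =
  fixes I :: "nat set" and X Y :: "nat \<Rightarrow> real \<Rightarrow> real" and live :: "nat \<Rightarrow> real \<Rightarrow> bool"
    and lab :: "nat \<Rightarrow> real \<Rightarrow> 'g::group_add" and hs :: "nat \<Rightarrow> 'g \<Rightarrow> 'g set"
    and cs :: "nat \<Rightarrow> real \<Rightarrow> 'g" and T :: "real \<times> real"
  assumes finite_strands: "finite I"
    and cont_X: "i \<in> I \<Longrightarrow> isCont (X i) s" and cont_Y: "i \<in> I \<Longrightarrow> isCont (Y i) s"
    and closed_live: "i \<in> I \<Longrightarrow> closed {s. live i s}"
    and hs: "0 \<in> hs i a" "a \<in> hs i a" "b \<in> hs i a \<Longrightarrow> c \<in> hs i a \<Longrightarrow> b + c \<in> hs i a" "b \<in> hs i a \<Longrightarrow> - b \<in> hs i a"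
    and hs_conj: "hs i (- c + a + c) = (\<lambda>h. - c + h + c) ` hs i a"
    and full_form: "{i \<in> I. live i s0 \<and> Y i s0 = y0} = {} \<or>
      (\<exists>i. {i \<in> I. live i s0 \<and> Y i s0 = y0} = {i} \<and> (\<forall>\<^sub>F s in nhds s0. live i s \<and> lab i s = lab i s0 \<and> cs i s = cs i s0)) \<or>
      (\<exists>i j. i \<noteq> j \<and> {i \<in> I. live i s0 \<and> Y i s0 = y0} = {i, j} \<and> X j s0 < X i s0 \<and>
        (\<forall>\<^sub>F s in nhds s0. live i s \<and> live j s \<and> lab i s = lab i s0 \<and> cs i s = cs i s0 \<and>
          lab j s = (if Y j s \<le> Y i s then lab j s0 else - lab i s0 + lab j s0 + lab i s0) \<and>
          cs j s = (if Y j s \<le> Y i s then cs j s0 else cs j s0 + lab j s0 + lab i s0))) \<or>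
      (\<exists>i j a. i \<noteq> j \<and> {i \<in> I. live i s0 \<and> Y i s0 = y0} = {i, j} \<and> X j s0 = X i s0 \<and> a + a = 0 \<and>
        hs i a = {0, a} \<and> hs j a = {0, a} \<and> ((s0, y0) \<noteq> T \<longrightarrow> cs i s0 = cs j s0) \<and> live i s0 \<and> live j s0 \<and>
        (\<forall>\<^sub>F s in nhds s0. (live i s \<longrightarrow> lab i s = a \<and> cs i s = cs i s0) \<and> (live j s \<longrightarrow> lab j s = a \<and> cs j s = cs j s0)) \<and>
        ((\<forall>\<^sub>F s in nhds s0. (live i s \<longleftrightarrow> s \<le> s0) \<and> (live j s \<longleftrightarrow> s \<le> s0)) \<or>
         (\<forall>\<^sub>F s in nhds s0. (live i s \<longleftrightarrow> s0 \<le> s) \<and> (live j s \<longleftrightarrow> s0 \<le> s))))"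
begin

lemma form_reduced: "{i \<in> I. live i s0 \<and> Y i s0 = y0} = {} \<or>
      (\<exists>i. {i \<in> I. live i s0 \<and> Y i s0 = y0} = {i} \<and> (\<forall>\<^sub>F s in nhds s0. live i s \<and> lab i s = lab i s0)) \<or>
      (\<exists>i j. i \<noteq> j \<and> {i \<in> I. live i s0 \<and> Y i s0 = y0} = {i, j} \<and> X j s0 < X i s0 \<and>
        (\<forall>\<^sub>F s in nhds s0. live i s \<and> live j s \<and> lab i s = lab i s0 \<and>
          lab j s = (if Y j s \<le> Y i s then lab j s0 else - lab i s0 + lab j s0 + lab i s0))) \<or>
      (\<exists>i j a. i \<noteq> j \<and> {i \<in> I. live i s0 \<and> Y i s0 = y0} = {i, j} \<and> X j s0 = X i s0 \<and> a + a = 0 \<and>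
        hs i a = {0, a} \<and> hs j a = {0, a} \<and> lab i s0 = a \<and> lab j s0 = a \<and>
        ((\<forall>\<^sub>F s in nhds s0. (live i s \<longleftrightarrow> s \<le> s0) \<and> (live j s \<longleftrightarrow> s \<le> s0) \<and> (s \<le> s0 \<longrightarrow> lab i s = a \<and> lab j s = a)) \<or>
         (\<forall>\<^sub>F s in nhds s0. (live i s \<longleftrightarrow> s0 \<le> s) \<and> (live j s \<longleftrightarrow> s0 \<le> s) \<and> (s0 \<le> s \<longrightarrow> lab i s = a \<and> lab j s = a))))"
  using full_form[of s0 y0]
proof (elim disjE exE conjE, goal_cases)
  case 1
  then show ?case by simp
next
  case (2 i)
  then show ?case by (intro disjI2[OF disjI1] exI[of _ i] conjI) (auto elim: eventually_mono)
next
  case (3 i j)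
  have "\<forall>\<^sub>F s in nhds s0. live i s \<and> live j s \<and> lab i s = lab i s0 \<and>
          lab j s = (if Y j s \<le> Y i s then lab j s0 else - lab i s0 + lab j s0 + lab i s0)"
    using 3(4) by (rule eventually_mono) blast
  with 3(1-3) show ?case by (intro disjI2[OF disjI2[OF disjI1]] exI[of _ i] exI[of _ j] conjI)
next
  case (4 i j a)
  have "\<forall>\<^sub>F s in nhds s0. (live i s \<longleftrightarrow> s \<le> s0) \<and> (live j s \<longleftrightarrow> s \<le> s0) \<and> (s \<le> s0 \<longrightarrow> lab i s = a \<and> lab j s = a)"
    using 4(10,11) by eventually_elim blast
  moreover have "lab i s0 = a" "lab j s0 = a" using eventually_nhds_x_imp_x[OF 4(10)] 4(8,9) by auto
  ultimately show ?case using 4(1-6)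
    by (rule_tac disjI2, rule_tac disjI2, rule_tac disjI2, rule_tac exI[of _ i], rule_tac exI[of _ j], rule_tac exI[of _ a]) (intro conjI disjI1)
next
  case (5 i j a)
  have "\<forall>\<^sub>F s in nhds s0. (live i s \<longleftrightarrow> s0 \<le> s) \<and> (live j s \<longleftrightarrow> s0 \<le> s) \<and> (s0 \<le> s \<longrightarrow> lab i s = a \<and> lab j s = a)"
    using 5(10,11) by eventually_elim blast
  moreover have "lab i s0 = a" "lab j s0 = a" using eventually_nhds_x_imp_x[OF 5(10)] 5(8,9) by auto
  ultimately show ?case using 5(1-6)
    by (rule_tac disjI2, rule_tac disjI2, rule_tac disjI2, rule_tac exI[of _ i], rule_tac exI[of _ j], rule_tac exI[of _ a]) (intro conjI disjI2)
qed

sublocale movie I X Y live lab hs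
  by standard (fact finite_strands cont_X cont_Y closed_live hs hs_conj form_reduced)+

text \<open>Two strands run through \<open>p\<close> only at an apex, where both give the same value
  unless the apex is \<open>T\<close>.\<close>

definition csec :: "real^3 \<Rightarrow> 'g" where
  "csec p = cs (SOME i. i \<in> on p) (p $ 3)"

lemma csec_1: "on p = {i} \<Longrightarrow> csec p = cs i (p $ 3)"
  by (simp add: csec_def)

lemma section_apex:
  assumes st: "stack p = {i, j}" and X: "X j (p $ 3) = X i (p $ 3)" and eq: "cs i (p $ 3) = cs j (p $ 3)"
    and ev: "\<forall>\<^sub>F s in nhds (p $ 3). (live i s \<longrightarrow> lab i s = a \<and> cs i s = cs i (p $ 3)) \<and> (live j s \<longrightarrow> lab j s = a \<and> cs j s = cs j (p $ 3))"
  shows "\<forall>\<^sub>F p' in nhds p. on p' \<noteq> {} \<longrightarrow> csec p' \<in> (\<lambda>h. csec p + h + potential p p') ` holo p"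
proof -
  show ?thesis using eventually_height[OF ev] eventually_follows[of p]
  proof eventually_elim
    case (elim p')
    show ?case
    proof
      assume "on p' \<noteq> {}"
      then have k: "(SOME l. l \<in> on p') \<in> on p'" by (metis ex_in_conv someI)
      note k' = on_follows[OF elim(2) st k]
      have sub: "on p' \<subseteq> {i, j}" "on p \<subseteq> {i, j}" using stack_follows[OF elim(2)] st by (auto simp: on_def)
      have "on p = {i, j}" "hid p = {}" using k'(1) st X by (auto simp: on_def hid_def)
      then have kp: "(SOME l. l \<in> on p) \<in> {i, j}" by (metis insertI1 someI)
      have "csec p' = cs i (p $ 3)" using k k'(2) sub elim(1) eq unfolding csec_def by auto
      moreover have "csec p = cs i (p $ 3)" using kp eq unfolding csec_def by auto
      ultimately have "csec p' = csec p + 0 + potential p p'" using \<open>hid p = {}\<close> by (simp add: potential_0)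
      then show "csec p' \<in> (\<lambda>h. csec p + h + potential p p') ` holo p" using holo_subgroup(1) by blast
    qed
  qed
qed

text \<open>In front, or before passing a crossing, the middle factor from \<open>holo p\<close> is
  0; on the rear strand beyond the crossing it is the label of that strand.\<close>

lemma section_eventually:
  assumes "(p $ 3, p $ 2) \<noteq> T"
  shows "\<forall>\<^sub>F p' in nhds p. on p' \<noteq> {} \<longrightarrow> csec p' \<in> (\<lambda>h. csec p + h + potential p p') ` holo p"
  using full_form[of "p $ 3" "p $ 2", folded stack_def]
proof (elim disjE exE conjE)
  assume st: "stack p = {}"
  show ?thesis using eventually_follows[of p]
  proof eventually_elim
    case (elim p')
    then have "on p' = {}" using stack_follows[of p p'] st by (auto simp: on_def)
    then show ?case by simp
  qed
next
  fix i assume st: "stack p = {i}" and ev: "\<forall>\<^sub>F s in nhds (p $ 3). live i s \<and> lab i s = lab i (p $ 3) \<and> cs i s = cs i (p $ 3)"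
  have st': "stack p = {i, i}" using st by simp
  show ?thesis using eventually_height[OF ev] eventually_follows[of p]
  proof eventually_elim
    case (elim p')
    show ?case
    proof
      assume "on p' \<noteq> {}"
      then obtain k where k: "k \<in> on p'" by blast
      have sub: "on p' \<subseteq> {i}" using stack_follows[OF elim(2)] st by (auto simp: on_def)
      then have on': "on p' = {i}" "k = i" using k by auto
      have "i \<in> on p" using on_follows(1)[OF elim(2) st' k] on' by simp
      then have onp: "on p = {i}" and "hid p = {}" using st by (auto simp: on_def hid_def)
      then have "csec p' = csec p + 0 + potential p p'"
        using elim(1) by (simp add: potential_0 csec_1[OF on'(1)] csec_1[OF onp])
      then show "csec p' \<in> (\<lambda>h. csec p + h + potential p p') ` holo p" using holo_subgroup(1) by blast
    qed
  qed
next
  fix i j assume st: "stack p = {i, j}" and ij: "i \<noteq> j" "X j (p $ 3) < X i (p $ 3)"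
    and ev: "\<forall>\<^sub>F s in nhds (p $ 3). live i s \<and> live j s \<and> lab i s = lab i (p $ 3) \<and> cs i s = cs i (p $ 3) \<and>
       lab j s = (if Y j s \<le> Y i s then lab j (p $ 3) else - lab i (p $ 3) + lab j (p $ 3) + lab i (p $ 3)) \<and>
       cs j s = (if Y j s \<le> Y i s then cs j (p $ 3) else cs j (p $ 3) + lab j (p $ 3) + lab i (p $ 3))"
  show ?thesis using eventually_height[OF ev] eventually_follows[of p]
  proof eventually_elim
    case (elim p')
    have X': "X j (p' $ 3) < X i (p' $ 3)" using follows_pair(4)[OF elim(2) st, of j i] ij by simp
    have sub: "on p' \<subseteq> {i, j}" using stack_follows[OF elim(2)] st by (auto simp: on_def)
    show ?case
    proof
      assume "on p' \<noteq> {}"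
      then consider "i \<in> on p'" | "j \<in> on p'" using sub by blast
      then show "csec p' \<in> (\<lambda>h. csec p + h + potential p p') ` holo p"
      proof cases
        case 1
        note k = on_follows[OF elim(2) st 1]
        have "on p' = {i}" using sub 1 k(4) X' by (auto simp: on_def)
        moreover have "on p = {i}" "hid p = {}" using k(1) st ij by (auto simp: on_def hid_def)
        ultimately have "csec p' = csec p + 0 + potential p p'" using elim(1) by (simp add: potential_0 csec_1)
        then show ?thesis using holo_subgroup(1) by blast
      next
        case 2
        note k = on_follows[OF elim(2) st 2]
        have o': "on p' = {j}" using sub 2 k(4) X' by (auto simp: on_def)
        have o: "on p = {j}" "hid p = {i}" using k(1) st ij by (auto simp: on_def hid_def)
        have pot: "potential p p' = (if Y i (p' $ 3) < Y j (p' $ 3) then lab i (p $ 3) else 0)"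
          using elim(1) k(3) by (simp add: potential_1[OF o(2)] charge_def)
        have "lab j (p $ 3) \<in> holo p" using holo_1[OF o(1)] hs(2) by simp
        moreover have "csec p' = csec p + (if Y j (p' $ 3) \<le> Y i (p' $ 3) then 0 else lab j (p $ 3)) + potential p p'"
          using elim(1) pot by (simp add: csec_1[OF o'] csec_1[OF o(1)])
        moreover have "(if Y j (p' $ 3) \<le> Y i (p' $ 3) then 0 else lab j (p $ 3)) \<in> holo p"
          using calculation(1) holo_subgroup(1)[of p] by simp
        ultimately show ?thesis by (intro image_eqI)
      qed
    qed
  qed
next
  fix i j a assume "stack p = {i, j}" "X j (p $ 3) = X i (p $ 3)" "(p $ 3, p $ 2) \<noteq> T \<longrightarrow> cs i (p $ 3) = cs j (p $ 3)"
    "\<forall>\<^sub>F s in nhds (p $ 3). (live i s \<longrightarrow> lab i s = a \<and> cs i s = cs i (p $ 3)) \<and> (live j s \<longrightarrow> lab j s = a \<and> cs j s = cs j (p $ 3))"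
  then show ?thesis using assms by (intro section_apex[of p i j a]) simp_all
next
  fix i j a assume "stack p = {i, j}" "X j (p $ 3) = X i (p $ 3)" "(p $ 3, p $ 2) \<noteq> T \<longrightarrow> cs i (p $ 3) = cs j (p $ 3)"
    "\<forall>\<^sub>F s in nhds (p $ 3). (live i s \<longrightarrow> lab i s = a \<and> cs i s = cs i (p $ 3)) \<and> (live j s \<longrightarrow> lab j s = a \<and> cs j s = cs j (p $ 3))"
  then show ?thesis using assms by (intro section_apex[of p i j a]) simp_all
qed

end

section \<open>Explicit piecewise linear strands and the coincidences of their projections\<close>

section \<open>The strands\<close>

text \<open>Piecewise linear interpolation at the integers, constant before 0 and after
  \<open>M\<close>. As a sum of clipped ramps it is visibly continuous.\<close>

definition interp :: "(nat \<Rightarrow> real) \<Rightarrow> nat \<Rightarrow> real \<Rightarrow> real" where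
  "interp f M t = f 0 + (\<Sum>i<M. (f (Suc i) - f i) * max 0 (min 1 (t - real i)))"

lemma interp_segment:
  assumes "m < M" "real m \<le> t" "t \<le> real m + 1"
  shows "interp f M t = f m + (f (Suc m) - f m) * (t - real m)"
proof -
  define g where "g i = (f (Suc i) - f i) * max 0 (min 1 (t - real i))" for i
  have "sum g {..<M} = sum g {..<m} + g m + sum g {Suc m..<M}"
    using sum.atLeastLessThan_concat[of 0 m M g] sum.atLeast_Suc_lessThan[of m M g] assms(1)
    by (simp add: lessThan_atLeast0 add.assoc)
  also have "sum g {..<m} = (\<Sum>i<m. f (Suc i) - f i)"
    using assms(2) by (intro sum.cong) (auto simp: g_def min_def max_def)
  also have "\<dots> = f m - f 0" by (rule sum_lessThan_telescope)
  also have "sum g {Suc m..<M} = 0"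
    using assms(3) by (intro sum.neutral) (auto simp: g_def min_def max_def)
  also have "g m = (f (Suc m) - f m) * (t - real m)" using assms by (simp add: g_def min_def max_def)
  finally show ?thesis by (simp add: interp_def g_def)
qed

lemma interp_le_0: "t \<le> 0 \<Longrightarrow> interp f M t = f 0"
  by (auto simp: interp_def min_def max_def intro!: sum.neutral)

lemma interp_ge: "real M \<le> t \<Longrightarrow> interp f M t = f M"
proof -
  assume "real M \<le> t"
  then have "(\<Sum>i<M. (f (Suc i) - f i) * max 0 (min 1 (t - real i))) = (\<Sum>i<M. f (Suc i) - f i)"
    by (intro sum.cong) (auto simp: min_def max_def)
  then show ?thesis by (simp add: interp_def sum_lessThan_telescope)
qed

lemma continuous_interp: "isCont (interp f M) t"
  unfolding interp_def[abs_def] by (intro continuous_intros)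

text \<open>In horizontal cross section the moving strand runs along the triangle (0, 0), (2, 4),
  (-2, 4), twice around strand 2 at (0, 2), and then along the same triangle rotated by a half turn,
  twice around strand 0 at (0, -2). The period is twelve edges.\<close>

definition sg :: "nat \<Rightarrow> real" where "sg m = (if even (m div 6) then 1 else - 1)"
definition vx :: "nat \<Rightarrow> real" where "vx m = sg m * (if m mod 3 = 0 then 0 else if m mod 3 = 1 then 2 else - 2)"
definition vy :: "nat \<Rightarrow> real" where "vy m = sg m * (if m mod 3 = 0 then 0 else 4)"

lemma sg_cases: "sg m = 1 \<or> sg m = - 1" by (simp add: sg_def)

lemma sg_Suc: "m mod 3 \<noteq> 2 \<Longrightarrow> sg (Suc m) = sg m"
proof -
  assume "m mod 3 \<noteq> 2"
  then have "Suc m div 6 = m div 6" by presburger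
  then show ?thesis by (simp add: sg_def)
qed

text \<open>\<open>J\<close> counts the edges of the winding in each half; multiples of 12 bring the
  strand back to the centre. At least 12 of them leave enough height in the middle for the crossings
  with the axis between -2 and 6.\<close>

locale strands =
  fixes J :: nat
  assumes J: "0 < J" "12 dvd J"
begin

abbreviation h :: real where "h \<equiv> real J"
abbreviation Z :: real where "Z \<equiv> 2 * real J"

lemma h12: "h \<ge> 12" using J by (auto elim!: dvdE)

definition PX :: "real \<Rightarrow> real" where "PX t = interp vx J t"
definition PY :: "real \<Rightarrow> real" where "PY t = interp vy J t"

lemma P_outside: "t \<le> 0 \<or> h \<le> t \<Longrightarrow> PX t = 0 \<and> PY t = 0"
proof -
  have "vx J = 0" "vy J = 0" using J(2) by (auto simp: vx_def vy_def elim!: dvdE)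
  then show "t \<le> 0 \<or> h \<le> t \<Longrightarrow> PX t = 0 \<and> PY t = 0"
    by (auto simp: PX_def PY_def interp_le_0 interp_ge) (simp_all add: vx_def vy_def)
qed

lemma P_segment:
  assumes "m < J" "real m \<le> t" "t \<le> real m + 1"
  shows "m mod 3 = 0 \<Longrightarrow> PX t = sg m * (2 * (t - real m)) \<and> PY t = sg m * (4 * (t - real m))"
    "m mod 3 = 1 \<Longrightarrow> PX t = sg m * (2 - 4 * (t - real m)) \<and> PY t = sg m * 4"
    "m mod 3 = 2 \<Longrightarrow> PX t = sg m * (2 * (t - real m) - 2) \<and> PY t = sg m * (4 - 4 * (t - real m))"
proof -
  note seg = interp_segment[OF assms]
  have s: "Suc m mod 3 = (if m mod 3 = 2 then 0 else Suc (m mod 3))" by presburger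
  show "m mod 3 = 0 \<Longrightarrow> PX t = sg m * (2 * (t - real m)) \<and> PY t = sg m * (4 * (t - real m))"
    "m mod 3 = 1 \<Longrightarrow> PX t = sg m * (2 - 4 * (t - real m)) \<and> PY t = sg m * 4"
    "m mod 3 = 2 \<Longrightarrow> PX t = sg m * (2 * (t - real m) - 2) \<and> PY t = sg m * (4 - 4 * (t - real m))"
    unfolding PX_def PY_def seg using s sg_Suc[of m] by (simp_all add: vx_def vy_def algebra_simps)
qed

lemma segment_exists:
  assumes "0 < t" "t < h"
  obtains m where "m < J" "real m \<le> t" "t \<le> real m + 1"
proof (rule that[of "nat \<lfloor>t\<rfloor>"])
  show "nat \<lfloor>t\<rfloor> < J" using assms by linarith
qed (use assms in linarith)+

lemma P_bounds: "\<bar>PX t\<bar> \<le> 2" "\<bar>PY t\<bar> \<le> 4"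
proof -
  have "\<bar>PX t\<bar> \<le> 2 \<and> \<bar>PY t\<bar> \<le> 4"
  proof (cases "0 < t \<and> t < h")
    case True
    then obtain m where m: "m < J" "real m \<le> t" "t \<le> real m + 1" using segment_exists by blast
    consider "m mod 3 = 0" | "m mod 3 = 1" | "m mod 3 = 2" by linarith
    then show ?thesis
      using P_segment[OF m] sg_cases[of m] m by cases (auto simp: abs_le_iff)
  next
    case False
    then show ?thesis using P_outside[of t] by auto
  qed
  then show "\<bar>PX t\<bar> \<le> 2" "\<bar>PY t\<bar> \<le> 4" by auto
qed

text \<open>The moving strand passes next to a fixed strand only half way along an edge; \<open>bk m\<close> is then the strand
  behind and \<open>fr m\<close> the one in front.\<close>

definition bk :: "nat \<Rightarrow> nat" where "bk m = (if sg m = 1 then (if m mod 3 = 0 then 2 else 1) else (if m mod 3 = 0 then 1 else 0))"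
definition fr :: "nat \<Rightarrow> nat" where "fr m = (if sg m = 1 then (if m mod 3 = 0 then 1 else 2) else (if m mod 3 = 0 then 0 else 1))"

lemma crossing_time:
  assumes "\<bar>PY t\<bar> = 2"
  obtains m where "m < J" "t = real m + 1 / 2" "m mod 3 \<noteq> 1" "PY t = 2 * sg m" "PX t = (if bk m = 1 then - 1 else 1)"
proof -
  have "0 < t \<and> t < h" using P_outside[of t] assms by force
  then obtain m where m: "m < J" "real m \<le> t" "t \<le> real m + 1" using segment_exists by blast
  consider "m mod 3 = 0" | "m mod 3 = 1" | "m mod 3 = 2" by linarith
  then show ?thesis
  proof cases
    case 1
    have "4 * (t - real m) = 2" using P_segment(1)[OF m 1] assms sg_cases[of m] m by (auto simp: abs_mult)
    then show ?thesis using P_segment(1)[OF m 1] 1 m sg_cases[of m] by (intro that[of m]) (auto simp: bk_def)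
  next
    case 2
    then show ?thesis using P_segment(2)[OF m 2] assms sg_cases[of m] by auto
  next
    case 3
    have "4 - 4 * (t - real m) = 2" using P_segment(3)[OF m 3] assms sg_cases[of m] m by (auto simp: abs_mult)
    then show ?thesis using P_segment(3)[OF m 3] 3 m sg_cases[of m] by (intro that[of m]) (auto simp: bk_def)
  qed
qed

text \<open>All triangles turn the same way, so the rear strand has the smaller second coordinate
  exactly from the crossing on. Hence one rule of conjugation serves for both neighbours and, as
  everything depends on the absolute height, for both halves.\<close>

lemma crossing_order:
  assumes m: "m < J" "m mod 3 \<noteq> 1" and t: "\<bar>t - (real m + 1 / 2)\<bar> \<le> 1 / 2"
  shows "(if bk m = 1 then PY t \<le> 2 * sg m else 2 * sg m \<le> PY t) \<longleftrightarrow> real m + 1 / 2 \<le> t"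
proof -
  have m': "m < J" "real m \<le> t" "t \<le> real m + 1" using m t by linarith+
  consider "m mod 3 = 0" | "m mod 3 = 2" using m(2) by linarith
  then show ?thesis
    using P_segment[OF m'] sg_cases[of m] by cases (auto simp: bk_def)
qed

text \<open>For \<open>\<bar>s\<bar> < h\<close> strands 0 and 1 bend backwards and strands 2 and 3
  bend forwards, which makes room for the axis, strand 4, at depth 0.\<close>

definition XX :: "nat \<Rightarrow> real \<Rightarrow> real" where
  "XX i s = (if i = 0 then - max 0 (h - \<bar>s\<bar>) else if i = 1 then PX (\<bar>s\<bar> - h) - max 0 (h - \<bar>s\<bar>)
     else if i = 4 then 0 else max 0 (h - \<bar>s\<bar>))"

text \<open>At the top strand 0 leans over to strand 1 and strand 3 to strand 2. At the bottom
  strand 2 leans over to strand 1, and strand 3 descends to strand 0: from 6 to -2 over a height of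
  7, passing outside the minimum of strands 1 and 2.\<close>

definition YY :: "nat \<Rightarrow> real \<Rightarrow> real" where
  "YY i s = (if i = 0 then - 2 + 2 * max 0 (s - Z) else if i = 1 then PY (\<bar>s\<bar> - h)
     else if i = 2 then 2 - 2 * max 0 (- Z - s) else if i = 3 then 6 - 4 * max 0 (s - Z) - 8 / 7 * max 0 (- Z - s) else s)"

definition lo :: "nat \<Rightarrow> real" where "lo i = (if i = 0 \<or> i = 3 then - Z - 7 else - Z - 1)"

definition lv :: "nat \<Rightarrow> real \<Rightarrow> bool" where "lv i s \<longleftrightarrow> i = 4 \<or> (lo i \<le> s \<and> s \<le> Z + 1)"

lemma continuous_XX: "isCont (XX i) s" and continuous_YY: "isCont (YY i) s"
proof -
  have *: "isCont (\<lambda>s :: real. \<bar>s\<bar> - h) s" by (intro continuous_intros)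
  have P: "isCont (\<lambda>s. PX (\<bar>s\<bar> - h)) s" "isCont (\<lambda>s. PY (\<bar>s\<bar> - h)) s"
    unfolding PX_def PY_def by (rule isCont_o2[OF * continuous_interp])+
  show "isCont (XX i) s" unfolding XX_def[abs_def]
    by (cases "i = 0"; cases "i = 1"; cases "i = 4") (auto intro!: continuous_intros P)
  show "isCont (YY i) s" unfolding YY_def[abs_def]
    by (cases "i = 0"; cases "i = 1"; cases "i = 2"; cases "i = 3") (auto intro!: continuous_intros P)
qed

lemma closed_lv: "closed {s. lv i s}"
proof -
  have "{s. lv i s} = (if i = 4 then UNIV else {lo i..Z + 1})" by (auto simp: lv_def)
  then show ?thesis by simp
qed

lemma YY_bounds:
  assumes "i < 4" "lv i s"
  shows "- 4 \<le> YY i s" "YY i s \<le> 6"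
proof -
  have "- 4 \<le> YY i s \<and> YY i s \<le> 6"
  proof (cases "i = 3")
    case True
    define u where "u = max 0 (s - Z)"
    define v where "v = max 0 (- Z - s)"
    have "0 \<le> u" "u \<le> 1" "0 \<le> v" "v \<le> 7" "u = 0 \<or> v = 0"
      using assms True h12 by (auto simp: lv_def lo_def u_def v_def)
    moreover have "YY i s = 6 - 4 * u - 8 / 7 * v" using True by (simp add: YY_def u_def v_def)
    ultimately show ?thesis by linarith
  next
    case False
    then show ?thesis using assms P_bounds(2)[of "\<bar>s\<bar> - h"] h12 by (auto simp: YY_def lv_def lo_def abs_le_iff max_def)
  qed
  then show "- 4 \<le> YY i s" "YY i s \<le> 6" by auto
qed

text \<open>Away from the caps the strands other than the moving one keep the second coordinates -2,
  2 and 6, so the moving strand and the axis cause all crossings. The complete list is used twice,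
  for the local pictures and for the injectivity of the parametrization.\<close>

lemma coincidence:
  assumes "i < j" "j < 5" "lv i s" "lv j s" "YY i s = YY j s"
  shows "(\<exists>m<J. \<bar>s\<bar> = h + real m + 1 / 2 \<and> m mod 3 \<noteq> 1 \<and> {i, j} = {bk m, fr m} \<and> XX (bk m) s < XX (fr m) s) \<or>
    (s = Z + 1 \<and> ((i, j) = (0, 1) \<or> (i, j) = (2, 3))) \<or> (s = - Z - 1 \<and> (i, j) = (1, 2)) \<or> (s = - Z - 7 \<and> (i, j) = (0, 3)) \<or>
    (j = 4 \<and> s = (if i = 0 then - 2 else if i = 1 then 0 else if i = 2 then 2 else 6))"
proof -
  have event: "\<exists>m<J. \<bar>s\<bar> = h + real m + 1 / 2 \<and> m mod 3 \<noteq> 1 \<and> {i, j} = {bk m, fr m} \<and> XX (bk m) s < XX (fr m) s"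
    if "i = 0 \<and> j = 1 \<and> PY (\<bar>s\<bar> - h) = - 2 \<or> i = 1 \<and> j = 2 \<and> PY (\<bar>s\<bar> - h) = 2"
  proof -
    have P2: "\<bar>PY (\<bar>s\<bar> - h)\<bar> = 2" using that by auto
    obtain m where m: "m < J" "\<bar>s\<bar> - h = real m + 1 / 2" "m mod 3 \<noteq> 1" "PY (\<bar>s\<bar> - h) = 2 * sg m"
      "PX (\<bar>s\<bar> - h) = (if bk m = 1 then - 1 else 1)"
      by (rule crossing_time[OF P2])
    have sp: "max 0 (h - \<bar>s\<bar>) = 0" using m(2) by simp
    have "sg m = - 1 \<longleftrightarrow> i = 0" using m(4) that sg_cases[of m] by auto
    then have "{i, j} = {bk m, fr m} \<and> XX (bk m) s < XX (fr m) s"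
      using that m(5) sp sg_cases[of m] by (auto simp: bk_def fr_def XX_def)
    then show ?thesis using m by (intro exI[of _ m]) auto
  qed
  have out: "PY (\<bar>s\<bar> - h) = 0" if "Z \<le> \<bar>s\<bar> \<or> \<bar>s\<bar> \<le> h" using P_outside[of "\<bar>s\<bar> - h"] that by auto
  have Pb: "- 4 \<le> PY (\<bar>s\<bar> - h)" "PY (\<bar>s\<bar> - h) \<le> 4" using P_bounds(2)[of "\<bar>s\<bar> - h"] by (auto simp: abs_le_iff)
  consider "i = 0" "j = 1" | "i = 0" "j = 2" | "i = 0" "j = 3" | "i = 1" "j = 2" | "i = 1" "j = 3" | "i = 2" "j = 3" | "j = 4" "i < 4"
    using assms(1,2) by linarith
  then show ?thesis
  proof cases
    case 1
    show ?thesis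
    proof (cases "s \<le> Z")
      case True
      then have "PY (\<bar>s\<bar> - h) = - 2" using assms(5) 1 by (simp add: YY_def)
      then show ?thesis using event 1 by simp
    next
      case False
      then show ?thesis using assms 1 out by (simp add: YY_def lv_def lo_def)
    qed
  next
    case 4
    show ?thesis
    proof (cases "- Z \<le> s")
      case True
      then have "PY (\<bar>s\<bar> - h) = 2" using assms(5) 4 by (simp add: YY_def)
      then show ?thesis using event 4 by simp
    next
      case False
      then show ?thesis using assms 4 out h12 by (simp add: YY_def lv_def lo_def)
    qed
  next
    case 6
    define u where "u = max 0 (s - Z)"
    define v where "v = max 0 (- Z - s)"
    have "0 \<le> u" "u \<le> 1" "0 \<le> v" "v \<le> 1" "u = 0 \<or> v = 0"
      using assms 6 h12 by (auto simp: lv_def lo_def u_def v_def)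
    moreover have "2 - 2 * v = 6 - 4 * u - 8 / 7 * v" using assms(5) 6 by (simp add: YY_def u_def v_def)
    ultimately have "u = 1" by linarith
    then have "s = Z + 1" by (simp add: u_def max_def split: if_splits)
    then show ?thesis using 6 by simp
  next
    case 7
    then have eq: "YY i s = s" using assms by (simp add: YY_def)
    then have "- 4 \<le> s" "s \<le> 6" using YY_bounds[of i s] 7 assms by auto
    then have s: "\<bar>s\<bar> \<le> h" "max 0 (s - Z) = 0" "max 0 (- Z - s) = 0" using h12 by auto
    show ?thesis using eq s out 7 unfolding YY_def by (auto split: if_splits)
  qed (use assms Pb h12 out in \<open>auto simp: YY_def lv_def lo_def max_def split: if_splits\<close>)
qed

text \<open>The number of edges whose midpoint has been passed on the way outwards. At the midpoint
  itself the edge already counts, so a crossing is labelled as on its outer side, in agreement with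
  the form of \<open>step_back\<close> below.\<close>

definition lev :: "real \<Rightarrow> nat" where "lev s = min J (nat \<lfloor>\<bar>s\<bar> - h + 1 / 2\<rfloor>)"

lemma lev_event:
  assumes "m < J" "\<bar>s0\<bar> = h + real m + 1 / 2"
  shows "\<forall>\<^sub>F s in nhds s0. lev s = (if \<bar>s0\<bar> \<le> \<bar>s\<bar> then Suc m else m) \<and> \<bar>(\<bar>s\<bar> - h) - (real m + 1 / 2)\<bar> \<le> 1 / 2 \<and> s * s0 > 0"
proof -
  have "lev s = (if \<bar>s0\<bar> \<le> \<bar>s\<bar> then Suc m else m) \<and> \<bar>(\<bar>s\<bar> - h) - (real m + 1 / 2)\<bar> \<le> 1 / 2 \<and> s * s0 > 0" if "dist s s0 < 1 / 2" for s
  proof -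
    have d: "\<bar>\<bar>s\<bar> - \<bar>s0\<bar>\<bar> < 1 / 2" using that unfolding dist_real_def by linarith
    have "s > 0 \<and> s0 > 0 \<or> s < 0 \<and> s0 < 0" using that assms(2) h12 unfolding dist_real_def by linarith
    then have "s * s0 > 0" by (auto simp: zero_less_mult_iff)
    moreover have "\<lfloor>\<bar>s\<bar> - h + 1 / 2\<rfloor> = (if \<bar>s0\<bar> \<le> \<bar>s\<bar> then int (Suc m) else int m)"
      using d assms(2) by (auto intro!: floor_unique)
    moreover have "\<bar>(\<bar>s\<bar> - h) - (real m + 1 / 2)\<bar> \<le> 1 / 2" using d assms(2) by linarith
    ultimately show ?thesis using assms(1) by (auto simp: lev_def)
  qed
  then show ?thesis unfolding eventually_nhds_metric by (intro exI[of _ "1 / 2"]) simp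
qed

lemma lev_const:
  assumes "\<And>m. m < J \<Longrightarrow> \<bar>s0\<bar> \<noteq> h + real m + 1 / 2"
  shows "\<forall>\<^sub>F s in nhds s0. lev s = lev s0"
proof -
  define a where "a = \<bar>s0\<bar> - h + 1 / 2"
  have cont: "((\<lambda>s. \<bar>s\<bar> - h + 1 / 2) \<longlongrightarrow> a) (nhds s0)"
    unfolding a_def by (intro tendsto_intros filterlim_ident)
  have ev: "\<forall>\<^sub>F s in nhds s0. \<bar>s\<bar> - h + 1 / 2 \<in> U" if "open U" "a \<in> U" for U
    using topological_tendstoD[OF cont that] .
  consider "a < 1" | "h < a" | "1 \<le> a" "a \<le> h" by linarith
  then show ?thesis
  proof cases
    case 1
    then have "\<forall>\<^sub>F s in nhds s0. \<bar>s\<bar> - h + 1 / 2 \<in> {..<1}" by (intro ev) auto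
    then show ?thesis
    proof eventually_elim
      case (elim s)
      then have "\<lfloor>\<bar>s\<bar> - h + 1 / 2\<rfloor> \<le> 0" by (simp add: floor_le_iff)
      moreover have "\<lfloor>a\<rfloor> \<le> 0" using 1 by (simp add: floor_le_iff)
      ultimately show ?case by (simp add: lev_def a_def)
    qed
  next
    case 2
    then have "\<forall>\<^sub>F s in nhds s0. \<bar>s\<bar> - h + 1 / 2 \<in> {h<..}" by (intro ev) auto
    then show ?thesis
    proof eventually_elim
      case (elim s)
      have "J \<le> nat \<lfloor>b\<rfloor>" if "h < b" for b using that by (simp add: le_nat_floor)
      then show ?case using elim 2 by (simp add: lev_def a_def)
    qed
  next
    case 3
    have "a \<noteq> of_int \<lfloor>a\<rfloor>"
    proof
      assume eq: "a = of_int \<lfloor>a\<rfloor>"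
      define m where "m = nat (\<lfloor>a\<rfloor> - 1)"
      have "1 \<le> \<lfloor>a\<rfloor>" using 3 by simp
      then have "a = real m + 1" using eq unfolding m_def by simp
      then show False using assms[of m] 3 unfolding a_def by auto
    qed
    then have "of_int \<lfloor>a\<rfloor> < a" "a < of_int \<lfloor>a\<rfloor> + 1" using floor_correct[of a] by linarith+
    then have "\<forall>\<^sub>F s in nhds s0. \<bar>s\<bar> - h + 1 / 2 \<in> {of_int \<lfloor>a\<rfloor><..<of_int \<lfloor>a\<rfloor> + 1}" by (intro ev) auto
    then show ?thesis
    proof eventually_elim
      case (elim s)
      then have "\<lfloor>\<bar>s\<bar> - h + 1 / 2\<rfloor> = \<lfloor>a\<rfloor>" by (intro floor_unique) auto
      then show ?case by (simp add: lev_def a_def)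
    qed
  qed
qed

end

section \<open>Conditions under which labels and section fit together\<close>

section \<open>Labelling the strands\<close>

text \<open>\<open>LU\<close> and \<open>LL\<close> label the strands 0, 1, 2 in the upper and lower
  half after \<open>m\<close> edges, \<open>CU\<close> and \<open>CL\<close> are the section there;
  \<open>w\<close> and \<open>C3\<close> belong to strand 3, \<open>t\<close> to the axis. Going
  from \<open>Suc m\<close> to \<open>m\<close> means moving inwards, and the rear strand is the one
  that changes. Among the caps the top one of strands 0 and 1 carries no condition on the section:
  this is where it may jump.\<close>

locale coloring = strands J for J +
  fixes LU LL CU CL :: "nat \<Rightarrow> nat \<Rightarrow> 'g::group_add" and w t C3 :: 'g and hs :: "nat \<Rightarrow> 'g \<Rightarrow> 'g set"
  assumes invol: "LU i m + LU i m = 0" "LL i m + LL i m = 0" "w + w = 0"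
    and step_same: "m < J \<Longrightarrow> m mod 3 = 1 \<or> i \<noteq> bk m \<Longrightarrow> LU i (Suc m) = LU i m \<and> LL i (Suc m) = LL i m \<and> CU i (Suc m) = CU i m \<and> CL i (Suc m) = CL i m"
    and step_back: "m < J \<Longrightarrow> m mod 3 \<noteq> 1 \<Longrightarrow>
        LU (bk m) m = - LU (fr m) m + LU (bk m) (Suc m) + LU (fr m) m \<and> LL (bk m) m = - LL (fr m) m + LL (bk m) (Suc m) + LL (fr m) m \<and>
        CU (bk m) m = CU (bk m) (Suc m) + LU (bk m) (Suc m) + LU (fr m) m \<and> CL (bk m) m = CL (bk m) (Suc m) + LL (bk m) (Suc m) + LL (fr m) m"
    and caps: "LU 0 J = LU 1 J" "LU 2 J = w" "LL 1 J = LL 2 J" "LL 0 J = w" "CU 2 J = C3" "CL 0 J = C3" "CL 1 J = CL 2 J"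
    and middle: "LU 2 0 = w" "LL 2 0 = w" "CU 2 0 = CL 2 0"
      "i \<in> {0, 1} \<Longrightarrow> LL i 0 = - t + LU i 0 + t \<and> CL i 0 = CU i 0 + LU i 0 + t"
    and hs: "0 \<in> hs i a" "a \<in> hs i a" "b \<in> hs i a \<Longrightarrow> c \<in> hs i a \<Longrightarrow> b + c \<in> hs i a" "b \<in> hs i a \<Longrightarrow> - b \<in> hs i a"
    and hs_conj: "hs i (- c + a + c) = (\<lambda>h. - c + h + c) ` hs i a"
    and hs_invol: "i < 4 \<Longrightarrow> a + a = 0 \<Longrightarrow> hs i a = {0, a}"
begin

text \<open>The height at which strand 0 or 1 passes behind the axis and changes from lower to upper
  labels. For strand 2, which stays in front, upper and lower values agree and 0 is an arbitrary
  choice.\<close>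

definition thr :: "nat \<Rightarrow> real" where "thr i = (if i = 0 then - 2 else 0)"

text \<open>The axis passes behind strand 2 at height 2 and behind strand 3 at height 6. Both have
  label \<open>w\<close> in the middle; as \<open>w\<close> is an involution, the second passage
  undoes the first.\<close>

definition lab :: "nat \<Rightarrow> real \<Rightarrow> 'g" where
  "lab i s = (if i = 3 then w else if i = 4 then (if s \<le> 2 then t else if s \<le> 6 then - w + t + w else t)
     else if thr i \<le> s then LU i (lev s) else LL i (lev s))"

definition cs :: "nat \<Rightarrow> real \<Rightarrow> 'g" where
  "cs i s = (if i = 3 then C3 else if i = 4 then (if s \<le> 2 then 0 else if s \<le> 6 then t + w else t + w + (- w + t + w) + w)
     else if thr i \<le> s then CU i (lev s) else CL i (lev s))"

definition interior :: "nat \<Rightarrow> real \<Rightarrow> bool" where "interior i s \<longleftrightarrow> i = 4 \<or> (lo i < s \<and> s < Z + 1)"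

lemma interior_live: "interior i s0 \<Longrightarrow> \<forall>\<^sub>F s in nhds s0. lv i s"
  using eventually_nhds_in_open[of "{lo i<..<Z + 1}" s0]
  by (cases "i = 4") (auto simp: interior_def lv_def elim!: eventually_mono)

lemma eventually_lt: "(a::real) < b \<Longrightarrow> \<forall>\<^sub>F s in nhds a. s < b" "b < a \<Longrightarrow> \<forall>\<^sub>F s in nhds a. b < s"
  using eventually_nhds_in_open[of "{..<b}" a] eventually_nhds_in_open[of "{b<..}" a] by auto

lemma lev_0: "\<bar>s\<bar> < h + 1 / 2 \<Longrightarrow> lev s = 0"
proof -
  assume "\<bar>s\<bar> < h + 1 / 2"
  then have "\<lfloor>\<bar>s\<bar> - h + 1 / 2\<rfloor> \<le> 0" by (simp add: floor_le_iff)
  then show ?thesis by (simp add: lev_def)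
qed

lemma lev_J: "Z \<le> \<bar>s\<bar> \<Longrightarrow> lev s = J"
proof -
  assume "Z \<le> \<bar>s\<bar>"
  then have "J \<le> nat \<lfloor>\<bar>s\<bar> - h + 1 / 2\<rfloor>" by (intro le_nat_floor) simp
  then show ?thesis by (simp add: lev_def)
qed

lemma lev_near: "\<bar>s0\<bar> < h \<Longrightarrow> \<forall>\<^sub>F s in nhds s0. lev s = 0 \<and> \<bar>s\<bar> < h"
proof -
  assume "\<bar>s0\<bar> < h"
  then have "\<forall>\<^sub>F s in nhds s0. s \<in> {- h<..<h}" by (intro eventually_nhds_in_open) auto
  then show ?thesis by eventually_elim (simp add: lev_0 abs_less_iff)
qed

lemma regular:
  assumes "i < 5" "interior i s0" "i = 0 \<longrightarrow> s0 \<noteq> - 2" "i = 1 \<longrightarrow> s0 \<noteq> 0" "i = 4 \<longrightarrow> s0 \<noteq> 2 \<and> s0 \<noteq> 6"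
    and nobk: "\<And>m. m < J \<Longrightarrow> \<bar>s0\<bar> = h + real m + 1 / 2 \<Longrightarrow> m mod 3 = 1 \<or> i \<noteq> bk m"
  shows "\<forall>\<^sub>F s in nhds s0. lv i s \<and> lab i s = lab i s0 \<and> cs i s = cs i s0"
proof -
  note live = interior_live[OF assms(2)]
  consider "i = 3" | "i = 4" | "i < 3" using assms(1) by linarith
  then show ?thesis
  proof cases
    case 1
    then show ?thesis using live by (auto simp: lab_def cs_def elim: eventually_mono)
  next
    case 2
    then consider "s0 < 2" | "2 < s0" "s0 < 6" | "6 < s0" using assms(5) by linarith
    then show ?thesis
    proof cases
      case 1
      show ?thesis using eventually_lt(1)[OF 1] by eventually_elim (use 1 2 in \<open>auto simp: lab_def cs_def lv_def\<close>)
    next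
      case 2
      show ?thesis using eventually_lt(1)[OF 2(2)] eventually_lt(2)[OF 2(1)]
        by eventually_elim (use 2 \<open>i = 4\<close> in \<open>auto simp: lab_def cs_def lv_def\<close>)
    next
      case 3
      show ?thesis using eventually_lt(2)[OF 3] by eventually_elim (use 2 3 in \<open>auto simp: lab_def cs_def lv_def\<close>)
    qed
  next
    case 3
    have lev_ok: "\<forall>\<^sub>F s in nhds s0. LU i (lev s) = LU i (lev s0) \<and> LL i (lev s) = LL i (lev s0) \<and> CU i (lev s) = CU i (lev s0) \<and> CL i (lev s) = CL i (lev s0)"
    proof (cases "\<exists>m<J. \<bar>s0\<bar> = h + real m + 1 / 2")
      case True
      then obtain m where m: "m < J" "\<bar>s0\<bar> = h + real m + 1 / 2" by blast
      have "lev s0 = Suc m" using eventually_nhds_x_imp_x[OF lev_event[OF m]] by simp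
      moreover note step_same[OF m(1), of i] nobk[OF m]
      ultimately show ?thesis using lev_event[OF m] by (auto elim!: eventually_mono)
    next
      case False
      then have "\<forall>\<^sub>F s in nhds s0. lev s = lev s0" by (intro lev_const) auto
      then show ?thesis by eventually_elim simp
    qed
    show ?thesis
    proof (cases "s0 = thr i")
      case False
      then have "\<forall>\<^sub>F s in nhds s0. thr i \<le> s \<longleftrightarrow> thr i \<le> s0"
        using eventually_lt(1)[of s0 "thr i"] eventually_lt(2)[of "thr i" s0] by (cases "s0 < thr i") (auto elim!: eventually_mono)
      with live lev_ok show ?thesis by eventually_elim (use 3 in \<open>simp add: lab_def cs_def\<close>)
    next
      case True
      then have i: "i = 2" "s0 = 0" using assms(3,4) 3 by (auto simp: thr_def split: if_splits)
      then have "\<bar>s0\<bar> < h" using h12 by simp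
      from live lev_near[OF this] show ?thesis
        by eventually_elim (use i middle in \<open>simp add: lab_def cs_def thr_def lev_0\<close>)
    qed
  qed
qed

lemma crossing:
  assumes m: "m < J" "\<bar>s0\<bar> = h + real m + 1 / 2" "m mod 3 \<noteq> 1"
  shows "\<forall>\<^sub>F s in nhds s0. lv (fr m) s \<and> lv (bk m) s \<and> lab (fr m) s = lab (fr m) s0 \<and> cs (fr m) s = cs (fr m) s0 \<and>
    lab (bk m) s = (if YY (bk m) s \<le> YY (fr m) s then lab (bk m) s0 else - lab (fr m) s0 + lab (bk m) s0 + lab (fr m) s0) \<and>
    cs (bk m) s = (if YY (bk m) s \<le> YY (fr m) s then cs (bk m) s0 else cs (bk m) s0 + lab (bk m) s0 + lab (fr m) s0)"
proof -
  have mJ: "real m + 1 \<le> h" using m(1) by linarith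
  have idx: "bk m < 3" "fr m < 3" "bk m \<noteq> fr m" using sg_cases[of m] by (auto simp: bk_def fr_def)
  have lev0: "lev s0 = Suc m" using eventually_nhds_x_imp_x[OF lev_event[OF m(1,2)]] by simp
  have "\<forall>\<^sub>F s in nhds s0. interior 1 s \<and> interior 2 s \<and> interior 0 s"
  proof -
    have "s0 \<in> {- Z - 1<..<Z + 1}" using m(2) mJ by (simp, linarith)
    then have "\<forall>\<^sub>F s in nhds s0. s \<in> {- Z - 1<..<Z + 1}" by (intro eventually_nhds_in_open) auto
    then show ?thesis by eventually_elim (simp add: interior_def lo_def)
  qed
  with lev_event[OF m(1,2)] show ?thesis
  proof eventually_elim
    case (elim s)
    have live: "lv (fr m) s" "lv (bk m) s" using elim by (auto simp: bk_def fr_def lv_def interior_def)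
    have sgn: "thr i \<le> s \<longleftrightarrow> thr i \<le> s0" for i
    proof -
      have "s > 0 \<and> s0 > 0 \<or> s < 0 \<and> s0 < 0" using elim by (auto simp: zero_less_mult_iff)
      moreover have "\<bar>s\<bar> \<ge> h" "\<bar>s0\<bar> \<ge> h" using elim(1) m(2) by linarith+
      ultimately show ?thesis using h12 by (auto simp: thr_def)
    qed
    have big: "h \<le> \<bar>s\<bar>" "\<bar>s\<bar> \<le> Z" using elim(1) m(2) mJ by linarith+
    have "max 0 (s - Z) = 0" "max 0 (- Z - s) = 0" using big(2) by auto
    then have YY': "YY 0 s = - 2" "YY 2 s = 2" "YY 1 s = PY (\<bar>s\<bar> - h)" by (simp_all add: YY_def)
    have "YY (bk m) s \<le> YY (fr m) s \<longleftrightarrow> (if bk m = 1 then PY (\<bar>s\<bar> - h) \<le> 2 * sg m else 2 * sg m \<le> PY (\<bar>s\<bar> - h))"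
      using YY' sg_cases[of m] by (auto simp: bk_def fr_def)
    also have "\<dots> \<longleftrightarrow> \<bar>s0\<bar> \<le> \<bar>s\<bar>"
      using crossing_order[OF m(1,3), of "\<bar>s\<bar> - h"] elim m(2) by auto
    finally have ord: "YY (bk m) s \<le> YY (fr m) s \<longleftrightarrow> \<bar>s0\<bar> \<le> \<bar>s\<bar>" .
    have lev: "lev s = (if \<bar>s0\<bar> \<le> \<bar>s\<bar> then Suc m else m)" using elim by blast
    note same = step_same[OF m(1), of "fr m"] and bkst = step_back[OF m(1,3)]
    have L: "lab i s = (if thr i \<le> s0 then LU i (lev s) else LL i (lev s))" "cs i s = (if thr i \<le> s0 then CU i (lev s) else CL i (lev s))"
      "lab i s0 = (if thr i \<le> s0 then LU i (Suc m) else LL i (Suc m))" "cs i s0 = (if thr i \<le> s0 then CU i (Suc m) else CL i (Suc m))" if "i < 3" for i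
      using that sgn[of i] lev0 by (auto simp: lab_def cs_def)
    have th: "thr (bk m) \<le> s0 \<longleftrightarrow> thr (fr m) \<le> s0"
      using m(2) h12 by (simp add: thr_def) linarith
    show ?case
    proof (cases "\<bar>s0\<bar> \<le> \<bar>s\<bar>")
      case True
      then have "lev s = Suc m" using lev by simp
      then show ?thesis unfolding ord using True live by (simp add: L[OF idx(1)] L[OF idx(2)])
    next
      case False
      then have l: "lev s = m" using lev by simp
      have f: "LU (fr m) (Suc m) = LU (fr m) m" "LL (fr m) (Suc m) = LL (fr m) m" "CU (fr m) (Suc m) = CU (fr m) m" "CL (fr m) (Suc m) = CL (fr m) m"
        using same idx(3) by auto
      show ?thesis unfolding ord L[OF idx(1)] L[OF idx(2)] l th f using False live bkst by (cases "thr (fr m) \<le> s0") simp_all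
    qed
  qed
qed

text \<open>The axis is in front of strands 0 and 1 and behind strands 2 and 3, hence two statements
  with the roles exchanged.\<close>

lemma crossing_axis:
  shows "i \<in> {0, 1} \<Longrightarrow> s0 = thr i \<Longrightarrow> \<forall>\<^sub>F s in nhds s0. lv 4 s \<and> lv i s \<and> lab 4 s = lab 4 s0 \<and> cs 4 s = cs 4 s0 \<and>
    lab i s = (if YY i s \<le> YY 4 s then lab i s0 else - lab 4 s0 + lab i s0 + lab 4 s0) \<and>
    cs i s = (if YY i s \<le> YY 4 s then cs i s0 else cs i s0 + lab i s0 + lab 4 s0)" (is "_ \<Longrightarrow> _ \<Longrightarrow> ?A")
    and "i = 2 \<and> s0 = 2 \<or> i = 3 \<and> s0 = 6 \<Longrightarrow> \<forall>\<^sub>F s in nhds s0. lv i s \<and> lv 4 s \<and> lab i s = lab i s0 \<and> cs i s = cs i s0 \<and>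
    lab 4 s = (if YY 4 s \<le> YY i s then lab 4 s0 else - lab i s0 + lab 4 s0 + lab i s0) \<and>
    cs 4 s = (if YY 4 s \<le> YY i s then cs 4 s0 else cs 4 s0 + lab 4 s0 + lab i s0)" (is "_ \<Longrightarrow> ?B")
proof -
  have YYs: "YY 0 s = - 2" "YY 1 s = 0" "YY 2 s = 2" "YY 3 s = 6" "YY 4 s = s" if "\<bar>s\<bar> < h" for s
    using that P_outside[of "\<bar>s\<bar> - h"] by (auto simp: YY_def)
  have lvs: "lv i s" if "\<bar>s\<bar> < h" for s i using that h12 by (auto simp: lv_def lo_def)
  have ww: "- w = w" using invol(3) by (simp add: eq_neg_iff_add_eq_0[symmetric])
  show ?A if i: "i \<in> {0, 1}" "s0 = thr i"
  proof -
    have s0: "\<bar>s0\<bar> < h" "s0 < 2" using i h12 by (auto simp: thr_def)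
    show ?thesis using lev_near[OF s0(1)] eventually_lt(1)[OF s0(2)]
    proof eventually_elim
      case (elim s)
      have "YY i s = thr i" "YY 4 s = s" using YYs[of s] elim i by (auto simp: thr_def)
      then show ?case using elim lvs s0 i middle(4)[OF i(1)] lev_0[of s0] by (auto simp: lab_def cs_def)
    qed
  qed
  show ?B if i: "i = 2 \<and> s0 = 2 \<or> i = 3 \<and> s0 = 6"
  proof -
    have s0: "\<bar>s0\<bar> < h" "s0 > 0" using i h12 by auto
    have "\<forall>\<^sub>F s in nhds s0. \<bar>s - s0\<bar> < 1" unfolding eventually_nhds_metric by (intro exI[of _ 1]) (simp add: dist_real_def)
    with lev_near[OF s0(1)] show ?thesis
    proof eventually_elim
      case (elim s)
      have l0: "lev s = 0" "lev s0 = 0" using elim(1) lev_0[of s0] s0 by simp_all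
      have sp: "s0 - 1 < s" "s < s0 + 1" using elim(2) by linarith+
      have "YY i s = s0" "YY 4 s = s" using YYs[of s] elim(1) i by (elim disjE; simp)+
      moreover have "lab i s = w" "lab i s0 = w" "cs i s = cs i s0"
        using i middle(1-3) l0 sp by (elim disjE; simp add: lab_def cs_def thr_def)+
      moreover have "lab 4 s = (if s \<le> s0 then lab 4 s0 else - w + lab 4 s0 + w)"
        using i sp ww invol(3) by (elim disjE; simp add: lab_def add.assoc; simp flip: add.assoc)
      moreover have "cs 4 s = (if s \<le> s0 then cs 4 s0 else cs 4 s0 + lab 4 s0 + w)"
        using i sp by (elim disjE; simp add: lab_def cs_def)
      ultimately show ?case using elim lvs by simp
    qed
  qed
qed

lemma event_meet:
  assumes m: "m < J" "\<bar>s0\<bar> = h + real m + 1 / 2" "m mod 3 \<noteq> 1"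
  shows "YY (bk m) s0 = YY (fr m) s0" "lv (bk m) s0" "lv (fr m) s0" "bk m < 3" "fr m < 3" "bk m \<noteq> fr m"
proof -
  have mJ: "real m + 1 \<le> h" using m(1) by linarith
  show idx: "bk m < 3" "fr m < 3" "bk m \<noteq> fr m" using sg_cases[of m] by (auto simp: bk_def fr_def)
  have big: "\<bar>s0\<bar> \<le> Z" using m(2) mJ by linarith
  have mx: "max 0 (s0 - Z) = 0" "max 0 (- Z - s0) = 0" using big by auto
  have t: "\<bar>s0\<bar> - h = real m + 1 / 2" using m(2) by simp
  have "PY (real m + 1 / 2) = 2 * sg m"
    using P_segment(1,3)[OF m(1), of "real m + 1 / 2"] m(3) by (cases "m mod 3 = 0") (auto simp: not_less)
  then show "YY (bk m) s0 = YY (fr m) s0" using t mx sg_cases[of m] by (auto simp: bk_def fr_def YY_def)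
  show "lv (bk m) s0" "lv (fr m) s0" using big h12 by (auto simp: lv_def lo_def abs_le_iff)
qed

text \<open>A strand can fail to be locally constant only at one of its ends, as the rear strand of
  a crossing, or at the axis; every time another strand is met in the projection.\<close>

lemma single:
  assumes "i < 5" "lv i s0"
  shows "(\<forall>\<^sub>F s in nhds s0. lv i s \<and> lab i s = lab i s0 \<and> cs i s = cs i s0) \<or> (\<exists>j<5. j \<noteq> i \<and> lv j s0 \<and> YY j s0 = YY i s0)"
proof -
  have P0: "PY (\<bar>s0\<bar> - h) = 0" if "Z \<le> \<bar>s0\<bar> \<or> \<bar>s0\<bar> \<le> h" using P_outside[of "\<bar>s0\<bar> - h"] that by auto
  have i5: "i = 0 \<or> i = 1 \<or> i = 2 \<or> i = 3 \<or> i = 4" using assms(1) by linarith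
  consider "i \<noteq> 4" "s0 = Z + 1" | "i \<noteq> 4" "s0 = lo i" | "i = 0 \<and> s0 = - 2 \<or> i = 1 \<and> s0 = 0" | "i = 4" "s0 = 2 \<or> s0 = 6"
    | m where "m < J" "\<bar>s0\<bar> = h + real m + 1 / 2" "m mod 3 \<noteq> 1" "i = bk m"
    | "interior i s0" "i = 0 \<longrightarrow> s0 \<noteq> - 2" "i = 1 \<longrightarrow> s0 \<noteq> 0" "i = 4 \<longrightarrow> s0 \<noteq> 2 \<and> s0 \<noteq> 6" "\<And>m. m < J \<Longrightarrow> \<bar>s0\<bar> = h + real m + 1 / 2 \<Longrightarrow> m mod 3 = 1 \<or> i \<noteq> bk m"
    using assms(2) by (fastforce simp: interior_def lv_def)
  then show ?thesis
  proof cases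
    case 1
    have "\<exists>j<5. j \<noteq> i \<and> lv j s0 \<and> YY j s0 = YY i s0"
      by (rule exI[of _ "if i = 0 then 1 else if i = 1 then 0 else if i = 2 then 3 else 2"])
        (use 1 i5 P0 h12 in \<open>auto simp: lv_def lo_def YY_def\<close>)
    then show ?thesis ..
  next
    case 2
    have "\<exists>j<5. j \<noteq> i \<and> lv j s0 \<and> YY j s0 = YY i s0"
      by (rule exI[of _ "if i = 0 then 3 else if i = 3 then 0 else if i = 1 then 2 else 1"])
        (use 2 i5 P0 h12 in \<open>auto simp: lv_def lo_def YY_def\<close>)
    then show ?thesis ..
  next
    case 3
    then have "\<exists>j<5. j \<noteq> i \<and> lv j s0 \<and> YY j s0 = YY i s0"
      by (intro exI[of _ 4]) (use P0 h12 in \<open>auto simp: lv_def YY_def\<close>)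
    then show ?thesis ..
  next
    case 4
    have "\<exists>j<5. j \<noteq> i \<and> lv j s0 \<and> YY j s0 = YY i s0"
      by (rule exI[of _ "if s0 = 2 then 2 else 3"]) (use 4 h12 in \<open>auto simp: lv_def lo_def YY_def\<close>)
    then show ?thesis ..
  next
    case (5 m)
    have "\<exists>j<5. j \<noteq> i \<and> lv j s0 \<and> YY j s0 = YY i s0"
      by (rule exI[of _ "fr m"]) (use event_meet[OF 5(1-3)] 5(4) in auto)
    then show ?thesis ..
  next
    case 6
    then show ?thesis using regular[OF assms(1) 6] by blast
  qed
qed

text \<open>By the list of coincidences the pairs 0, 2 and 1, 3 never meet, and the axis meets
  different strands at different heights.\<close>

lemma no_triple:
  assumes "i < j" "j < k" "k < 5" "lv i s" "lv j s" "lv k s" "YY i s = YY j s" "YY j s = YY k s"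
  shows False
proof -
  have ev: "\<not> (\<exists>m<J. \<bar>s\<bar> = h + real m + 1 / 2 \<and> m mod 3 \<noteq> 1 \<and> {a, b} = {bk m, fr m} \<and> XX (bk m) s < XX (fr m) s)"
    if "(a, b) = (0, 2) \<or> (a, b) = (1, 3) \<or> (a, b) = (0, 3) \<or> b = 4" for a b
    using that by (auto simp: bk_def fr_def doubleton_eq_iff split: if_splits)
  have c02: "\<not> (lv 0 s \<and> lv 2 s \<and> YY 0 s = YY 2 s)" using coincidence[of 0 2 s] ev[of 0 2] by auto
  have c13: "\<not> (lv 1 s \<and> lv 3 s \<and> YY 1 s = YY 3 s)" using coincidence[of 1 3 s] ev[of 1 3] by auto
  have c4: "s = (if a = 0 then - 2 else if a = 1 then 0 else if a = 2 then 2 else 6)" if "a < 4" "lv a s" "YY a s = YY 4 s" for a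
    using coincidence[of a 4 s] ev[of a 4] that by (auto simp: lv_def)
  consider "(i, j, k) = (0, 1, 2)" | "(i, j, k) = (0, 1, 3)" | "(i, j, k) = (0, 2, 3)" | "(i, j, k) = (1, 2, 3)" | "k = 4"
    using assms(1-3) by fastforce
  then show ?thesis
  proof cases
    case 5
    then have "s = (if i = 0 then - 2 else if i = 1 then 0 else if i = 2 then 2 else 6)" "s = (if j = 0 then - 2 else if j = 1 then 0 else if j = 2 then 2 else 6)"
      using c4[of i] c4[of j] assms by simp_all
    then show ?thesis using assms(1,2) 5 by (auto split: if_splits)
  qed (use assms c02 c13 in auto)
qed

lemma apex_form:
  assumes ij: "(s0, i, j) = (Z + 1, 0, 1) \<or> (s0, i, j) = (Z + 1, 2, 3) \<or> (s0, i, j) = (- Z - 1, 1, 2) \<or> (s0, i, j) = (- Z - 7, 0, 3)"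
  shows "XX j s0 = XX i s0" "lv i s0" "lv j s0" "YY i s0 = YY j s0"
    "\<exists>a. a + a = 0 \<and> hs i a = {0, a} \<and> hs j a = {0, a} \<and>
      (\<forall>\<^sub>F s in nhds s0. (lv i s \<longrightarrow> lab i s = a \<and> cs i s = cs i s0) \<and> (lv j s \<longrightarrow> lab j s = a \<and> cs j s = cs j s0))"
    "(\<forall>\<^sub>F s in nhds s0. (lv i s \<longleftrightarrow> s \<le> s0) \<and> (lv j s \<longleftrightarrow> s \<le> s0)) \<or> (\<forall>\<^sub>F s in nhds s0. (lv i s \<longleftrightarrow> s0 \<le> s) \<and> (lv j s \<longleftrightarrow> s0 \<le> s))"
    "(i, j) \<noteq> (0, 1) \<longrightarrow> cs i s0 = cs j s0"
proof -
  have big: "Z + 1 \<le> \<bar>s0\<bar>" using ij h12 by auto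
  have P0: "PY (\<bar>s0\<bar> - h) = 0" "PX (\<bar>s0\<bar> - h) = 0" using P_outside[of "\<bar>s0\<bar> - h"] big by auto
  show "XX j s0 = XX i s0" "lv i s0" "lv j s0" "YY i s0 = YY j s0"
    using ij P0 big h12 by (auto simp: XX_def lv_def lo_def YY_def)
  have near: "\<forall>\<^sub>F s in nhds s0. \<bar>s - s0\<bar> < 1" unfolding eventually_nhds_metric by (intro exI[of _ 1]) (simp add: dist_real_def)
  have lJ: "lev s = J" "thr k \<le> s \<longleftrightarrow> 0 \<le> s0" if "\<bar>s - s0\<bar> < 1" for s k
  proof -
    show "lev s = J" using that big by (intro lev_J) linarith
    show "thr k \<le> s \<longleftrightarrow> 0 \<le> s0" using that big h12 unfolding thr_def by (cases "k = 0") (simp_all, linarith+)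
  qed
  have cst: "cs i s = cs i s0" "cs j s = cs j s0" "lab i s = lab i s0" "lab j s = lab j s0" if "\<bar>s - s0\<bar> < 1" for s
    using lJ[OF that] lJ[of s0] ij by (auto simp: cs_def lab_def)
  have labeq: "lab i s0 = lab j s0" "lab j s0 + lab j s0 = 0" and c: "(i, j) \<noteq> (0, 1) \<longrightarrow> cs i s0 = cs j s0"
    using lJ[of s0] ij caps invol h12 by (auto simp: lab_def cs_def)
  show "(i, j) \<noteq> (0, 1) \<longrightarrow> cs i s0 = cs j s0" by (fact c)
  have "i < 4" "j < 4" using ij by auto
  then have "hs i (lab j s0) = {0, lab j s0}" "hs j (lab j s0) = {0, lab j s0}" using hs_invol[OF _ labeq(2)] by simp_all
  moreover have "\<forall>\<^sub>F s in nhds s0. (lv i s \<longrightarrow> lab i s = lab j s0 \<and> cs i s = cs i s0) \<and> (lv j s \<longrightarrow> lab j s = lab j s0 \<and> cs j s = cs j s0)"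
    using near
  proof eventually_elim
    case (elim s)
    show ?case using cst[OF elim] labeq(1) by simp
  qed
  ultimately show "\<exists>a. a + a = 0 \<and> hs i a = {0, a} \<and> hs j a = {0, a} \<and>
      (\<forall>\<^sub>F s in nhds s0. (lv i s \<longrightarrow> lab i s = a \<and> cs i s = cs i s0) \<and> (lv j s \<longrightarrow> lab j s = a \<and> cs j s = cs j s0))"
    using labeq(2) by blast
  show "(\<forall>\<^sub>F s in nhds s0. (lv i s \<longleftrightarrow> s \<le> s0) \<and> (lv j s \<longleftrightarrow> s \<le> s0)) \<or> (\<forall>\<^sub>F s in nhds s0. (lv i s \<longleftrightarrow> s0 \<le> s) \<and> (lv j s \<longleftrightarrow> s0 \<le> s))"
  proof (cases "s0 = Z + 1")
    case True
    have "\<forall>\<^sub>F s in nhds s0. (lv i s \<longleftrightarrow> s \<le> s0) \<and> (lv j s \<longleftrightarrow> s \<le> s0)"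
      using near by eventually_elim (use True ij h12 in \<open>auto simp: lv_def lo_def\<close>)
    then show ?thesis ..
  next
    case False
    have "\<forall>\<^sub>F s in nhds s0. (lv i s \<longleftrightarrow> s0 \<le> s) \<and> (lv j s \<longleftrightarrow> s0 \<le> s)"
      using near by eventually_elim (use False ij h12 in \<open>auto simp: lv_def lo_def\<close>)
    then show ?thesis ..
  qed
qed

end

context coloring
begin

lemma full_form: "{i \<in> {..<5}. lv i s0 \<and> YY i s0 = y0} = {} \<or>
      (\<exists>i. {i \<in> {..<5}. lv i s0 \<and> YY i s0 = y0} = {i} \<and> (\<forall>\<^sub>F s in nhds s0. lv i s \<and> lab i s = lab i s0 \<and> cs i s = cs i s0)) \<or>
      (\<exists>i j. i \<noteq> j \<and> {i \<in> {..<5}. lv i s0 \<and> YY i s0 = y0} = {i, j} \<and> XX j s0 < XX i s0 \<and>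
        (\<forall>\<^sub>F s in nhds s0. lv i s \<and> lv j s \<and> lab i s = lab i s0 \<and> cs i s = cs i s0 \<and>
          lab j s = (if YY j s \<le> YY i s then lab j s0 else - lab i s0 + lab j s0 + lab i s0) \<and>
          cs j s = (if YY j s \<le> YY i s then cs j s0 else cs j s0 + lab j s0 + lab i s0))) \<or>
      (\<exists>i j a. i \<noteq> j \<and> {i \<in> {..<5}. lv i s0 \<and> YY i s0 = y0} = {i, j} \<and> XX j s0 = XX i s0 \<and> a + a = 0 \<and>
        hs i a = {0, a} \<and> hs j a = {0, a} \<and> ((s0, y0) \<noteq> (Z + 1, 0) \<longrightarrow> cs i s0 = cs j s0) \<and> lv i s0 \<and> lv j s0 \<and>
        (\<forall>\<^sub>F s in nhds s0. (lv i s \<longrightarrow> lab i s = a \<and> cs i s = cs i s0) \<and> (lv j s \<longrightarrow> lab j s = a \<and> cs j s = cs j s0)) \<and>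
        ((\<forall>\<^sub>F s in nhds s0. (lv i s \<longleftrightarrow> s \<le> s0) \<and> (lv j s \<longleftrightarrow> s \<le> s0)) \<or>
         (\<forall>\<^sub>F s in nhds s0. (lv i s \<longleftrightarrow> s0 \<le> s) \<and> (lv j s \<longleftrightarrow> s0 \<le> s))))"
proof -
  define S where "S = {i \<in> {..<5}. lv i s0 \<and> YY i s0 = y0}"
  have mem: "i < 5" "lv i s0" "YY i s0 = y0" if "i \<in> S" for i using that by (simp_all add: S_def)
  have triple: False if "i < j" "j < k" "i \<in> S" "j \<in> S" "k \<in> S" for i j k
    using no_triple[OF that(1,2) mem(1)[OF that(5)] mem(2)[OF that(3)] mem(2)[OF that(4)] mem(2)[OF that(5)]] mem(3)[OF that(3)] mem(3)[OF that(4)] mem(3)[OF that(5)] by simp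
  consider "S = {}" | i where "S = {i}" | i j where "i < j" "S = {i, j}"
  proof (cases "S = {} \<or> (\<exists>i. S = {i})")
    case False
    then obtain a where "a \<in> S" by blast
    moreover from this False obtain b where "b \<in> S" "b \<noteq> a" by blast
    ultimately obtain i j where ij: "i < j" "i \<in> S" "j \<in> S" using linorder_less_linear[of a b] by blast
    have "S \<subseteq> {i, j}"
    proof
      fix k assume k: "k \<in> S"
      show "k \<in> {i, j}"
        using triple[OF ij(1) _ ij(2,3) k] triple[OF _ ij(1) k ij(2,3)] triple[OF _ _ ij(2) k ij(3)] by (metis insert_iff linorder_less_linear)
    qed
    then have "S = {i, j}" using ij by blast
    with ij(1) show ?thesis by (rule that(3))
  qed (use that in blast)
  then show ?thesis
  proof cases
    case 1
    then show ?thesis unfolding S_def[symmetric] ..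
  next
    case (2 i)
    have i: "i < 5" "lv i s0" "YY i s0 = y0" using mem 2 by auto
    have "\<not> (\<exists>j<5. j \<noteq> i \<and> lv j s0 \<and> YY j s0 = YY i s0)"
    proof
      assume "\<exists>j<5. j \<noteq> i \<and> lv j s0 \<and> YY j s0 = YY i s0"
      then obtain j where "j < 5" "j \<noteq> i" "lv j s0" "YY j s0 = y0" using i(3) by auto
      then have "j \<in> S" by (simp add: S_def)
      then show False using 2 \<open>j \<noteq> i\<close> by simp
    qed
    with single[OF i(1,2)] 2 show ?thesis unfolding S_def[symmetric] by blast
  next
    case (3 i j)
    note ij = mem[of i] mem[of j]
    have i: "i < 5" "lv i s0" "YY i s0 = y0" and j: "j < 5" "lv j s0" "YY j s0 = y0" using mem 3 by auto
    have cross: "\<exists>i j. i \<noteq> j \<and> S = {i, j} \<and> XX j s0 < XX i s0 \<and>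
        (\<forall>\<^sub>F s in nhds s0. lv i s \<and> lv j s \<and> lab i s = lab i s0 \<and> cs i s = cs i s0 \<and>
          lab j s = (if YY j s \<le> YY i s then lab j s0 else - lab i s0 + lab j s0 + lab i s0) \<and>
          cs j s = (if YY j s \<le> YY i s then cs j s0 else cs j s0 + lab j s0 + lab i s0))"
      if "a \<noteq> b" "S = {b, a}" "XX b s0 < XX a s0"
       "\<forall>\<^sub>F s in nhds s0. lv a s \<and> lv b s \<and> lab a s = lab a s0 \<and> cs a s = cs a s0 \<and>
          lab b s = (if YY b s \<le> YY a s then lab b s0 else - lab a s0 + lab b s0 + lab a s0) \<and>
          cs b s = (if YY b s \<le> YY a s then cs b s0 else cs b s0 + lab b s0 + lab a s0)" for a b
      using that(1,3,4) that(2)[unfolded insert_commute[of b a "{}"]] by (intro exI[of _ a] exI[of _ b] conjI)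
    have apex: "\<exists>i j a. i \<noteq> j \<and> S = {i, j} \<and> XX j s0 = XX i s0 \<and> a + a = 0 \<and>
        hs i a = {0, a} \<and> hs j a = {0, a} \<and> ((s0, y0) \<noteq> (Z + 1, 0) \<longrightarrow> cs i s0 = cs j s0) \<and> lv i s0 \<and> lv j s0 \<and>
        (\<forall>\<^sub>F s in nhds s0. (lv i s \<longrightarrow> lab i s = a \<and> cs i s = cs i s0) \<and> (lv j s \<longrightarrow> lab j s = a \<and> cs j s = cs j s0)) \<and>
        ((\<forall>\<^sub>F s in nhds s0. (lv i s \<longleftrightarrow> s \<le> s0) \<and> (lv j s \<longleftrightarrow> s \<le> s0)) \<or>
         (\<forall>\<^sub>F s in nhds s0. (lv i s \<longleftrightarrow> s0 \<le> s) \<and> (lv j s \<longleftrightarrow> s0 \<le> s)))"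
      if A: "(s0, i, j) = (Z + 1, 0, 1) \<or> (s0, i, j) = (Z + 1, 2, 3) \<or> (s0, i, j) = (- Z - 1, 1, 2) \<or> (s0, i, j) = (- Z - 7, 0, 3)"
    proof -
      note F = apex_form[OF A]
      obtain a where a: "a + a = 0" "hs i a = {0, a}" "hs j a = {0, a}"
        "\<forall>\<^sub>F s in nhds s0. (lv i s \<longrightarrow> lab i s = a \<and> cs i s = cs i s0) \<and> (lv j s \<longrightarrow> lab j s = a \<and> cs j s = cs j s0)" using F(5) by blast
      have ne: "i \<noteq> j" using 3(1) by simp
      have T: "(s0, y0) \<noteq> (Z + 1, 0) \<longrightarrow> cs i s0 = cs j s0"
      proof (cases "(i, j) = (0, 1)")
        case True
        then have "s0 = Z + 1" using A by auto
        moreover have "y0 = 0" using i(3) True \<open>s0 = Z + 1\<close> by (simp add: YY_def)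
        ultimately show ?thesis by simp
      next
        case False
        then show ?thesis using F(7) by blast
      qed
      show ?thesis
        by (rule exI[of _ i], rule exI[of _ j], rule exI[of _ a], intro conjI ne 3(2) F(1) a T i(2) j(2) F(6))
    qed
    have X4: "XX 4 s0 = 0" "\<bar>s0\<bar> < h \<Longrightarrow> XX 0 s0 < 0" "\<bar>s0\<bar> < h \<Longrightarrow> XX 1 s0 < 0" "\<bar>s0\<bar> < h \<Longrightarrow> XX 2 s0 > 0" "\<bar>s0\<bar> < h \<Longrightarrow> XX 3 s0 > 0"
      using P_outside[of "\<bar>s0\<bar> - h"] by (auto simp: XX_def)
    note coin = coincidence[OF 3(1) j(1) i(2) j(2) trans[OF i(3) j(3)[symmetric]]]
    consider (ev) m where "m < J" "\<bar>s0\<bar> = h + real m + 1 / 2" "m mod 3 \<noteq> 1" "{i, j} = {bk m, fr m}" "XX (bk m) s0 < XX (fr m) s0"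
      | (ap) "(s0, i, j) = (Z + 1, 0, 1) \<or> (s0, i, j) = (Z + 1, 2, 3) \<or> (s0, i, j) = (- Z - 1, 1, 2) \<or> (s0, i, j) = (- Z - 7, 0, 3)"
      | (ax) "j = 4" "s0 = (if i = 0 then - 2 else if i = 1 then 0 else if i = 2 then 2 else 6)"
      using coin by (elim disjE exE conjE) auto
    then show ?thesis
    proof cases
      case (ev m)
      have "S = {bk m, fr m}" using 3(2) ev(4) by simp
      from cross[OF event_meet(6)[OF ev(1-3), symmetric] this ev(5) crossing[OF ev(1-3)]]
      show ?thesis unfolding S_def[symmetric] by (intro disjI2[OF disjI2[OF disjI1]])
    next
      case ap
      from apex[OF this] show ?thesis unfolding S_def[symmetric] by (intro disjI2[OF disjI2[OF disjI2]])
    next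
      case ax
      have s: "\<bar>s0\<bar> < h" using ax h12 by auto
      consider "i \<in> {0, 1}" "s0 = thr i" | "i = 2 \<and> s0 = 2 \<or> i = 3 \<and> s0 = 6"
        using ax 3(1) by (cases "i = 0"; cases "i = 1"; cases "i = 2") (auto simp: thr_def)
      then show ?thesis
      proof cases
        case 1
        have "XX i s0 < XX 4 s0" using 1(1) X4 s by auto
        moreover have "S = {i, 4}" "4 \<noteq> i" using 3 ax by auto
        ultimately show ?thesis unfolding S_def[symmetric] using cross[OF _ _ _ crossing_axis(1)[OF 1]] by (intro disjI2[OF disjI2[OF disjI1]])
      next
        case 2
        have "XX 4 s0 < XX i s0" using 2 X4 s by auto
        moreover have "S = {4, i}" "i \<noteq> 4" using 3 ax by auto
        ultimately show ?thesis unfolding S_def[symmetric] using cross[OF _ _ _ crossing_axis(2)[OF 2]] by (intro disjI2[OF disjI2[OF disjI1]])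
      qed
    qed
  qed
qed

end

sublocale coloring \<subseteq> movie_section "{..<5}" XX YY lv lab hs cs "(Z + 1, 0)"
  by standard (fact full_form | simp add: continuous_XX continuous_YY closed_lv hs hs_conj)+

section \<open>Reflection indices along the windings, and their realisation by permutations\<close>

section \<open>The permutation labels\<close>

text \<open>Conjugating the reflection with index \<open>b\<close> by the one with index
  \<open>a\<close> gives index \<open>2 * a - b\<close>. An edge moving outwards does this to the
  rear strand.\<close>

definition nxt :: "nat \<Rightarrow> (nat \<Rightarrow> int) \<Rightarrow> nat \<Rightarrow> int" where
  "nxt m e = (if m mod 3 = 1 then e else e(strands.bk m := 2 * e (strands.fr m) - e (strands.bk m)))"

primrec ix :: "(nat \<Rightarrow> int) \<Rightarrow> nat \<Rightarrow> nat \<Rightarrow> int" where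
  "ix e 0 = e" | "ix e (Suc m) = nxt m (ix e m)"

definition tri :: "int \<Rightarrow> int \<Rightarrow> int \<Rightarrow> nat \<Rightarrow> int" where
  "tri a b c i = (if i = 0 then a else if i = 1 then b else if i = 2 then c else 0)"

lemma tri_upd: "(tri a b c)(0 := d) = tri d b c" "(tri a b c)(Suc 0 := d) = tri a d c" "(tri a b c)(2 := d) = tri a b d"
  "tri a b c 0 = a" "tri a b c (Suc 0) = b" "tri a b c 2 = c" "tri a b c 1 = b"
  by (auto simp: tri_def)

lemma nxt_tri: "nxt m (tri a b c) = (if m mod 3 = 1 then tri a b c else
   if even (m div 6) then (if m mod 3 = 0 then tri a b (2 * b - c) else tri a (2 * c - b) c)
   else (if m mod 3 = 0 then tri a (2 * a - b) c else tri (2 * b - a) b c))"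
proof -
  have "strands 12" by standard simp_all
  then interpret strands 12 .
  show ?thesis by (auto simp: nxt_def bk_def fr_def sg_def tri_upd)
qed

lemma nxt_12: "nxt (12 + m) = nxt m"
proof -
  have "strands 12" by standard simp_all
  then interpret strands 12 .
  have "(12 + m) mod 3 = m mod 3" "(12 + m) div 6 = 2 + m div 6" by presburger+
  then show ?thesis by (intro ext) (simp add: nxt_def bk_def fr_def sg_def)
qed

text \<open>A full turn of two strands adds twice the difference of their indices to both, so two
  turns have the coefficients 5, 4 and 4, 3. One period does this for strands 1, 2 and then for
  strands 0, 1.\<close>

lemma ix_12: "ix (tri a b c) 12 = tri (5 * a - 4 * (5 * b - 4 * c)) (4 * a - 3 * (5 * b - 4 * c)) (4 * b - 3 * c)"
proof -
  have "ix e 12 = nxt 11 (nxt 10 (nxt 9 (nxt 8 (nxt 7 (nxt 6 (nxt 5 (nxt 4 (nxt 3 (nxt 2 (nxt 1 (nxt 0 e)))))))))))" for e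
    by (simp add: eval_nat_numeral)
  then show ?thesis by (simp add: nxt_tri algebra_simps)
qed

lemma ix_add_12: "ix e (12 + m) = ix (ix e 12) m"
  by (induction m) (simp_all only: add_Suc_right add_0_right ix.simps nxt_12)

text \<open>Two periods carry the indices belonging to the next Pell solution to those of the
  present one, so the induction peels off the innermost 24 edges. The outer values are what the caps
  require.\<close>

lemma ix_final:
  assumes "pell_pair j = (x, y)"
  shows "ix (tri (1 - (x - y) * (3 * y - x)) (1 + 2 * x * y - (x - y) * (3 * y - x)) (1 + 2 * x * y)) (12 * (2 * j + 1)) = tri 0 0 1"
    "ix (tri (2 * x * y) (2 * x * y - (x + y) * (x + 3 * y)) (- ((x + y) * (x + 3 * y)))) (12 * (2 * j + 1)) = tri 0 1 1"
proof -
  have "ix (tri (1 - (x - y) * (3 * y - x)) (1 + 2 * x * y - (x - y) * (3 * y - x)) (1 + 2 * x * y)) (12 * (2 * j + 1)) = tri 0 0 1 \<and>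
    ix (tri (2 * x * y) (2 * x * y - (x + y) * (x + 3 * y)) (- ((x + y) * (x + 3 * y)))) (12 * (2 * j + 1)) = tri 0 1 1"
    using assms
  proof (induction j arbitrary: x y)
    case 0
    then have xy: "x = 2" "y = 1" by simp_all
    show ?case using ix_12[of 0 4 5] ix_12[of 4 "-11" "-15"] by (simp add: xy)
  next
    case (Suc j)
    obtain u v where uv: "pell_pair j = (u, v)" by force
    interpret pell u v using pell_pair[of j] uv by simp
    have xy: "x = 7 * u + 12 * v" "y = 4 * u + 7 * v" using Suc.prems uv by simp_all
    have n: "12 * (2 * Suc j + 1) = 12 + (12 + 12 * (2 * j + 1))" by simp
    have uu: "u * u = 3 * (v * v) + 1" using pell by (simp add: power2_eq_square)
    \<comment> \<open>The rewriting must also reach \<open>u * u\<close> inside longer, right-nested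
      products.\<close>
    have uuk: "u * (u * k) = k + v * (v * (3 * k))" for k using arg_cong[OF uu, of "\<lambda>z. z * k"] by (simp add: algebra_simps)
    have E: "tri a b c = tri a' b' c'" if "a = a'" "b = b'" "c = c'" for a b c a' b' c' using that by simp
    show ?case unfolding n ix_add_12 ix_12
      using Suc.IH[OF uv]
      by (elim conjE, intro conjI; elim trans[rotated]; intro arg_cong[where f = "\<lambda>e. ix e (12 * (2 * j + 1))"] E)
        (simp_all add: xy algebra_simps uu uuk)
  qed
  then show "ix (tri (1 - (x - y) * (3 * y - x)) (1 + 2 * x * y - (x - y) * (3 * y - x)) (1 + 2 * x * y)) (12 * (2 * j + 1)) = tri 0 0 1"
    "ix (tri (2 * x * y) (2 * x * y - (x + y) * (x + 3 * y)) (- ((x + y) * (x + 3 * y)))) (12 * (2 * j + 1)) = tri 0 1 1" by auto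
qed

text \<open>For an involution on the curve this is the group it generates. For the axis a larger
  subgroup will do: none of its elements moves a point that the label fixes.\<close>

definition hset :: "nat \<Rightarrow> 'a perm \<Rightarrow> 'a perm set" where
  "hset i a = (if i < 4 \<and> a + a = 0 then {0, a} else {g. affected g \<subseteq> affected a})"

lemma hset_subgroup: "0 \<in> hset i a" "a \<in> hset i a" "b \<in> hset i a \<Longrightarrow> c \<in> hset i a \<Longrightarrow> b + c \<in> hset i a" "b \<in> hset i a \<Longrightarrow> - b \<in> hset i a"
proof -
  have "- a = a" if "a + a = 0" using that by (simp add: eq_neg_iff_add_eq_0[symmetric])
  then show "0 \<in> hset i a" "a \<in> hset i a" "b \<in> hset i a \<Longrightarrow> c \<in> hset i a \<Longrightarrow> b + c \<in> hset i a" "b \<in> hset i a \<Longrightarrow> - b \<in> hset i a"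
    using affected_plus[of b c] by (auto simp: hset_def split: if_splits)
qed

lemma hset_conj: "hset i (- c + a + c) = (\<lambda>h. - c + h + c) ` hset i a"
proof -
  have "- c + a + c + (- c + a + c) = - c + (a + a) + c" by (simp add: add.assoc)
  moreover have "- c + (a + a) + c = 0 \<longleftrightarrow> a + a = 0"
    by (metis add.assoc add.right_neutral add_0 add_minus_cancel left_minus minus_add_cancel)
  ultimately have inv: "- c + a + c + (- c + a + c) = 0 \<longleftrightarrow> a + a = 0" by simp
  have sub: "{g. affected g \<subseteq> affected (- c + a + c)} = (\<lambda>h. - c + h + c) ` {g. affected g \<subseteq> affected a}"
  proof (intro set_eqI iffI)
    fix g assume "g \<in> (\<lambda>h. - c + h + c) ` {g. affected g \<subseteq> affected a}"
    then obtain k where "g = - c + k + c" "affected k \<subseteq> affected a" by blast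
    then show "g \<in> {g. affected g \<subseteq> affected (- c + a + c)}" by (simp add: affected_conj image_mono)
  next
    fix g assume g: "g \<in> {g. affected g \<subseteq> affected (- c + a + c)}"
    have "affected (- (- c) + g + (- c)) \<subseteq> affected a"
      using g unfolding affected_conj by (auto simp: image_iff)
    moreover have "g = - c + (- (- c) + g + (- c)) + c" by (simp add: add.assoc)
    ultimately show "g \<in> (\<lambda>h. - c + h + c) ` {g. affected g \<subseteq> affected a}" by blast
  qed
  show ?thesis using inv sub by (auto simp: hset_def)
qed

text \<open>An odd number of periods, matching the odd powers of \<open>2 + sqrt 3\<close>.\<close>

definition JJ :: "nat \<Rightarrow> nat" where "JJ j = 12 * (2 * j + 1)"

locale tangle =
  fixes j :: nat
begin

abbreviation "x \<equiv> fst (pell_pair j)"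
abbreviation "y \<equiv> snd (pell_pair j)"

sublocale pell x y by (rule pell_pair)
sublocale strands "JJ j" by standard (simp_all add: JJ_def)

text \<open>With the shift by 1 both \<open>up 1\<close> and \<open>lw 0\<close> are
  \<open>fl\<close>, the label of strand 3. These are the indices at which strand 2 above and strand
  0 below arrive at their caps with strand 3.\<close>

definition up :: "int \<Rightarrow> (int \<times> bool) perm" where "up i = rot (i - 1) + fl"
definition lw :: "int \<Rightarrow> (int \<times> bool) perm" where "lw i = rot' i + fl"

text \<open>The indices in the middle. Modulo \<open>D\<close> they are \<open>1 - E\<close>,
  \<open>1 - E\<close>, \<open>1\<close>, so strands 0 and 1 share the unit reflection and strand 2
  has \<open>fl\<close>; the lower ones in \<open>il\<close> behave likewise modulo
  \<open>D'\<close>.\<close>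

definition iu :: "nat \<Rightarrow> nat \<Rightarrow> int" where "iu = ix (tri (1 - E) (1 + D - E) (1 + D))"
definition il :: "nat \<Rightarrow> nat \<Rightarrow> int" where "il = ix (tri (- E') (D' - E') D')"

text \<open>Integration constants of the section, solved from the caps with strand 3, from strand 2
  in the middle, from the bottom cap of strands 1 and 2, and from the passages behind the
  axis.\<close>

definition kU :: "nat \<Rightarrow> (int \<times> bool) perm" where
  "kU i = (if i = 0 then rot' (- (x * y)) - mer - fl + rot ((1 + E) div 2)
     else if i = 1 then rot (- (x * y)) + rot' (- (x * y)) - mer - fl + rot (x * y + (1 + E) div 2) else 0)"
definition kL :: "nat \<Rightarrow> (int \<times> bool) perm" where
  "kL i = (if i = 0 then 0 else rot (- (x * y)) - rot' (- (D' div 2)))"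

definition LU where "LU i m = up (iu m i)"
definition LL where "LL i m = lw (il m i)"
text \<open>A crossing changes an index from \<open>b\<close> to \<open>2 * a - b\<close>, by an
  even amount, and the section by a rotation of half that amount. So the section follows half the
  index, rounded down.\<close>

definition CU where "CU i m = kU i + rot (- (iu m i div 2))"
definition CL where "CL i m = kL i + rot' (- (il m i div 2))"

lemma rot_0 [simp]: "rot 0 = 0" using rot_add[of 0 0] by (metis add.right_neutral add_left_cancel)
lemma rot'_0 [simp]: "rot' 0 = 0" using rot'_add[of 0 0] by (metis add.right_neutral add_left_cancel)
lemma rot_minus: "- rot i = rot (- i)" using rot_add[of i "- i"] by (simp add: minus_unique)
lemma rot'_minus: "- rot' i = rot' (- i)" using rot'_add[of i "- i"] by (simp add: minus_unique)
lemma rot_rot: "rot i + (rot k + a) = rot (i + k) + a" "rot' i + (rot' k + a) = rot' (i + k) + a"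
  by (simp_all add: rot_add rot'_add add.assoc)
lemma diff_rot: "a - rot i = a + rot (- i)" "a - rot' i = a + rot' (- i)"
  by (simp_all add: diff_conv_add_uminus rot_minus rot'_minus del: add_uminus_conv_diff)
lemma fl_minus: "- fl = fl" using fl_fl by (simp add: minus_unique)

lemma reflection_mult: "up a + up b = rot (a - b)" "lw a + lw b = rot' (a - b)"
proof -
  have "up a + up b = rot (a - 1) + (fl + rot (b - 1)) + fl" by (simp add: up_def add.assoc)
  also have "\<dots> = rot (a - 1) + rot (- (b - 1))" using fl_fl by (simp add: fl_rot add.assoc)
  finally show "up a + up b = rot (a - b)" by (simp flip: rot_add)
  have "lw a + lw b = rot' a + (fl + rot' b) + fl" by (simp add: lw_def add.assoc)
  also have "\<dots> = rot' a + rot' (- b)" using fl_fl by (simp add: fl_rot' add.assoc)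
  finally show "lw a + lw b = rot' (a - b)" by (simp flip: rot'_add)
qed

lemma reflection_rot: "rot b + up a = up (a + b)" "rot' b + lw a = lw (a + b)"
  by (simp_all add: up_def lw_def algebra_simps flip: add.assoc rot_add rot'_add)

lemma reflection_minus: "- up a = up a" "- lw a = lw a"
  using reflection_mult[of a a] by (simp_all add: minus_unique)

lemma iu_final: "iu (JJ j) = tri 0 0 1" "il (JJ j) = tri 0 1 1"
proof -
  have p: "pell_pair j = (x, y)" by simp
  show "iu (JJ j) = tri 0 0 1" unfolding iu_def JJ_def using ix_final(1)[OF p] by simp
  have e: "tri (- E') (D' - E') D' = tri (2 * x * y) (2 * x * y - (x + y) * (x + 3 * y)) (- ((x + y) * (x + 3 * y)))" by simp
  show "il (JJ j) = tri 0 1 1" unfolding il_def e JJ_def using ix_final(2)[OF p] by simp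
qed

lemma halves: "(1 + D) div 2 = x * y" "- E' div 2 = x * y" "D' div 2 - (D' - E') div 2 = - (x * y)"
  "(1 - E) div 2 = (1 + E) div 2 - E" "(1 + D - E) div 2 = x * y + (1 + E) div 2 - E"
proof -
  have "odd E" using parity by simp
  then obtain e where e: "E = 2 * e + 1" by (elim oddE)
  define d where "d = x * y"
  have D: "D = 2 * d" "E' = - (2 * d)" by (simp_all add: d_def)
  show "(1 + D) div 2 = x * y" "- E' div 2 = x * y" "D' div 2 - (D' - E') div 2 = - (x * y)"
    unfolding D d_def[symmetric] by simp_all
  show "(1 - E) div 2 = (1 + E) div 2 - E" "(1 + D - E) div 2 = x * y + (1 + E) div 2 - E"
    unfolding e D d_def[symmetric] by simp_all
qed

lemma half_reflect: "(2 * a - b) div 2 = a - b + b div 2" for a b :: int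
  by presburger

lemma middle_upper: "LU 0 0 = rot (- E) + fl" "LU (Suc 0) 0 = rot (- E) + fl" "LU 2 0 = fl"
  using rot_add[of D "- E"] rot_D by (simp_all add: LU_def iu_def tri_upd up_def)

lemma middle_lower: "LL 0 0 = rot' (- E') + fl" "LL (Suc 0) 0 = rot' (- E') + fl" "LL 2 0 = fl"
  using rot'_add[of D' "- E'"] rot'_D' by (simp_all add: LL_def il_def tri_upd lw_def del: minus_minus)

sublocale coloring "JJ j" LU LL CU CL fl mer 0 hset
proof
  fix i m
  show "LU i m + LU i m = 0" "LL i m + LL i m = 0" "fl + fl = 0" by (simp_all add: LU_def LL_def reflection_mult fl_fl)
  show "LU i (Suc m) = LU i m \<and> LL i (Suc m) = LL i m \<and> CU i (Suc m) = CU i m \<and> CL i (Suc m) = CL i m"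
    if "m mod 3 = 1 \<or> i \<noteq> bk m"
    using that by (auto simp: LU_def LL_def CU_def CL_def iu_def il_def nxt_def)
  show "LU (bk m) m = - LU (fr m) m + LU (bk m) (Suc m) + LU (fr m) m \<and>
        LL (bk m) m = - LL (fr m) m + LL (bk m) (Suc m) + LL (fr m) m \<and>
        CU (bk m) m = CU (bk m) (Suc m) + LU (bk m) (Suc m) + LU (fr m) m \<and>
        CL (bk m) m = CL (bk m) (Suc m) + LL (bk m) (Suc m) + LL (fr m) m"
    if "m mod 3 \<noteq> 1"
  proof -
    have new: "iu (Suc m) (bk m) = 2 * iu m (fr m) - iu m (bk m)" "il (Suc m) (bk m) = 2 * il m (fr m) - il m (bk m)"
      using that by (simp_all add: iu_def il_def nxt_def)
    show ?thesis
      by (simp add: LU_def LL_def CU_def CL_def new reflection_minus reflection_mult reflection_rot add.assoc half_reflect flip: rot_add rot'_add)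
  qed
  show "LU 0 (JJ j) = LU 1 (JJ j)" "LU 2 (JJ j) = fl"
    "LL 1 (JJ j) = LL 2 (JJ j)" "LL 0 (JJ j) = fl"
    "CU 2 (JJ j) = 0" "CL 0 (JJ j) = 0" "CL 1 (JJ j) = CL 2 (JJ j)"
    unfolding LU_def LL_def CU_def CL_def iu_final by (simp_all add: tri_upd up_def lw_def kU_def kL_def)
  show "LU 2 0 = fl" "LL 2 0 = fl" by (simp_all add: middle_upper middle_lower)
  show "CU 2 0 = CL 2 0"
    by (simp add: CU_def CL_def kU_def kL_def iu_def il_def tri_upd halves(1) add.assoc)
  show "LL i 0 = - mer + LU i 0 + mer \<and> CL i 0 = CU i 0 + LU i 0 + mer" if "i \<in> {0, 1}"
  proof -
    have L: "LU i 0 = rot (- E) + fl" "LL i 0 = rot' (- E') + fl" using that middle_upper middle_lower by auto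
    have "- mer + (rot (- E) + fl + mer) = rot' (- E') + fl" unfolding meridian_relation by (simp add: add.assoc)
    then have 1: "LL i 0 = - mer + LU i 0 + mer" by (simp add: L add.assoc)
    have "CL i 0 = CU i 0 + (rot (- E) + fl) + mer"
    proof (cases "i = 0")
      case True
      have "CU i 0 + (rot (- E) + fl) + mer = rot' (- (x * y)) - mer - fl + rot ((1 + E) div 2 - (1 - E) div 2 - E) + fl + mer"
        using True by (simp add: CU_def kU_def iu_def tri_upd add.assoc rot_rot flip: rot_add)
      also have "\<dots> = rot' (- (x * y))" unfolding halves(4) using fl_fl by (simp add: add.assoc)
      finally show ?thesis using True halves(2) by (simp add: CL_def kL_def il_def tri_upd)
    next
      case False
      then have i: "i = Suc 0" using that by simp
      have "CU i 0 + (rot (- E) + fl) + mer = rot (- (x * y)) + rot' (- (x * y)) - mer - fl + rot (x * y + (1 + E) div 2 - (1 + D - E) div 2 - E) + fl + mer"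
        using i by (simp add: CU_def kU_def iu_def tri_upd add.assoc rot_rot flip: rot_add)
      also have "\<dots> = rot (- (x * y)) + rot' (- (x * y))" unfolding halves(5) using fl_fl by (simp add: add.assoc)
      also have "\<dots> = rot (- (x * y)) + rot' (D' div 2 - (D' - E') div 2)" by (simp only: halves(3))
      finally show ?thesis using i by (simp add: CL_def kL_def il_def tri_upd add.assoc diff_rot flip: rot'_add)
    qed
    with 1 L show ?thesis by simp
  qed
  show "0 \<in> hset i (a :: (int \<times> bool) perm)" "a \<in> hset i a" "b \<in> hset i a \<Longrightarrow> c \<in> hset i a \<Longrightarrow> b + c \<in> hset i a"
    "b \<in> hset i a \<Longrightarrow> - b \<in> hset i a" "hset i (- c + a + c) = (\<lambda>h. - c + h + c) ` hset i a" for a b c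
    by (fact hset_subgroup hset_conj)+
  show "i < 4 \<Longrightarrow> a + a = 0 \<Longrightarrow> hset i a = {0, a}" for a :: "(int \<times> bool) perm" by (simp add: hset_def)
qed

text \<open>The left side is the jump at the top cap of strands 0 and 1. Since \<open>rot D\<close>
  is trivial, \<open>rot (x * y)\<close> is its own inverse, and the word becomes a conjugate of the
  commutator.\<close>

lemma holonomy: "- CU 1 (JJ j) + CU 0 (JJ j) = - (fl + rot ((1 + E) div 2)) + longitude + (fl + rot ((1 + E) div 2))"
proof -
  define q where "q = (1 + E) div 2"
  define d where "d = x * y"
  have dd: "rot d = rot (- d)" using rot_D rot_add[of d d] unfolding d_def
    by (metis mult.assoc mult_2 minus_unique rot_minus)
  have "- CU 1 (JJ j) + CU 0 (JJ j) =
      - (rot (- d) + rot' (- d) - mer - fl + rot (d + q)) + (rot' (- d) - mer - fl + rot q)"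
    unfolding CU_def iu_final by (simp add: tri_upd kU_def q_def d_def)
  also have "\<dots> = - rot q + (rot (- d) + fl) + mer + rot' d + rot d - rot' d - mer + fl + rot q"
    unfolding rot_add[of d q]
    by (simp only: diff_conv_add_uminus minus_add minus_minus add.assoc rot_minus rot'_minus fl_minus)
  also have "\<dots> = - rot q + (fl + rot d) + mer + rot' d + rot d - rot' d - mer + fl + rot q"
    by (simp only: fl_rot)
  also have "\<dots> = - (fl + rot q) + longitude + (fl + rot q)"
    unfolding longitude_def d_def[symmetric]
    by (simp only: diff_conv_add_uminus minus_add minus_minus add.assoc rot_minus rot'_minus fl_minus dd[symmetric])
  finally show ?thesis unfolding q_def .
qed

text \<open>\<open>g\<close> is the unknown multiple of the meridian at the base point. If it is
  trivial, the commutator is counted. Otherwise the product exchanges the sheets.\<close>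

lemma holonomy_moves:
  assumes "g \<in> {0, up 0}"
  shows "nat (4 * (x - y)) \<le> card (affected (- CU 1 (JJ j) + CU 0 (JJ j) + g))"
proof -
  define a where "a = fl + rot ((1 + E) div 2)"
  have eq: "- CU 1 (JJ j) + CU 0 (JJ j) + g = - a + (longitude + (a + g - a)) + a"
    unfolding holonomy a_def by (simp add: add.assoc)
  show ?thesis
  proof (cases "g = 0")
    case True
    then show ?thesis unfolding eq card_affected_conj using longitude_moves by simp
  next
    case False
    then have g: "g = rot (- 1) + fl" using assms by (simp add: up_def)
    define q where "q = (1 + E) div 2"
    have q2: "2 * q - 1 = q + - 1 + q" by simp
    have "a + g - a = fl + (rot q + rot (- 1)) + (fl + rot (- q)) + fl"
      unfolding a_def g q_def[symmetric]
      by (simp only: diff_conv_add_uminus minus_add minus_minus add.assoc rot_minus fl_minus)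
    also have "\<dots> = fl + rot (2 * q - 1) + fl + fl"
      unfolding fl_rot[of "- q"] q2 rot_add by (simp only: minus_minus add.assoc)
    also have "\<dots> = rot (1 - 2 * q) + fl" unfolding fl_rot using fl_fl by (simp add: add.assoc)
    finally have a: "a + g - a = rot (1 - 2 * q) + fl" .
    have r: "snd (rot i \<langle>$\<rangle> z) = snd z" "snd (rot' i \<langle>$\<rangle> z) = snd z" "snd (mer \<langle>$\<rangle> z) = snd z" for i z
      unfolding rot_def rot'_def mer_def
      by (cases z; simp only: rho[OF splits(1,2)] rho[OF splits(3,4)] meridian[OF splits] snd_conv)+
    have m: "snd ((- mer) \<langle>$\<rangle> z) = snd z" for z using r(3)[of "(- mer) \<langle>$\<rangle> z"] by simp
    have "snd (longitude \<langle>$\<rangle> z) = snd z" for z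
      unfolding longitude_def by (simp add: minus_add rot_minus rot'_minus r m del: add_uminus_conv_diff flip: add_uminus_conv_diff)
    then show ?thesis unfolding eq card_affected_conj a by (intro reflection_moves) simp
  qed
qed

end

section \<open>The curve as a set, the axis, and the lower bound for the number of punctures\<close>

context strands
begin

definition scurve :: "(nat \<Rightarrow> real \<Rightarrow> real) \<Rightarrow> (nat \<Rightarrow> real \<Rightarrow> real) \<Rightarrow> (real^3) set" where
  "scurve X Y = {p. \<exists>i<4. lv i (p $ 3) \<and> p $ 1 = X i (p $ 3) \<and> p $ 2 = Y i (p $ 3)}"

definition curve :: "(real^3) set" where "curve = scurve XX YY"

lemma curve_def': "curve = {p. \<exists>i<4. lv i (p $ 3) \<and> p $ 1 = XX i (p $ 3) \<and> p $ 2 = YY i (p $ 3)}"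
  by (simp add: curve_def scurve_def)

text \<open>As a graph over the height this line can be treated as a fifth strand, which meets the
  others in the projection at distinct heights.\<close>

definition axis :: "(real^3) set" where "axis = {p. p $ 1 = 0 \<and> p $ 2 = p $ 3}"

text \<open>Second coordinates on the curve lie between -4 and 6, so they can equal the height only
  in the middle part, where every strand has left depth 0.\<close>

lemma curve_off_axis: "curve \<inter> axis = {}"
proof (intro equals0I)
  fix p assume "p \<in> curve \<inter> axis"
  then obtain i where i: "i < 4" "lv i (p $ 3)" "XX i (p $ 3) = 0" "YY i (p $ 3) = p $ 3" by (auto simp: curve_def' axis_def)
  have "- 4 \<le> p $ 3" "p $ 3 \<le> 6" using YY_bounds[OF i(1,2)] i(4) by auto
  then have "\<bar>p $ 3\<bar> < h" using h12 by linarith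
  then show False using i(1,3) P_outside[of "\<bar>p $ 3\<bar> - h"] by (auto simp: XX_def split: if_splits)
qed

end

context tangle
begin

lemma on_iff: "i \<in> on p \<longleftrightarrow> i < 5 \<and> lv i (p $ 3) \<and> p $ 1 = XX i (p $ 3) \<and> p $ 2 = YY i (p $ 3)"
  by (auto simp: on_def stack_def)

lemma curve_on: "p \<in> curve \<longleftrightarrow> (\<exists>i<4. i \<in> on p)" and axis_on: "p \<in> axis \<longleftrightarrow> 4 \<in> on p"
  by (auto simp: curve_def' axis_def on_iff XX_def YY_def lv_def)

lemma on_nonempty: "{p. on p \<noteq> {}} = curve \<union> axis"
proof -
  have "i < 4 \<or> i = 4" if "i \<in> on p" for i p using that by (auto simp: on_iff)
  then show ?thesis unfolding set_eq_iff mem_Collect_eq Un_iff curve_on axis_on by blast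
qed

lemma card_affected_lab4: "card (affected (lab 4 s)) \<le> 3"
proof -
  have "card (affected mer) \<le> 3" unfolding mer_def using pos by (intro card_affected_meridian) simp_all
  then show ?thesis using card_affected_conj[of fl mer] by (simp add: lab_def)
qed

sublocale nls: normed_local_system potential holo curve axis "\<lambda>a. card (affected a)" 3
proof (intro normed_local_system.intro normed_local_system_axioms.intro)
  show "local_system potential holo (curve \<union> axis)" using local_system_axioms unfolding on_nonempty .
next
  fix a b :: "(int \<times> bool) perm"
  show "card (affected (a + b)) \<le> card (affected a) + card (affected b)" by (rule card_affected_plus)
  show "card (affected (- b + a + b)) = card (affected a)" by (rule card_affected_conj)
next
  fix p g assume p: "p \<in> axis" "g \<in> holo p"
  then have "p \<notin> curve" using curve_off_axis by blast
  have four: "i < 4 \<or> i = 4" if "i \<in> on p" for i using that by (auto simp: on_iff)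
  have "on p = {4}" using \<open>p \<notin> curve\<close> p(1) four unfolding curve_on axis_on set_eq_iff singleton_iff by metis
  then have "affected g \<subseteq> affected (lab 4 (p $ 3))" using p(2) by (simp add: holo_1 hset_def)
  then have "card (affected g) \<le> card (affected (lab 4 (p $ 3)))" by (intro card_mono finite_affected)
  then show "card (affected g) \<le> 3" using card_affected_lab4 by (rule order_trans)
qed simp_all

text \<open>The base point is the apex of strands 0 and 1, the only place where the section jumps,
  from \<open>CU 1\<close> to \<open>CU 0\<close> at the outermost level.\<close>

theorem puncture_bound:
  assumes S: "disk_bounded_by S curve" and fin: "finite (S \<inter> axis)"
  shows "2 ^ (2 * j + 1) \<le> card (S \<inter> axis)"
proof -
  obtain f g where fg: "homeomorphism (cball (0 :: real^2) 1) S f g" "f ` sphere 0 1 = curve"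
    using S by (auto simp: disk_bounded_by_def)
  define p0 :: "real^3" where "p0 = vector [0, 0, Z + 1]"
  have p0c: "p0 $ 1 = 0" "p0 $ 2 = 0" "p0 $ 3 = Z + 1" by (simp_all add: p0_def)
  have top: "XX 0 s = 0" "XX 1 s = 0" "YY 1 s = 0" "YY 0 s = 2 * (s - Z - 1)" "YY 2 s = 2" "YY 3 s = 6 - 4 * (s - Z)" if "Z \<le> s" for s
    using that P_outside[of "\<bar>s\<bar> - h"] by (auto simp: XX_def YY_def)
  have top3: "2 \<le> YY 3 s" if "Z \<le> s" "s \<le> Z + 1" for s using top[OF that(1)] that by simp
  have on0: "on p0 = {0, 1}"
  proof -
    have "i \<in> on p0 \<longleftrightarrow> i = 0 \<or> i = 1" for i
    proof -
      have "i < 5 \<longleftrightarrow> i = 0 \<or> i = 1 \<or> i = 2 \<or> i = 3 \<or> i = 4" by linarith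
      then show ?thesis using top[of "Z + 1"] h12 by (auto simp: on_iff p0c lv_def lo_def YY_def)
    qed
    then show ?thesis by blast
  qed
  have p0K: "p0 \<in> curve" unfolding curve_on on0 by (intro exI[of _ 0]) simp
  have hid0: "hid p0 = {}"
  proof -
    have "XX i (Z + 1) = 0" for i using P_outside[of "\<bar>Z + 1\<bar> - h"] h12 by (auto simp: XX_def)
    then show ?thesis by (simp add: hid_def p0c)
  qed
  have lJ: "lev s = JJ j" if "Z \<le> s" for s using that h12 by (intro lev_J) simp
  have lab0: "lab 0 (Z + 1) = up 0" "lab 1 (Z + 1) = up 0"
    using lJ[of "Z + 1"] h12 unfolding lab_def LU_def by (simp_all add: thr_def iu_final tri_upd del: mult_Suc_right)
  have up2: "up 0 + up 0 = 0" by (simp add: reflection_mult)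
  have holo0: "holo p0 = {0, up 0}"
    by (rule holo_2[OF on0]) (use lab0 up2 in \<open>simp_all add: p0c hset_def\<close>)
  have apex: "p = p0" if p: "p \<in> curve" "(p $ 3, p $ 2) = (Z + 1, 0)" for p
  proof -
    obtain i where i: "i < 4" "p $ 1 = XX i (p $ 3)" "p $ 2 = YY i (p $ 3)" using p(1) by (auto simp: curve_def')
    have "p $ 1 = 0"
      using i p(2) P_outside[of "\<bar>Z + 1\<bar> - h"] by (auto simp: XX_def)
    then show ?thesis using p(2) by (simp add: vec_eq_iff forall_3 p0c)
  qed
  \<comment> \<open>The plane separates the branches below the apex: strand 1 has second coordinate
    0 and strand 0 twice the negative number \<open>p $ 3 - Z - 1\<close>.\<close>
  define U1 :: "(real^3) set" where "U1 = {p. p $ 2 > p $ 3 - Z - 1}"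
  define U2 :: "(real^3) set" where "U2 = {p. p $ 2 < p $ 3 - Z - 1}"
  have near: "Z \<le> p $ 3 \<and> p $ 3 \<le> Z + 1 \<and> on p \<subseteq> {0, 1} \<and> (0 \<in> on p \<longrightarrow> p $ 2 = 2 * (p $ 3 - Z - 1)) \<and> (1 \<in> on p \<longrightarrow> p $ 2 = 0)"
    if p: "p \<in> curve" "dist p0 p < 1 / 2" for p
  proof -
    have d: "\<bar>p $ 2\<bar> < 1 / 2" "\<bar>p $ 3 - (Z + 1)\<bar> < 1 / 2"
      using p(2) dist_vec_nth_le[of p0 2 p] dist_vec_nth_le[of p0 3 p] unfolding dist_real_def p0c by linarith+
    obtain i where "i < 4" "lv i (p $ 3)" using p(1) by (auto simp: curve_def')
    then have s: "Z \<le> p $ 3" "p $ 3 \<le> Z + 1" using d(2) by (auto simp: lv_def)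
    have "on p \<subseteq> {0, 1}"
    proof
      fix i assume i: "i \<in> on p"
      then have "i = 0 \<or> i = 1 \<or> i = 2 \<or> i = 3 \<or> i = 4" unfolding on_iff by linarith
      then show "i \<in> {0, 1}"
        using i d top[OF s(1)] top3[OF s] h12 s unfolding on_iff by (elim disjE) (auto simp: YY_def[of 4])
    qed
    then show ?thesis using s top[OF s(1)] by (auto simp: on_iff)
  qed
  have csec: "csec p = CU i (JJ j)" if "p \<in> curve" "dist p0 p < 1 / 2" "on p = {i}" for p i
  proof -
    have "i = 0 \<or> i = 1" "Z \<le> p $ 3" using near[OF that(1,2)] that(3) by auto
    then show ?thesis using csec_1[OF that(3)] lJ[of "p $ 3"] h12
      by (elim disjE) (simp_all add: cs_def thr_def)
  qed
  have cos: "csec p \<in> nls.coset (csec p) p0 p" for p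
    unfolding nls.coset_def holo0 by (auto simp: potential_0[OF hid0])
  have only1: "on p = {1}" if "p \<in> curve" "dist p0 p < 1 / 2" "p \<in> U1" for p
  proof -
    note n = near[OF that(1,2)]
    have "0 \<notin> on p" using n that(3) by (auto simp: U1_def)
    then show ?thesis using n that(1) by (force simp: curve_on)
  qed
  have only0: "on p = {0}" if "p \<in> curve" "dist p0 p < 1 / 2" "p \<in> U2" for p
  proof -
    note n = near[OF that(1,2)]
    have "1 \<notin> on p" using n that(3) by (auto simp: U2_def)
    then show ?thesis using n that(1) by (force simp: curve_on)
  qed
  have "\<exists>a\<in>holo p0. card (affected (- CU 1 (JJ j) + CU 0 (JJ j) + a)) \<le> 3 * card (S \<inter> axis)"
  proof (rule nls.disk_bound[OF fg curve_off_axis fin p0K, where c = csec and ?U1.0 = U1 and ?U2.0 = U2 and r = "1 / 2"])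
    fix p assume p: "p \<in> curve - {p0}"
    then have "(p $ 3, p $ 2) \<noteq> (Z + 1, 0)" using apex by blast
    from section_eventually[OF this] obtain d where d: "d > 0" "\<And>p'. dist p' p < d \<Longrightarrow> on p' \<noteq> {} \<Longrightarrow> csec p' \<in> (\<lambda>h. csec p + h + potential p p') ` holo p"
      unfolding eventually_nhds_metric by blast
    show "\<exists>\<delta>>0. \<forall>p'\<in>ball p \<delta> \<inter> curve. csec p' \<in> nls.coset (csec p) p p'"
    proof (intro exI[of _ d] conjI ballI d(1))
      fix p' assume "p' \<in> ball p d \<inter> curve"
      then have "dist p' p < d" "on p' \<noteq> {}" by (auto simp: dist_commute curve_on)
      then show "csec p' \<in> nls.coset (csec p) p p'" unfolding nls.coset_def by (rule d(2))
    qed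
  next
    fix p assume p: "p \<in> curve"
    from holo_conj[of p] obtain d where "d > 0" "\<And>p'. dist p' p < d \<Longrightarrow> on p' \<noteq> {} \<Longrightarrow> holo p' = (\<lambda>h. - potential p p' + h + potential p p') ` holo p"
      unfolding eventually_nhds_metric by blast
    then show "\<exists>\<delta>>0. \<forall>p'\<in>ball p \<delta> \<inter> curve. holo p' = (\<lambda>h. - potential p p' + h + potential p p') ` holo p"
      by (intro exI[of _ d] conjI ballI) (auto simp: curve_on dist_commute)
  next
    show "open U1" unfolding U1_def by (intro open_Collect_less continuous_intros)
    show "open U2" unfolding U2_def by (intro open_Collect_less continuous_intros)
    show "U1 \<inter> U2 = {}" by (auto simp: U1_def U2_def)
    show "(curve - {p0}) \<inter> ball p0 (1 / 2) \<subseteq> U1 \<union> U2"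
    proof
      fix p assume p: "p \<in> (curve - {p0}) \<inter> ball p0 (1 / 2)"
      then have n: "Z \<le> p $ 3 \<and> p $ 3 \<le> Z + 1 \<and> on p \<subseteq> {0, 1} \<and> (0 \<in> on p \<longrightarrow> p $ 2 = 2 * (p $ 3 - Z - 1)) \<and> (1 \<in> on p \<longrightarrow> p $ 2 = 0)"
        by (intro near) auto
      have o: "0 \<in> on p \<or> 1 \<in> on p" using n p by (force simp: curve_on)
      have "p $ 3 \<noteq> Z + 1"
      proof
        assume "p $ 3 = Z + 1"
        then have "p $ 2 = 0" using n o by auto
        then show False using apex[of p] p \<open>p $ 3 = Z + 1\<close> by simp
      qed
      then have "p $ 3 < Z + 1" using n by linarith
      with n o show "p \<in> U1 \<union> U2" by (elim disjE) (simp_all add: U1_def U2_def)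
    qed
  next
    fix p assume "p \<in> curve \<inter> U1 \<inter> ball p0 (1 / 2)"
    then have "csec p = CU 1 (JJ j)" by (intro csec only1) auto
    then show "csec p \<in> nls.coset (CU 1 (JJ j)) p0 p" using cos[of p] by simp
  next
    fix p assume "p \<in> curve \<inter> U2 \<inter> ball p0 (1 / 2)"
    then have "csec p = CU 0 (JJ j)" by (intro csec only0) auto
    then show "csec p \<in> nls.coset (CU 0 (JJ j)) p0 p" using cos[of p] by simp
  next
    fix e :: real assume e: "e > 0"
    define d where "d = min (1 / 2) (e / 4)"
    have d: "0 < d" "d \<le> 1 / 2" "4 * d \<le> e" using e by (auto simp: d_def)
    have lv: "lv i (Z + 1 - d)" if "i < 2" for i using d h12 by (simp add: lv_def lo_def)
    have dist: "dist (vector [0, a, Z + 1 - d] :: real^3) p0 < e" if "\<bar>a\<bar> \<le> 2 * d" for a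
    proof -
      have "dist (vector [0, a, Z + 1 - d] :: real^3) p0 \<le> \<bar>a\<bar> + d"
        using norm_le_l1_cart[of "vector [0, a, Z + 1 - d] - p0"] d by (simp add: dist_norm sum_3 p0c)
      then show ?thesis using that d by linarith
    qed
    have "vector [0, 0, Z + 1 - d] \<in> curve \<inter> U1"
      using top[of "Z + 1 - d"] lv[of 1] d by (auto simp: curve_def' U1_def intro!: exI[of _ 1])
    then show "\<exists>p\<in>curve \<inter> U1. dist p p0 < e" using dist[of 0] d by (intro bexI[of _ "vector [0, 0, Z + 1 - d]"]) auto
    have "vector [0, - 2 * d, Z + 1 - d] \<in> curve \<inter> U2"
      using top[of "Z + 1 - d"] lv[of 0] d by (auto simp: curve_def' U2_def intro!: exI[of _ 0])
    then show "\<exists>p\<in>curve \<inter> U2. dist p p0 < e" using dist[of "- 2 * d"] d by (intro bexI[of _ "vector [0, - 2 * d, Z + 1 - d]"]) auto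
  qed simp
  then obtain a where "a \<in> {0, up 0}" "card (affected (- CU 1 (JJ j) + CU 0 (JJ j) + a)) \<le> 3 * card (S \<inter> axis)"
    unfolding holo0 by blast
  then have "nat (4 * (x - y)) \<le> 3 * card (S \<inter> axis)" using holonomy_moves[of a] by linarith
  then have "4 * (x - y) \<le> 3 * int (card (S \<inter> axis))" by linarith
  then have "3 * 2 ^ (2 * j + 1) - 2 \<le> 3 * int (card (S \<inter> axis))" using pell_growth[of j] by linarith
  \<comment> \<open>Integrality absorbs the 2: a multiple of 3 that is at least
    \<open>3 * N - 2\<close> is at least \<open>3 * N\<close>.\<close>
  then have "2 ^ (2 * j + 1) \<le> int (card (S \<inter> axis))" by linarith
  then show ?thesis by (metis of_nat_le_iff of_nat_numeral of_nat_power)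
qed

end

section \<open>Unknottedness is preserved by injective piecewise affine maps\<close>

section \<open>Piecewise affine maps\<close>

lemma disk_bounded_by_image:
  fixes \<phi> :: "'a::t2_space \<Rightarrow> 'b::t2_space"
  assumes "disk_bounded_by D K" "continuous_on D \<phi>" "inj_on \<phi> D"
  shows "disk_bounded_by (\<phi> ` D) (\<phi> ` K)"
proof -
  obtain f g where fg: "homeomorphism (cball (0 :: real^2) 1) D f g" "f ` sphere 0 1 = K"
    using assms(1) by (auto simp: disk_bounded_by_def)
  have "f ` cball 0 1 = D" "continuous_on (cball 0 1) f" "inj_on f (cball 0 1)"
    using fg(1) by (auto simp: homeomorphism_def intro: inj_on_inverseI)
  then have "\<exists>g'. homeomorphism (cball (0 :: real^2) 1) (\<phi> ` D) (\<phi> \<circ> f) g'"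
    using assms by (intro homeomorphism_compact continuous_on_compose comp_inj_on) (auto simp: image_comp)
  then show ?thesis using fg(2) unfolding disk_bounded_by_def by (force simp: image_comp)
qed

text \<open>No hyperplane from \<open>I\<close> separates points of \<open>C\<close> strictly. Cells
  of a subdivision along \<open>I\<close> have this property.\<close>

definition unsep :: "('a::euclidean_space \<times> real) set \<Rightarrow> 'a set \<Rightarrow> bool" where
  "unsep I C \<longleftrightarrow> (\<forall>(a, b)\<in>I. (\<forall>x\<in>C. a \<bullet> x \<le> b) \<or> (\<forall>x\<in>C. b \<le> a \<bullet> x))"

text \<open>Piecewise affine with respect to a finite hyperplane arrangement. Quantifying over all
  unseparated sets avoids naming the cells and makes sums immediate.\<close>

definition pa :: "('a::euclidean_space \<Rightarrow> real) \<Rightarrow> bool" where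
  "pa f \<longleftrightarrow> (\<exists>I. finite I \<and> (\<forall>C. unsep I C \<longrightarrow> (\<exists>v c. \<forall>x\<in>C. f x = v \<bullet> x + c)))"

lemma unsep_mono: "unsep I C \<Longrightarrow> I' \<subseteq> I \<Longrightarrow> unsep I' C"
  by (auto simp: unsep_def)

lemma pa_affine: "pa (\<lambda>x. a \<bullet> x + b)"
  unfolding pa_def by (intro exI[of _ "{}"]) auto

lemma pa_const: "pa (\<lambda>x. b)"
  using pa_affine[of 0 b] by simp

lemma pa_coord: "pa (\<lambda>p :: real^'n. p $ i)"
  using pa_affine[of "axis i 1 :: real^'n" 0] by (simp add: inner_axis inner_commute)

lemma pa_add: assumes "pa f" "pa g" shows "pa (\<lambda>x. f x + g x)"
proof -
  obtain I I' where I: "finite I" "\<And>C. unsep I C \<Longrightarrow> \<exists>v c. \<forall>x\<in>C. f x = v \<bullet> x + c"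
    "finite I'" "\<And>C. unsep I' C \<Longrightarrow> \<exists>v c. \<forall>x\<in>C. g x = v \<bullet> x + c"
    using assms unfolding pa_def by blast
  have "\<exists>v c. \<forall>x\<in>C. f x + g x = v \<bullet> x + c" if "unsep (I \<union> I') C" for C
  proof -
    have "unsep I C" "unsep I' C" using that by (auto elim: unsep_mono)
    then obtain v c v' c' where "\<forall>x\<in>C. f x = v \<bullet> x + c" "\<forall>x\<in>C. g x = v' \<bullet> x + c'" using I(2,4) by blast
    then show ?thesis by (intro exI[of _ "v + v'"] exI[of _ "c + c'"]) (simp add: inner_add_left)
  qed
  then show ?thesis unfolding pa_def using I(1,3) by (intro exI[of _ "I \<union> I'"]) auto
qed

lemma pa_scale: assumes "pa f" shows "pa (\<lambda>x. k * f x)"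
proof -
  obtain I where I: "finite I" "\<And>C. unsep I C \<Longrightarrow> \<exists>v c. \<forall>x\<in>C. f x = v \<bullet> x + c"
    using assms unfolding pa_def by blast
  have "\<exists>v c. \<forall>x\<in>C. k * f x = v \<bullet> x + c" if un: "unsep I C" for C
  proof -
    obtain v c where "\<forall>x\<in>C. f x = v \<bullet> x + c" using I(2)[OF un] by blast
    then show ?thesis by (intro exI[of _ "k *\<^sub>R v"] exI[of _ "k * c"]) (simp add: distrib_left)
  qed
  then show ?thesis unfolding pa_def using I(1) by blast
qed

text \<open>On each cell of a common arrangement both functions are affine. For every sign pattern
  \<open>\<sigma>\<close> the hyperplane on which the two affine forms agree is added, after which
  one of them dominates on each unseparated set.\<close>

lemma pa_max: assumes "pa f" "pa g" shows "pa (\<lambda>x. max (f x) (g x))"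
proof -
  obtain I1 I2 where I12: "finite I1" "\<And>C. unsep I1 C \<Longrightarrow> \<exists>v c. \<forall>x\<in>C. f x = v \<bullet> x + c"
    "finite I2" "\<And>C. unsep I2 C \<Longrightarrow> \<exists>v c. \<forall>x\<in>C. g x = v \<bullet> x + c"
    using assms unfolding pa_def by blast
  define I where "I = I1 \<union> I2"
  have I: "finite I" "\<And>C. unsep I C \<Longrightarrow> \<exists>v c. \<forall>x\<in>C. f x = v \<bullet> x + c" "\<And>C. unsep I C \<Longrightarrow> \<exists>v c. \<forall>x\<in>C. g x = v \<bullet> x + c"
    using I12 by (auto simp: I_def dest: unsep_mono[of "I1 \<union> I2"])
  define cell where "cell \<sigma> = {x. (\<forall>(a, b)\<in>\<sigma>. a \<bullet> x \<le> b) \<and> (\<forall>(a, b)\<in>I - \<sigma>. b \<le> a \<bullet> x)}" for \<sigma>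
  have un: "unsep I (cell \<sigma>)" for \<sigma> unfolding unsep_def
  proof safe
    fix a b x y assume "(a, b) \<in> I" "x \<in> cell \<sigma>" "\<not> b \<le> a \<bullet> x" "y \<in> cell \<sigma>"
    moreover from this have "(a, b) \<in> \<sigma>" by (auto simp: cell_def)
    ultimately show "a \<bullet> y \<le> b" by (auto simp: cell_def)
  qed
  obtain vf cf where F: "\<And>\<sigma> x. x \<in> cell \<sigma> \<Longrightarrow> f x = vf \<sigma> \<bullet> x + cf \<sigma>" using I(2)[OF un] by metis
  obtain vg cg where G: "\<And>\<sigma> x. x \<in> cell \<sigma> \<Longrightarrow> g x = vg \<sigma> \<bullet> x + cg \<sigma>" using I(3)[OF un] by metis
  define I' where "I' = I \<union> (\<lambda>\<sigma>. (vf \<sigma> - vg \<sigma>, cg \<sigma> - cf \<sigma>)) ` Pow I"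
  have "\<exists>v c. \<forall>x\<in>C. max (f x) (g x) = v \<bullet> x + c" if C: "unsep I' C" for C
  proof -
    define \<sigma> where "\<sigma> = {(a, b) \<in> I. \<forall>x\<in>C. a \<bullet> x \<le> b}"
    have "unsep I C" using C by (rule unsep_mono) (simp add: I'_def)
    then have sub: "C \<subseteq> cell \<sigma>" unfolding cell_def \<sigma>_def unsep_def by (fastforce)
    have "(vf \<sigma> - vg \<sigma>, cg \<sigma> - cf \<sigma>) \<in> I'" by (auto simp: I'_def \<sigma>_def)
    then consider "\<forall>x\<in>C. (vf \<sigma> - vg \<sigma>) \<bullet> x \<le> cg \<sigma> - cf \<sigma>" | "\<forall>x\<in>C. cg \<sigma> - cf \<sigma> \<le> (vf \<sigma> - vg \<sigma>) \<bullet> x"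
      using C unfolding unsep_def by blast
    then show ?thesis
    proof cases
      case 1
      have "max (f x) (g x) = vg \<sigma> \<bullet> x + cg \<sigma>" if "x \<in> C" for x
        using 1[rule_format, OF that] F[of x \<sigma>] G[of x \<sigma>] sub that by (auto simp: inner_diff_left)
      then show ?thesis by blast
    next
      case 2
      have "max (f x) (g x) = vf \<sigma> \<bullet> x + cf \<sigma>" if "x \<in> C" for x
        using 2[rule_format, OF that] F[of x \<sigma>] G[of x \<sigma>] sub that by (auto simp: inner_diff_left)
      then show ?thesis by blast
    qed
  qed
  moreover have "finite I'" using I(1) by (simp add: I'_def)
  ultimately show ?thesis unfolding pa_def by blast
qed

lemma pa_minus: "pa f \<Longrightarrow> pa (\<lambda>x. - f x)"
  using pa_scale[of f "- 1"] by simp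

lemma pa_diff: assumes "pa f" "pa g" shows "pa (\<lambda>x. f x - g x)"
  using pa_add[OF assms(1) pa_minus[OF assms(2)]] by simp

lemma pa_min: assumes "pa f" "pa g" shows "pa (\<lambda>x. min (f x) (g x))"
proof -
  have "(\<lambda>x. min (f x) (g x)) = (\<lambda>x. - max (- f x) (- g x))" by (auto simp: fun_eq_iff min_def max_def)
  then show ?thesis using pa_minus[OF pa_max[OF pa_minus[OF assms(1)] pa_minus[OF assms(2)]]] by simp
qed

lemma pa_abs: assumes "pa f" shows "pa (\<lambda>x. \<bar>f x\<bar>)"
proof -
  have "(\<lambda>x. \<bar>f x\<bar>) = (\<lambda>x. max (f x) (- f x))" by (auto simp: fun_eq_iff max_def)
  then show ?thesis using pa_max[OF assms pa_minus[OF assms]] by simp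
qed

lemmas pa_intros = pa_const pa_coord pa_add pa_diff pa_minus pa_scale pa_max pa_min pa_abs

lemma face_of_affine_image:
  assumes face: "F face_of S" and S: "convex S" and inj: "inj_on \<phi> S" and L: "linear L" "\<And>x. x \<in> S \<Longrightarrow> \<phi> x = L x + c"
  shows "\<phi> ` F face_of \<phi> ` S"
proof -
  have comb: "\<phi> ((1 - u) *\<^sub>R x + u *\<^sub>R y) = (1 - u) *\<^sub>R \<phi> x + u *\<^sub>R \<phi> y" if "x \<in> S" "y \<in> S" "0 \<le> u" "u \<le> 1" for x y u
  proof -
    have "(1 - u) *\<^sub>R x + u *\<^sub>R y \<in> S" using S that by (simp add: convexD)
    then have "\<phi> ((1 - u) *\<^sub>R x + u *\<^sub>R y) = (1 - u) *\<^sub>R L x + u *\<^sub>R L y + c" by (simp add: L linear_add linear_scale)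
    also have "\<dots> = (1 - u) *\<^sub>R (L x + c) + u *\<^sub>R (L y + c)" by (simp add: algebra_simps)
    finally show ?thesis using L(2) that by simp
  qed
  have FS: "F \<subseteq> S" "convex F" using face by (auto simp: face_of_def)
  have conv: "convex (\<phi> ` F)"
  proof -
    have "\<phi> ` F = (\<lambda>x. c + x) ` L ` F" using L(2) FS(1) by (force simp: image_image add.commute)
    then show ?thesis using FS(2) L(1) by (simp add: convex_linear_image convex_translation)
  qed
  show ?thesis unfolding face_of_def
  proof (intro conjI ballI impI)
    fix a b x assume "a \<in> \<phi> ` S" "b \<in> \<phi> ` S" "x \<in> \<phi> ` F" and seg: "x \<in> open_segment a b"
    then obtain a' b' x' where p: "a' \<in> S" "a = \<phi> a'" "b' \<in> S" "b = \<phi> b'" "x' \<in> F" "x = \<phi> x'" by blast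
    obtain u where u: "a \<noteq> b" "0 < u" "u < 1" "x = (1 - u) *\<^sub>R a + u *\<^sub>R b" using seg by (auto simp: in_segment)
    have "\<phi> x' = \<phi> ((1 - u) *\<^sub>R a' + u *\<^sub>R b')" using comb[OF p(1,3), of u] u p by simp
    moreover have "(1 - u) *\<^sub>R a' + u *\<^sub>R b' \<in> S" using S p u by (simp add: convexD)
    ultimately have "x' = (1 - u) *\<^sub>R a' + u *\<^sub>R b'" using inj p FS(1) by (meson inj_onD subsetD)
    then have "x' \<in> open_segment a' b'" using u p by (auto simp: in_segment)
    then have "a' \<in> F" "b' \<in> F" using face p by (auto simp: face_of_def)
    then show "a \<in> \<phi> ` F" "b \<in> \<phi> ` F" using p by auto
  qed (use FS conv in auto)
qed

text \<open>Cutting the triangulation along the hyperplanes makes \<open>\<phi>\<close> affine on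
  every cell. The images are polytopes meeting in faces and can be triangulated again.\<close>

theorem PL_unknotted:
  fixes \<phi> :: "real^3 \<Rightarrow> real^3"
  assumes K: "unknotted K" and cont: "continuous_on UNIV \<phi>" and inj: "inj \<phi>"
    and I: "finite I" "\<And>C. unsep I C \<Longrightarrow> \<exists>L c. linear L \<and> (\<forall>x\<in>C. \<phi> x = L x + c)"
  shows "unknotted (\<phi> ` K)"
proof -
  obtain T where T: "simplicial_complex T" "disk_bounded_by (\<Union>T) K"
    using K by (auto simp: unknotted_def PL_triangulated_disk_bounded_by_def)
  have T': "finite T" "\<And>S. S \<in> T \<Longrightarrow> \<exists>n. n simplex S" "\<And>S S'. S \<in> T \<Longrightarrow> S' \<in> T \<Longrightarrow> (S \<inter> S') face_of S"
    using T(1) by (auto simp: simplicial_complex_def)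
  have poly: "polytope S" if "S \<in> T" for S using T'(2)[OF that] by (auto dest: simplex_imp_polytope)
  have dim: "aff_dim X \<le> int DIM(real^3)" for X :: "(real^3) set" by (rule aff_dim_le_DIM)
  have "\<exists>G. \<Union>G = \<Union>T \<and> finite G \<and> (\<forall>C \<in> G. \<exists>D. D \<in> T \<and> C \<subseteq> D) \<and>
      (\<forall>C \<in> T. \<forall>x \<in> C. \<exists>D. D \<in> G \<and> x \<in> D \<and> D \<subseteq> C) \<and> (\<forall>X \<in> G. polytope X) \<and>
      (\<forall>X \<in> G. aff_dim X \<le> int DIM(real^3)) \<and> (\<forall>X \<in> G. \<forall>Y \<in> G. X \<inter> Y face_of X) \<and>
      (\<forall>X \<in> G. \<forall>x \<in> X. \<forall>y \<in> X. \<forall>a b. (a,b) \<in> I \<longrightarrow> a \<bullet> x \<le> b \<and> a \<bullet> y \<le> b \<or> a \<bullet> x \<ge> b \<and> a \<bullet> y \<ge> b)"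
  proof (rule cell_subdivision_lemma)
    show "polytope X" if "X \<in> T" for X using poly that .
    show "X \<inter> Y face_of X" if "X \<in> T" "Y \<in> T" for X Y using T'(3) that .
  qed (use T'(1) I(1) dim in auto)
  then obtain G where G: "\<Union>G = \<Union>T" "finite G" "\<forall>X\<in>G. polytope X" "\<forall>X\<in>G. \<forall>Y\<in>G. X \<inter> Y face_of X"
    "\<forall>X\<in>G. \<forall>x\<in>X. \<forall>y\<in>X. \<forall>a b. (a, b) \<in> I \<longrightarrow> a \<bullet> x \<le> b \<and> a \<bullet> y \<le> b \<or> a \<bullet> x \<ge> b \<and> a \<bullet> y \<ge> b"
    by (elim exE conjE) (rule that)
  have un: "unsep I X" if "X \<in> G" for X
    unfolding unsep_def
  proof safe
    fix a b x y assume "(a, b) \<in> I" "x \<in> X" "\<not> b \<le> a \<bullet> x" "y \<in> X"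
    then show "a \<bullet> y \<le> b" using G(5)[rule_format, OF that, of x y a b] by linarith
  qed
  define M where "M = (\<lambda>X. \<phi> ` X) ` G"
  have poly': "polytope (\<phi> ` X)" if X: "X \<in> G" for X
  proof -
    obtain L c where L: "linear L" "\<forall>x\<in>X. \<phi> x = L x + c" using I(2)[OF un[OF X]] by blast
    have "\<phi> ` X = (\<lambda>x. c + x) ` L ` X" using L(2) by (force simp: image_image add.commute)
    then show ?thesis using L(1) G(3)[rule_format, OF X] by (simp add: polytope_linear_image polytope_translation_eq)
  qed
  have face': "\<phi> ` X \<inter> \<phi> ` Y face_of \<phi> ` X" if X: "X \<in> G" "Y \<in> G" for X Y
  proof -
    obtain L c where L: "linear L" "\<forall>x\<in>X. \<phi> x = L x + c" using I(2)[OF un[OF X(1)]] by blast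
    have "\<phi> ` (X \<inter> Y) face_of \<phi> ` X"
      using G(4)[rule_format, OF X] G(3)[rule_format, OF X(1)] inj L
      by (intro face_of_affine_image[where L = L and c = c]) (auto intro: polytope_imp_convex inj_on_subset)
    then show ?thesis by (simp add: image_Int[OF inj])
  qed
  have "finite M" "\<And>C. C \<in> M \<Longrightarrow> polytope C" "\<And>C1 C2. C1 \<in> M \<Longrightarrow> C2 \<in> M \<Longrightarrow> C1 \<inter> C2 face_of C1"
    unfolding M_def using G(2) poly' face' by auto
  note mp = this
  obtain T2 where T2: "simplicial_complex T2" "\<Union>T2 = \<Union>M"
  proof (rule simplicial_subdivision_of_cell_complex[OF mp(1)])
    show "polytope C" if "C \<in> M" for C using mp(2) that .
    show "C1 \<inter> C2 face_of C1" if "C1 \<in> M" "C2 \<in> M" for C1 C2 using mp(3) that .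
  qed (rule that)
  have "\<Union>M = \<phi> ` \<Union>T" unfolding M_def G(1)[symmetric] by blast
  moreover have "disk_bounded_by (\<phi> ` \<Union>T) (\<phi> ` K)"
    using T(2) cont inj by (intro disk_bounded_by_image) (auto intro: continuous_on_subset inj_on_subset)
  ultimately show ?thesis using T2 unfolding unknotted_def PL_triangulated_disk_bounded_by_def by auto
qed

lemma linear_unknotted:
  fixes L :: "real^3 \<Rightarrow> real^3"
  assumes "unknotted K" "linear L" "inj L"
  shows "unknotted (L ` K)"
proof (rule PL_unknotted[OF assms(1) _ assms(3), of "{}"])
  show "continuous_on UNIV L" using assms(2) by (simp add: linear_continuous_on linear_conv_bounded_linear)
  show "\<exists>L' c. linear L' \<and> (\<forall>x\<in>C. L x = L' x + c)" for C using assms(2) by (intro exI[of _ L] exI[of _ 0]) simp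
qed simp

text \<open>On a line in direction \<open>e\<close> the new position is \<open>t + m\<close>, which
  is strictly increasing because \<open>m\<close> has slope above -1; hence the push is
  injective.\<close>

theorem push_unknotted:
  fixes m :: "real^3 \<Rightarrow> real"
  assumes K: "unknotted K" and m: "pa m" and cont: "continuous_on UNIV m"
    and slope: "\<And>p t. t > 0 \<Longrightarrow> m p - t < m (p + t *\<^sub>R e)"
  shows "unknotted ((\<lambda>p. p + m p *\<^sub>R e) ` K)"
proof -
  obtain I where I: "finite I" "\<And>C. unsep I C \<Longrightarrow> \<exists>v c. \<forall>x\<in>C. m x = v \<bullet> x + c"
    using m unfolding pa_def by blast
  show ?thesis
  proof (rule PL_unknotted[OF K _ _ I(1)])
    show "continuous_on UNIV (\<lambda>p. p + m p *\<^sub>R e)" using cont by (intro continuous_intros)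
    show "inj (\<lambda>p. p + m p *\<^sub>R e)"
    proof (rule injI)
      fix p q assume eq: "p + m p *\<^sub>R e = q + m q *\<^sub>R e"
      have p: "p = q + (m q - m p) *\<^sub>R e" and q: "q = p + (m p - m q) *\<^sub>R e"
        using eq by (auto simp: algebra_simps)
      consider "m q - m p > 0" | "m p - m q > 0" | "m p = m q" by linarith
      then show "p = q"
      proof cases
        case 1
        then show ?thesis using slope[OF 1, of q] p by simp
      next
        case 2
        then show ?thesis using slope[OF 2, of p] q by simp
      qed (use p in simp)
    qed
    show "\<exists>L c. linear L \<and> (\<forall>x\<in>C. x + m x *\<^sub>R e = L x + c)" if "unsep I C" for C
    proof -
      obtain v c where v: "\<forall>x\<in>C. m x = v \<bullet> x + c" using I(2)[OF \<open>unsep I C\<close>] by blast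
      have "linear (\<lambda>x. x + (v \<bullet> x) *\<^sub>R e)"
        by (intro linearI) (simp_all add: inner_add_right algebra_simps)
      moreover have "\<forall>x\<in>C. x + m x *\<^sub>R e = (x + (v \<bullet> x) *\<^sub>R e) + c *\<^sub>R e" using v by (simp add: algebra_simps)
      ultimately show ?thesis by blast
    qed
  qed
qed

lemma shear_unknotted:
  fixes m :: "real^3 \<Rightarrow> real"
  assumes "unknotted K" "pa m" "continuous_on UNIV m" "\<And>p t. m (p + t *\<^sub>R e) = m p"
  shows "unknotted ((\<lambda>p. p + m p *\<^sub>R e) ` K)"
  using assms by (intro push_unknotted) auto

text \<open>The homeomorphism that convexity provides does not come with information on the
  boundary. Invariance of domain, applied to it and to its inverse, shows that it carries the circle
  to the frontier.\<close>

lemma triangle_unknotted: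
  fixes L :: "real^2 \<Rightarrow> real^3"
  assumes L: "linear L" "inj L" and ne: "interior (convex hull {a, b, c}) \<noteq> {}"
  shows "unknotted (closed_segment (L a) (L b) \<union> closed_segment (L b) (L c) \<union> closed_segment (L c) (L a))"
proof -
  define T where "T = convex hull {a, b, c}"
  have T: "convex T" "compact T" "interior T \<noteq> {}" using ne by (auto simp: T_def compact_convex_hull finite_imp_compact)
  have "cball (0 :: real^2) 1 homeomorphic T"
    using T by (intro homeomorphic_convex_compact) auto
  then obtain f g where fg: "homeomorphism (cball (0 :: real^2) 1) T f g" by (auto simp: homeomorphic_def)
  have f: "f ` cball 0 1 = T" "continuous_on (cball 0 1) f" "inj_on f (cball 0 1)" "g ` T = cball 0 1" "continuous_on T g" "inj_on g T"
    "\<And>x. x \<in> cball 0 1 \<Longrightarrow> g (f x) = x" "\<And>y. y \<in> T \<Longrightarrow> f (g y) = y"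
    using fg by (auto simp: homeomorphism_def intro: inj_on_inverseI)
  have "f ` ball 0 1 \<subseteq> interior T"
    using f by (intro interior_maximal invariance_of_domain) (auto intro: continuous_on_subset inj_on_subset)
  moreover have "g ` interior T \<subseteq> ball 0 1"
  proof -
    have sub: "interior T \<subseteq> T" by (rule interior_subset)
    have "g ` interior T \<subseteq> interior (cball 0 1)"
      using f(4) sub by (intro interior_maximal invariance_of_domain continuous_on_subset[OF f(5)] inj_on_subset[OF f(6)]) auto
    then show ?thesis by simp
  qed
  moreover have "interior T \<subseteq> f ` ball 0 1" if "g ` interior T \<subseteq> ball 0 1"
  proof
    fix z assume z: "z \<in> interior T"
    then have "f (g z) = z" using f(8) interior_subset[of T] by blast
    moreover have "g z \<in> ball 0 1" using that z by blast
    ultimately show "z \<in> f ` ball 0 1" by (metis imageI)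
  qed
  ultimately have fb: "f ` ball 0 1 = interior T" by blast
  have "f ` sphere 0 1 = T - interior T"
  proof -
    have "sphere (0 :: real^2) 1 = cball 0 1 - ball 0 1" by auto
    then have "f ` sphere 0 1 = f ` cball 0 1 - f ` ball 0 1" using f(3) by (auto simp: inj_on_image_set_diff[of f "cball 0 1"] ball_subset_cball)
    then show ?thesis by (simp add: f fb)
  qed
  also have "\<dots> = frontier T" using compact_imp_closed[OF T(2)] by (simp add: frontier_def)
  also have "\<dots> = closed_segment a b \<union> closed_segment b c \<union> closed_segment c a"
    unfolding T_def by (rule frontier_of_triangle) simp
  finally have "disk_bounded_by T (closed_segment a b \<union> closed_segment b c \<union> closed_segment c a)"
    using fg unfolding disk_bounded_by_def by blast
  then have "disk_bounded_by (L ` T) (L ` (closed_segment a b \<union> closed_segment b c \<union> closed_segment c a))"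
    using L by (intro disk_bounded_by_image) (auto intro: linear_continuous_on inj_on_subset simp: linear_conv_bounded_linear)
  moreover have "polytope (L ` T)" using L(1) by (simp add: T_def polytope_linear_image polytope_convex_hull)
  then have "finite {L ` T}" "\<And>C. C \<in> {L ` T} \<Longrightarrow> polytope C" "\<And>C1 C2. C1 \<in> {L ` T} \<Longrightarrow> C2 \<in> {L ` T} \<Longrightarrow> C1 \<inter> C2 face_of C1"
    by (auto simp: polytope_imp_convex face_of_refl)
  note mp = this
  obtain M where "simplicial_complex M" "\<Union>M = \<Union>{L ` T}"
  proof (rule simplicial_subdivision_of_cell_complex[OF mp(1)])
    show "polytope C" if "C \<in> {L ` T}" for C using mp(2) that .
    show "C1 \<inter> C2 face_of C1" if "C1 \<in> {L ` T}" "C2 \<in> {L ` T}" for C1 C2 using mp(3) that .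
  qed (rule that)
  then have "simplicial_complex M" "\<Union>M = L ` T" by auto
  ultimately show ?thesis
    unfolding unknotted_def PL_triangulated_disk_bounded_by_def image_Un closed_segment_linear_image[OF L(1), symmetric] by metis
qed

section \<open>From a flat triangle to the curve by pushes and shears\<close>

section \<open>The curves are unknotted\<close>

definition pt :: "real \<Rightarrow> real \<Rightarrow> real^3" where "pt y s = vector [0, y, s]"

lemma pt_nth [simp]: "pt y s $ 1 = 0" "pt y s $ 2 = y" "pt y s $ 3 = s"
  by (simp_all add: pt_def)

lemma pt_comb: "(1 - u) *\<^sub>R pt y s + u *\<^sub>R pt y' s' = pt ((1 - u) * y + u * y') ((1 - u) * s + u * s')"
  by (simp add: vec_eq_iff forall_3)

definition edge :: "real \<Rightarrow> real \<Rightarrow> real \<Rightarrow> real \<Rightarrow> (real^3) set" where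
  "edge y s y' s' = closed_segment (pt y s) (pt y' s')"

lemma edge_image: "edge y s y' s' = (\<lambda>u. pt ((1 - u) * y + u * y') ((1 - u) * s + u * s')) ` {0..1}"
  unfolding edge_def closed_segment_image_interval pt_comb ..

lemma edge_commute: "edge y s y' s' = edge y' s' y s"
  by (simp add: edge_def closed_segment_commute)

lemma edge_split:
  assumes "0 \<le> l" "l \<le> 1" "y0 = (1 - l) * y1 + l * y2" "s0 = (1 - l) * s1 + l * s2"
  shows "edge y1 s1 y2 s2 = edge y1 s1 y0 s0 \<union> edge y0 s0 y2 s2"
proof -
  have "pt y0 s0 \<in> closed_segment (pt y1 s1) (pt y2 s2)"
    unfolding in_segment pt_comb using assms by blast
  then show ?thesis unfolding edge_def by (rule Un_closed_segment[symmetric])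
qed

lemma edge_vertical:
  assumes "s < s'"
  shows "p \<in> edge y s y s' \<longleftrightarrow> p $ 1 = 0 \<and> p $ 2 = y \<and> s \<le> p $ 3 \<and> p $ 3 \<le> s'"
proof
  assume "p \<in> edge y s y s'"
  then obtain u where u: "0 \<le> u" "u \<le> 1" "p = pt ((1 - u) * y + u * y) ((1 - u) * s + u * s')" unfolding edge_image by auto
  have "0 \<le> u * (s' - s)" "u * (s' - s) \<le> s' - s" using u assms by (auto intro: mult_left_le_one_le)
  then show "p $ 1 = 0 \<and> p $ 2 = y \<and> s \<le> p $ 3 \<and> p $ 3 \<le> s'" using u(3) by (simp add: algebra_simps)
next
  assume p: "p $ 1 = 0 \<and> p $ 2 = y \<and> s \<le> p $ 3 \<and> p $ 3 \<le> s'"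
  define u where "u = (p $ 3 - s) / (s' - s)"
  have "0 \<le> u" "u \<le> 1" using p assms by (auto simp: u_def)
  moreover have "u * (s' - s) = p $ 3 - s" using assms by (simp add: u_def)
  then have "p = pt ((1 - u) * y + u * y) ((1 - u) * s + u * s')" using p by (simp add: vec_eq_iff forall_3 algebra_simps)
  ultimately show "p \<in> edge y s y s'" unfolding edge_image by auto
qed

lemma edge_slanted:
  assumes "s' = s + d" "d > 0"
  shows "p \<in> edge y s y' s' \<longleftrightarrow> p $ 1 = 0 \<and> s \<le> p $ 3 \<and> p $ 3 \<le> s' \<and> p $ 2 = y + (y' - y) / d * (p $ 3 - s)"
proof
  assume "p \<in> edge y s y' s'"
  then obtain u where u: "0 \<le> u" "u \<le> 1" "p = pt ((1 - u) * y + u * y') ((1 - u) * s + u * s')" unfolding edge_image by auto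
  have "0 \<le> u * d" "u * d \<le> d" using u assms by (auto intro: mult_left_le_one_le)
  moreover have "p $ 3 = s + u * d" using u assms by (simp add: algebra_simps)
  moreover have "(y' - y) / d * (p $ 3 - s) = (y' - y) * u" using \<open>p $ 3 = s + u * d\<close> assms(2) by simp
  then have "p $ 2 = y + (y' - y) / d * (p $ 3 - s)" using u by (simp add: algebra_simps)
  ultimately show "p $ 1 = 0 \<and> s \<le> p $ 3 \<and> p $ 3 \<le> s' \<and> p $ 2 = y + (y' - y) / d * (p $ 3 - s)" using u assms by simp
next
  assume p: "p $ 1 = 0 \<and> s \<le> p $ 3 \<and> p $ 3 \<le> s' \<and> p $ 2 = y + (y' - y) / d * (p $ 3 - s)"
  define u where "u = (p $ 3 - s) / d"
  have "0 \<le> u" "u \<le> 1" using p assms by (auto simp: u_def)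
  moreover have ud: "u * d = p $ 3 - s" using assms by (simp add: u_def)
  moreover have "p $ 2 = y + (y' - y) * u" using p by (simp add: u_def)
  ultimately have "p = pt ((1 - u) * y + u * y') ((1 - u) * s + u * s')" using p assms(1) by (simp add: vec_eq_iff forall_3 algebra_simps)
  then show "p \<in> edge y s y' s'" unfolding edge_image using \<open>0 \<le> u\<close> \<open>u \<le> 1\<close> by auto
qed

lemma push_edge:
  assumes "\<And>u. 0 \<le> u \<Longrightarrow> u \<le> 1 \<Longrightarrow> M ((1 - u) * y + u * y') ((1 - u) * s + u * s') = (1 - u) * k + u * k'"
  shows "(\<lambda>p. p + M (p $ 2) (p $ 3) *\<^sub>R pt a b) ` edge y s y' s' = edge (y + k * a) (s + k * b) (y' + k' * a) (s' + k' * b)"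
  unfolding edge_image image_image
proof (intro image_cong refl)
  fix u :: real assume "u \<in> {0..1}"
  then have M: "M ((1 - u) * y + u * y') ((1 - u) * s + u * s') = (1 - u) * k + u * k'" by (intro assms) auto
  show "pt ((1 - u) * y + u * y') ((1 - u) * s + u * s') + M (pt ((1 - u) * y + u * y') ((1 - u) * s + u * s') $ 2) (pt ((1 - u) * y + u * y') ((1 - u) * s + u * s') $ 3) *\<^sub>R pt a b =
    pt ((1 - u) * (y + k * a) + u * (y' + k' * a)) ((1 - u) * (s + k * b) + u * (s' + k' * b))"
    unfolding pt_nth M by (simp add: vec_eq_iff forall_3 algebra_simps)
qed

fun ev :: "real \<times> real \<times> real \<Rightarrow> real \<Rightarrow> real \<Rightarrow> real" where "ev (a, b, c) y s = a * y + b * s + c"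

lemma ev_comb: "ev g ((1 - u) * y + u * y') ((1 - u) * s + u * s') = (1 - u) * ev g y s + u * ev g y' s'"
  by (cases g) (simp add: algebra_simps)

lemma ev_edge: "p \<in> edge y s y' s' \<Longrightarrow> ev g y s \<le> 0 \<Longrightarrow> ev g y' s' \<le> 0 \<Longrightarrow> ev g (p $ 2) (p $ 3) \<le> 0"
  unfolding edge_image by (auto simp: ev_comb intro!: add_nonpos_nonpos mult_nonneg_nonpos)

text \<open>The push will be the positive part of the minimum of the three functions, so a point
  stays put if one of them is nonpositive there.\<close>

definition keeps :: "real \<times> real \<times> real \<Rightarrow> real \<times> real \<times> real \<Rightarrow> real \<times> real \<times> real \<Rightarrow> (real^3) set \<Rightarrow> bool" where
  "keeps g1 g2 g3 R \<longleftrightarrow> (\<forall>p\<in>R. ev g1 (p $ 2) (p $ 3) \<le> 0 \<or> ev g2 (p $ 2) (p $ 3) \<le> 0 \<or> ev g3 (p $ 2) (p $ 3) \<le> 0)"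

lemma keeps_Un: "keeps g1 g2 g3 (A \<union> B) \<longleftrightarrow> keeps g1 g2 g3 A \<and> keeps g1 g2 g3 B"
  by (auto simp: keeps_def)

lemma keeps_edge:
  "(ev g1 y s \<le> 0 \<and> ev g1 y' s' \<le> 0) \<or> (ev g2 y s \<le> 0 \<and> ev g2 y' s' \<le> 0) \<or> (ev g3 y s \<le> 0 \<and> ev g3 y' s' \<le> 0) \<Longrightarrow>
    keeps g1 g2 g3 (edge y s y' s')"
  unfolding keeps_def using ev_edge by blast

text \<open>Pushing the point \<open>(y0, s0)\<close> of an edge along \<open>(a, b)\<close>: the displacement is cut off by three affine functions,
  each of which also keeps some of the remaining edges in place.\<close>

lemma ear:
  assumes K: "unknotted (edge y1 s1 y2 s2 \<union> R)"
    and M: "0 \<le> l" "l \<le> 1" "y0 = (1 - l) * y1 + l * y2" "s0 = (1 - l) * s1 + l * s2"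
    and slope: "ev g1 a b - ev g1 0 0 > - 1" "ev g2 a b - ev g2 0 0 > - 1" "ev g3 a b - ev g3 0 0 > - 1"
    and v1: "ev g1 y1 s1 = 0" "ev g1 y0 s0 = 1" "ev g1 y2 s2 \<ge> 0"
    and v2: "ev g2 y1 s1 \<ge> 0" "ev g2 y0 s0 = 1" "ev g2 y2 s2 = 0"
    and v3: "ev g3 y1 s1 \<ge> 0" "ev g3 y0 s0 \<ge> 1" "ev g3 y2 s2 \<ge> 0"
    and R: "keeps g1 g2 g3 R"
    and q: "y = y0 + a" "s = s0 + b"
  shows "unknotted (edge y1 s1 y s \<union> (edge y s y2 s2 \<union> R))"
proof -
  define f where "f y s = max 0 (min (ev g1 y s) (min (ev g2 y s) (ev g3 y s)))" for y s
  have ev_pa: "pa (\<lambda>p :: real^3. ev g (p $ 2) (p $ 3))" for g by (cases g) (auto intro!: pa_intros)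
  have ev_cont: "continuous_on UNIV (\<lambda>p :: real^3. ev g (p $ 2) (p $ 3))" for g by (cases g) (auto intro!: continuous_intros)
  have sl: "ev g (y + t * a) (s + t * b) > ev g y s - t" if "ev g a b - ev g 0 0 > - 1" "t > 0" for g y s t
  proof -
    have "ev g (y + t * a) (s + t * b) = ev g y s + t * (ev g a b - ev g 0 0)" by (cases g) (simp add: algebra_simps)
    moreover have "t * (ev g a b - ev g 0 0) > t * (- 1)" using that by (intro mult_strict_left_mono)
    ultimately show ?thesis by simp
  qed
  have "unknotted ((\<lambda>p. p + f (p $ 2) (p $ 3) *\<^sub>R pt a b) ` (edge y1 s1 y2 s2 \<union> R))"
  proof (rule push_unknotted[OF K])
    show "pa (\<lambda>p :: real^3. f (p $ 2) (p $ 3))" unfolding f_def by (intro pa_intros ev_pa)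
    show "continuous_on UNIV (\<lambda>p :: real^3. f (p $ 2) (p $ 3))" unfolding f_def by (intro continuous_intros ev_cont)
    fix p :: "real^3" and t :: real assume t: "t > 0"
    show "f (p $ 2) (p $ 3) - t < f ((p + t *\<^sub>R pt a b) $ 2) ((p + t *\<^sub>R pt a b) $ 3)"
      using sl[OF slope(1) t, of "p $ 2" "p $ 3"] sl[OF slope(2) t, of "p $ 2" "p $ 3"] sl[OF slope(3) t, of "p $ 2" "p $ 3"] t
      unfolding f_def by (simp add: max_def min_def) linarith?
  qed
  also have "edge y1 s1 y2 s2 = edge y1 s1 y0 s0 \<union> edge y0 s0 y2 s2" by (rule edge_split[OF M])
  also have "(\<lambda>p. p + f (p $ 2) (p $ 3) *\<^sub>R pt a b) ` (edge y1 s1 y0 s0 \<union> edge y0 s0 y2 s2 \<union> R)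
      = edge y1 s1 y s \<union> (edge y s y2 s2 \<union> R)"
  proof -
    have "(\<lambda>p. p + f (p $ 2) (p $ 3) *\<^sub>R pt a b) ` edge y1 s1 y0 s0 = edge (y1 + 0 * a) (s1 + 0 * b) (y0 + 1 * a) (s0 + 1 * b)"
    proof (rule push_edge)
      fix u :: real assume u: "0 \<le> u" "u \<le> 1"
      have "ev g2 ((1 - u) * y1 + u * y0) ((1 - u) * s1 + u * s0) \<ge> u" using u v2 by (simp add: ev_comb)
      moreover have "ev g3 ((1 - u) * y1 + u * y0) ((1 - u) * s1 + u * s0) \<ge> u"
        using u v3 mult_left_mono[OF v3(2) u(1)] by (simp add: ev_comb add_nonneg_nonneg add_increasing)
      moreover have "ev g1 ((1 - u) * y1 + u * y0) ((1 - u) * s1 + u * s0) = u" using v1 by (simp add: ev_comb)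
      ultimately show "f ((1 - u) * y1 + u * y0) ((1 - u) * s1 + u * s0) = (1 - u) * 0 + u * 1" using u by (simp add: f_def)
    qed
    moreover have "(\<lambda>p. p + f (p $ 2) (p $ 3) *\<^sub>R pt a b) ` edge y0 s0 y2 s2 = edge (y0 + 1 * a) (s0 + 1 * b) (y2 + 0 * a) (s2 + 0 * b)"
    proof (rule push_edge)
      fix u :: real assume u: "0 \<le> u" "u \<le> 1"
      have u': "0 \<le> 1 - u" using u by simp
      have "ev g1 ((1 - u) * y0 + u * y2) ((1 - u) * s0 + u * s2) \<ge> 1 - u" using u v1 by (simp add: ev_comb)
      moreover have "ev g3 ((1 - u) * y0 + u * y2) ((1 - u) * s0 + u * s2) \<ge> 1 - u"
        using u v3 mult_left_mono[OF v3(2) u'] by (simp add: ev_comb add_increasing2)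
      moreover have "ev g2 ((1 - u) * y0 + u * y2) ((1 - u) * s0 + u * s2) = 1 - u" using v2 by (simp add: ev_comb)
      ultimately show "f ((1 - u) * y0 + u * y2) ((1 - u) * s0 + u * s2) = (1 - u) * 1 + u * 0" using u by (simp add: f_def)
    qed
    moreover have "(\<lambda>p. p + f (p $ 2) (p $ 3) *\<^sub>R pt a b) ` R = R"
    proof -
      have "f (p $ 2) (p $ 3) = 0" if "p \<in> R" for p using R that by (auto simp: f_def keeps_def)
      then show ?thesis by (force simp: image_iff)
    qed
    ultimately show ?thesis by (simp add: image_Un Un_assoc q)
  qed
  finally show ?thesis .
qed

text \<open>Its corners are already three of the eight vertices of the polygon to be built; the
  other five arise by pushing edges.\<close>

lemma start_triangle: "unknotted (edge 0 2 2 2 \<union> (edge 2 2 (-2) (-8) \<union> edge (-2) (-8) 0 2))"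
proof -
  define L :: "real^2 \<Rightarrow> real^3" where "L v = pt (v $ 1) (v $ 2)" for v
  define a b c :: "real^2" where "a = vector [0, 2]" and "b = vector [2, 2]" and "c = vector [-2, -8]"
  have L: "linear L" by (intro linearI) (simp_all add: L_def vec_eq_iff forall_3)
  have inj: "inj L" by (rule injI) (simp add: L_def vec_eq_iff forall_3 forall_2)
  have dist: "a \<noteq> b" "a \<noteq> c" "b \<noteq> c" by (auto simp: a_def b_def c_def vec_eq_iff forall_2)
  have "\<not> collinear {a, b, c}"
  proof
    assume "collinear {a, b, c}"
    then obtain u where u: "\<And>x y. x \<in> {a, b, c} \<Longrightarrow> y \<in> {a, b, c} \<Longrightarrow> \<exists>k. x - y = k *\<^sub>R u" unfolding collinear_def by blast
    obtain k where k: "b - a = k *\<^sub>R u" using u[of b a] by auto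
    obtain k' where k': "c - a = k' *\<^sub>R u" using u[of c a] by auto
    have "k * u $ 1 = 2" "k * u $ 2 = 0" using k by (simp_all add: vec_eq_iff forall_2 a_def b_def)
    then have "u $ 2 = 0" by auto
    moreover have "k' * u $ 2 = - 10" using k' by (simp add: vec_eq_iff forall_2 a_def c_def)
    ultimately show False by simp
  qed
  then have "\<not> affine_dependent {a, b, c}" using collinear_3_eq_affine_dependent[of a b c] by blast
  moreover have "card {a, b, c} = Suc DIM(real^2)" using dist by simp
  ultimately have "interior (convex hull {a, b, c}) \<noteq> {}" using interior_convex_hull_eq_empty[of "{a, b, c}"] by blast
  from triangle_unknotted[OF L inj this] show ?thesis
    by (simp add: L_def a_def b_def c_def edge_def Un_assoc)
qed

text \<open>Every use of \<open>ear\<close> replaces an edge by two: \<open>l\<close> locates the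
  pushed point, \<open>(a, b)\<close> leads to the new vertex, and the first two functions are
  normalised to 1 at that point and to 0 at one end each. The third one repeats the second except in
  the last push, where it protects the long lower edge.\<close>

lemma planar_polygon:
  "unknotted (edge 0 2 0 (-2) \<union> edge 0 (-2) 2 (-1) \<union> edge 2 (-1) 2 2 \<union> edge 2 2 6 1 \<union> edge 6 1 6 (-1) \<union>
     edge 6 (-1) (-2) (-8) \<union> edge (-2) (-8) (-2) 1 \<union> edge (-2) 1 0 2)"
proof -
  have 1: "unknotted (edge 0 2 0 (-2) \<union> (edge 0 (-2) 2 2 \<union> (edge 2 2 (-2) (-8) \<union> edge (-2) (-8) 0 2)))"
    apply (rule ear[OF start_triangle, where l = "1/2" and ?y0.0 = 1 and ?s0.0 = 2 and a = "-1" and b = "-4" and ?g1.0 = "(1, -1/5, 2/5)" and ?g2.0 = "(-1, 2/5, 6/5)" and ?g3.0 = "(-1, 2/5, 6/5)"])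
    by (simp_all add: keeps_Un keeps_edge)
  have 2: "unknotted (edge 2 2 6 1 \<union> (edge 6 1 (-2) (-8) \<union> (edge 0 2 0 (-2) \<union> edge 0 (-2) 2 2 \<union> edge (-2) (-8) 0 2)))"
  proof (rule ear[where l = "1/10" and ?y0.0 = "8/5" and ?s0.0 = 1 and a = "22/5" and b = 0 and ?g1.0 = "(10, -5, -10)" and ?g2.0 = "(5/9, -1/9, 2/9)" and ?g3.0 = "(5/9, -1/9, 2/9)"])
    show "unknotted (edge 2 2 (-2) (-8) \<union> (edge 0 2 0 (-2) \<union> edge 0 (-2) 2 2 \<union> edge (-2) (-8) 0 2))" using 1 by (simp add: Un_ac)
  qed (simp_all add: keeps_Un keeps_edge)
  have 3: "unknotted (edge 6 1 6 (-1) \<union> (edge 6 (-1) (-2) (-8) \<union> (edge 0 2 0 (-2) \<union> edge 0 (-2) 2 2 \<union> edge 2 2 6 1 \<union> edge (-2) (-8) 0 2)))"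
  proof (rule ear[where l = "2/9" and ?y0.0 = "38/9" and ?s0.0 = "-1" and a = "16/9" and b = 0 and ?g1.0 = "(9/20, -9/10, -9/5)" and ?g2.0 = "(45/217, -9/217, 18/217)" and ?g3.0 = "(45/217, -9/217, 18/217)"])
    show "unknotted (edge 6 1 (-2) (-8) \<union> (edge 0 2 0 (-2) \<union> edge 0 (-2) 2 2 \<union> edge 2 2 6 1 \<union> edge (-2) (-8) 0 2))" using 2 by (simp add: Un_ac)
  qed (simp_all add: keeps_Un keeps_edge)
  have 4: "unknotted (edge (-2) (-8) (-2) 1 \<union> (edge (-2) 1 0 2 \<union> (edge 0 2 0 (-2) \<union> edge 0 (-2) 2 2 \<union> edge 2 2 6 1 \<union> edge 6 1 6 (-1) \<union> edge 6 (-1) (-2) (-8))))"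
  proof (rule ear[where l = "9/10" and ?y0.0 = "-1/5" and ?s0.0 = 1 and a = "-9/5" and b = 0 and ?g1.0 = "(-35/297, 40/297, 250/297)" and ?g2.0 = "(-5, 0, 0)" and ?g3.0 = "(-5, 0, 0)"])
    show "unknotted (edge (-2) (-8) 0 2 \<union> (edge 0 2 0 (-2) \<union> edge 0 (-2) 2 2 \<union> edge 2 2 6 1 \<union> edge 6 1 6 (-1) \<union> edge 6 (-1) (-2) (-8)))" using 3 by (simp add: Un_ac)
  qed (simp_all add: keeps_Un keeps_edge)
  have 5: "unknotted (edge 0 (-2) 2 (-1) \<union> (edge 2 (-1) 2 2 \<union> (edge 0 2 0 (-2) \<union> edge 2 2 6 1 \<union> edge 6 1 6 (-1) \<union> edge 6 (-1) (-2) (-8) \<union> edge (-2) (-8) (-2) 1 \<union> edge (-2) 1 0 2)))"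
  proof (rule ear[where l = "1/4" and ?y0.0 = "1/2" and ?s0.0 = "-1" and a = "3/2" and b = 0 and ?g1.0 = "(2, 0, 0)" and ?g2.0 = "(-2/9, -2/9, 8/9)" and ?g3.0 = "(-2/11, 12/11, 24/11)"])
    show "unknotted (edge 0 (-2) 2 2 \<union> (edge 0 2 0 (-2) \<union> edge 2 2 6 1 \<union> edge 6 1 6 (-1) \<union> edge 6 (-1) (-2) (-8) \<union> edge (-2) (-8) (-2) 1 \<union> edge (-2) 1 0 2))" using 4 by (simp add: Un_ac)
  qed (simp_all add: keeps_Un keeps_edge)
  from 5 show ?thesis by (simp add: Un_ac)
qed

text \<open>Heights between -1 and 1 are stretched to the range from \<open>- Z\<close> to
  \<open>Z\<close>, and the rest is translated. The displacement increases weakly with the height,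
  which gives the slope condition.\<close>

lemma stretched_polygon:
  assumes "Z \<ge> 1"
  shows "unknotted (edge 0 (Z + 1) 0 Z \<union> edge 0 Z 0 (- Z) \<union> edge 0 (- Z) 0 (- Z - 1) \<union> edge 0 (- Z - 1) 2 (- Z) \<union>
    edge 2 (- Z) 2 Z \<union> edge 2 Z 2 (Z + 1) \<union> edge 2 (Z + 1) 6 Z \<union> edge 6 Z 6 (- Z) \<union> edge 6 (- Z) (-2) (- Z - 7) \<union>
    edge (-2) (- Z - 7) (-2) (- Z) \<union> edge (-2) (- Z) (-2) Z \<union> edge (-2) Z 0 (Z + 1))"
proof -
  define f :: "real \<Rightarrow> real \<Rightarrow> real" where "f y s = (Z - 1) * max (- 1) (min 1 s)" for y s
  have K: "unknotted (edge 0 2 0 1 \<union> edge 0 1 0 (-1) \<union> edge 0 (-1) 0 (-2) \<union> edge 0 (-2) 2 (-1) \<union> edge 2 (-1) 2 1 \<union> edge 2 1 2 2 \<union> edge 2 2 6 1 \<union>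
     edge 6 1 6 (-1) \<union> edge 6 (-1) (-2) (-8) \<union> edge (-2) (-8) (-2) (-1) \<union> edge (-2) (-1) (-2) 1 \<union> edge (-2) 1 0 2)"
  proof -
    have "edge 0 2 0 (-2) = edge 0 2 0 1 \<union> edge 0 1 0 (-2)" by (rule edge_split[of "1/4"]) simp_all
    moreover have "edge 0 1 0 (-2) = edge 0 1 0 (-1) \<union> edge 0 (-1) 0 (-2)" by (rule edge_split[of "2/3"]) simp_all
    moreover have "edge 2 (-1) 2 2 = edge 2 (-1) 2 1 \<union> edge 2 1 2 2" by (rule edge_split[of "2/3"]) simp_all
    moreover have "edge (-2) (-8) (-2) 1 = edge (-2) (-8) (-2) (-1) \<union> edge (-2) (-1) (-2) 1" by (rule edge_split[of "7/9"]) simp_all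
    ultimately show ?thesis using planar_polygon by (simp add: Un_ac)
  qed
  define \<phi> where "\<phi> = (\<lambda>p :: real^3. p + f (p $ 2) (p $ 3) *\<^sub>R pt 0 1)"
  have "unknotted (\<phi> `
     (edge 0 2 0 1 \<union> edge 0 1 0 (-1) \<union> edge 0 (-1) 0 (-2) \<union> edge 0 (-2) 2 (-1) \<union> edge 2 (-1) 2 1 \<union> edge 2 1 2 2 \<union> edge 2 2 6 1 \<union>
     edge 6 1 6 (-1) \<union> edge 6 (-1) (-2) (-8) \<union> edge (-2) (-8) (-2) (-1) \<union> edge (-2) (-1) (-2) 1 \<union> edge (-2) 1 0 2))"
    unfolding \<phi>_def
  proof (rule push_unknotted[OF K])
    show "pa (\<lambda>p :: real^3. f (p $ 2) (p $ 3))" unfolding f_def by (intro pa_intros)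
    show "continuous_on UNIV (\<lambda>p :: real^3. f (p $ 2) (p $ 3))" unfolding f_def by (intro continuous_intros)
    fix p :: "real^3" and t :: real assume t: "t > 0"
    have "f (p $ 2) (p $ 3) \<le> f ((p + t *\<^sub>R pt 0 1) $ 2) ((p + t *\<^sub>R pt 0 1) $ 3)"
      unfolding f_def using assms t by (intro mult_left_mono) auto
    then show "f (p $ 2) (p $ 3) - t < f ((p + t *\<^sub>R pt 0 1) $ 2) ((p + t *\<^sub>R pt 0 1) $ 3)" using t by linarith
  qed
  moreover have E: "\<phi> ` edge y s y' s' = edge y r y' r'"
    if c: "(1 \<le> s \<and> 1 \<le> s' \<and> r - s = Z - 1 \<and> r' - s' = Z - 1) \<or> (\<bar>s\<bar> \<le> 1 \<and> \<bar>s'\<bar> \<le> 1 \<and> r - s = (Z - 1) * s \<and> r' - s' = (Z - 1) * s') \<or>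
      (s \<le> - 1 \<and> s' \<le> - 1 \<and> r - s = 1 - Z \<and> r' - s' = 1 - Z)" for y s y' s' r r'
  proof -
    have "f ((1 - u) * y + u * y') ((1 - u) * s + u * s') = (1 - u) * (r - s) + u * (r' - s')" if u: "0 \<le> u" "u \<le> 1" for u
      using c
    proof (elim disjE conjE)
      assume a: "1 \<le> s" "1 \<le> s'" "r - s = Z - 1" "r' - s' = Z - 1"
      have "(1 - u) * 1 + u * 1 \<le> (1 - u) * s + u * s'" using a u by (intro add_mono mult_left_mono) auto
      then have m: "max (- 1) (min 1 ((1 - u) * s + u * s')) = 1" by simp
      show ?thesis unfolding f_def m a(3,4) by (simp add: algebra_simps)
    next
      assume a: "s \<le> - 1" "s' \<le> - 1" "r - s = 1 - Z" "r' - s' = 1 - Z"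
      have "(1 - u) * s + u * s' \<le> (1 - u) * (- 1) + u * (- 1)" using a u by (intro add_mono mult_left_mono) auto
      then have m: "max (- 1) (min 1 ((1 - u) * s + u * s')) = - 1" by simp
      show ?thesis unfolding f_def m a(3,4) by (simp add: algebra_simps)
    next
      assume a: "\<bar>s\<bar> \<le> 1" "\<bar>s'\<bar> \<le> 1" "r - s = (Z - 1) * s" "r' - s' = (Z - 1) * s'"
      have "(1 - u) * s + u * s' \<le> (1 - u) * 1 + u * 1" using a u by (intro add_mono mult_left_mono) auto
      moreover have "(1 - u) * (- 1) + u * (- 1) \<le> (1 - u) * s + u * s'" using a u by (intro add_mono mult_left_mono) auto
      ultimately have m: "max (- 1) (min 1 ((1 - u) * s + u * s')) = (1 - u) * s + u * s'" by simp
      show ?thesis unfolding f_def m a(3,4) by (simp add: algebra_simps)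
    qed
    from push_edge[of f y y' s s' "r - s" "r' - s'" 0 1, OF this] show ?thesis by (simp add: \<phi>_def)
  qed
  have e: "\<phi> ` edge y 2 y' 1 = edge y (Z + 1) y' Z" "\<phi> ` edge y 1 y' (-1) = edge y Z y' (- Z)" "\<phi> ` edge y (-1) y' (-2) = edge y (- Z) y' (- Z - 1)"
    "\<phi> ` edge y (-2) y' (-1) = edge y (- Z - 1) y' (- Z)" "\<phi> ` edge y (-1) y' 1 = edge y (- Z) y' Z" "\<phi> ` edge y 1 y' 2 = edge y Z y' (Z + 1)"
    "\<phi> ` edge y (-1) y' (-8) = edge y (- Z) y' (- Z - 7)" "\<phi> ` edge y (-8) y' (-1) = edge y (- Z - 7) y' (- Z)" for y y'
    by (rule E, simp)+
  ultimately show ?thesis by (simp only: image_Un e)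
qed

context strands
begin

lemma scurve_image:
  assumes "\<And>i s. i < 4 \<Longrightarrow> lv i s \<Longrightarrow> \<phi> (vector [X i s, Y i s, s]) = (vector [X' i s, Y' i s, s] :: real^3)"
  shows "\<phi> ` scurve X Y = scurve X' Y'"
proof -
  have sc: "scurve X Y = {vector [X i s, Y i s, s] | i s. i < 4 \<and> lv i s}" for X Y
  proof (intro set_eqI iffI)
    fix p assume "p \<in> scurve X Y"
    then obtain i where i: "i < 4" "lv i (p $ 3)" "p $ 1 = X i (p $ 3)" "p $ 2 = Y i (p $ 3)" by (auto simp: scurve_def)
    then have "p = vector [X i (p $ 3), Y i (p $ 3), p $ 3]" by (simp add: vec_eq_iff forall_3)
    with i(1,2) show "p \<in> {vector [X i s, Y i s, s] | i s. i < 4 \<and> lv i s}" by blast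
  qed (auto simp: scurve_def)
  show ?thesis unfolding sc using assms by (force simp: image_iff)
qed

text \<open>Every strand, with the moving one straightened, breaks at the heights \<open>Z\<close>
  and \<open>- Z\<close> into three straight pieces, the twelve edges of the stretched
  polygon.\<close>

lemma flat_unknotted: "unknotted (scurve (\<lambda>i s. 0) (\<lambda>i s. if i = 1 then 0 else YY i s))"
proof -
  have Z: "Z \<ge> 1" "0 < Z" using h12 by auto
  note V = edge_vertical and S1 = edge_slanted[where d = 1] and S7 = edge_slanted[where d = 7]
  have sets: "p \<in> edge 0 (Z + 1) 0 Z \<longleftrightarrow> p $ 1 = 0 \<and> p $ 2 = 0 \<and> Z \<le> p $ 3 \<and> p $ 3 \<le> Z + 1"
    "p \<in> edge 0 Z 0 (- Z) \<longleftrightarrow> p $ 1 = 0 \<and> p $ 2 = 0 \<and> - Z \<le> p $ 3 \<and> p $ 3 \<le> Z"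
    "p \<in> edge 0 (- Z) 0 (- Z - 1) \<longleftrightarrow> p $ 1 = 0 \<and> p $ 2 = 0 \<and> - Z - 1 \<le> p $ 3 \<and> p $ 3 \<le> - Z"
    "p \<in> edge 0 (- Z - 1) 2 (- Z) \<longleftrightarrow> p $ 1 = 0 \<and> - Z - 1 \<le> p $ 3 \<and> p $ 3 \<le> - Z \<and> p $ 2 = 2 * (p $ 3 + Z + 1)"
    "p \<in> edge 2 (- Z) 2 Z \<longleftrightarrow> p $ 1 = 0 \<and> p $ 2 = 2 \<and> - Z \<le> p $ 3 \<and> p $ 3 \<le> Z"
    "p \<in> edge 2 Z 2 (Z + 1) \<longleftrightarrow> p $ 1 = 0 \<and> p $ 2 = 2 \<and> Z \<le> p $ 3 \<and> p $ 3 \<le> Z + 1"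
    "p \<in> edge 2 (Z + 1) 6 Z \<longleftrightarrow> p $ 1 = 0 \<and> Z \<le> p $ 3 \<and> p $ 3 \<le> Z + 1 \<and> p $ 2 = 6 - 4 * (p $ 3 - Z)"
    "p \<in> edge 6 Z 6 (- Z) \<longleftrightarrow> p $ 1 = 0 \<and> p $ 2 = 6 \<and> - Z \<le> p $ 3 \<and> p $ 3 \<le> Z"
    "p \<in> edge 6 (- Z) (-2) (- Z - 7) \<longleftrightarrow> p $ 1 = 0 \<and> - Z - 7 \<le> p $ 3 \<and> p $ 3 \<le> - Z \<and> p $ 2 = - 2 + 8 / 7 * (p $ 3 + Z + 7)"
    "p \<in> edge (-2) (- Z - 7) (-2) (- Z) \<longleftrightarrow> p $ 1 = 0 \<and> p $ 2 = - 2 \<and> - Z - 7 \<le> p $ 3 \<and> p $ 3 \<le> - Z"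
    "p \<in> edge (-2) (- Z) (-2) Z \<longleftrightarrow> p $ 1 = 0 \<and> p $ 2 = - 2 \<and> - Z \<le> p $ 3 \<and> p $ 3 \<le> Z"
    "p \<in> edge (-2) Z 0 (Z + 1) \<longleftrightarrow> p $ 1 = 0 \<and> Z \<le> p $ 3 \<and> p $ 3 \<le> Z + 1 \<and> p $ 2 = - 2 + 2 * (p $ 3 - Z)" for p
    unfolding edge_commute[of 0 "Z + 1" 0 Z] edge_commute[of 0 Z 0 "- Z"] edge_commute[of 0 "- Z" 0 "- Z - 1"] edge_commute[of 2 "Z + 1" 6 Z]
      edge_commute[of 6 Z 6 "- Z"] edge_commute[of 6 "- Z" "-2" "- Z - 7"]
    using Z by (simp_all add: V S1 S7 algebra_simps)
  have y0: "s \<le> Z \<Longrightarrow> YY 0 s = - 2" "Z \<le> s \<Longrightarrow> YY 0 s = - 2 + 2 * (s - Z)" for s by (simp_all add: YY_def)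
  have y2: "- Z \<le> s \<Longrightarrow> YY 2 s = 2" "s \<le> - Z \<Longrightarrow> YY 2 s = 2 * (s + Z + 1)" for s by (simp_all add: YY_def algebra_simps)
  have y3: "- Z \<le> s \<Longrightarrow> s \<le> Z \<Longrightarrow> YY 3 s = 6" "Z \<le> s \<Longrightarrow> YY 3 s = 6 - 4 * (s - Z)" "s \<le> - Z \<Longrightarrow> YY 3 s = - 2 + 8 / 7 * (s + Z + 7)" for s
    using Z by (simp_all add: YY_def field_simps)
  have live: "lv 0 s \<longleftrightarrow> - Z - 7 \<le> s \<and> s \<le> Z + 1" "lv 1 s \<longleftrightarrow> - Z - 1 \<le> s \<and> s \<le> Z + 1" "lv 2 s \<longleftrightarrow> - Z - 1 \<le> s \<and> s \<le> Z + 1" "lv 3 s \<longleftrightarrow> - Z - 7 \<le> s \<and> s \<le> Z + 1"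
    "lv (Suc 0) s \<longleftrightarrow> - Z - 1 \<le> s \<and> s \<le> Z + 1" for s
    by (simp_all add: lv_def lo_def)
  define F where "F = scurve (\<lambda>i s. 0) (\<lambda>i s. if i = 1 then 0 else YY i s)"
  have F: "p \<in> F" if "i < 4" "lv i (p $ 3)" "p $ 1 = 0" "p $ 2 = (if i = 1 then 0 else YY i (p $ 3))" for p i
    using that by (auto simp: F_def scurve_def)
  have b1: "edge 0 (Z + 1) 0 Z \<subseteq> F"
  proof
    fix p assume "p \<in> edge 0 (Z + 1) 0 Z"
    then show "p \<in> F" unfolding sets by (elim conjE, intro F[of 1]) (use Z in \<open>simp_all add: live\<close>)
  qed
  have b2: "edge 0 Z 0 (- Z) \<subseteq> F"
  proof
    fix p assume "p \<in> edge 0 Z 0 (- Z)"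
    then show "p \<in> F" unfolding sets by (elim conjE, intro F[of 1]) (use Z in \<open>simp_all add: live\<close>)
  qed
  have b3: "edge 0 (- Z) 0 (- Z - 1) \<subseteq> F"
  proof
    fix p assume "p \<in> edge 0 (- Z) 0 (- Z - 1)"
    then show "p \<in> F" unfolding sets by (elim conjE, intro F[of 1]) (use Z in \<open>simp_all add: live\<close>)
  qed
  have b4: "edge 0 (- Z - 1) 2 (- Z) \<subseteq> F"
  proof
    fix p assume "p \<in> edge 0 (- Z - 1) 2 (- Z)"
    then show "p \<in> F" unfolding sets by (elim conjE, intro F[of 2]) (use Z in \<open>simp_all add: live y2(2)\<close>)
  qed
  have b5: "edge 2 (- Z) 2 Z \<subseteq> F"
  proof
    fix p assume "p \<in> edge 2 (- Z) 2 Z"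
    then show "p \<in> F" unfolding sets by (elim conjE, intro F[of 2]) (use Z in \<open>simp_all add: live y2(1)\<close>)
  qed
  have b6: "edge 2 Z 2 (Z + 1) \<subseteq> F"
  proof
    fix p assume "p \<in> edge 2 Z 2 (Z + 1)"
    then show "p \<in> F" unfolding sets by (elim conjE, intro F[of 2]) (use Z in \<open>simp_all add: live y2(1)\<close>)
  qed
  have b7: "edge 2 (Z + 1) 6 Z \<subseteq> F"
  proof
    fix p assume "p \<in> edge 2 (Z + 1) 6 Z"
    then show "p \<in> F" unfolding sets by (elim conjE, intro F[of 3]) (use Z in \<open>simp_all add: live y3(2)\<close>)
  qed
  have b8: "edge 6 Z 6 (- Z) \<subseteq> F"
  proof
    fix p assume "p \<in> edge 6 Z 6 (- Z)"
    then show "p \<in> F" unfolding sets by (elim conjE, intro F[of 3]) (use Z in \<open>simp_all add: live y3(1)\<close>)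
  qed
  have b9: "edge 6 (- Z) (-2) (- Z - 7) \<subseteq> F"
  proof
    fix p assume "p \<in> edge 6 (- Z) (-2) (- Z - 7)"
    then show "p \<in> F" unfolding sets by (elim conjE, intro F[of 3]) (use Z in \<open>simp_all add: live y3(3)\<close>)
  qed
  have b10: "edge (-2) (- Z - 7) (-2) (- Z) \<subseteq> F"
  proof
    fix p assume "p \<in> edge (-2) (- Z - 7) (-2) (- Z)"
    then show "p \<in> F" unfolding sets by (elim conjE, intro F[of 0]) (use Z in \<open>simp_all add: live y0(1)\<close>)
  qed
  have b11: "edge (-2) (- Z) (-2) Z \<subseteq> F"
  proof
    fix p assume "p \<in> edge (-2) (- Z) (-2) Z"
    then show "p \<in> F" unfolding sets by (elim conjE, intro F[of 0]) (use Z in \<open>simp_all add: live y0(1)\<close>)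
  qed
  have b12: "edge (-2) Z 0 (Z + 1) \<subseteq> F"
  proof
    fix p assume "p \<in> edge (-2) Z 0 (Z + 1)"
    then show "p \<in> F" unfolding sets by (elim conjE, intro F[of 0]) (use Z in \<open>simp_all add: live y0(2)\<close>)
  qed
  have "F \<subseteq> edge 0 (Z + 1) 0 Z \<union> edge 0 Z 0 (- Z) \<union> edge 0 (- Z) 0 (- Z - 1) \<union> edge 0 (- Z - 1) 2 (- Z) \<union> edge 2 (- Z) 2 Z \<union> edge 2 Z 2 (Z + 1) \<union> edge 2 (Z + 1) 6 Z \<union> edge 6 Z 6 (- Z) \<union> edge 6 (- Z) (-2) (- Z - 7) \<union> edge (-2) (- Z - 7) (-2) (- Z) \<union> edge (-2) (- Z) (-2) Z \<union> edge (-2) Z 0 (Z + 1)"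
  proof
    fix p assume "p \<in> F"
    then obtain i where i: "i < 4" "lv i (p $ 3)" "p $ 1 = 0" "p $ 2 = (if i = 1 then 0 else YY i (p $ 3))" by (auto simp: F_def scurve_def)
    have rc: "(p $ 3 \<le> - Z \<Longrightarrow> thesis) \<Longrightarrow> (- Z \<le> p $ 3 \<Longrightarrow> p $ 3 \<le> Z \<Longrightarrow> thesis) \<Longrightarrow> (Z \<le> p $ 3 \<Longrightarrow> thesis) \<Longrightarrow> thesis" for thesis using linear by blast
    consider "i = 0" | "i = 1" | "i = 2" | "i = 3" using i(1) by linarith
    then show "p \<in> edge 0 (Z + 1) 0 Z \<union> edge 0 Z 0 (- Z) \<union> edge 0 (- Z) 0 (- Z - 1) \<union> edge 0 (- Z - 1) 2 (- Z) \<union> edge 2 (- Z) 2 Z \<union> edge 2 Z 2 (Z + 1) \<union> edge 2 (Z + 1) 6 Z \<union> edge 6 Z 6 (- Z) \<union> edge 6 (- Z) (-2) (- Z - 7) \<union> edge (-2) (- Z - 7) (-2) (- Z) \<union> edge (-2) (- Z) (-2) Z \<union> edge (-2) Z 0 (Z + 1)"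
    proof cases
      case 1
      show ?thesis
      proof (rule rc)
        assume r: "p $ 3 \<le> - Z"
        have "p \<in> edge (-2) (- Z - 7) (-2) (- Z)" unfolding sets using i r Z 1 by (simp add: live y0(1))
        then show ?thesis by blast
      next
        assume r: "- Z \<le> p $ 3" "p $ 3 \<le> Z"
        have "p \<in> edge (-2) (- Z) (-2) Z" unfolding sets using i r Z 1 by (simp add: live y0(1))
        then show ?thesis by blast
      next
        assume r: "Z \<le> p $ 3"
        have "p \<in> edge (-2) Z 0 (Z + 1)" unfolding sets using i r Z 1 by (simp add: live y0(2))
        then show ?thesis by blast
      qed
    next
      case 2
      show ?thesis
      proof (rule rc)
        assume r: "p $ 3 \<le> - Z"
        have "p \<in> edge 0 (- Z) 0 (- Z - 1)" unfolding sets using i r Z 2 by (simp add: live)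
        then show ?thesis by blast
      next
        assume r: "- Z \<le> p $ 3" "p $ 3 \<le> Z"
        have "p \<in> edge 0 Z 0 (- Z)" unfolding sets using i r Z 2 by (simp add: live)
        then show ?thesis by blast
      next
        assume r: "Z \<le> p $ 3"
        have "p \<in> edge 0 (Z + 1) 0 Z" unfolding sets using i r Z 2 by (simp add: live)
        then show ?thesis by blast
      qed
    next
      case 3
      show ?thesis
      proof (rule rc)
        assume r: "p $ 3 \<le> - Z"
        have "p \<in> edge 0 (- Z - 1) 2 (- Z)" unfolding sets using i r Z 3 by (simp add: live y2(2))
        then show ?thesis by blast
      next
        assume r: "- Z \<le> p $ 3" "p $ 3 \<le> Z"
        have "p \<in> edge 2 (- Z) 2 Z" unfolding sets using i r Z 3 by (simp add: live y2(1))
        then show ?thesis by blast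
      next
        assume r: "Z \<le> p $ 3"
        have "p \<in> edge 2 Z 2 (Z + 1)" unfolding sets using i r Z 3 by (simp add: live y2(1))
        then show ?thesis by blast
      qed
    next
      case 4
      show ?thesis
      proof (rule rc)
        assume r: "p $ 3 \<le> - Z"
        have "p \<in> edge 6 (- Z) (-2) (- Z - 7)" unfolding sets using i r Z 4 by (simp add: live y3(3))
        then show ?thesis by blast
      next
        assume r: "- Z \<le> p $ 3" "p $ 3 \<le> Z"
        have "p \<in> edge 6 Z 6 (- Z)" unfolding sets using i r Z 4 by (simp add: live y3(1))
        then show ?thesis by blast
      next
        assume r: "Z \<le> p $ 3"
        have "p \<in> edge 2 (Z + 1) 6 Z" unfolding sets using i r Z 4 by (simp add: live y3(2))
        then show ?thesis by blast
      qed
    qed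
  qed
  with b1 b2 b3 b4 b5 b6 b7 b8 b9 b10 b11 b12 have "F = edge 0 (Z + 1) 0 Z \<union> edge 0 Z 0 (- Z) \<union> edge 0 (- Z) 0 (- Z - 1) \<union> edge 0 (- Z - 1) 2 (- Z) \<union> edge 2 (- Z) 2 Z \<union> edge 2 Z 2 (Z + 1) \<union> edge 2 (Z + 1) 6 Z \<union> edge 6 Z 6 (- Z) \<union> edge 6 (- Z) (-2) (- Z - 7) \<union> edge (-2) (- Z - 7) (-2) (- Z) \<union> edge (-2) (- Z) (-2) Z \<union> edge (-2) Z 0 (Z + 1)"
    by (intro equalityI Un_least)
  then show ?thesis using stretched_polygon[OF Z(1)] unfolding F_def by simp
qed

text \<open>Where \<open>\<bar>s\<bar> - h\<close> is below \<open>k\<close> the moving strand rests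
  at the vertex \<open>k\<close> of its path; beyond that it winds. So \<open>stage J\<close> is
  flat and \<open>stage 0\<close> has all windings, still without the bend in depth near the
  middle.\<close>

definition stage :: "nat \<Rightarrow> (real^3) set" where
  "stage k = scurve (\<lambda>i s. if i = 1 then PX (max (\<bar>s\<bar> - h) (real k)) else 0) (\<lambda>i s. if i = 1 then PY (max (\<bar>s\<bar> - h) (real k)) else YY i s)"

lemma P_truncated:
  assumes "k < J"
  defines "c t \<equiv> max 0 (min 1 (real k + 1 - t))"
  shows "PX (max t (real k)) = PX (max t (real (Suc k))) + c t * (vx k - vx (Suc k))"
    "PY (max t (real k)) = PY (max t (real (Suc k))) + c t * (vy k - vy (Suc k))"
    "c t \<noteq> 0 \<Longrightarrow> PX (max t (real (Suc k))) = vx (Suc k) \<and> PY (max t (real (Suc k))) = vy (Suc k)"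
proof -
  have seg: "PX u = vx k + (vx (Suc k) - vx k) * (u - real k)" "PY u = vy k + (vy (Suc k) - vy k) * (u - real k)" if "real k \<le> u" "u \<le> real k + 1" for u
    using interp_segment[OF assms(1) that] by (simp_all add: PX_def PY_def)
  have end_pt: "PX (real (Suc k)) = vx (Suc k)" "PY (real (Suc k)) = vy (Suc k)" using seg[of "real (Suc k)"] by simp_all
  show "c t \<noteq> 0 \<Longrightarrow> PX (max t (real (Suc k))) = vx (Suc k) \<and> PY (max t (real (Suc k))) = vy (Suc k)"
  proof -
    assume "c t \<noteq> 0"
    then have "t < real (Suc k)" by (auto simp: c_def max_def min_def split: if_splits)
    then have "max t (real (Suc k)) = real (Suc k)" by simp
    then show ?thesis using end_pt by simp
  qed
  consider "t \<le> real k" | "real k < t" "t < real k + 1" | "real k + 1 \<le> t" by linarith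
  then have "PX (max t (real k)) = PX (max t (real (Suc k))) + c t * (vx k - vx (Suc k)) \<and> PY (max t (real k)) = PY (max t (real (Suc k))) + c t * (vy k - vy (Suc k))"
  proof cases
    case 1
    then have "max t (real k) = real k" "max t (real (Suc k)) = real (Suc k)" "c t = 1" by (auto simp: c_def)
    then show ?thesis using seg[of "real k"] end_pt by simp
  next
    case 2
    then have "max t (real k) = t" "max t (real (Suc k)) = real (Suc k)" "c t = real k + 1 - t" by (auto simp: c_def)
    then show ?thesis using seg[of t] 2 unfolding end_pt by (simp only: end_pt) (simp add: algebra_simps)
  next
    case 3
    then have "max t (real k) = t" "max t (real (Suc k)) = t" "c t = 0" by (auto simp: c_def)
    then show ?thesis by simp
  qed
  then show "PX (max t (real k)) = PX (max t (real (Suc k))) + c t * (vx k - vx (Suc k))"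
    "PY (max t (real k)) = PY (max t (real (Suc k))) + c t * (vy k - vy (Suc k))" by auto
qed

text \<open>The shear acts in the strip around the line from \<open>v (k + 1)\<close> to \<open>v k\<close>; the other strands lie outside the strip.\<close>

lemma stage_step:
  assumes k: "k < J" and K: "unknotted (stage (Suc k))"
  shows "unknotted (stage k)"
proof -
  \<comment> \<open>The zero line of \<open>w\<close> carries the side of the triangle between the
    vertices \<open>k\<close> and \<open>k + 1\<close>; three sides, three formulas.\<close>
  define w where "w x y = (if k mod 3 = 0 then y - 2 * x else if k mod 3 = 1 then y - 4 * sg k else y + 2 * x)" for x y :: real
  define e :: "real^3" where "e = vector [vx k - vx (Suc k), vy k - vy (Suc k), 0]"
  define m where "m p = max 0 (min (1 - \<bar>w (p $ 1) (p $ 2)\<bar>) (real k + 1 - (\<bar>p $ 3\<bar> - h)))" for p :: "real^3"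
  have v: "vx (Suc k) = sg k * (if k mod 3 = 0 then 2 else if k mod 3 = 1 then - 2 else 0)" "vy (Suc k) = sg k * (if k mod 3 = 2 then 0 else 4)"
    "vx k = sg k * (if k mod 3 = 0 then 0 else if k mod 3 = 1 then 2 else - 2)" "vy k = sg k * (if k mod 3 = 0 then 0 else 4)"
  proof -
    have "Suc k mod 3 = (if k mod 3 = 2 then 0 else Suc (k mod 3))" by presburger
    moreover have "k mod 3 = 0 \<or> k mod 3 = 1 \<or> k mod 3 = 2" by linarith
    ultimately show "vx (Suc k) = sg k * (if k mod 3 = 0 then 2 else if k mod 3 = 1 then - 2 else 0)" "vy (Suc k) = sg k * (if k mod 3 = 2 then 0 else 4)"
      using sg_Suc[of k] by (auto simp: vx_def vy_def)
  qed (simp_all add: vx_def vy_def)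
  have m3: "k mod 3 = 0 \<or> k mod 3 = 1 \<or> k mod 3 = 2" by linarith
  have ec: "e $ 1 = vx k - vx (Suc k)" "e $ 2 = vy k - vy (Suc k)" "e $ 3 = 0" by (simp_all add: e_def)
  have "unknotted ((\<lambda>p. p + m p *\<^sub>R e) ` stage (Suc k))"
  proof (rule shear_unknotted[OF K])
    have "pa (\<lambda>p :: real^3. w (p $ 1) (p $ 2))" unfolding w_def by (cases "k mod 3 = 0"; cases "k mod 3 = 1") (auto intro!: pa_intros)
    then show "pa m" unfolding m_def[abs_def] by (intro pa_intros)
    have "continuous_on UNIV (\<lambda>p :: real^3. w (p $ 1) (p $ 2))" unfolding w_def by (cases "k mod 3 = 0"; cases "k mod 3 = 1") (auto intro!: continuous_intros)
    then show "continuous_on UNIV m" unfolding m_def[abs_def] by (intro continuous_intros)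
    fix p :: "real^3" and t :: real
    have "w (p $ 1 + t * e $ 1) (p $ 2 + t * e $ 2) = w (p $ 1) (p $ 2)"
      using m3 unfolding w_def ec v by (elim disjE) (simp_all add: algebra_simps)
    then show "m (p + t *\<^sub>R e) = m p" by (simp add: m_def ec(3))
  qed
  also have "(\<lambda>p. p + m p *\<^sub>R e) ` stage (Suc k) = stage k"
    unfolding stage_def
  proof (rule scurve_image)
    fix i s assume i: "i < 4" "lv i s"
    define t where "t = \<bar>s\<bar> - h"
    show "vector [if i = 1 then PX (max (\<bar>s\<bar> - h) (real (Suc k))) else 0, if i = 1 then PY (max (\<bar>s\<bar> - h) (real (Suc k))) else YY i s, s] +
        m (vector [if i = 1 then PX (max (\<bar>s\<bar> - h) (real (Suc k))) else 0, if i = 1 then PY (max (\<bar>s\<bar> - h) (real (Suc k))) else YY i s, s]) *\<^sub>R e =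
        (vector [if i = 1 then PX (max (\<bar>s\<bar> - h) (real k)) else 0, if i = 1 then PY (max (\<bar>s\<bar> - h) (real k)) else YY i s, s] :: real^3)"
    proof (cases "i = 1")
      case True
      define c where "c = max 0 (min 1 (real k + 1 - t))"
      have w1: "w (vx (Suc k)) (vy (Suc k)) = 0" using m3 unfolding w_def v by auto
      have "m (vector [PX (max t (real (Suc k))), PY (max t (real (Suc k))), s]) = c"
      proof (cases "c = 0")
        case True
        then have "real k + 1 - t \<le> 0" by (auto simp: c_def max_def min_def split: if_splits)
        then show ?thesis using True by (simp add: m_def t_def)
      next
        case False
        then show ?thesis using P_truncated(3)[OF k, of t] w1 by (simp add: m_def c_def t_def)
      qed
      then show ?thesis using True P_truncated(1,2)[OF k, of t] unfolding t_def[symmetric]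
        by (simp add: vec_eq_iff forall_3 ec c_def)
    next
      case False
      have "m (vector [0, YY i s, s]) = 0"
      proof (cases "\<bar>s\<bar> \<le> Z")
        case True
        then have "YY i s = - 2 \<or> YY i s = 2 \<or> YY i s = 6" using False i by (auto simp: YY_def)
        then have "1 - \<bar>w 0 (YY i s)\<bar> \<le> 0" using m3 sg_cases[of k] unfolding w_def by (elim disjE) simp_all
        then show ?thesis by (simp add: m_def)
      next
        case out: False
        have "real k + 1 \<le> h" using k by linarith
        then have "real k + 1 - (\<bar>s\<bar> - h) \<le> 0" using out by linarith
        then show ?thesis by (simp add: m_def)
      qed
      then show ?thesis using False by simp
    qed
  qed
  finally show ?thesis .
qed

lemma stage_unknotted: "unknotted (stage 0)"
proof -
  have "unknotted (stage (J - k))" if "k \<le> J" for k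
    using that
  proof (induction k)
    case 0
    have "PX (max t h) = 0" "PY (max t h) = 0" for t using P_outside[of "max t h"] by auto
    then have "stage J = scurve (\<lambda>i s. 0) (\<lambda>i s. if i = 1 then 0 else YY i s)" by (simp add: stage_def cong: if_cong)
    then show ?case using flat_unknotted by simp
  next
    case (Suc k)
    then have "Suc (J - Suc k) = J - k" by simp
    with Suc show ?case using stage_step[of "J - Suc k"] by simp
  qed
  from this[of J] show ?thesis by simp
qed

text \<open>What is missing from \<open>stage 0\<close> is the bend in depth. Two shears along the
  first coordinate supply it; their cut-offs \<open>h - h / 2 * y\<close> and
  \<open>h / 2 * y\<close> are at most 0 on the strands that must stay and at least \<open>h\<close>
  on the others.\<close>

theorem curve_unknotted: "unknotted curve"
proof -
  define e :: "real^3" where "e = vector [1, 0, 0]"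
  have ec: "e $ 1 = 1" "e $ 2 = 0" "e $ 3 = 0" by (simp_all add: e_def)
  define m1 :: "real^3 \<Rightarrow> real" where "m1 p = - max 0 (min (h - \<bar>p $ 3\<bar>) (h - h / 2 * p $ 2))" for p
  define m2 :: "real^3 \<Rightarrow> real" where "m2 p = max 0 (min (h - \<bar>p $ 3\<bar>) (h / 2 * p $ 2))" for p
  have YYc: "YY 0 s = - 2" "YY 2 s = 2" "YY 3 s = 6" "PY (max (\<bar>s\<bar> - h) 0) = 0" "PX (max (\<bar>s\<bar> - h) 0) = 0" "PX (\<bar>s\<bar> - h) = 0" if "\<bar>s\<bar> < h" for s
    using that P_outside[of "max (\<bar>s\<bar> - h) 0"] P_outside[of "\<bar>s\<bar> - h"] by (auto simp: YY_def)
  have Pm: "PX (max (\<bar>s\<bar> - h) 0) = PX (\<bar>s\<bar> - h)" "PY (max (\<bar>s\<bar> - h) 0) = PY (\<bar>s\<bar> - h)" for s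
    using P_outside[of "\<bar>s\<bar> - h"] P_outside[of 0] by (cases "\<bar>s\<bar> - h \<le> 0"; simp add: max_def)+
  define X1 where "X1 i s = (if i = 1 then PX (\<bar>s\<bar> - h) else 0) - (if i < 2 then max 0 (h - \<bar>s\<bar>) else 0)" for i :: nat and s
  have sp: "max 0 (h - \<bar>s\<bar>) = 0" if "\<not> \<bar>s\<bar> < h" for s using that by simp
  have i4: "i = 0 \<or> i = 1 \<or> i = 2 \<or> i = 3" if "i < 4" for i :: nat using that by linarith
  have "unknotted ((\<lambda>p. p + m1 p *\<^sub>R e) ` stage 0)"
  proof (rule shear_unknotted[OF stage_unknotted])
    show "pa m1" unfolding m1_def[abs_def] by (intro pa_intros)
    show "continuous_on UNIV m1" unfolding m1_def[abs_def] by (intro continuous_intros)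
    show "m1 (p + t *\<^sub>R e) = m1 p" for p t by (simp add: m1_def ec)
  qed
  also have "(\<lambda>p. p + m1 p *\<^sub>R e) ` stage 0 = scurve X1 YY"
    unfolding stage_def
  proof (rule scurve_image)
    fix i s assume i: "i < 4" "lv i s"
    have "m1 (vector [a, if i = 1 then PY (max (\<bar>s\<bar> - h) (real 0)) else YY i s, s]) = - (if i < 2 then max 0 (h - \<bar>s\<bar>) else 0)" for a
    proof (cases "\<bar>s\<bar> < h")
      case True
      then show ?thesis using i4[OF i(1)] YYc[OF True] by (elim disjE) (auto simp: m1_def)
    next
      case False
      then show ?thesis using sp[OF False] by (simp add: m1_def)
    qed
    then show "vector [if i = 1 then PX (max (\<bar>s\<bar> - h) (real 0)) else 0, if i = 1 then PY (max (\<bar>s\<bar> - h) (real 0)) else YY i s, s] +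
        m1 (vector [if i = 1 then PX (max (\<bar>s\<bar> - h) (real 0)) else 0, if i = 1 then PY (max (\<bar>s\<bar> - h) (real 0)) else YY i s, s]) *\<^sub>R e =
        (vector [X1 i s, YY i s, s] :: real^3)"
      using Pm by (simp add: vec_eq_iff forall_3 ec X1_def YY_def)
  qed
  finally have "unknotted ((\<lambda>p. p + m2 p *\<^sub>R e) ` scurve X1 YY)"
  proof (rule shear_unknotted)
    show "pa m2" unfolding m2_def[abs_def] by (intro pa_intros)
    show "continuous_on UNIV m2" unfolding m2_def[abs_def] by (intro continuous_intros)
    show "m2 (p + t *\<^sub>R e) = m2 p" for p t by (simp add: m2_def ec)
  qed
  also have "(\<lambda>p. p + m2 p *\<^sub>R e) ` scurve X1 YY = scurve XX YY"
  proof (rule scurve_image)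
    fix i s assume i: "i < 4" "lv i s"
    have "m2 (vector [a, YY i s, s]) = (if i < 2 then 0 else max 0 (h - \<bar>s\<bar>))" for a
    proof (cases "\<bar>s\<bar> < h")
      case True
      have "YY 1 s = 0" using YYc(4)[OF True] Pm by (simp add: YY_def)
      then show ?thesis using i4[OF i(1)] YYc[OF True] by (elim disjE) (auto simp: m2_def)
    next
      case False
      then show ?thesis using sp[OF False] by (simp add: m2_def)
    qed
    then show "vector [X1 i s, YY i s, s] + m2 (vector [X1 i s, YY i s, s]) *\<^sub>R e = (vector [XX i s, YY i s, s] :: real^3)"
      using i4[OF i(1)] by (auto simp: vec_eq_iff forall_3 ec X1_def XX_def)
  qed
  finally show ?thesis by (simp add: curve_def)
qed

end

section \<open>Polygons whose vertices lie on a parametrized curve\<close>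

section \<open>Polygons from parametrizations\<close>

definition lin :: "(real \<Rightarrow> 'a::real_normed_vector) \<Rightarrow> real \<Rightarrow> real \<Rightarrow> bool" where
  "lin g s t \<longleftrightarrow> (\<forall>u\<in>{0..1}. g ((1 - u) * s + u * t) = (1 - u) *\<^sub>R g s + u *\<^sub>R g t)"

lemma lin_image:
  assumes "lin g s t" "s < t"
  shows "closed_segment (g s) (g t) = g ` {s..t}"
proof -
  have "{s..t} = (\<lambda>u. (1 - u) * s + u * t) ` {0..1}"
    using closed_segment_image_interval[of s t] assms(2) by (simp add: closed_segment_eq_real_ivl)
  then have "g ` {s..t} = (\<lambda>u. g ((1 - u) * s + u * t)) ` {0..1}" by (simp add: image_image)
  also have "\<dots> = (\<lambda>u. (1 - u) *\<^sub>R g s + u *\<^sub>R g t) ` {0..1}" using assms(1) by (intro image_cong) (auto simp: lin_def)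
  finally show ?thesis by (simp add: closed_segment_image_interval)
qed

lemma successively_sorted: "successively (\<lambda>s t :: real. s < t \<and> P s t) ts \<Longrightarrow> sorted_wrt (<) ts"
proof (induction ts rule: induct_list012)
  case (3 x y zs)
  then have "x < y" "sorted_wrt (<) (y # zs)" by auto
  moreover from this have "x < z" if "z \<in> set zs" for z using that by (auto intro: less_trans[of x y z])
  ultimately show ?case by simp
qed simp_all

lemma polygonal_path_arc:
  assumes "2 \<le> length ts" "successively (\<lambda>s t. s < t \<and> lin g s t) ts" "inj_on g {hd ts..last ts}"
  shows "arc (polygonal_path (map g ts)) \<and> path_image (polygonal_path (map g ts)) = g ` {hd ts..last ts} \<and>
    pathstart (polygonal_path (map g ts)) = g (hd ts) \<and> pathfinish (polygonal_path (map g ts)) = g (last ts) \<and> hd ts < last ts"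
  using assms
proof (induction ts rule: induct_list012)
  case (3 a b ts)
  have ab: "a < b" "lin g a b" using "3.prems"(2) by auto
  show ?case
  proof (cases ts)
    case Nil
    have "g a \<noteq> g b" using inj_onD[OF "3.prems"(3), of a b] ab Nil by auto
    then show ?thesis using Nil ab lin_image[OF ab(2,1)] by (simp add: arc_linepath)
  next
    case (Cons c vs)
    have suc: "successively (\<lambda>s t. s < t \<and> lin g s t) (b # ts)" using "3.prems"(2) by simp
    have le: "b < last (b # ts)"
    proof -
      have "sorted_wrt (<) (b # ts)" using suc by (rule successively_sorted)
      then show ?thesis using Cons by (metis last.simps last_in_set list.distinct(1) sorted_wrt.simps(2))
    qed
    have inj: "inj_on g {b..last (b # ts)}" using "3.prems"(3) ab Cons by (auto elim: inj_on_subset)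
    have IH: "arc (polygonal_path (map g (b # ts)))" "path_image (polygonal_path (map g (b # ts))) = g ` {b..last (b # ts)}"
      "pathstart (polygonal_path (map g (b # ts))) = g b" "pathfinish (polygonal_path (map g (b # ts))) = g (last (b # ts))"
      using "3.IH"(2) suc inj Cons by auto
    have path: "polygonal_path (map g (a # b # ts)) = linepath (g a) (g b) +++ polygonal_path (map g (b # ts))" using Cons by simp
    have last: "last (a # b # ts) = last (b # ts)" by simp
    have ne: "g a \<noteq> g b" using inj_onD[OF "3.prems"(3), of a b] ab le Cons by auto
    have seg: "path_image (linepath (g a) (g b)) = g ` {a..b}" using lin_image[OF ab(2,1)] by simp
    have "g ` {a..b} \<inter> g ` {b..last (b # ts)} = g ` ({a..b} \<inter> {b..last (b # ts)})"
      using "3.prems"(3) ab le last by (intro inj_on_image_Int[symmetric, of g "{a..last (b # ts)}"]) (auto simp: Cons)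
    also have "{a..b} \<inter> {b..last (b # ts)} = {b}" using ab le by auto
    finally have int: "g ` {a..b} \<inter> g ` {b..last (b # ts)} = {g b}" by simp
    have un: "{a..b} \<union> {b..last (b # ts)} = {a..last (b # ts)}" using ab le by auto
    have "arc (linepath (g a) (g b) +++ polygonal_path (map g (b # ts)))"
      using IH ne int seg by (intro arc_join) (auto simp: arc_linepath)
    moreover have "path_image (linepath (g a) (g b) +++ polygonal_path (map g (b # ts))) = g ` {a..last (b # ts)}"
      using IH seg un by (subst path_image_join) (auto simp flip: image_Un)
    ultimately show ?thesis unfolding path last using IH ab le by simp
  qed
qed simp_all

text \<open>The first edge is split off. The other edges form an arc by injectivity away from the
  closing point, and the edge meets this arc in its two end points only.\<close>

lemma closed_polygon_param:
  assumes ts: "4 \<le> length ts" "successively (\<lambda>s t. s < t \<and> lin g s t) ts"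
    and inj: "inj_on g {hd ts..<last ts}" and closed: "g (last ts) = g (hd ts)"
  shows "closed_polygonal_curve (map g (butlast ts))" "polygon_carrier (map g (butlast ts)) = g ` {hd ts..last ts}"
proof -
  obtain a b c vs where t: "ts = a # b # c # vs" using ts(1) by (auto simp: Suc_le_length_iff numeral_eq_Suc)
  have ab: "a < b" "lin g a b" using ts(2) t by auto
  have "successively (\<lambda>s t. s < t \<and> lin g s t) (b # c # vs)" using ts(2) t by simp
  then have "sorted_wrt (<) (b # c # vs)" by (rule successively_sorted)
  then have le: "b < last ts" using t by (metis last.simps last_in_set list.distinct(1) sorted_wrt.simps(2))
  have la: "last ts = last (b # c # vs)" "hd ts = a" using t by simp_all
  have inj': "inj_on g {b..last ts}"
  proof (rule inj_onI)
    fix x y assume xy: "x \<in> {b..last ts}" "y \<in> {b..last ts}" "g x = g y"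
    have *: "g z \<noteq> g (last ts)" if "b \<le> z" "z < last ts" for z
      using inj_onD[OF inj, of z a] that ab le la closed by auto
    show "x = y"
      using xy *[of x] *[of y] inj_onD[OF inj, of x y] ab la by (cases "x = last ts"; cases "y = last ts") auto
  qed
  have suc: "successively (\<lambda>s t. s < t \<and> lin g s t) (b # c # vs)" using ts(2) t by simp
  have inj'': "inj_on g {hd (b # c # vs)..last (b # c # vs)}" using inj' la by simp
  have "2 \<le> length (b # c # vs)" by simp
  note R = polygonal_path_arc[OF this suc inj'']
  define r where "r = polygonal_path (map g (b # c # vs))"
  have r: "arc r" "path_image r = g ` {b..last ts}" "pathstart r = g b" "pathfinish r = g a"
    using R closed la unfolding r_def by simp_all
  have "map g (butlast ts) @ [hd (map g (butlast ts))] = map g ts"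
  proof -
    have "hd (map g (butlast ts)) = g (last ts)" using closed t by simp
    moreover have "map g ts = map g (butlast ts) @ [g (last ts)]"
      using append_butlast_last_id[of ts] t by (metis list.distinct(1) list.simps(8,9) map_append)
    ultimately show ?thesis by simp
  qed
  then have path: "closed_polygon_path (map g (butlast ts)) = linepath (g a) (g b) +++ r"
    unfolding closed_polygon_path_def r_def by (simp add: t)
  have ne: "g a \<noteq> g b" using inj_onD[OF inj, of a b] ab le la by auto
  have seg: "path_image (linepath (g a) (g b)) = g ` {a..b}" using lin_image[OF ab(2,1)] by simp
  have int: "g ` {a..b} \<inter> g ` {b..last ts} \<subseteq> {g a, g b}"
  proof
    fix z assume "z \<in> g ` {a..b} \<inter> g ` {b..last ts}"
    then obtain x y where xy: "a \<le> x" "x \<le> b" "z = g x" "b \<le> y" "y \<le> last ts" "z = g y" by auto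
    show "z \<in> {g a, g b}"
    proof (cases "y = last ts")
      case True
      then show ?thesis using xy closed la by simp
    next
      case False
      then have "x = y" using inj_onD[OF inj, of x y] xy le la by auto
      then show ?thesis using xy by simp
    qed
  qed
  have "simple_path (linepath (g a) (g b) +++ r)"
    using r ne int seg by (intro simple_path_join_loop) (auto simp: arc_linepath)
  then show "closed_polygonal_curve (map g (butlast ts))"
    unfolding closed_polygonal_curve_def path using r by simp
  have "{a..b} \<union> {b..last ts} = {a..last ts}" using ab le by auto
  then show "polygon_carrier (map g (butlast ts)) = g ` {hd ts..last ts}"
    unfolding polygon_carrier_def path using r seg la by (subst path_image_join) (auto simp flip: image_Un)
qed

text \<open>Positivity is needed to rescale to length one; a single nondegenerate edge gives
  it.\<close>

lemma polygon_length_bounds: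
  assumes ts: "4 \<le> length ts" and closed: "g (last ts) = g (hd ts)"
    and lip: "successively (\<lambda>s t. dist (g s) (g t) \<le> C * (t - s)) ts" and first: "g (ts ! 0) \<noteq> g (ts ! 1)"
  shows "0 < polygon_length (map g (butlast ts))" "polygon_length (map g (butlast ts)) \<le> C * (last ts - hd ts)"
proof -
  obtain a b c vs where t: "ts = a # b # c # vs" using ts(1) by (auto simp: Suc_le_length_iff numeral_eq_Suc)
  have edges: "polygon_edges (map g (butlast ts)) = zip (map g (butlast ts)) (map g (tl ts))"
  proof -
    have "rotate1 (map g (butlast ts)) = map g (tl ts)"
    proof -
      have "map g (tl ts) = map g (butlast (tl ts)) @ [g (last ts)]"
        using append_butlast_last_id[of "tl ts"] t by (metis last_tl list.distinct(1) list.sel(3) list.simps(8,9) map_append)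
      then show ?thesis using closed t by simp
    qed
    then show ?thesis by (simp add: polygon_edges_def)
  qed
  define S where "S ts = sum_list (map (\<lambda>(x, y). dist x y) (zip (map g (butlast ts)) (map g (tl ts))))" for ts
  have S: "polygon_length (map g (butlast ts)) = S ts" unfolding polygon_length_def edges S_def ..
  have Sc: "S (x # y # zs) = dist (g x) (g y) + S (y # zs)" for x y zs by (simp add: S_def)
  have nonneg: "0 \<le> S zs" for zs unfolding S_def by (rule sum_list_nonneg) auto
  have "g a \<noteq> g b" using first t by simp
  then have "0 < S ts" unfolding t Sc[of a] using nonneg[of "b # c # vs"] by (simp add: add_pos_nonneg)
  then show "0 < polygon_length (map g (butlast ts))" by (simp only: S)
  have "S zs \<le> C * (last zs - hd zs)" if "successively (\<lambda>s t. dist (g s) (g t) \<le> C * (t - s)) zs" "zs \<noteq> []" for zs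
    using that
  proof (induction zs rule: induct_list012)
    case (3 x y zs)
    have "S (y # zs) \<le> C * (last (y # zs) - y)" using 3 by simp
    moreover have "dist (g x) (g y) \<le> C * (y - x)" using 3 by simp
    ultimately show ?case unfolding Sc by (simp add: algebra_simps)
  qed (simp_all add: S_def)
  from this[OF lip] show "polygon_length (map g (butlast ts)) \<le> C * (last ts - hd ts)" unfolding S using t by simp
qed

lemma polygon_length_scale:
  assumes "c > 0"
  shows "polygon_length (map (\<lambda>p. c *\<^sub>R p) vs) = c * polygon_length vs"
proof -
  have d: "dist (c *\<^sub>R a) (c *\<^sub>R b) = c * dist a b" for a b :: 'a
    using assms by (simp add: dist_norm flip: scaleR_diff_right)
  have "polygon_edges (map (\<lambda>p. c *\<^sub>R p) vs) = map (\<lambda>(a, b). (c *\<^sub>R a, c *\<^sub>R b)) (polygon_edges vs)"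
    unfolding polygon_edges_def by (simp add: rotate1_map zip_map_map)
  then show ?thesis unfolding polygon_length_def by (simp add: comp_def case_prod_unfold d sum_list_const_mult)
qed

lemma successively_upt:
  assumes "\<And>m. a \<le> m \<Longrightarrow> Suc m < b \<Longrightarrow> P m (Suc m)"
  shows "successively P [a..<b]"
  using assms
proof (induction b)
  case (Suc b)
  show ?case
  proof (cases "a < b")
    case True
    then have "last [a..<b] = b - 1" "Suc (b - 1) = b" by auto
    then show ?thesis using Suc True Suc.prems[of "b - 1"] by (auto simp: successively_append_iff)
  next
    case False
    then show ?thesis by (cases "a = b") auto
  qed
qed simp

section \<open>The curve parametrized by height: edges, length, distance from the axis\<close>

section \<open>A parametrization of the curve\<close>

definition aff :: "(real \<Rightarrow> real) \<Rightarrow> real \<Rightarrow> real \<Rightarrow> bool" where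
  "aff f p q \<longleftrightarrow> (\<exists>a b. \<forall>s\<in>{p..q}. f s = a + b * s)"

lemma aff_const: "aff (\<lambda>s. c) p q"
  unfolding aff_def by (intro exI[of _ c] exI[of _ 0]) simp

lemma aff_cong: "aff f p q \<Longrightarrow> (\<And>s. p \<le> s \<Longrightarrow> s \<le> q \<Longrightarrow> f' s = f s) \<Longrightarrow> aff f' p q"
  unfolding aff_def by auto

lemma aff_combine: "aff f p q \<Longrightarrow> aff g p q \<Longrightarrow> aff (\<lambda>s. k * f s + l * g s) p q"
proof -
  assume "aff f p q" "aff g p q"
  then obtain a b a' b' where "\<forall>s\<in>{p..q}. f s = a + b * s" "\<forall>s\<in>{p..q}. g s = a' + b' * s" unfolding aff_def by blast
  then show ?thesis unfolding aff_def
    by (intro exI[of _ "k * a + l * a'"] exI[of _ "k * b + l * b'"]) (simp add: algebra_simps)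
qed

context strands
begin

definition S :: "nat \<Rightarrow> real \<Rightarrow> real^3" where "S i s = vector [XX i s, YY i s, s]"

lemma S_nth [simp]: "S i s $ 1 = XX i s" "S i s $ 2 = YY i s" "S i s $ 3 = s"
  by (simp_all add: S_def)

text \<open>The curve goes down strand 1, up strand 2, down strand 3 and up strand 0, covering
  heights of \<open>2 * Z + 2\<close> twice and \<open>2 * Z + 8\<close> twice. At a cap the earlier
  strand is used.\<close>

definition idx :: "real \<Rightarrow> nat" where
  "idx t = (if t \<le> 2 * Z + 2 then 1 else if t \<le> 4 * Z + 4 then 2 else if t \<le> 6 * Z + 12 then 3 else 0)"

definition ht :: "real \<Rightarrow> real" where
  "ht t = (if t \<le> 2 * Z + 2 then Z + 1 - t else if t \<le> 4 * Z + 4 then t - (3 * Z + 3) else if t \<le> 6 * Z + 12 then 5 * Z + 5 - t else t - (7 * Z + 19))"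

definition gam :: "real \<Rightarrow> real^3" where "gam t = S (idx t) (ht t)"

lemma cap_points: "S 1 (Z + 1) = S 0 (Z + 1)" "S 1 (- Z - 1) = S 2 (- Z - 1)" "S 2 (Z + 1) = S 3 (Z + 1)" "S 3 (- Z - 7) = S 0 (- Z - 7)"
  using P_outside[of "\<bar>Z + 1\<bar> - h"] P_outside[of "\<bar>- Z - 1\<bar> - h"] h12
  by (auto simp: vec_eq_iff forall_3 XX_def YY_def)

lemma gam_1: "t \<le> 2 * Z + 2 \<Longrightarrow> gam t = S 1 (Z + 1 - t)"
  by (simp add: gam_def idx_def ht_def)

lemma gam_2: "2 * Z + 2 \<le> t \<Longrightarrow> t \<le> 4 * Z + 4 \<Longrightarrow> gam t = S 2 (t - (3 * Z + 3))"
proof (cases "t = 2 * Z + 2")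
  case True
  then have "Z + 1 - t = - Z - 1" "t - (3 * Z + 3) = - Z - 1" by simp_all
  then show ?thesis using True cap_points(2) gam_1[of t] by simp
qed (simp add: gam_def idx_def ht_def)

lemma gam_3: "4 * Z + 4 \<le> t \<Longrightarrow> t \<le> 6 * Z + 12 \<Longrightarrow> gam t = S 3 (5 * Z + 5 - t)"
proof (cases "t = 4 * Z + 4")
  case True
  then have "5 * Z + 5 - t = Z + 1" "t - (3 * Z + 3) = Z + 1" by simp_all
  then show ?thesis using True cap_points(3) gam_2[of t] h12 by simp
qed (use h12 in \<open>simp add: gam_def idx_def ht_def\<close>)

lemma gam_4: "6 * Z + 12 \<le> t \<Longrightarrow> gam t = S 0 (t - (7 * Z + 19))"
proof (cases "t = 6 * Z + 12")
  case True
  then have "5 * Z + 5 - t = - Z - 7" "t - (7 * Z + 19) = - Z - 7" by simp_all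
  then show ?thesis using True cap_points(4) gam_3[of t] h12 by simp
qed (use h12 in \<open>simp add: gam_def idx_def ht_def\<close>)

lemma gam_closed: "gam (8 * Z + 20) = gam 0"
proof -
  have "8 * Z + 20 - (7 * Z + 19) = Z + 1" by simp
  then show ?thesis using gam_4[of "8 * Z + 20"] gam_1[of 0] cap_points(1) h12 by simp
qed

lemma gam_live: "0 \<le> t \<Longrightarrow> t \<le> 8 * Z + 20 \<Longrightarrow> idx t < 4 \<and> lv (idx t) (ht t)"
  using h12 by (auto simp: idx_def ht_def lv_def lo_def)

lemma gam_image: "gam ` {0..8 * Z + 20} = curve"
proof
  show "gam ` {0..8 * Z + 20} \<subseteq> curve"
  proof
    fix p assume "p \<in> gam ` {0..8 * Z + 20}"
    then obtain t where "0 \<le> t" "t \<le> 8 * Z + 20" "p = gam t" by auto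
    then show "p \<in> curve" using gam_live[of t] unfolding curve_def' mem_Collect_eq by (intro exI[of _ "idx t"]) (simp add: gam_def)
  qed
  show "curve \<subseteq> gam ` {0..8 * Z + 20}"
  proof
    fix p assume "p \<in> curve"
    then obtain i where i: "i < 4" "lv i (p $ 3)" "p = S i (p $ 3)"
      by (auto simp: curve_def' vec_eq_iff forall_3)
    define s where "s = p $ 3"
    have l: "lo i \<le> s" "s \<le> Z + 1" using i by (auto simp: lv_def s_def)
    consider "i = 0" | "i = 1" | "i = 2" | "i = 3" using i(1) by linarith
    then have "\<exists>t\<in>{0..8 * Z + 20}. gam t = S i s"
    proof cases
      case 1
      then show ?thesis using l h12 gam_4[of "s + (7 * Z + 19)"] by (intro bexI[of _ "s + (7 * Z + 19)"]) (auto simp: lo_def)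
    next
      case 2
      then show ?thesis using l h12 gam_1[of "Z + 1 - s"] by (intro bexI[of _ "Z + 1 - s"]) (auto simp: lo_def)
    next
      case 3
      then show ?thesis using l h12 gam_2[of "s + (3 * Z + 3)"] by (intro bexI[of _ "s + (3 * Z + 3)"]) (auto simp: lo_def)
    next
      case 4
      then show ?thesis using l h12 gam_3[of "5 * Z + 5 - s"] by (intro bexI[of _ "5 * Z + 5 - s"]) (auto simp: lo_def)
    qed
    then show "p \<in> gam ` {0..8 * Z + 20}" using i(3) by (force simp: s_def image_iff)
  qed
qed

text \<open>Points on different strands are compared by the list of coincidences: at a crossing the
  depths differ, and a cap is reached with one index only, the closing cap being cut off by the
  half-open interval.\<close>

lemma gam_inj: "inj_on gam {0..<8 * Z + 20}"
proof -
  have dif: False if tu: "0 \<le> t" "t < 8 * Z + 20" "0 \<le> u" "u < 8 * Z + 20" and eq: "gam t = gam u" and lt: "idx t < idx u" for t u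
  proof -
    have h: "ht t = ht u" "XX (idx t) (ht u) = XX (idx u) (ht u)" "YY (idx t) (ht u) = YY (idx u) (ht u)"
      using eq by (auto simp: gam_def vec_eq_iff forall_3)
    have l: "idx u < 4" "lv (idx t) (ht u)" "lv (idx u) (ht u)" using gam_live[of t] gam_live[of u] tu h(1) by auto
    then have u5: "idx u < 5" by simp
    note co = coincidence[OF lt u5 l(2,3) h(3)]
    have ev: "\<not> (\<exists>m<J. \<bar>ht u\<bar> = h + real m + 1 / 2 \<and> m mod 3 \<noteq> 1 \<and> {idx t, idx u} = {bk m, fr m} \<and> XX (bk m) (ht u) < XX (fr m) (ht u))"
      using h(2) by (auto simp: doubleton_eq_iff)
    have 0: "ht v < Z + 1" "- Z - 7 < ht v" if "idx v = 0" "v < 8 * Z + 20" for v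
      using that by (auto simp: idx_def ht_def split: if_splits)
    have 2: "- Z - 1 < ht v" if "idx v = 2" for v using that by (auto simp: idx_def ht_def split: if_splits)
    have 3: "ht v < Z + 1" if "idx v = 3" for v using that by (auto simp: idx_def ht_def split: if_splits)
    show False using co ev 0[of t] 2[of u] 3[of u] l(1) h(1) tu by auto
  qed
  show ?thesis
  proof (rule inj_onI)
    fix t u assume tu: "t \<in> {0..<8 * Z + 20}" "u \<in> {0..<8 * Z + 20}" "gam t = gam u"
    then have "idx t = idx u" using dif[of t u] dif[of u t] by (metis atLeastLessThan_iff linorder_less_linear)
    moreover have "ht t = ht u" using tu(3) by (simp add: gam_def vec_eq_iff forall_3)
    ultimately show "t = u" by (auto simp: idx_def ht_def split: if_splits)
  qed
qed

text \<open>No kink: none of the heights \<open>- Z\<close>, \<open>- h\<close>, \<open>0\<close>,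
  \<open>h\<close>, \<open>Z\<close>, at which the clipped ramps of \<open>XX\<close> and
  \<open>YY\<close> bend, lies strictly inside the interval.\<close>

definition nk :: "real \<Rightarrow> real \<Rightarrow> bool" where
  "nk p q \<longleftrightarrow> (q \<le> - h \<or> (- h \<le> p \<and> q \<le> 0) \<or> (0 \<le> p \<and> q \<le> h) \<or> h \<le> p) \<and> (Z \<le> p \<or> q \<le> Z) \<and> (- Z \<le> p \<or> q \<le> - Z)"

lemma nk_aff:
  assumes "nk p q"
  shows "aff (\<lambda>s. max 0 (h - \<bar>s\<bar>)) p q" "aff (\<lambda>s. max 0 (s - Z)) p q" "aff (\<lambda>s. max 0 (- Z - s)) p q"
proof -
  consider "q \<le> - h" | "- h \<le> p" "q \<le> 0" | "0 \<le> p" "q \<le> h" | "h \<le> p" using assms by (auto simp: nk_def)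
  then show "aff (\<lambda>s. max 0 (h - \<bar>s\<bar>)) p q"
  proof cases
    case 1
    then show ?thesis by (intro aff_cong[OF aff_const[of 0]]) auto
  next
    case 2
    then show ?thesis unfolding aff_def by (intro exI[of _ h] exI[of _ 1]) auto
  next
    case 3
    then show ?thesis unfolding aff_def by (intro exI[of _ h] exI[of _ "- 1"]) auto
  next
    case 4
    then show ?thesis by (intro aff_cong[OF aff_const[of 0]]) auto
  qed
  show "aff (\<lambda>s. max 0 (s - Z)) p q"
  proof (cases "Z \<le> p")
    case True
    then show ?thesis unfolding aff_def by (intro exI[of _ "- Z"] exI[of _ 1]) auto
  next
    case False
    then have "q \<le> Z" using assms by (auto simp: nk_def)
    then show ?thesis by (intro aff_cong[OF aff_const[of 0]]) auto
  qed
  show "aff (\<lambda>s. max 0 (- Z - s)) p q"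
  proof (cases "q \<le> - Z")
    case True
    then show ?thesis unfolding aff_def by (intro exI[of _ "- Z"] exI[of _ "- 1"]) auto
  next
    case False
    then have "- Z \<le> p" using assms by (auto simp: nk_def)
    then show ?thesis by (intro aff_cong[OF aff_const[of 0]]) auto
  qed
qed

lemma strand_aff:
  assumes "nk p q" "i \<noteq> 1" "i < 4"
  shows "aff (XX i) p q" "aff (YY i) p q"
proof -
  note a = nk_aff[OF assms(1)]
  show "aff (XX i) p q"
    by (rule aff_cong[OF aff_combine[OF a(1) aff_const[of 0], of "if i = 0 then - 1 else 1" 0]]) (use assms in \<open>auto simp: XX_def\<close>)
  consider "i = 0" | "i = 2" | "i = 3" using assms(2,3) by linarith
  then show "aff (YY i) p q"
  proof cases
    case 1
    show ?thesis by (rule aff_cong[OF aff_combine[OF a(2) aff_const[of 1], of 2 "- 2"]]) (simp add: YY_def 1)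
  next
    case 2
    show ?thesis by (rule aff_cong[OF aff_combine[OF a(3) aff_const[of 1], of "- 2" 2]]) (simp add: YY_def 2)
  next
    case 3
    show ?thesis by (rule aff_cong[OF aff_combine[OF aff_combine[OF a(2,3), of "- 4" "- 8 / 7"] aff_const[of 1], of 1 6]]) (simp add: YY_def 3)
  qed
qed

text \<open>The corresponding condition for the windings: the interval stays within one edge of the
  moving strand, or where that strand rests at the centre.\<close>

definition seg1 :: "real \<Rightarrow> real \<Rightarrow> bool" where
  "seg1 p q \<longleftrightarrow> (- h \<le> p \<and> q \<le> h) \<or> Z \<le> p \<or> q \<le> - Z \<or> (\<exists>m<J. h + real m \<le> p \<and> q \<le> h + real m + 1) \<or> (\<exists>m<J. - h - real m - 1 \<le> p \<and> q \<le> - h - real m)"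

lemma strand1_aff:
  assumes "nk p q" "seg1 p q"
  shows "aff (XX 1) p q" "aff (YY 1) p q"
proof -
  have "aff (\<lambda>s. PX (\<bar>s\<bar> - h)) p q \<and> aff (\<lambda>s. PY (\<bar>s\<bar> - h)) p q"
    using assms(2) unfolding seg1_def
  proof (elim disjE exE conjE)
    assume pq: "- h \<le> p" "q \<le> h"
    have "PX (\<bar>s\<bar> - h) = 0 \<and> PY (\<bar>s\<bar> - h) = 0" if "p \<le> s" "s \<le> q" for s
    proof -
      have "\<bar>s\<bar> - h \<le> 0" using that pq by linarith
      then show ?thesis using P_outside by blast
    qed
    then show ?thesis by (auto intro!: aff_cong[OF aff_const[of 0]])
  next
    assume "Z \<le> p"
    then have "PX (\<bar>s\<bar> - h) = 0 \<and> PY (\<bar>s\<bar> - h) = 0" if "p \<le> s" "s \<le> q" for s using P_outside[of "\<bar>s\<bar> - h"] that by auto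
    then show ?thesis by (auto intro!: aff_cong[OF aff_const[of 0]])
  next
    assume "q \<le> - Z"
    then have "PX (\<bar>s\<bar> - h) = 0 \<and> PY (\<bar>s\<bar> - h) = 0" if "p \<le> s" "s \<le> q" for s using P_outside[of "\<bar>s\<bar> - h"] that by auto
    then show ?thesis by (auto intro!: aff_cong[OF aff_const[of 0]])
  next
    fix m assume m: "m < J" "h + real m \<le> p" "q \<le> h + real m + 1"
    have f: "interp f J (\<bar>s\<bar> - h) = (f m + (f (Suc m) - f m) * (- h - real m)) + (f (Suc m) - f m) * s" if "p \<le> s" "s \<le> q" for s f
    proof -
      have s: "\<bar>s\<bar> = s" using that m by simp
      have "interp f J (s - h) = f m + (f (Suc m) - f m) * (s - h - real m)" using that m by (intro interp_segment) auto
      then show ?thesis unfolding s by (simp add: algebra_simps)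
    qed
    show ?thesis unfolding aff_def PX_def PY_def
      by (intro conjI exI ballI, rule f, simp, simp, rule f) simp_all
  next
    fix m assume m: "m < J" "- h - real m - 1 \<le> p" "q \<le> - h - real m"
    have f: "interp f J (\<bar>s\<bar> - h) = (f m + (f (Suc m) - f m) * (- h - real m)) + (- (f (Suc m) - f m)) * s" if "p \<le> s" "s \<le> q" for s f
    proof -
      have s: "\<bar>s\<bar> = - s" using that m by simp
      have "interp f J (- s - h) = f m + (f (Suc m) - f m) * (- s - h - real m)" using that m by (intro interp_segment) auto
      then show ?thesis unfolding s by (simp add: algebra_simps)
    qed
    show ?thesis unfolding aff_def PX_def PY_def
      by (intro conjI exI ballI, rule f, simp, simp, rule f) simp_all
  qed
  then have P: "aff (\<lambda>s. PX (\<bar>s\<bar> - h)) p q" "aff (\<lambda>s. PY (\<bar>s\<bar> - h)) p q" by auto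
  show "aff (XX 1) p q"
    by (rule aff_cong[OF aff_combine[OF P(1) nk_aff(1)[OF assms(1)], of 1 "- 1"]]) (simp add: XX_def)
  show "aff (YY 1) p q" by (rule aff_cong[OF P(2)]) (simp add: YY_def)
qed

text \<open>The linear map sending the line \<open>axis\<close> to the \<open>y\<close>-axis.\<close>

definition shear :: "real^3 \<Rightarrow> real^3" where "shear p = vector [p $ 1, p $ 2, p $ 3 - p $ 2]"

lemma linear_shear: "linear shear"
  by (intro linearI) (simp_all add: shear_def vec_eq_iff forall_3 algebra_simps)

definition good :: "real \<Rightarrow> real \<Rightarrow> bool" where
  "good s t \<longleftrightarrow> s < t \<and> lin (\<lambda>t. shear (gam t)) s t \<and> dist (shear (gam s)) (shear (gam t)) \<le> 26 * (t - s)"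

lemma good_piece:
  assumes st: "s + 1 \<le> t" and i: "i < 4" and eps: "\<epsilon> = 1 \<or> \<epsilon> = - 1"
    and g: "\<And>u. s \<le> u \<Longrightarrow> u \<le> t \<Longrightarrow> gam u = S i (c + \<epsilon> * u) \<and> lv i (c + \<epsilon> * u)"
    and a: "aff (XX i) (min (c + \<epsilon> * s) (c + \<epsilon> * t)) (max (c + \<epsilon> * s) (c + \<epsilon> * t))"
      "aff (YY i) (min (c + \<epsilon> * s) (c + \<epsilon> * t)) (max (c + \<epsilon> * s) (c + \<epsilon> * t))"
  shows "good s t"
proof -
  obtain a1 b1 where X: "\<And>z. z \<in> {min (c + \<epsilon> * s) (c + \<epsilon> * t)..max (c + \<epsilon> * s) (c + \<epsilon> * t)} \<Longrightarrow> XX i z = a1 + b1 * z"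
    using a(1) unfolding aff_def by blast
  obtain a2 b2 where Y: "\<And>z. z \<in> {min (c + \<epsilon> * s) (c + \<epsilon> * t)..max (c + \<epsilon> * s) (c + \<epsilon> * t)} \<Longrightarrow> YY i z = a2 + b2 * z"
    using a(2) unfolding aff_def by blast
  have in_iv: "c + \<epsilon> * u \<in> {min (c + \<epsilon> * s) (c + \<epsilon> * t)..max (c + \<epsilon> * s) (c + \<epsilon> * t)}" if "s \<le> u" "u \<le> t" for u
    using that eps by auto
  have form: "shear (gam u) = vector [a1 + b1 * (c + \<epsilon> * u), a2 + b2 * (c + \<epsilon> * u), c + \<epsilon> * u - (a2 + b2 * (c + \<epsilon> * u))]" if "s \<le> u" "u \<le> t" for u
    using g[OF that] X[OF in_iv[OF that]] Y[OF in_iv[OF that]] by (simp add: shear_def)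
  have "lin (\<lambda>t. shear (gam t)) s t" unfolding lin_def
  proof
    fix u :: real assume u: "u \<in> {0..1}"
    define z where "z = (1 - u) * s + u * t"
    have zs: "z = s + u * (t - s)" by (simp add: z_def algebra_simps)
    have "0 \<le> u * (t - s)" "u * (t - s) \<le> t - s" using u st by (auto intro: mult_left_le_one_le)
    then have z: "s \<le> z" "z \<le> t" unfolding zs by linarith+
    show "shear (gam ((1 - u) * s + u * t)) = (1 - u) *\<^sub>R shear (gam s) + u *\<^sub>R shear (gam t)"
      unfolding z_def[symmetric] using form[OF z] form[of s] form[of t] st
      by (simp add: vec_eq_iff forall_3) (simp add: zs algebra_simps)
  qed
  moreover have "dist (shear (gam s)) (shear (gam t)) \<le> 26 * (t - s)"
  proof -
    define z where "z = c + \<epsilon> * s"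
    define z' where "z' = c + \<epsilon> * t"
    have zz: "\<bar>z - z'\<bar> = t - s" using eps st by (auto simp: z_def z'_def)
    have gs: "gam s = S i z" "gam t = S i z'" "lv i z" "lv i z'" using g[of s] g[of t] st by (auto simp: z_def z'_def)
    have y: "\<bar>YY i z - YY i z'\<bar> \<le> 10" using YY_bounds[OF i gs(3)] YY_bounds[OF i gs(4)] by linarith
    have sp: "\<bar>max 0 (h - \<bar>z\<bar>) - max 0 (h - \<bar>z'\<bar>)\<bar> \<le> t - s" using zz by linarith
    have x: "\<bar>XX i z - XX i z'\<bar> \<le> 4 + (t - s)"
    proof -
      define A A' where "A = max 0 (h - \<bar>z\<bar>)" and "A' = max 0 (h - \<bar>z'\<bar>)"
      have A: "\<bar>A - A'\<bar> \<le> t - s" using sp by (simp only: A_def A'_def)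
      consider "i = 0" | "i = 1" | "i = 2 \<or> i = 3" using i by linarith
      then show ?thesis
      proof cases
        case 1
        then have "XX i z = - A" "XX i z' = - A'" by (simp_all add: XX_def A_def A'_def)
        then show ?thesis using A by linarith
      next
        case 2
        then have "XX i z = PX (\<bar>z\<bar> - h) - A" "XX i z' = PX (\<bar>z'\<bar> - h) - A'" by (simp_all add: XX_def A_def A'_def)
        then show ?thesis using A P_bounds(1)[of "\<bar>z\<bar> - h"] P_bounds(1)[of "\<bar>z'\<bar> - h"] by linarith
      next
        case 3
        then have "XX i z = A" "XX i z' = A'" by (auto simp: XX_def A_def A'_def)
        then show ?thesis using A by linarith
      qed
    qed
    have "dist (shear (gam s)) (shear (gam t)) \<le> \<bar>XX i z - XX i z'\<bar> + \<bar>YY i z - YY i z'\<bar> + \<bar>(z - YY i z) - (z' - YY i z')\<bar>"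
      unfolding dist_norm using norm_le_l1_cart[of "shear (gam s) - shear (gam t)"] by (simp add: sum_3 shear_def gs)
    also have "\<dots> \<le> (4 + (t - s)) + 10 + ((t - s) + 10)" using x y zz by linarith
    \<comment> \<open>Pieces have parameter length at least 1, so \<open>24 + 2 * (t - s)\<close> is
      at most \<open>26 * (t - s)\<close>.\<close>
    also have "\<dots> \<le> 26 * (t - s)" using st by simp
    finally show ?thesis .
  qed
  ultimately show ?thesis using st by (simp add: good_def)
qed

lemma good_1:
  assumes "0 \<le> s" "s + 1 \<le> t" "t \<le> 2 * Z + 2" "nk (Z + 1 - t) (Z + 1 - s)" "seg1 (Z + 1 - t) (Z + 1 - s)"
  shows "good s t"
proof (rule good_piece[where i = 1 and c = "Z + 1" and \<epsilon> = "- 1"])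
  have "min (Z + 1 + - 1 * s) (Z + 1 + - 1 * t) = Z + 1 - t" "max (Z + 1 + - 1 * s) (Z + 1 + - 1 * t) = Z + 1 - s" using assms by auto
  then show "aff (XX 1) (min (Z + 1 + - 1 * s) (Z + 1 + - 1 * t)) (max (Z + 1 + - 1 * s) (Z + 1 + - 1 * t))"
    "aff (YY 1) (min (Z + 1 + - 1 * s) (Z + 1 + - 1 * t)) (max (Z + 1 + - 1 * s) (Z + 1 + - 1 * t))"
    using strand1_aff[OF assms(4,5)] by simp_all
  show "gam u = S 1 (Z + 1 + - 1 * u) \<and> lv 1 (Z + 1 + - 1 * u)" if "s \<le> u" "u \<le> t" for u
    using gam_1[of u] that assms by (simp add: lv_def lo_def)
qed (use assms in simp_all)

lemma good_2:
  assumes "2 * Z + 2 \<le> s" "s + 1 \<le> t" "t \<le> 4 * Z + 4" "nk (s - (3 * Z + 3)) (t - (3 * Z + 3))"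
  shows "good s t"
proof (rule good_piece[where i = 2 and c = "- (3 * Z + 3)" and \<epsilon> = 1])
  have mm: "min (- (3 * Z + 3) + 1 * s) (- (3 * Z + 3) + 1 * t) = s - (3 * Z + 3)" "max (- (3 * Z + 3) + 1 * s) (- (3 * Z + 3) + 1 * t) = t - (3 * Z + 3)" using assms by auto
  show "aff (XX 2) (min (- (3 * Z + 3) + 1 * s) (- (3 * Z + 3) + 1 * t)) (max (- (3 * Z + 3) + 1 * s) (- (3 * Z + 3) + 1 * t))"
    "aff (YY 2) (min (- (3 * Z + 3) + 1 * s) (- (3 * Z + 3) + 1 * t)) (max (- (3 * Z + 3) + 1 * s) (- (3 * Z + 3) + 1 * t))"
    unfolding mm using strand_aff[OF assms(4), of 2] by auto
  show "gam u = S 2 (- (3 * Z + 3) + 1 * u) \<and> lv 2 (- (3 * Z + 3) + 1 * u)" if "s \<le> u" "u \<le> t" for u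
  proof -
    have e: "- (3 * Z + 3) + 1 * u = u - (3 * Z + 3)" by simp
    show ?thesis unfolding e using gam_2[of u] that assms by (simp add: lv_def lo_def)
  qed
qed (use assms in simp_all)

lemma good_3:
  assumes "4 * Z + 4 \<le> s" "s + 1 \<le> t" "t \<le> 6 * Z + 12" "nk (5 * Z + 5 - t) (5 * Z + 5 - s)"
  shows "good s t"
proof (rule good_piece[where i = 3 and c = "5 * Z + 5" and \<epsilon> = "- 1"])
  have "min (5 * Z + 5 + - 1 * s) (5 * Z + 5 + - 1 * t) = 5 * Z + 5 - t" "max (5 * Z + 5 + - 1 * s) (5 * Z + 5 + - 1 * t) = 5 * Z + 5 - s" using assms by auto
  then show "aff (XX 3) (min (5 * Z + 5 + - 1 * s) (5 * Z + 5 + - 1 * t)) (max (5 * Z + 5 + - 1 * s) (5 * Z + 5 + - 1 * t))"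
    "aff (YY 3) (min (5 * Z + 5 + - 1 * s) (5 * Z + 5 + - 1 * t)) (max (5 * Z + 5 + - 1 * s) (5 * Z + 5 + - 1 * t))"
    using strand_aff[OF assms(4), of 3] by simp_all
  show "gam u = S 3 (5 * Z + 5 + - 1 * u) \<and> lv 3 (5 * Z + 5 + - 1 * u)" if "s \<le> u" "u \<le> t" for u
    using gam_3[of u] that assms by (simp add: lv_def lo_def)
qed (use assms in simp_all)

lemma good_4:
  assumes "6 * Z + 12 \<le> s" "s + 1 \<le> t" "t \<le> 8 * Z + 20" "nk (s - (7 * Z + 19)) (t - (7 * Z + 19))"
  shows "good s t"
proof (rule good_piece[where i = 0 and c = "- (7 * Z + 19)" and \<epsilon> = 1])
  have mm: "min (- (7 * Z + 19) + 1 * s) (- (7 * Z + 19) + 1 * t) = s - (7 * Z + 19)" "max (- (7 * Z + 19) + 1 * s) (- (7 * Z + 19) + 1 * t) = t - (7 * Z + 19)" using assms by auto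
  show "aff (XX 0) (min (- (7 * Z + 19) + 1 * s) (- (7 * Z + 19) + 1 * t)) (max (- (7 * Z + 19) + 1 * s) (- (7 * Z + 19) + 1 * t))"
    "aff (YY 0) (min (- (7 * Z + 19) + 1 * s) (- (7 * Z + 19) + 1 * t)) (max (- (7 * Z + 19) + 1 * s) (- (7 * Z + 19) + 1 * t))"
    unfolding mm using strand_aff[OF assms(4), of 0] by auto
  show "gam u = S 0 (- (7 * Z + 19) + 1 * u) \<and> lv 0 (- (7 * Z + 19) + 1 * u)" if "s \<le> u" "u \<le> t" for u
  proof -
    have e: "- (7 * Z + 19) + 1 * u = u - (7 * Z + 19)" by simp
    show ?thesis unfolding e using gam_4[of u] that assms by (simp add: lv_def lo_def)
  qed
qed (use assms in simp_all)

text \<open>Parameters of the vertices: unit steps along both windings of strand 1, and otherwise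
  the caps and the heights of possible bends of each strand. Natural numbers are used so that the
  unit steps are intervals \<open>[a..<b]\<close>.\<close>

definition breaks :: "nat list" where
  "breaks = [0] @ [1..<J + 2] @ [2 * J + 1] @ [3 * J + 1..<4 * J + 2] @ [4 * J + 2, 4 * J + 3, 5 * J + 3, 6 * J + 3, 7 * J + 3, 8 * J + 3, 8 * J + 4,
     8 * J + 5, 9 * J + 5, 10 * J + 5, 11 * J + 5, 12 * J + 5, 12 * J + 12, 12 * J + 19, 13 * J + 19, 14 * J + 19, 15 * J + 19, 16 * J + 19, 16 * J + 20]"

lemma breaks_ends: "length breaks = 2 * J + 23" "hd (map real breaks) = 0" "last (map real breaks) = 8 * Z + 20"
  by (simp_all add: breaks_def)

lemma good_breaks: "successively good (map real breaks)"
proof -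
  have u1: "successively (\<lambda>a b. good (real a) (real b)) [1..<J + 2]"
  proof (rule successively_upt)
    fix m assume m: "1 \<le> m" "Suc m < J + 2"
    then have e: "real (J - m) = h - real m" by simp
    have m': "1 \<le> real m" "real m \<le> h" using m by auto
    show "good (real m) (real (Suc m))"
    proof (rule good_1)
      have "J - m < J \<and> h + real (J - m) \<le> Z + 1 - real (Suc m) \<and> Z + 1 - real m \<le> h + real (J - m) + 1" unfolding e using m h12 by auto
      then show "seg1 (Z + 1 - real (Suc m)) (Z + 1 - real m)" unfolding seg1_def by blast
      show "nk (Z + 1 - real (Suc m)) (Z + 1 - real m)" using m' h12 by (auto simp: nk_def)
    qed (use m' h12 in auto)
  qed
  have u2: "successively (\<lambda>a b. good (real a) (real b)) [3 * J + 1..<4 * J + 2]"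
  proof (rule successively_upt)
    fix m assume m: "3 * J + 1 \<le> m" "Suc m < 4 * J + 2"
    then have e: "real (m - (3 * J + 1)) = real m - 3 * h - 1" by simp
    have m': "3 * h + 1 \<le> real m" "real m + 1 \<le> 4 * h + 1" using m by linarith+
    show "good (real m) (real (Suc m))"
    proof (rule good_1)
      have "m - (3 * J + 1) < J \<and> - h - real (m - (3 * J + 1)) - 1 \<le> Z + 1 - real (Suc m) \<and> Z + 1 - real m \<le> - h - real (m - (3 * J + 1))" unfolding e using m by auto
      then show "seg1 (Z + 1 - real (Suc m)) (Z + 1 - real m)" unfolding seg1_def by blast
      show "nk (Z + 1 - real (Suc m)) (Z + 1 - real m)" using m' h12 by (auto simp: nk_def)
    qed (use m' h12 in auto)
  qed
  have g: "good 0 1" "good (h + 1) (2 * h + 1)" "good (2 * h + 1) (3 * h + 1)" "good (4 * h + 1) (4 * h + 2)"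
    by (rule good_1; use h12 in \<open>simp add: nk_def seg1_def\<close>)+
  have g2: "good (4 * h + 2) (4 * h + 3)" "good (4 * h + 3) (5 * h + 3)" "good (5 * h + 3) (6 * h + 3)" "good (6 * h + 3) (7 * h + 3)" "good (7 * h + 3) (8 * h + 3)" "good (8 * h + 3) (8 * h + 4)"
    by (rule good_2; use h12 in \<open>simp add: nk_def\<close>)+
  have g3: "good (8 * h + 4) (8 * h + 5)" "good (8 * h + 5) (9 * h + 5)" "good (9 * h + 5) (10 * h + 5)" "good (10 * h + 5) (11 * h + 5)" "good (11 * h + 5) (12 * h + 5)" "good (12 * h + 5) (12 * h + 12)"
    by (rule good_3; use h12 in \<open>simp add: nk_def\<close>)+
  have g4: "good (12 * h + 12) (12 * h + 19)" "good (12 * h + 19) (13 * h + 19)" "good (13 * h + 19) (14 * h + 19)" "good (14 * h + 19) (15 * h + 19)" "good (15 * h + 19) (16 * h + 19)" "good (16 * h + 19) (16 * h + 20)"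
    by (rule good_4; use h12 in \<open>simp add: nk_def\<close>)+
  have l: "hd [1..<J + 2] = 1" "last [1..<J + 2] = J + 1" "[1..<J + 2] \<noteq> []" "hd [3 * J + 1..<4 * J + 2] = 3 * J + 1" "last [3 * J + 1..<4 * J + 2] = 4 * J + 1" "[3 * J + 1..<4 * J + 2] \<noteq> []"
    by (simp_all del: upt_Suc)
  have cast: "real (J + 1) = h + 1" "real (2 * J + 1) = 2 * h + 1" "real (3 * J + 1) = 3 * h + 1" "real (4 * J + 1) = 4 * h + 1" by simp_all
  have g': "good (1 + h) (1 + 2 * h)" "good (1 + 2 * h) (1 + 3 * h)" "good (1 + 4 * h) (2 + 4 * h)" "good (2 + 4 * h) (4 * h + 3)"
    using g g2(1) by (simp_all add: add.commute)
  show ?thesis unfolding successively_map breaks_def successively_append_iff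
    using u1 u2 l g g' g2 g3 g4 by (simp del: upt_Suc upt_conv_Cons add: l successively_Cons)
qed

definition raw :: "(real^3) list" where "raw = map (\<lambda>t. shear (gam t)) (butlast (map real breaks))"

lemma inj_shear: "inj shear"
  by (rule injI) (auto simp: shear_def vec_eq_iff forall_3)

lemma raw_length: "length raw = 2 * J + 22" "0 < polygon_length raw" "polygon_length raw \<le> 26 * (8 * Z + 20)"
proof -
  note B = breaks_ends
  have len: "4 \<le> length (map real breaks)" using B(1) by simp
  show "length raw = 2 * J + 22" using B(1) by (simp add: raw_def)
  have closed: "shear (gam (last (map real breaks))) = shear (gam (hd (map real breaks)))" unfolding B using gam_closed by simp
  have lip: "successively (\<lambda>s t. dist (shear (gam s)) (shear (gam t)) \<le> 26 * (t - s)) (map real breaks)"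
    by (rule successively_mono[OF good_breaks]) (auto simp: good_def)
  have first: "shear (gam (map real breaks ! 0)) \<noteq> shear (gam (map real breaks ! 1))"
  proof -
    have "map real breaks ! 0 = 0" "map real breaks ! 1 = 1" by (simp_all add: breaks_def nth_append)
    moreover have "gam 0 \<noteq> gam 1" using inj_onD[OF gam_inj, of 0 1] h12 by auto
    ultimately show ?thesis using inj_shear by (simp add: inj_eq)
  qed
  from polygon_length_bounds[OF len closed lip first] show "0 < polygon_length raw" "polygon_length raw \<le> 26 * (8 * Z + 20)"
    unfolding raw_def[symmetric] B by simp_all
qed

lemma scaled_raw:
  assumes "c > 0"
  shows "closed_polygonal_curve (map (\<lambda>p. c *\<^sub>R p) raw)" "polygon_carrier (map (\<lambda>p. c *\<^sub>R p) raw) = (\<lambda>p. c *\<^sub>R shear p) ` curve"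
proof -
  note B = breaks_ends
  have raw: "map (\<lambda>p. c *\<^sub>R p) raw = map (\<lambda>t. c *\<^sub>R shear (gam t)) (butlast (map real breaks))" by (simp add: raw_def)
  have len: "4 \<le> length (map real breaks)" using B(1) by simp
  have closed: "c *\<^sub>R shear (gam (last (map real breaks))) = c *\<^sub>R shear (gam (hd (map real breaks)))" unfolding B using gam_closed by simp
  have inj: "inj_on (\<lambda>t. c *\<^sub>R shear (gam t)) {hd (map real breaks)..<last (map real breaks)}"
    unfolding B
  proof (rule inj_onI)
    fix s t assume st: "s \<in> {0..<8 * Z + 20}" "t \<in> {0..<8 * Z + 20}" "c *\<^sub>R shear (gam s) = c *\<^sub>R shear (gam t)"
    then have "gam s = gam t" using assms inj_shear by (simp add: inj_eq)
    then show "s = t" using inj_onD[OF gam_inj] st by blast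
  qed
  have "lin (\<lambda>t. c *\<^sub>R shear (gam t)) s t" if "lin (\<lambda>t. shear (gam t)) s t" for s t
    using that by (simp add: lin_def scaleR_add_right) (simp add: mult.commute)
  then have suc: "successively (\<lambda>s t. s < t \<and> lin (\<lambda>t. c *\<^sub>R shear (gam t)) s t) (map real breaks)"
    by (intro successively_mono[OF good_breaks]) (auto simp: good_def)
  have im: "(\<lambda>t. c *\<^sub>R shear (gam t)) ` {hd (map real breaks)..last (map real breaks)} = (\<lambda>p. c *\<^sub>R shear p) ` curve"
    unfolding B gam_image[symmetric] by (simp add: image_image)
  from closed_polygon_param[OF len suc inj closed] show "closed_polygonal_curve (map (\<lambda>p. c *\<^sub>R p) raw)"
    "polygon_carrier (map (\<lambda>p. c *\<^sub>R p) raw) = (\<lambda>p. c *\<^sub>R shear p) ` curve"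
    unfolding raw im by simp_all
qed

text \<open>These are the coordinates transverse to the axis. In the middle the depth
  \<open>h - \<bar>s\<bar>\<close> makes up for a small height; elsewhere the height alone exceeds
  the second coordinate by at least \<open>h - 6\<close>, and \<open>h\<close> is at least
  12.\<close>

lemma curve_away:
  assumes "p \<in> curve"
  shows "h / 2 \<le> \<bar>p $ 1\<bar> + \<bar>p $ 3 - p $ 2\<bar>"
proof -
  obtain i where i: "i < 4" "lv i (p $ 3)" "p $ 1 = XX i (p $ 3)" "p $ 2 = YY i (p $ 3)" using assms by (auto simp: curve_def')
  have y: "\<bar>p $ 2\<bar> \<le> 6" using YY_bounds[OF i(1,2)] i(4) by linarith
  show ?thesis
  proof (cases "\<bar>p $ 3\<bar> < h")
    case True
    then have "\<bar>p $ 1\<bar> = h - \<bar>p $ 3\<bar>" using i(1,3) P_outside[of "\<bar>p $ 3\<bar> - h"] by (auto simp: XX_def)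
    then show ?thesis using y h12 by linarith
  next
    case False
    then show ?thesis using y h12 by linarith
  qed
qed

text \<open>From \<open>(a + b)^2 \<le> 2 * (a^2 + b^2)\<close> the distance from the axis is at
  least \<open>c * h / (2 * sqrt 2)\<close>, more than \<open>c * h / 4\<close>.\<close>

lemma scaled_curve_cylinder:
  assumes c: "c > 0" and r: "0 \<le> r" "r \<le> c * h / 4"
  shows "(\<lambda>p. c *\<^sub>R shear p) ` curve \<inter> Cyl r = {}"
proof (intro equals0I)
  fix z assume "z \<in> (\<lambda>p. c *\<^sub>R shear p) ` curve \<inter> Cyl r"
  then obtain p where p: "p \<in> curve" "z = c *\<^sub>R shear p" "z \<in> Cyl r" by blast
  define a where "a = \<bar>p $ 1\<bar>"
  define b where "b = \<bar>p $ 3 - p $ 2\<bar>"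
  have "(c * h / 2)\<^sup>2 \<le> (c * (a + b))\<^sup>2"
    using curve_away[OF p(1)] c h12 by (intro power_mono) (auto simp: a_def b_def mult_left_mono)
  also have "\<dots> \<le> 2 * ((c * a)\<^sup>2 + (c * b)\<^sup>2)"
    using sum_squares_ge_zero[of "c * a - c * b" 0] by (simp add: power2_eq_square algebra_simps)
  also have "(c * a)\<^sup>2 + (c * b)\<^sup>2 \<le> r\<^sup>2" using p(2,3) by (simp add: Cyl_def shear_def a_def b_def power_mult_distrib)
  also have "r\<^sup>2 \<le> (c * h / 4)\<^sup>2" using r by (intro power_mono)
  finally have "(c * h)\<^sup>2 \<le> 0" by (simp add: power_divide)
  then show False using c h12 by simp
qed

end

section \<open>From intersection points with the axis to triangles\<close>

section \<open>Counting triangles\<close>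

text \<open>The pair \<open>p\<close>, \<open>q\<close> extends to an affine basis of three points,
  and two of these have the same image, so the image is spanned by at most two points.\<close>

lemma simplex_of_dim_2_line:
  fixes \<pi> :: "real^3 \<Rightarrow> real^2"
  assumes L: "linear \<pi>" and t: "aff_dim t = 2" and pq: "p \<in> t" "q \<in> t" "p \<noteq> q" "\<pi> p = \<pi> q"
  shows "aff_dim (\<pi> ` t) \<le> 1"
proof -
  have "\<not> affine_dependent {p, q}" by (rule affine_independent_2)
  then obtain B where B: "\<not> affine_dependent B" "{p, q} \<subseteq> B" "B \<subseteq> t" "affine hull B = affine hull t"
    using extend_to_affine_basis_nonempty[of "{p, q}" t] pq by blast
  have fin: "finite B" using B(1) by (rule aff_independent_finite)
  have "aff_dim B = 2" using B(4) t by (metis aff_dim_affine_hull)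
  then have "card B = 3" using aff_dim_affine_independent[OF B(1)] by simp
  then have "card (B - {p, q}) = 1" using B(2) pq(3) fin by (simp add: card_Diff_subset)
  then obtain r where "B - {p, q} = {r}" by (rule card_1_singletonE)
  then have "B \<subseteq> {p, q, r}" by blast
  then have "\<pi> ` B \<subseteq> \<pi> ` {p, q, r}" by (rule image_mono)
  also have "\<pi> ` {p, q, r} = {\<pi> p, \<pi> r}" using pq(4) by simp
  finally have "card (\<pi> ` B) \<le> card {\<pi> p, \<pi> r}" by (intro card_mono) simp_all
  also have "\<dots> \<le> 2" by (simp add: card_insert_if)
  finally have c: "card (\<pi> ` B) \<le> 2" .
  have "aff_dim (\<pi> ` t) \<le> aff_dim (\<pi> ` (affine hull t))" by (intro aff_dim_subset image_mono hull_subset)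
  also have "\<dots> = aff_dim (\<pi> ` (affine hull B))" by (simp add: B(4))
  also have "\<dots> = aff_dim (affine hull (\<pi> ` B))" using L by (simp add: affine_hull_linear_image linear_conv_bounded_linear)
  also have "\<dots> = aff_dim (\<pi> ` B)" by (rule aff_dim_affine_hull)
  also have "\<dots> \<le> int (card (\<pi> ` B)) - 1" using fin by (intro aff_dim_le_card finite_imageI)
  finally show ?thesis using c by linarith
qed

text \<open>Triangles may meet the axis itself in whole segments, so a generic parallel is counted
  instead. An injective map \<open>\<beta>\<close>, supported inside the cylinder, carries this
  parallel onto the axis and fixes \<open>K\<close>. The image disk is no longer polyhedral, which
  is why the hypothesis \<open>N\<close> speaks of arbitrary topological disks.\<close>

theorem triangles_bound:
  fixes K :: "(real^3) set"
  assumes N: "\<And>D. disk_bounded_by D K \<Longrightarrow> finite (D \<inter> y_axis) \<Longrightarrow> N \<le> card (D \<inter> y_axis)"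
    and r: "r > 0" "K \<inter> Cyl r = {}" and T: "PL_triangulated_disk_bounded_by T K"
  shows "N \<le> card (triangles T)"
proof -
  have T': "simplicial_complex T" "disk_bounded_by (\<Union>T) K" using T by (auto simp: PL_triangulated_disk_bounded_by_def)
  have fin: "finite T" and simp: "\<And>S. S \<in> T \<Longrightarrow> \<exists>n. n simplex S" using T'(1) by (auto simp: simplicial_complex_def)
  define \<pi> :: "real^3 \<Rightarrow> real^2" where "\<pi> p = vector [p $ 1, p $ 3]" for p
  have \<pi>n: "\<pi> p $ 1 = p $ 1" "\<pi> p $ 2 = p $ 3" for p by (simp_all add: \<pi>_def)
  have lin: "linear \<pi>" by (intro linearI) (simp_all add: vec_eq_iff forall_2 \<pi>n)
  have cont\<pi>: "continuous_on UNIV \<pi>" using lin by (simp add: linear_continuous_on linear_conv_bounded_linear)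
  have n2: "norm v = sqrt ((v $ 1)\<^sup>2 + (v $ 2)\<^sup>2)" for v :: "real^2" by (simp add: norm_vec_def L2_set_def sum_2)
  have n3: "norm v = sqrt ((v $ 1)\<^sup>2 + (v $ 2)\<^sup>2 + (v $ 3)\<^sup>2)" for v :: "real^3" by (simp add: norm_vec_def L2_set_def sum_3)
  have \<pi>le: "norm (\<pi> p) \<le> norm p" for p unfolding n2 n3 \<pi>n by simp
  \<comment> \<open>The points over which some simplex projects degenerately form a finite union of
    convex sets without interior, hence a null set.\<close>
  define bad where "bad = \<Union>{\<pi> ` S | S. S \<in> T \<and> aff_dim (\<pi> ` S) \<le> 1}"
  have "negligible bad" unfolding bad_def
  proof (rule negligible_Union)
    have "{\<pi> ` S | S. S \<in> T \<and> aff_dim (\<pi> ` S) \<le> 1} \<subseteq> (\<lambda>S. \<pi> ` S) ` T" by blast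
    then show "finite {\<pi> ` S | S. S \<in> T \<and> aff_dim (\<pi> ` S) \<le> 1}" using fin by (auto intro: finite_subset)
    fix X assume "X \<in> {\<pi> ` S | S. S \<in> T \<and> aff_dim (\<pi> ` S) \<le> 1}"
    then obtain S where S: "X = \<pi> ` S" "S \<in> T" "aff_dim (\<pi> ` S) \<le> 1" by blast
    have "convex S" using simp[OF S(2)] by (auto dest: convex_simplex)
    then have "convex X" unfolding S(1) using lin by (rule convex_linear_image[rotated])
    moreover have "interior X = {}" using S by (intro low_dim_interior) auto
    ultimately show "negligible X" by (simp add: negligible_convex_interior)
  qed
  have "\<not> negligible (ball (0 :: real^2) (r / 2))" using r by (intro open_not_negligible) auto
  then have "\<not> ball 0 (r / 2) \<subseteq> bad" using \<open>negligible bad\<close> negligible_subset by blast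
  then obtain v where v: "norm v < r / 2" "v \<notin> bad" by (auto simp: subset_iff)
  define w :: "real^3" where "w = vector [v $ 1, 0, v $ 2]"
  have wn: "w $ 1 = v $ 1" "w $ 2 = 0" "w $ 3 = v $ 2" by (simp_all add: w_def)
  have nw: "norm w = norm v" unfolding n2 n3 wn by simp
  \<comment> \<open>A bump equal to 1 over \<open>v\<close> and 0 from distance \<open>r / 2\<close>
    on, with Lipschitz constant \<open>2 / r\<close>. Since \<open>w\<close> is shorter than
    \<open>r / 2\<close>, the displacement is a strict contraction, and \<open>\<beta>\<close> is
    injective.\<close>
  define m where "m p = max 0 (1 - norm (\<pi> p - v) / (r / 2))" for p
  define \<beta> where "\<beta> p = p - m p *\<^sub>R w" for p
  have lip: "\<bar>m p - m q\<bar> \<le> norm (p - q) / (r / 2)" for p q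
  proof -
    have "\<bar>m p - m q\<bar> \<le> \<bar>norm (\<pi> p - v) / (r / 2) - norm (\<pi> q - v) / (r / 2)\<bar>" unfolding m_def by linarith
    also have "\<dots> = \<bar>norm (\<pi> p - v) - norm (\<pi> q - v)\<bar> / (r / 2)" unfolding diff_divide_distrib[symmetric] abs_divide using r(1) by simp
    also have "\<dots> \<le> norm (p - q) / (r / 2)"
    proof (rule divide_right_mono)
      have "\<bar>norm (\<pi> p - v) - norm (\<pi> q - v)\<bar> \<le> norm ((\<pi> p - v) - (\<pi> q - v))" by (rule norm_triangle_ineq3)
      also have "(\<pi> p - v) - (\<pi> q - v) = \<pi> (p - q)" using lin by (simp add: linear_diff)
      also have "norm \<dots> \<le> norm (p - q)" by (rule \<pi>le)
      finally show "\<bar>norm (\<pi> p - v) - norm (\<pi> q - v)\<bar> \<le> norm (p - q)" .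
    qed (use r in simp)
    finally show ?thesis .
  qed
  have inj: "inj \<beta>"
  proof (rule injI)
    fix p q assume "\<beta> p = \<beta> q"
    then have eq: "p - q = (m p - m q) *\<^sub>R w" by (simp add: \<beta>_def algebra_simps)
    have "norm (p - q) = \<bar>m p - m q\<bar> * norm v" unfolding eq by (simp add: nw)
    also have "\<dots> \<le> norm (p - q) / (r / 2) * norm v" by (intro mult_right_mono lip) simp
    finally have le: "norm (p - q) \<le> norm (p - q) * (norm v / (r / 2))" by (simp add: mult_ac)
    have "norm v / (r / 2) < 1" using v(1) r(1) by simp
    then have "norm (p - q) * (norm v / (r / 2)) < norm (p - q)" if "norm (p - q) > 0"
      using mult_strict_left_mono[OF _ that, of "norm v / (r / 2)" 1] by (simp only: mult_1_right)
    then show "p = q" using le by force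
  qed
  have cont: "continuous_on UNIV \<beta>" unfolding \<beta>_def m_def using r(1) by (intro continuous_intros cont\<pi>) auto
  have fixK: "\<beta> p = p" if "p \<in> K" for p
  proof -
    have "\<not> (p $ 1)\<^sup>2 + (p $ 3)\<^sup>2 \<le> r\<^sup>2" using that r(2) by (auto simp: Cyl_def)
    then have "r < norm (\<pi> p)" unfolding n2 \<pi>n using r(1) by (intro real_less_rsqrt) simp
    moreover have "norm (\<pi> p) \<le> norm (\<pi> p - v) + norm v" using norm_triangle_ineq[of "\<pi> p - v" v] by simp
    ultimately have "r / 2 \<le> norm (\<pi> p - v)" using v(1) by linarith
    then have "m p = 0" using r(1) by (simp add: m_def)
    then show ?thesis by (simp add: \<beta>_def)
  qed
  define D where "D = \<beta> ` \<Union>T"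
  have "\<beta> ` K = K" using fixK by force
  then have disk: "disk_bounded_by D K"
    using disk_bounded_by_image[OF T'(2), of \<beta>] cont inj unfolding D_def by (auto intro: continuous_on_subset inj_on_subset)
  define l where "l = {p \<in> \<Union>T. \<pi> p = v}"
  have Dl: "D \<inter> y_axis = \<beta> ` l"
  proof (intro set_eqI iffI)
    fix z assume "z \<in> D \<inter> y_axis"
    then obtain p where p: "p \<in> \<Union>T" "z = \<beta> p" "\<beta> p $ 1 = 0" "\<beta> p $ 3 = 0" by (auto simp: D_def y_axis_def)
    define p' :: "real^3" where "p' = vector [v $ 1, p $ 2, v $ 2]"
    have p'n: "p' $ 1 = v $ 1" "p' $ 2 = p $ 2" "p' $ 3 = v $ 2" by (simp_all add: p'_def)
    have \<pi>p': "\<pi> p' = v" by (simp add: vec_eq_iff forall_2 \<pi>n p'n)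
    then have "m p' = 1" by (simp add: m_def)
    then have "\<beta> p' = \<beta> p" using p(3,4) by (simp add: vec_eq_iff forall_3 \<beta>_def wn p'n)
    then have "p' = p" using inj by (simp add: inj_eq)
    then show "z \<in> \<beta> ` l" using p \<pi>p' by (auto simp: l_def)
  next
    fix z assume "z \<in> \<beta> ` l"
    then obtain p where p: "p \<in> \<Union>T" "\<pi> p = v" "z = \<beta> p" by (auto simp: l_def)
    then have "m p = 1" "p $ 1 = v $ 1" "p $ 3 = v $ 2" using \<pi>n[of p] by (auto simp: m_def)
    then have "z \<in> y_axis" using p(3) by (simp add: y_axis_def \<beta>_def wn)
    moreover have "z \<in> D" unfolding D_def p(3) using p(1) by (rule imageI)
    ultimately show "z \<in> D \<inter> y_axis" by simp
  qed
  have tri: "S \<in> triangles T" if S: "S \<in> T" "p \<in> S" "\<pi> p = v" for S p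
  proof -
    obtain n where n: "n simplex S" using simp[OF S(1)] by blast
    have dimS: "aff_dim S = n" using n by (rule aff_dim_simplex)
    have "\<not> aff_dim (\<pi> ` S) \<le> 1" using S v(2) unfolding bad_def by blast
    moreover have "aff_dim (\<pi> ` S) \<le> aff_dim S" using lin by (rule aff_dim_linear_image_le)
    ultimately have "2 \<le> n" using dimS by linarith
    \<comment> \<open>A solid simplex inside a disk would contradict invariance of
      dimension.\<close>
    moreover have "n \<noteq> 3"
    proof
      assume "n = 3"
      then have "aff_dim S = int DIM(real^3)" using dimS by simp
      then have "affine hull S = UNIV" using aff_dim_eq_full by blast
      then have "interior S = rel_interior S" by (simp add: rel_interior_interior)
      moreover have "rel_interior S \<noteq> {}" using n S(2) by (auto simp: rel_interior_eq_empty convex_simplex)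
      ultimately have ne: "interior S \<noteq> {}" by simp
      obtain f g where hom: "homeomorphism (cball (0 :: real^2) 1) (\<Union>T) f g" using T'(2) by (auto simp: disk_bounded_by_def)
      have g: "continuous_on (\<Union>T) g" "inj_on g (\<Union>T)"
        using hom by (auto simp: homeomorphism_def intro!: inj_on_inverseI[of "\<Union>T" f g])
      have sub: "interior S \<subseteq> \<Union>T" using S(1) interior_subset[of S] by blast
      have "DIM(real^3) \<le> DIM(real^2)"
        using continuous_on_subset[OF g(1) sub] inj_on_subset[OF g(2) sub] ne open_interior by (intro invariance_of_dimension)
      then show False by simp
    qed
    moreover have "n \<le> 3" using aff_dim_le_DIM[of S] dimS by simp
    ultimately have "n = 2" by linarith
    then show ?thesis using n S(1) by (simp add: triangles_def)
  qed
  have unique: "p = q" if "S \<in> T" "p \<in> S" "q \<in> S" "\<pi> p = v" "\<pi> q = v" for S p q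
  proof (rule ccontr)
    assume "p \<noteq> q"
    have "2 simplex S" using tri[OF that(1,2,4)] by (simp add: triangles_def)
    then have "aff_dim (\<pi> ` S) \<le> 1" by (intro simplex_of_dim_2_line[OF lin _ that(2,3) \<open>p \<noteq> q\<close>]) (simp_all add: aff_dim_simplex that)
    then have "v \<in> bad" using that unfolding bad_def by blast
    then show False using v(2) by simp
  qed
  have "\<forall>p\<in>l. \<exists>S. S \<in> T \<and> p \<in> S" by (auto simp: l_def)
  then obtain c where c: "\<And>p. p \<in> l \<Longrightarrow> c p \<in> T \<and> p \<in> c p" by metis
  have finT: "finite (triangles T)" using fin by (simp add: triangles_def)
  have injc: "inj_on c l"
  proof (rule inj_onI)
    fix p q assume pq: "p \<in> l" "q \<in> l" "c p = c q"
    then show "p = q" using unique[of "c p" p q] c[of p] c[of q] by (auto simp: l_def)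
  qed
  have sub: "c ` l \<subseteq> triangles T" using tri c by (auto simp: l_def)
  have finl: "finite l" using inj_on_finite[OF injc sub finT] .
  have "card (D \<inter> y_axis) = card l" unfolding Dl using inj by (intro card_image) (auto intro: inj_on_subset)
  also have "\<dots> \<le> card (triangles T)" using card_inj_on_le[OF injc sub finT] .
  finally show ?thesis using N[OF disk] finl unfolding Dl by simp
qed

context tangle
begin

definition knot :: "(real^3) list" where "knot = map (\<lambda>p. (1 / polygon_length raw) *\<^sub>R p) raw"

lemma scaled_puncture_bound:
  assumes c: "c > 0" and W: "disk_bounded_by W ((\<lambda>p. c *\<^sub>R shear p) ` curve)" "finite (W \<inter> y_axis)"
  shows "2 ^ (2 * j + 1) \<le> card (W \<inter> y_axis)"
proof -
  define u :: "real^3 \<Rightarrow> real^3" where "u q = vector [q $ 1 / c, q $ 2 / c, (q $ 3 + q $ 2) / c]" for q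
  have un: "u q $ 1 = q $ 1 / c" "u q $ 2 = q $ 2 / c" "u q $ 3 = (q $ 3 + q $ 2) / c" for q by (simp_all add: u_def)
  have "linear u" by (intro linearI) (simp_all add: vec_eq_iff forall_3 un add_divide_distrib distrib_left)
  then have cont: "continuous_on W u" by (simp add: linear_continuous_on linear_conv_bounded_linear)
  have inj: "inj u" by (rule injI) (use c in \<open>auto simp: vec_eq_iff forall_3 un\<close>)
  have uc: "u (c *\<^sub>R shear p) = p" for p using c by (simp add: vec_eq_iff forall_3 un shear_def right_diff_distrib)
  have "disk_bounded_by (u ` W) (u ` (\<lambda>p. c *\<^sub>R shear p) ` curve)"
    using W(1) cont inj by (intro disk_bounded_by_image) (auto intro: inj_on_subset)
  then have D: "disk_bounded_by (u ` W) curve" by (simp add: image_image uc)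
  have ax: "u q \<in> axis \<longleftrightarrow> q \<in> y_axis" for q using c by (auto simp: axis_def y_axis_def un)
  have im: "u ` W \<inter> axis = u ` (W \<inter> y_axis)" using ax by blast
  have "2 ^ (2 * j + 1) \<le> card (u ` W \<inter> axis)" using D W(2) by (intro puncture_bound) (simp_all add: im)
  also have "\<dots> = card (W \<inter> y_axis)" unfolding im using inj by (intro card_image) (auto intro: inj_on_subset)
  finally show ?thesis .
qed

theorem knot_properties:
  "closed_polygonal_curve knot" "unknotted (polygon_carrier knot)" "length (polygon_edges knot) = 24 * (2 * j + 1) + 22"
  "disk_bounded_by W (polygon_carrier knot) \<Longrightarrow> finite (W \<inter> y_axis) \<Longrightarrow> 2 ^ (2 * j + 1) \<le> card (W \<inter> y_axis)"
  "polygon_length knot = 1" "polygon_carrier knot \<inter> Cyl (1 / 1872) = {}"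
proof -
  define c where "c = 1 / polygon_length raw"
  have c: "c > 0" using raw_length(2) by (simp add: c_def)
  have knot: "knot = map (\<lambda>p. c *\<^sub>R p) raw" by (simp add: knot_def c_def)
  have carrier: "polygon_carrier knot = (\<lambda>p. c *\<^sub>R shear p) ` curve" unfolding knot by (rule scaled_raw(2)[OF c])
  show "closed_polygonal_curve knot" unfolding knot by (rule scaled_raw(1)[OF c])
  have "linear (\<lambda>p. c *\<^sub>R shear p)" using linear_compose_scale_right[OF linear_shear] .
  moreover have "inj (\<lambda>p. c *\<^sub>R shear p)" using inj_shear c by (auto simp: inj_def)
  ultimately show "unknotted (polygon_carrier knot)" unfolding carrier by (intro linear_unknotted curve_unknotted)
  have "2 * JJ j = 24 * (2 * j + 1)" by (simp add: JJ_def)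
  then show "length (polygon_edges knot) = 24 * (2 * j + 1) + 22"
    unfolding polygon_edges_def knot length_zip length_map length_rotate1 raw_length(1) by simp
  show "disk_bounded_by W (polygon_carrier knot) \<Longrightarrow> finite (W \<inter> y_axis) \<Longrightarrow> 2 ^ (2 * j + 1) \<le> card (W \<inter> y_axis)"
    unfolding carrier by (rule scaled_puncture_bound[OF c])
  show "polygon_length knot = 1" unfolding knot polygon_length_scale[OF c] using raw_length(2) by (simp add: c_def)
  \<comment> \<open>Because \<open>h\<close> is at least 12, \<open>26 * (16 * h + 20)\<close> is at
    most \<open>468 * h\<close>. A quarter of \<open>1 / 468\<close> is then the common
    radius.\<close>
  have "polygon_length raw \<le> 468 * h" using raw_length(3) h12 by simp
  then have "1 / 468 \<le> c * h" unfolding c_def using raw_length(2) by (simp add: field_simps)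
  then show "polygon_carrier knot \<inter> Cyl (1 / 1872) = {}" unfolding carrier by (intro scaled_curve_cylinder c) simp_all
qed

end

lemma piecewise_smooth_disk: "piecewise_smooth_disk_bounded_by D K \<Longrightarrow> disk_bounded_by D K"
proof -
  assume "piecewise_smooth_disk_bounded_by D K"
  then obtain T B and f :: "real^2 \<Rightarrow> real^3" and g where D: "disk_bounded_by (\<Union>T) B" "homeomorphism (\<Union>T) D f g" "f ` B = K"
    unfolding piecewise_smooth_disk_bounded_by_def PL_triangulated_disk_bounded_by_def by blast
  have f: "f ` \<Union>T = D" "continuous_on (\<Union>T) f" using D(2) by (auto simp: homeomorphism_def)
  have "inj_on f (\<Union>T)" using D(2) by (intro inj_on_inverseI[of _ g]) (auto simp: homeomorphism_def)
  from disk_bounded_by_image[OF D(1) f(2) this] show ?thesis by (simp only: f(1) D(3))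
qed

theorem theorem4p1:
  shows "\<exists>K :: nat \<Rightarrow> (real^3) list.
    (\<forall>n\<ge>1. closed_polygonal_curve (K n) \<and> unknotted (polygon_carrier (K n))) \<and>
    (\<forall>n\<ge>1. length (polygon_edges (K n)) \<le> 24 * n + 40) \<and>
    (\<forall>n\<ge>1. \<forall>D. piecewise_smooth_disk_bounded_by D (polygon_carrier (K n)) \<longrightarrow>
        infinite (D \<inter> y_axis) \<or> 2 ^ (n - 1) \<le> card (D \<inter> y_axis)) \<and>
    (\<forall>n\<ge>1. \<forall>\<T>. PL_triangulated_disk_bounded_by \<T> (polygon_carrier (K n)) \<longrightarrow>
        2 ^ (n - 1) \<le> card (triangles \<T>)) \<and>
    (\<forall>n\<ge>1. polygon_length (K n) = 1) \<and>
    (\<exists>r\<^sub>0>0. \<forall>n\<ge>1. polygon_carrier (K n) \<inter> Cyl r\<^sub>0 = {})"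
proof (rule exI[of _ "\<lambda>n. tangle.knot ((n - 1) div 2)"], intro conjI allI impI)
  note props = tangle.knot_properties
  \<comment> \<open>The exponent on the right is \<open>n - 1\<close> for even \<open>n\<close> and
    \<open>n\<close> for odd \<open>n\<close>, as long as \<open>n\<close> is positive.\<close>
  have pow: "2 ^ (n - 1) \<le> (2 :: nat) ^ (2 * ((n - 1) div 2) + 1)" for n :: nat by (intro power_increasing) auto
  have bound: "2 ^ (n - 1) \<le> card (D \<inter> y_axis)" if "disk_bounded_by D (polygon_carrier (tangle.knot ((n - 1) div 2)))" "finite (D \<inter> y_axis)" for n :: nat and D
    using props(4)[OF that] pow[of n] by (rule order_trans[rotated])
  fix n :: nat assume n: "1 \<le> n"
  show "closed_polygonal_curve (tangle.knot ((n - 1) div 2))" "unknotted (polygon_carrier (tangle.knot ((n - 1) div 2)))" by (fact props)+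
  have "2 * ((n - 1) div 2) + 1 \<le> n" using n by linarith
  then show "length (polygon_edges (tangle.knot ((n - 1) div 2))) \<le> 24 * n + 40" unfolding props(3) by simp
  show "infinite (D \<inter> y_axis) \<or> 2 ^ (n - 1) \<le> card (D \<inter> y_axis)"
    if "piecewise_smooth_disk_bounded_by D (polygon_carrier (tangle.knot ((n - 1) div 2)))" for D
    using bound[OF piecewise_smooth_disk[OF that]] by blast
  show "2 ^ (n - 1) \<le> card (triangles \<T>)" if "PL_triangulated_disk_bounded_by \<T> (polygon_carrier (tangle.knot ((n - 1) div 2)))" for \<T>
    using bound props(6) that by (intro triangles_bound[of _ _ "1 / 1872"]) auto
  show "polygon_length (tangle.knot ((n - 1) div 2)) = 1" by (fact props)
next
  show "\<exists>r\<^sub>0>0. \<forall>n\<ge>1. polygon_carrier (tangle.knot ((n - 1) div 2)) \<inter> Cyl r\<^sub>0 = {}"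
    using tangle.knot_properties(6) by (intro exI[of _ "1 / 1872"]) simp
qed

end
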